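(* For every two-dimensional torus $T^2$ there is no immersion $f_0: T^2 \to \mathbb{R}^4$ which has at least one double point (i.e. $f_0(p_1)=f_0(p_2)$ for some $p_1\neq p_2$ in $T^2$) and satisfies $\mathcal{W}(f_0) = 8\pi$.
   Context: The Willmore energy of an immersion $f:\Sigma\to\mathbb{R}^n$ of a surface is $\mathcal{W}(f)=\frac14\int_\Sigma |H|^2\,d\mu$, where $H$ is the mean curvature vector and $\mu$ the induced area measure. *)

theory Defs
  imports "HOL-Analysis.Analysis"
begin

definition pd :: "('a::real_normed_vector \<Rightarrow> 'b::real_normed_vector) \<Rightarrow> 'a \<Rightarrow> 'a \<Rightarrow> 'b" where
  "pd f v x = frechet_derivative f (at x) v"

fun Ck :: "nat \<Rightarrow> ('a::real_normed_vector \<Rightarrow> 'b::real_normed_vector) \<Rightarrow> bool" where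
  "Ck 0 f = continuous_on UNIV f"
| "Ck (Suc k) f = (continuous_on UNIV f \<and> f differentiable_on UNIV \<and> (\<forall>v. Ck k (pd f v)))"

definition smooth_map :: "('a::real_normed_vector \<Rightarrow> 'b::real_normed_vector) \<Rightarrow> bool" where
  "smooth_map f = (\<forall>k. Ck k f)"

text \<open>Maps of the torus T^2 = R^2 / Z^2 are the doubly 1-periodic maps on R^2.\<close>
definition torus_periodic :: "(real \<times> real \<Rightarrow> 'b) \<Rightarrow> bool" where
  "torus_periodic f = (\<forall>x. f (x + (1,0)) = f x \<and> f (x + (0,1)) = f x)"

definition e1 :: "real \<times> real" where "e1 = (1,0)"
definition e2 :: "real \<times> real" where "e2 = (0,1)"

definition torus_immersion :: "(real \<times> real \<Rightarrow> real^4) \<Rightarrow> bool" where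
  "torus_immersion f = (smooth_map f \<and> torus_periodic f \<and>
      (\<forall>x. inj (frechet_derivative f (at x))))"

definition has_double_point :: "(real \<times> real \<Rightarrow> 'b) \<Rightarrow> bool" where
  "has_double_point f = (\<exists>x y. \<not> (fst x - fst y \<in> \<int> \<and> snd x - snd y \<in> \<int>) \<and> f x = f y)"

definition fffE :: "(real \<times> real \<Rightarrow> real^4) \<Rightarrow> real \<times> real \<Rightarrow> real" where
  "fffE f x = pd f e1 x \<bullet> pd f e1 x"
definition fffF :: "(real \<times> real \<Rightarrow> real^4) \<Rightarrow> real \<times> real \<Rightarrow> real" where
  "fffF f x = pd f e1 x \<bullet> pd f e2 x"
definition fffG :: "(real \<times> real \<Rightarrow> real^4) \<Rightarrow> real \<times> real \<Rightarrow> real" where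
  "fffG f x = pd f e2 x \<bullet> pd f e2 x"
definition gdet :: "(real \<times> real \<Rightarrow> real^4) \<Rightarrow> real \<times> real \<Rightarrow> real" where
  "gdet f x = fffE f x * fffG f x - (fffF f x)\<^sup>2"

definition tan_proj :: "(real \<times> real \<Rightarrow> real^4) \<Rightarrow> real \<times> real \<Rightarrow> real^4 \<Rightarrow> real^4" where
  "tan_proj f x w =
     (1 / gdet f x) *\<^sub>R
     ((fffG f x * (w \<bullet> pd f e1 x) - fffF f x * (w \<bullet> pd f e2 x)) *\<^sub>R pd f e1 x +
      (fffE f x * (w \<bullet> pd f e2 x) - fffF f x * (w \<bullet> pd f e1 x)) *\<^sub>R pd f e2 x)"
definition nor_proj :: "(real \<times> real \<Rightarrow> real^4) \<Rightarrow> real \<times> real \<Rightarrow> real^4 \<Rightarrow> real^4" where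
  "nor_proj f x w = w - tan_proj f x w"

text \<open>Mean curvature vector H = g^{ij} (d_i d_j f)^perp (trace of the second fundamental form,
  so that a round sphere has W = 4 pi).\<close>
definition mean_curv :: "(real \<times> real \<Rightarrow> real^4) \<Rightarrow> real \<times> real \<Rightarrow> real^4" where
  "mean_curv f x = nor_proj f x
     ((1 / gdet f x) *\<^sub>R
       (fffG f x *\<^sub>R pd (pd f e1) e1 x - (2 * fffF f x) *\<^sub>R pd (pd f e1) e2 x
        + fffE f x *\<^sub>R pd (pd f e2) e2 x))"

definition willmore :: "(real \<times> real \<Rightarrow> real^4) \<Rightarrow> real" where
  "willmore f = (1/4) * integral (cbox (0,0) (1,1))
      (\<lambda>x. (norm (mean_curv f x))\<^sup>2 * sqrt (gdet f x))"

end

theory Submission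
  imports Defs "HOL-Complex_Analysis.Complex_Analysis"
begin

text \<open>
  Translate the double point to the origin and invert. The equality case of the Li--Yau inequality forces
  \<open>H = - 4 X\<^sup>\<bottom> / |X|\<^sup>2\<close>, so \<open>f / |f|\<^sup>2\<close> is the real part of the integral of a null closed (1,0)-form \<open>Omega\<close> on the torus
  minus the two preimages of the origin, with double poles and no residues there. If the contraction of \<open>Omega\<close> with
  a constant vector is a non-zero holomorphic differential, an index count shows that it has no zeros and its primitive
  identifies the universal cover with the complex plane; \<open>Omega\<close> becomes a null combination of two shifted Weierstrass
  functions whose real periods vanish. Such a combination forces the poles to differ by a half period and yields an
  equation between values at half periods that fails for every reduced lattice. Hence no such contraction exists, and
  \<open>Omega\<close> takes values in the span of its two polar directions, which contradicts the index count or gives a function of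
  degree one on the torus.
\<close>

section \<open>Smooth maps of the plane\<close>

type_synonym plane = "real \<times> real"

lemma Ck_imp_continuous: "Ck k f \<Longrightarrow> continuous_on UNIV f"
  by (cases k) auto

lemma Ck_SucD: "Ck (Suc k) f \<Longrightarrow> Ck k f"
proof (induction k arbitrary: f)
  case 0
  then show ?case by simp
next
  case (Suc k)
  then have "Ck k (pd f v)" for v by (metis Ck.simps(2))
  then show ?case using Suc.prems by simp
qed

lemma has_derivative_pd:
  assumes "f differentiable (at x)"
  shows "(f has_derivative (\<lambda>v. pd f v x)) (at x)"
  using assms frechet_derivative_works unfolding pd_def by (metis (no_types, lifting) ext)

lemma pd_eqI: "(f has_derivative D) (at x) \<Longrightarrow> pd f v x = D v"
  unfolding pd_def by (metis frechet_derivative_at)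

lemma Ck_pd: "Ck (Suc k) f \<Longrightarrow> Ck k (pd f v)"
  by simp

lemma Ck_Suc_has_derivative: "Ck (Suc k) f \<Longrightarrow> (f has_derivative (\<lambda>v. pd f v x)) (at x)"
  by (intro has_derivative_pd) (simp add: differentiable_on_def)

lemma Ck_SucI:
  assumes "\<And>x. (f has_derivative (\<lambda>v. D v x)) (at x)" "\<And>v. Ck k (D v)"
  shows "Ck (Suc k) f"
proof -
  have "pd f v = D v" for v using assms(1) by (auto intro!: pd_eqI)
  moreover have diff: "f differentiable (at x)" for x using assms(1) differentiable_def by blast
  moreover have "continuous_on UNIV f"
    using diff by (intro differentiable_imp_continuous_on)
      (auto simp: differentiable_on_def intro: differentiable_at_withinI)
  ultimately show ?thesis using assms(2) by (auto simp: differentiable_on_def)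
qed

declare Ck.simps(2) [simp del]

lemma Ck_const: "Ck k (\<lambda>x. c)"
proof (induction k arbitrary: c)
  case (Suc k) thus ?case by (intro Ck_SucI[where D = "\<lambda>v x. 0"]) auto
qed simp

lemma Ck_bounded_linear:
  assumes "bounded_linear L" shows "Ck k f \<Longrightarrow> Ck k (\<lambda>x. L (f x))"
proof (induction k arbitrary: f)
  case 0
  then show ?case by (simp add: bounded_linear.continuous_on[OF assms])
next
  case (Suc k)
  note deriv = bounded_linear.has_derivative[OF assms Ck_Suc_has_derivative[OF Suc.prems]]
  show ?case by (rule Ck_SucI[OF deriv]) (intro Suc.IH Ck_pd Suc.prems)
qed

lemma Ck_add: "Ck k f \<Longrightarrow> Ck k g \<Longrightarrow> Ck k (\<lambda>x. f x + g x)"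
proof (induction k arbitrary: f g)
  case 0
  then show ?case by (simp add: continuous_on_add)
next
  case (Suc k)
  note deriv = has_derivative_add[OF Suc.prems[THEN Ck_Suc_has_derivative]]
  show ?case by (rule Ck_SucI[OF deriv]) (intro Suc.IH Ck_pd Suc.prems)
qed

lemma Ck_bilinear:
  assumes "bounded_bilinear B" shows "Ck k f \<Longrightarrow> Ck k g \<Longrightarrow> Ck k (\<lambda>x. B (f x) (g x))"
proof (induction k arbitrary: f g)
  case 0
  then show ?case by (simp add: bounded_bilinear.continuous_on[OF assms])
next
  case (Suc k)
  note deriv = bounded_bilinear.FDERIV[OF assms Suc.prems[THEN Ck_Suc_has_derivative]]
  show ?case
    by (rule Ck_SucI[OF deriv]) (intro Ck_add Suc.IH Ck_pd Suc.prems[THEN Ck_SucD] Suc.prems)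
qed

lemma Ck_inverse:
  fixes f :: "'a::real_normed_vector \<Rightarrow> real"
  assumes nz: "\<And>x. f x \<noteq> 0"
  shows "Ck k f \<Longrightarrow> Ck k (\<lambda>x. inverse (f x))"
proof (induction k)
  case 0
  then show ?case using nz by (auto intro!: continuous_on_inverse)
next
  case (Suc k)
  have "((\<lambda>x. inverse (f x)) has_derivative (\<lambda>v. - (inverse (f x) * pd f v x * inverse (f x)))) (at x)" for x
    using Deriv.has_derivative_inverse[OF nz[of x] Ck_Suc_has_derivative[OF Suc.prems]] by simp
  then show ?case
    by (rule Ck_SucI)
      (intro Ck_bounded_linear[OF bounded_linear_minus[OF bounded_linear_ident]]
        Ck_bilinear[OF bounded_bilinear_mult] Suc.IH Ck_SucD[OF Suc.prems] Ck_pd Suc.prems)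
qed

lemma Ck_sqrt:
  fixes f :: "'a::real_normed_vector \<Rightarrow> real"
  assumes pos: "\<And>x. f x > 0"
  shows "Ck k f \<Longrightarrow> Ck k (\<lambda>x. sqrt (f x))"
proof (induction k)
  case 0
  then show ?case by (auto intro!: continuous_on_real_sqrt)
next
  case (Suc k)
  have Ck_inv: "Ck k (\<lambda>x. inverse (sqrt (f x)))"
    using pos by (intro Ck_inverse Suc.IH Ck_SucD[OF Suc.prems]) (simp add: less_imp_neq[symmetric])
  have "((\<lambda>x. sqrt (f x)) has_derivative (\<lambda>v. (inverse 2 * inverse (sqrt (f x))) * pd f v x)) (at x)" for x
  proof -
    note [derivative_intros] = Ck_Suc_has_derivative[OF Suc.prems]
    show ?thesis using pos[of x] by (auto intro!: derivative_eq_intros simp: field_simps)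
  qed
  then show ?case
    by (rule Ck_SucI) (intro Ck_bilinear[OF bounded_bilinear_mult] Ck_const Ck_inv Ck_pd Suc.prems)
qed

named_theorems smooth_intros

lemma smooth_map_has_derivative: "smooth_map f \<Longrightarrow> (f has_derivative (\<lambda>v. pd f v x)) (at x)"
  unfolding smooth_map_def using Ck_Suc_has_derivative by blast

lemma smooth_map_differentiable: "smooth_map f \<Longrightarrow> f differentiable (at x)"
  using smooth_map_has_derivative differentiable_def by blast

lemma smooth_map_pd [smooth_intros]: "smooth_map f \<Longrightarrow> smooth_map (pd f v)"
  unfolding smooth_map_def using Ck_pd by blast

lemma smooth_map_continuous_on: "smooth_map f \<Longrightarrow> continuous_on S f"
  unfolding smooth_map_def using Ck_imp_continuous continuous_on_subset by blast

lemma smooth_map_continuous_compose: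
  "smooth_map f \<Longrightarrow> continuous_on S g \<Longrightarrow> continuous_on S (\<lambda>x. f (g x))"
  by (rule continuous_on_compose2[OF smooth_map_continuous_on]) auto

lemma smooth_map_isCont: "smooth_map f \<Longrightarrow> isCont f x"
  using smooth_map_has_derivative has_derivative_continuous by blast

lemma smooth_map_tendsto: "smooth_map g \<Longrightarrow> (x \<longlongrightarrow> a) F \<Longrightarrow> ((\<lambda>t. g (x t)) \<longlongrightarrow> g a) F"
  using smooth_map_isCont isCont_tendsto_compose by blast

lemma smooth_map_const [smooth_intros]: "smooth_map (\<lambda>x. c)"
  by (simp add: smooth_map_def Ck_const)

lemma smooth_map_bounded_linear: "bounded_linear L \<Longrightarrow> smooth_map f \<Longrightarrow> smooth_map (\<lambda>x. L (f x))"
  by (simp add: smooth_map_def Ck_bounded_linear)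

lemma smooth_map_add [smooth_intros]: "smooth_map f \<Longrightarrow> smooth_map g \<Longrightarrow> smooth_map (\<lambda>x. f x + g x)"
  by (simp add: smooth_map_def Ck_add)

lemma smooth_map_minus [smooth_intros]: "smooth_map f \<Longrightarrow> smooth_map (\<lambda>x. - f x)"
  by (rule smooth_map_bounded_linear[OF bounded_linear_minus[OF bounded_linear_ident]])

lemma smooth_map_diff [smooth_intros]: "smooth_map f \<Longrightarrow> smooth_map g \<Longrightarrow> smooth_map (\<lambda>x. f x - g x)"
  using smooth_map_add[of f "\<lambda>x. - g x"] smooth_map_minus[of g] by simp

lemma smooth_map_bilinear:
  "bounded_bilinear B \<Longrightarrow> smooth_map f \<Longrightarrow> smooth_map g \<Longrightarrow> smooth_map (\<lambda>x. B (f x) (g x))"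
  by (simp add: smooth_map_def Ck_bilinear)

lemmas smooth_map_mult [smooth_intros] = smooth_map_bilinear[OF bounded_bilinear_mult]
lemmas smooth_map_scaleR [smooth_intros] = smooth_map_bilinear[OF bounded_bilinear_scaleR]
lemmas smooth_map_inner [smooth_intros] = smooth_map_bilinear[OF bounded_bilinear_inner]
lemmas smooth_map_of_real [smooth_intros] = smooth_map_bounded_linear[OF bounded_linear_of_real]

lemma smooth_map_divide [smooth_intros]:
  fixes f :: "'a::real_normed_vector \<Rightarrow> real"
  shows "(\<And>x. g x \<noteq> 0) \<Longrightarrow> smooth_map f \<Longrightarrow> smooth_map g \<Longrightarrow> smooth_map (\<lambda>x. f x / g x)"
  by (simp add: divide_inverse smooth_map_mult) (simp add: smooth_map_def Ck_inverse Ck_bilinear[OF bounded_bilinear_mult])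

lemma smooth_map_sqrt [smooth_intros]:
  fixes f :: "'a::real_normed_vector \<Rightarrow> real"
  shows "(\<And>x. f x > 0) \<Longrightarrow> smooth_map f \<Longrightarrow> smooth_map (\<lambda>x. sqrt (f x))"
  by (simp add: smooth_map_def Ck_sqrt)

lemma smooth_map_power [smooth_intros]:
  fixes f :: "'a::real_normed_vector \<Rightarrow> real"
  shows "smooth_map f \<Longrightarrow> smooth_map (\<lambda>x. f x ^ n)"
  by (induction n) (auto intro: smooth_map_const smooth_map_mult)

lemma pd_const: "pd (\<lambda>x. c) v x = 0"
  by (intro pd_eqI) (auto intro!: derivative_eq_intros)

lemma pd_add: "smooth_map f \<Longrightarrow> smooth_map g \<Longrightarrow> pd (\<lambda>x. f x + g x) v x = pd f v x + pd g v x"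
  by (intro pd_eqI has_derivative_add smooth_map_has_derivative)

lemma pd_diff: "smooth_map f \<Longrightarrow> smooth_map g \<Longrightarrow> pd (\<lambda>x. f x - g x) v x = pd f v x - pd g v x"
  by (intro pd_eqI has_derivative_diff smooth_map_has_derivative)

lemma pd_bounded_linear: "bounded_linear L \<Longrightarrow> f differentiable (at x) \<Longrightarrow> pd (\<lambda>x. L (f x)) v x = L (pd f v x)"
  by (rule pd_eqI[OF bounded_linear.has_derivative[OF _ has_derivative_pd]])

lemma pd_bilinear:
  "bounded_bilinear B \<Longrightarrow> smooth_map f \<Longrightarrow> smooth_map g \<Longrightarrow>
    pd (\<lambda>x. B (f x) (g x)) v x = B (f x) (pd g v x) + B (pd f v x) (g x)"
  by (rule pd_eqI[OF bounded_bilinear.FDERIV[OF _ smooth_map_has_derivative smooth_map_has_derivative]])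

lemmas pd_mult = pd_bilinear[OF bounded_bilinear_mult]
lemmas pd_scaleR = pd_bilinear[OF bounded_bilinear_scaleR]
lemmas pd_inner = pd_bilinear[OF bounded_bilinear_inner]

lemma pd_divide:
  fixes f :: "'a::real_normed_vector \<Rightarrow> real"
  assumes "smooth_map f" "smooth_map g" "g x \<noteq> 0"
  shows "pd (\<lambda>x. f x / g x) v x = (pd f v x * g x - f x * pd g v x) / (g x)\<^sup>2"
  unfolding power2_eq_square
  by (rule pd_eqI[OF has_derivative_divide'[OF assms(1,2)[THEN smooth_map_has_derivative] assms(3)]])

lemma pd_decompose:
  assumes "f differentiable (at x)"
  shows "pd f v x = fst v *\<^sub>R pd f e1 x + snd v *\<^sub>R pd f e2 x"
proof -
  have lin: "linear (\<lambda>v. pd f v x)"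
    using has_derivative_pd[OF assms] has_derivative_linear by blast
  have "v = fst v *\<^sub>R e1 + snd v *\<^sub>R e2" by (simp add: e1_def e2_def)
  then have "pd f v x = pd f (fst v *\<^sub>R e1 + snd v *\<^sub>R e2) x" by simp
  also have "\<dots> = fst v *\<^sub>R pd f e1 x + snd v *\<^sub>R pd f e2 x"
    using linear_add[OF lin] linear_scale[OF lin] by simp
  finally show ?thesis .
qed

lemmas smooth_map_pd_decompose = pd_decompose[OF smooth_map_differentiable]

lemma norm_fst_le: "norm (fst v) \<le> norm v" and norm_snd_le: "norm (snd v) \<le> norm v"
  for v :: "'a::real_normed_vector \<times> 'b::real_normed_vector"
  by (auto simp: norm_prod_def real_le_rsqrt)

lemma has_vector_derivative_partials:
  fixes f :: "plane \<Rightarrow> 'b::real_normed_vector"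
  assumes "f differentiable (at (x,y))"
  shows "((\<lambda>x. f (x,y)) has_vector_derivative pd f e1 (x,y)) (at x within S)" (is ?fst)
    and "((\<lambda>y. f (x,y)) has_vector_derivative pd f e2 (x,y)) (at y within S)" (is ?snd)
proof -
  note chain = has_derivative_compose[where g = f and g' = "\<lambda>v. pd f v (x,y)"]
  have "((\<lambda>x. f (x,y)) has_derivative (\<lambda>h. pd f (h,0) (x,y))) (at x)"
    by (rule chain[of "\<lambda>x. (x,y)"]) (auto intro!: derivative_eq_intros has_derivative_pd assms)
  moreover have "((\<lambda>y. f (x,y)) has_derivative (\<lambda>h. pd f (0,h) (x,y))) (at y)"
    by (rule chain[of "\<lambda>y. (x,y)"]) (auto intro!: derivative_eq_intros has_derivative_pd assms)
  ultimately show ?fst ?snd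
    unfolding has_vector_derivative_def pd_decompose[OF assms, of "(_,_)"] by (auto intro: has_derivative_at_withinI)
qed

lemmas smooth_map_partials = has_vector_derivative_partials[OF smooth_map_differentiable]

lemma pd_commute:
  fixes f :: "plane \<Rightarrow> 'b::banach"
  assumes f: "smooth_map f"
  shows "pd (pd f e1) e2 z = pd (pd f e2) e1 z"
proof -
  obtain a b where z: "z = (a,b)" by fastforce
  define c where "c = b - 1"
  note smooth_pd = smooth_map_pd[OF f] smooth_map_pd[OF smooth_map_pd[OF f]]
  have cont: "continuous_on S (\<lambda>t. pd f e2 (x,t))" "continuous_on S (\<lambda>t. pd (pd f e2) e1 (x,t))" for x S
    by (intro smooth_map_continuous_compose[of "pd _ _"] smooth_pd continuous_intros)+
  have slice: "integral (cbox c y) (\<lambda>t. pd f e2 (x,t)) = f (x,y) - f (x,c)" if "c \<le> y" for x y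
    using fundamental_theorem_of_calculus[OF that, of "\<lambda>t. f (x,t)" "\<lambda>t. pd f e2 (x,t)"]
      smooth_map_partials(2)[OF f] by (auto intro: integral_unique)
  have slice_deriv: "integral (cbox c y) (\<lambda>t. pd (pd f e2) e1 (a,t)) = pd f e1 (a,y) - pd f e1 (a,c)"
    if "c \<le> y" for y
  proof -
    have "((\<lambda>x. integral (cbox c y) (\<lambda>t. pd f e2 (x,t))) has_vector_derivative
        integral (cbox c y) (\<lambda>t. pd (pd f e2) e1 (a,t))) (at a within UNIV)"
      by (rule leibniz_rule_vector_derivative)
        (auto intro: smooth_map_partials(1) smooth_map_continuous_on smooth_pd
          simp: integrable_continuous_real cont)
    then have "((\<lambda>x. f (x,y) - f (x,c)) has_vector_derivative
        integral (cbox c y) (\<lambda>t. pd (pd f e2) e1 (a,t))) (at a)"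
      using slice[OF that] by simp
    moreover have "((\<lambda>x. f (x,y) - f (x,c)) has_vector_derivative
        pd f e1 (a,y) - pd f e1 (a,c)) (at a)"
      by (intro has_vector_derivative_diff smooth_map_partials f)
    ultimately show ?thesis by (rule vector_derivative_unique_at)
  qed
  have "((\<lambda>y. integral {c..y} (\<lambda>t. pd (pd f e2) e1 (a,t))) has_vector_derivative
      pd (pd f e2) e1 (a,b)) (at b within {c..b + 1})"
    by (rule integral_has_vector_derivative) (auto simp: c_def cont)
  then have "((\<lambda>y. integral {c..y} (\<lambda>t. pd (pd f e2) e1 (a,t))) has_vector_derivative
      pd (pd f e2) e1 (a,b)) (at b)"
    by (subst (asm) at_within_Icc_at) (auto simp: c_def)
  then have "((\<lambda>y. pd f e1 (a,y) - pd f e1 (a,c)) has_vector_derivative pd (pd f e2) e1 (a,b)) (at b)"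
    by (rule has_vector_derivative_transform_within[where d = 1])
      (use slice_deriv in \<open>auto simp: c_def dist_real_def\<close>)
  moreover have "((\<lambda>y. pd f e1 (a,y) - pd f e1 (a,c)) has_vector_derivative pd (pd f e1) e2 (a,b)) (at b)"
    using smooth_map_partials(2)[OF smooth_pd(1)]
      has_vector_derivative_diff[OF _ has_vector_derivative_const] by fastforce
  ultimately show ?thesis unfolding z by (meson vector_derivative_unique_at)
qed

lemma pd_pd_commute:
  fixes f :: "plane \<Rightarrow> 'b::banach"
  assumes f: "smooth_map f"
  shows "pd (pd f v) w x = pd (pd f w) v x"
proof -
  have pd_eq: "pd f v = (\<lambda>x. fst v *\<^sub>R pd f e1 x + snd v *\<^sub>R pd f e2 x)" for v
    using smooth_map_pd_decompose[OF f] by blast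
  have bilinear: "pd (pd f v) w x = fst v *\<^sub>R pd (pd f e1) w x + snd v *\<^sub>R pd (pd f e2) w x" for v w
    using smooth_map_pd[OF f]
    by (subst pd_eq) (simp add: pd_add pd_scaleR pd_const smooth_map_scaleR smooth_map_const)
  have "pd (pd f u) v x = fst v *\<^sub>R pd (pd f u) e1 x + snd v *\<^sub>R pd (pd f u) e2 x" for u v
    by (rule smooth_map_pd_decompose[OF smooth_map_pd[OF f]])
  from this[of e1 v] this[of e2 v] this[of e1 w] this[of e2 w] show ?thesis
    unfolding bilinear[of v w] bilinear[of w v]
    by (simp add: pd_commute[OF f] scaleR_add_right mult.commute)
qed

section \<open>Order of vanishing at the origin\<close>

definition vanishes :: "nat \<Rightarrow> (plane \<Rightarrow> 'b::real_normed_vector) \<Rightarrow> bool" where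
  "vanishes k g \<longleftrightarrow> (\<exists>C. \<forall>\<^sub>F v in nhds 0. norm (g v) \<le> C * norm v ^ k)"

lemma vanishesE:
  assumes "vanishes k g"
  obtains C where "C > 0" "\<forall>\<^sub>F v in nhds 0. norm (g v) \<le> C * norm v ^ k"
proof -
  obtain C where "\<forall>\<^sub>F v in nhds 0. norm (g v) \<le> C * norm v ^ k"
    using assms by (auto simp: vanishes_def)
  then have "\<forall>\<^sub>F v in nhds 0. norm (g v) \<le> max C 1 * norm v ^ k"
    by (rule eventually_mono)
      (meson max.cobounded1 mult_right_mono norm_ge_zero order_trans zero_le_power)
  then show ?thesis using that[of "max C 1"] by simp
qed

lemma vanishes_add: "vanishes k g \<Longrightarrow> vanishes k h \<Longrightarrow> vanishes k (\<lambda>v. g v + h v)"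
proof -
  assume "vanishes k g" "vanishes k h"
  then obtain C D where "\<forall>\<^sub>F v in nhds 0. norm (g v) \<le> C * norm v ^ k"
    "\<forall>\<^sub>F v in nhds 0. norm (h v) \<le> D * norm v ^ k"
    by (auto simp: vanishes_def)
  then have "\<forall>\<^sub>F v in nhds 0. norm (g v + h v) \<le> (C + D) * norm v ^ k"
    by eventually_elim (metis add_mono distrib_right norm_triangle_le)
  then show ?thesis unfolding vanishes_def by blast
qed

lemma vanishes_diff: "vanishes k g \<Longrightarrow> vanishes k h \<Longrightarrow> vanishes k (\<lambda>v. g v - h v)"
  using vanishes_add[of k g "\<lambda>v. - h v"] by (simp add: vanishes_def)

lemma vanishes_bilinear:
  assumes B: "bounded_bilinear B" and "vanishes k g" "vanishes l h"
  shows "vanishes (k + l) (\<lambda>v. B (g v) (h v))"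
proof -
  obtain C D where C: "C > 0" "\<forall>\<^sub>F v in nhds 0. norm (g v) \<le> C * norm v ^ k"
    and D: "D > 0" "\<forall>\<^sub>F v in nhds 0. norm (h v) \<le> D * norm v ^ l"
    using assms(2,3) by (elim vanishesE)
  obtain K where K: "K > 0" "\<And>x y. norm (B x y) \<le> norm x * norm y * K"
    using bounded_bilinear.pos_bounded[OF B] by blast
  have "\<forall>\<^sub>F v in nhds 0. norm (B (g v) (h v)) \<le> (C * D * K) * norm v ^ (k + l)"
    using C(2) D(2)
  proof eventually_elim
    case (elim v)
    have "norm (B (g v) (h v)) \<le> (C * norm v ^ k) * (D * norm v ^ l) * K"
      by (rule order_trans[OF K(2)]) (intro mult_mono elim; use C D K in auto)
    then show ?case by (simp add: power_add mult_ac)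
  qed
  then show ?thesis unfolding vanishes_def by blast
qed

lemmas vanishes_mult = vanishes_bilinear[OF bounded_bilinear_mult]
lemmas vanishes_inner = vanishes_bilinear[OF bounded_bilinear_inner]

lemma vanishes_mono: "vanishes k g \<Longrightarrow> l \<le> k \<Longrightarrow> vanishes l g"
proof -
  assume "vanishes k g" and "l \<le> k"
  then obtain C where C: "C > 0" "\<forall>\<^sub>F v in nhds 0. norm (g v) \<le> C * norm v ^ k"
    by (elim vanishesE)
  have "\<forall>\<^sub>F v in nhds 0. v \<in> ball (0 :: plane) 1" by (intro eventually_nhds_in_open) auto
  with C(2) have "\<forall>\<^sub>F v in nhds 0. norm (g v) \<le> C * norm v ^ l"
  proof eventually_elim
    case (elim v)
    then have "norm v ^ k \<le> norm v ^ l" using \<open>l \<le> k\<close> by (intro power_decreasing) auto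
    then show ?case using elim(1) C(1) by (smt (verit) mult_left_mono)
  qed
  then show ?thesis unfolding vanishes_def by blast
qed

lemma vanishes_bounded_linear: "bounded_linear L \<Longrightarrow> vanishes 1 L"
  unfolding vanishes_def power_one_right using bounded_linear.bounded[of L]
  by (metis (mono_tags, lifting) always_eventually mult.commute)

lemma vanishes_of_real: "vanishes k g \<Longrightarrow> vanishes k (\<lambda>v. complex_of_real (g v))"
  unfolding vanishes_def norm_of_real real_norm_def .

definition vanishes_at_most :: "nat \<Rightarrow> (plane \<Rightarrow> 'b::real_normed_vector) \<Rightarrow> bool" where
  "vanishes_at_most k h \<longleftrightarrow> (\<exists>c>0. \<forall>\<^sub>F v in nhds 0. c * norm v ^ k \<le> norm (h v))"

lemma vanishes_at_most_mult:
  fixes g h :: "plane \<Rightarrow> complex"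
  assumes "vanishes_at_most k g" "vanishes_at_most l h" shows "vanishes_at_most (k + l) (\<lambda>v. g v * h v)"
proof -
  obtain c d where "c > 0" "d > 0" "\<forall>\<^sub>F v in nhds 0. c * norm v ^ k \<le> norm (g v)"
    "\<forall>\<^sub>F v in nhds 0. d * norm v ^ l \<le> norm (h v)" using assms by (auto simp: vanishes_at_most_def)
  moreover from this(3,4) have "\<forall>\<^sub>F v in nhds 0. c * d * norm v ^ (k + l) \<le> norm (g v * h v)"
  proof eventually_elim
    case (elim v)
    then have "(c * norm v ^ k) * (d * norm v ^ l) \<le> norm (g v) * norm (h v)"
      using \<open>d > 0\<close> by (intro mult_mono) auto
    then show ?case by (simp add: norm_mult power_add mult_ac)
  qed
  ultimately show ?thesis unfolding vanishes_at_most_def by (intro exI[of _ "c * d"]) simp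
qed

lemma eventually_nonzero_if_vanishes_at_most:
  assumes "vanishes_at_most k (\<lambda>v. h (p + v))" shows "\<forall>\<^sub>F x in at p. h x \<noteq> 0"
proof -
  obtain c where c: "c > 0" "\<forall>\<^sub>F v in nhds 0. c * norm v ^ k \<le> norm (h (p + v))"
    using assms by (auto simp: vanishes_at_most_def)
  have "\<forall>\<^sub>F v in at 0. h (p + v) \<noteq> 0"
    using c(2)[unfolded eventually_nhds_conv_at, THEN conjunct1] eventually_neq_at_within[of 0 0 UNIV]
    by eventually_elim (metis c(1) mult_pos_pos norm_zero not_le zero_less_norm_iff zero_less_power)
  then show ?thesis by (simp add: at_to_0[of p] eventually_filtermap add.commute)
qed

lemma vanishes_quotient:
  fixes g h :: "plane \<Rightarrow> complex"
  assumes "vanishes (k + l) g" and h: "vanishes_at_most k h"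
  shows "\<exists>C. \<forall>\<^sub>F v in at 0. norm (g v / h v) \<le> C * norm v ^ l"
proof -
  obtain C where C: "C > 0" "\<forall>\<^sub>F v in nhds 0. norm (g v) \<le> C * norm v ^ (k + l)"
    using assms(1) by (rule vanishesE)
  obtain c where c: "c > 0" "\<forall>\<^sub>F v in nhds 0. c * norm v ^ k \<le> norm (h v)"
    using h by (auto simp: vanishes_at_most_def)
  have "\<forall>\<^sub>F v in at 0. norm (g v / h v) \<le> (C / c) * norm v ^ l"
    using C(2)[unfolded eventually_nhds_conv_at, THEN conjunct1]
      c(2)[unfolded eventually_nhds_conv_at, THEN conjunct1] eventually_neq_at_within[of 0 0]
  proof eventually_elim
    case (elim v)
    then have "norm (g v / h v) \<le> C * norm v ^ (k + l) / (c * norm v ^ k)"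
      unfolding norm_divide using C(1) c(1) by (intro frac_le) auto
    then show ?case using elim(3) by (simp add: power_add)
  qed
  then show ?thesis by blast
qed

lemma tendsto_quotient_if_vanishes:
  fixes g h :: "plane \<Rightarrow> complex"
  assumes "vanishes (Suc k) g" "vanishes_at_most k h" shows "((\<lambda>v. g v / h v) \<longlongrightarrow> 0) (at 0)"
proof -
  obtain C where "\<forall>\<^sub>F v in at 0. norm (g v / h v) \<le> C * norm v"
    using vanishes_quotient[OF _ assms(2), of 1 g] assms(1) by auto
  moreover have "((\<lambda>v. C * norm v) \<longlongrightarrow> 0) (at 0)" by (auto intro!: tendsto_eq_intros)
  ultimately show ?thesis by (rule Lim_null_comparison)
qed

lemma vanishes_at_most_if_vanishes_diff:
  assumes "vanishes (Suc k) (\<lambda>v. g v - h v)" and "vanishes_at_most k h" shows "vanishes_at_most k g"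
proof -
  obtain C where C: "C > 0" "\<forall>\<^sub>F v in nhds 0. norm (g v - h v) \<le> C * norm v ^ Suc k"
    using assms(1) by (rule vanishesE)
  obtain c where h: "c > 0" "\<forall>\<^sub>F v in nhds 0. c * norm v ^ k \<le> norm (h v)"
    using assms(2) by (auto simp: vanishes_at_most_def)
  have "\<forall>\<^sub>F v in nhds 0. v \<in> ball (0 :: plane) (c / (2 * C))"
    using C(1) h(1) by (intro eventually_nhds_in_open) auto
  with C(2) h(2) have "\<forall>\<^sub>F v in nhds 0. c / 2 * norm v ^ k \<le> norm (g v)"
  proof eventually_elim
    case (elim v)
    have "C * norm v ^ Suc k = norm v ^ k * (C * norm v)" by simp
    also have "\<dots> \<le> norm v ^ k * (c / 2)"
      using elim(3) C(1) by (intro mult_left_mono) (auto simp: field_simps)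
    finally show ?case using elim(1,2) norm_triangle_ineq2[of "h v" "h v - g v"]
      by (simp add: norm_minus_commute mult_ac)
  qed
  then show ?thesis unfolding vanishes_at_most_def using h(1) by (intro exI[of _ "c / 2"]) simp
qed

lemma vanishes_mult_diff:
  fixes g g' h h' :: "plane \<Rightarrow> complex"
  assumes "vanishes (Suc k) (\<lambda>v. g v - g' v)" "vanishes k g'"
    and "vanishes (Suc l) (\<lambda>v. h v - h' v)" "vanishes l h"
  shows "vanishes (Suc (k + l)) (\<lambda>v. g v * h v - g' v * h' v)"
proof -
  have "vanishes (Suc (k + l)) (\<lambda>v. (g v - g' v) * h v + g' v * (h v - h' v))"
    using vanishes_mult[OF assms(1,4)] vanishes_mult[OF assms(2,3)] by (intro vanishes_add) simp_all
  then show ?thesis by (simp add: algebra_simps)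
qed

lemma smooth_map_vanishes_pd: "smooth_map g \<Longrightarrow> vanishes 1 (\<lambda>v. pd g v p)"
  using smooth_map_has_derivative has_derivative_bounded_linear vanishes_bounded_linear by blast

lemma smooth_map_vanishes_increment:
  fixes g :: "plane \<Rightarrow> 'b::real_normed_vector"
  assumes g: "smooth_map g"
  shows "vanishes 1 (\<lambda>v. g (p + v) - g p)"
proof -
  obtain d where d: "d > 0"
    "\<And>y. norm (y - p) < d \<Longrightarrow> norm (g y - g p - pd g (y - p) p) \<le> 1 * norm (y - p)"
    using smooth_map_has_derivative[OF g, of p] unfolding has_derivative_at_alt by (meson zero_less_one)
  have "\<forall>\<^sub>F v in nhds 0. v \<in> ball (0 :: plane) d" using d(1) by (intro eventually_nhds_in_open) auto
  then have "\<forall>\<^sub>F v in nhds 0. norm (g (p + v) - g p - pd g v p) \<le> 1 * norm v ^ 1"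
    by (rule eventually_mono) (use d(2)[of "p + _"] in auto)
  then have "vanishes 1 (\<lambda>v. g (p + v) - g p - pd g v p)" unfolding vanishes_def by blast
  then have "vanishes 1 (\<lambda>v. g (p + v) - g p - pd g v p + pd g v p)"
    by (intro vanishes_add smooth_map_vanishes_pd g)
  then show ?thesis by simp
qed

lemma pd_increment_bound:
  fixes g :: "plane \<Rightarrow> 'b::real_normed_vector"
  assumes g: "smooth_map g"
  obtains C d where "C > 0" "d > 0"
    "\<And>u w. norm u < d \<Longrightarrow> norm (pd g w (p + u) - pd g w p) \<le> norm w * (C * norm u)"
proof -
  have "vanishes 1 (\<lambda>v. norm (pd g e1 (p + v) - pd g e1 p) + norm (pd g e2 (p + v) - pd g e2 p))"
    using smooth_map_vanishes_increment[OF smooth_map_pd[OF g]]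
    by (intro vanishes_add) (simp_all add: vanishes_def)
  then obtain C d where C: "C > 0" and d: "d > 0" "\<And>v. norm v < d \<Longrightarrow>
      norm (pd g e1 (p + v) - pd g e1 p) + norm (pd g e2 (p + v) - pd g e2 p) \<le> C * norm v"
    by (elim vanishesE) (auto simp: eventually_nhds_metric)
  have "norm (pd g w (p + u) - pd g w p) \<le> norm w * (C * norm u)" if "norm u < d" for u w :: "plane"
  proof -
    have "pd g w (p + u) - pd g w p
        = fst w *\<^sub>R (pd g e1 (p + u) - pd g e1 p) + snd w *\<^sub>R (pd g e2 (p + u) - pd g e2 p)"
      unfolding smooth_map_pd_decompose[OF g, of w] by (simp add: algebra_simps)
    then have "norm (pd g w (p + u) - pd g w p) \<le>
        \<bar>fst w\<bar> * norm (pd g e1 (p + u) - pd g e1 p) + \<bar>snd w\<bar> * norm (pd g e2 (p + u) - pd g e2 p)"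
      by (metis norm_scaleR norm_triangle_ineq)
    also have "\<dots> \<le> norm w * norm (pd g e1 (p + u) - pd g e1 p) + norm w * norm (pd g e2 (p + u) - pd g e2 p)"
      using norm_fst_le[of w] norm_snd_le[of w] by (intro add_mono mult_right_mono) auto
    also have "\<dots> \<le> norm w * (C * norm u)"
      unfolding distrib_left[symmetric] by (intro mult_left_mono d(2)[OF that]) auto
    finally show ?thesis .
  qed
  then show ?thesis using that C d(1) by blast
qed

lemma smooth_map_vanishes_Taylor:
  fixes g :: "plane \<Rightarrow> 'b::real_normed_vector"
  assumes g: "smooth_map g"
  shows "vanishes 2 (\<lambda>v. g (p + v) - g p - pd g v p)"
proof -
  obtain C d where C: "C > 0" and d: "d > 0"
    and pd_le: "\<And>u w. norm u < d \<Longrightarrow> norm (pd g w (p + u) - pd g w p) \<le> norm w * (C * norm u)"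
    using pd_increment_bound[OF g] by blast
  define k where "k = (\<lambda>u. g (p + u) - pd g u p)"
  have k_deriv: "(k has_derivative (\<lambda>w. pd g w (p + u) - pd g w p)) (at u)" for u
  proof -
    have "((\<lambda>u. g (p + u)) has_derivative (\<lambda>w. pd g w (p + u))) (at u)"
      by (rule has_derivative_compose[where f = "\<lambda>u. p + u" and g = g and f' = "\<lambda>w. w"])
        (auto intro!: derivative_eq_intros smooth_map_has_derivative g)
    then show ?thesis
      unfolding k_def using smooth_map_has_derivative[OF g, of p] has_derivative_bounded_linear
      by (intro has_derivative_diff bounded_linear_imp_has_derivative) blast+
  qed
  have "norm (g (p + v) - g p - pd g v p) \<le> C * norm v ^ 2" if v: "norm v < d" for v
  proof -
    have "norm (k v - k 0) \<le> C * norm v * norm (v - 0)"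
    proof (rule differentiable_bound[of "cball 0 (norm v)" k "\<lambda>u w. pd g w (p + u) - pd g w p"])
      show "onorm (\<lambda>w. pd g w (p + u) - pd g w p) \<le> C * norm v" if u: "u \<in> cball 0 (norm v)" for u
      proof (intro onorm_bound)
        fix w :: "plane"
        have "norm w * (C * norm u) \<le> norm w * (C * norm v)" using u C by (intro mult_left_mono) auto
        then show "norm (pd g w (p + u) - pd g w p) \<le> C * norm v * norm w"
          using pd_le[of u w] u v by (simp add: mult_ac)
      qed (use C in auto)
    qed (auto intro: has_derivative_at_withinI k_deriv)
    moreover have "pd g 0 p = 0" unfolding smooth_map_pd_decompose[OF g, of 0] by simp
    ultimately show ?thesis by (simp add: k_def power2_eq_square algebra_simps)
  qed
  then show ?thesis
    unfolding vanishes_def eventually_nhds_metric dist_norm using d by (metis diff_zero)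
qed

lemma smooth_map_vanishes_0:
  fixes g :: "plane \<Rightarrow> 'b::real_normed_vector"
  assumes "smooth_map g" shows "vanishes 0 (\<lambda>v. g (p + v))"
proof -
  have "vanishes 0 (\<lambda>v. g p)" unfolding vanishes_def by auto
  then show ?thesis
    using vanishes_add[OF vanishes_mono[OF smooth_map_vanishes_increment[OF assms, of p]], of 0 "\<lambda>v. g p"]
    by simp
qed

lemma vanishes_1_if_zero: "smooth_map g \<Longrightarrow> g p = 0 \<Longrightarrow> vanishes 1 (\<lambda>v. g (p + v))"
  using smooth_map_vanishes_increment[of g p] by simp

lemma vanishes_2_if_zero: "smooth_map g \<Longrightarrow> g p = 0 \<Longrightarrow> vanishes 2 (\<lambda>v. g (p + v) - pd g v p)"
  using smooth_map_vanishes_Taylor[of g p] by simp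

section \<open>Doubly periodic maps\<close>

definition int_vectors :: "plane set" where
  "int_vectors = {w. fst w \<in> \<int> \<and> snd w \<in> \<int>}"

lemma int_vectors_simps [simp]:
  "0 \<in> int_vectors" "w \<in> int_vectors \<Longrightarrow> - w \<in> int_vectors"
  "(of_int m, of_int n) \<in> int_vectors" "(1,0) \<in> int_vectors" "(0,1) \<in> int_vectors"
  by (auto simp: int_vectors_def)

lemma int_vectors_add: "v \<in> int_vectors \<Longrightarrow> w \<in> int_vectors \<Longrightarrow> v + w \<in> int_vectors"
  and int_vectors_diff: "v \<in> int_vectors \<Longrightarrow> w \<in> int_vectors \<Longrightarrow> v - w \<in> int_vectors"
  by (auto simp: int_vectors_def)

lemma int_vectors_minus_commute: "x - y \<in> int_vectors \<longleftrightarrow> y - x \<in> int_vectors"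
  using int_vectors_simps(2)[of "x - y"] int_vectors_simps(2)[of "y - x"] by auto

lemma int_vectorsE:
  assumes "w \<in> int_vectors" obtains m n :: int where "w = (of_int m, of_int n)"
  using assms by (cases w) (auto simp: int_vectors_def elim!: Ints_cases)

lemma countable_int_vectors: "countable int_vectors"
proof -
  have "int_vectors \<subseteq> (\<lambda>(m::int, n::int). (of_int m, of_int n)) ` UNIV"
    by (auto elim!: int_vectorsE)
  then show ?thesis by (rule countable_subset) auto
qed

lemma torus_periodicD:
  assumes "torus_periodic g" "w \<in> int_vectors" shows "g (x + w) = g x"
proof -
  have e1_shift: "g (a + 1, b) = g (a,b)" and e2_shift: "g (a, b + 1) = g (a,b)" for a b
    using assms(1) unfolding torus_periodic_def by (metis add.right_neutral add_Pair)+
  obtain a b where x: "x = (a,b)" by fastforce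
  obtain m n where w: "w = (of_int m, of_int n)" using assms(2) by (rule int_vectorsE)
  interpret fst: periodic_fun_simple' "\<lambda>a. g (a, b + of_int n)" by unfold_locales (rule e1_shift)
  interpret snd: periodic_fun_simple' "\<lambda>b. g (a, b)" by unfold_locales (rule e2_shift)
  show ?thesis unfolding x w using fst.plus_of_int[of a m] snd.plus_of_int[of b n] by simp
qed

lemma torus_periodic_unit_shift:
  assumes "torus_periodic g" shows "g (x + 1, y) = g (x,y)" "g (x, y + 1) = g (x,y)"
  using torus_periodicD[OF assms, of "(1,0)" "(x,y)"] torus_periodicD[OF assms, of "(0,1)" "(x,y)"] by simp_all

lemma torus_periodicI: "(\<And>x w. w \<in> int_vectors \<Longrightarrow> g (x + w) = g x) \<Longrightarrow> torus_periodic g"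
  by (simp add: torus_periodic_def)

lemma torus_periodic_pd:
  fixes g :: "plane \<Rightarrow> 'b::real_normed_vector"
  assumes g: "smooth_map g" and "torus_periodic g" shows "torus_periodic (pd g v)"
proof -
  have "pd g v (x + m) = pd g v x" if periodic: "\<And>x. g (x + m) = g x" for x m
  proof -
    have "((\<lambda>x. g (x + m)) has_derivative (\<lambda>v. pd g v (x + m))) (at x)"
      by (rule has_derivative_compose[where f = "\<lambda>x. x + m" and g = g and f' = "\<lambda>v. v"])
        (auto intro!: derivative_eq_intros smooth_map_has_derivative g)
    then show ?thesis unfolding periodic by (metis pd_eqI)
  qed
  then show ?thesis using assms(2) unfolding torus_periodic_def by blast
qed

lemma int_vector_representative:
  obtains w where "w \<in> int_vectors" "x + w \<in> cbox (0,0) (1,1)"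
proof
  let ?w = "(of_int (- \<lfloor>fst x\<rfloor>), of_int (- \<lfloor>snd x\<rfloor>))"
  show "?w \<in> int_vectors" by (rule int_vectors_simps)
  have "x + ?w = (frac (fst x), frac (snd x))"
    by (cases x) (simp add: frac_def)
  then show "x + ?w \<in> cbox (0,0) (1,1)"
    by (auto simp: cbox_Pair_eq frac_ge_0 frac_lt_1 less_imp_le)
qed

lemma torus_periodic_bounded:
  fixes g :: "plane \<Rightarrow> 'b::real_normed_vector"
  assumes "torus_periodic g" "continuous_on UNIV g" obtains C where "C > 0" "\<And>x. norm (g x) \<le> C"
proof -
  have "bounded (g ` cbox (0,0) (1,1))"
    using assms(2) by (intro compact_imp_bounded compact_continuous_image compact_cbox)
      (auto intro: continuous_on_subset)
  then obtain C where C: "C > 0" "\<And>x. x \<in> cbox (0,0) (1,1) \<Longrightarrow> norm (g x) \<le> C"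
    by (metis bounded_pos imageI)
  have "norm (g x) \<le> C" for x
    using int_vector_representative[of x] torus_periodicD[OF assms(1)] C(2) by metis
  then show ?thesis using that C(1) by blast
qed

text \<open>Compactness of the torus turns a local bound into a uniform one.\<close>

lemma torus_periodic_uniform:
  fixes P :: "plane \<Rightarrow> real \<Rightarrow> bool"
  assumes loc: "\<And>x0. \<exists>d>0. \<exists>e>0. \<forall>x\<in>ball x0 e. P x d"
    and antimono: "\<And>x d d'. P x d \<Longrightarrow> 0 < d' \<Longrightarrow> d' \<le> d \<Longrightarrow> P x d'"
    and periodic: "\<And>x d w. P x d \<Longrightarrow> w \<in> int_vectors \<Longrightarrow> P (x + w) d"
  shows "\<exists>d>0. \<forall>x. P x d"
proof -
  obtain d e where de: "\<And>x. d x > 0" "\<And>x. e x > 0" "\<And>x y. y \<in> ball x (e x) \<Longrightarrow> P y (d x)"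
    using loc by metis
  let ?K = "cbox (0,0) (1,1) :: plane set"
  have "?K \<subseteq> (\<Union>x\<in>?K. ball x (e x))" using de(2) by (meson UN_iff centre_in_ball subsetI)
  then obtain T where T: "T \<subseteq> ?K" "finite T" "?K \<subseteq> (\<Union>x\<in>T. ball x (e x))"
    by (rule compactE_image[OF compact_cbox, rotated]) auto
  have "(0,0) \<in> ?K" by (simp add: cbox_Pair_eq)
  then have "T \<noteq> {}" using T(3) by blast
  define m where "m = Min (d ` T)"
  have m: "m > 0" unfolding m_def using T(2) \<open>T \<noteq> {}\<close> de(1) by (subst Min_gr_iff) auto
  have "P x m" if x: "x \<in> ?K" for x
  proof -
    obtain y where y: "y \<in> T" "x \<in> ball y (e y)" using T(3) x by blast
    have "m \<le> d y" unfolding m_def using T(2) y(1) by (intro Min_le) auto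
    then show ?thesis using antimono[OF de(3)[OF y(2)] m] by blast
  qed
  then have "P x m" for x
    using int_vector_representative[of x] periodic[of "x + _" m "- _"]
    by (metis add_diff_cancel_right' diff_conv_add_uminus int_vectors_simps(2))
  then show ?thesis using m by blast
qed

lemma exists_real_avoiding_cosets:
  assumes "finite (Z :: real set)" shows "\<exists>a. \<forall>z\<in>Z. z - a \<notin> \<int>"
proof -
  have "countable (\<Union>z\<in>Z. range (\<lambda>n. z - of_int n))"
    by (intro countable_UN[OF countable_finite[OF assms]]) auto
  hence "(\<Union>z\<in>Z. range (\<lambda>n. z - of_int n)) \<noteq> (UNIV :: real set)" using uncountable_UNIV_real by metis
  then obtain a where a: "a \<notin> (\<Union>z\<in>Z. range (\<lambda>n. z - of_int n))" by blast
  have "z - a \<notin> \<int>" if "z \<in> Z" for z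
  proof
    assume "z - a \<in> \<int>"
    then obtain n where "z - a = of_int n" by (rule Ints_cases)
    hence "a = z - of_int n" by simp
    thus False using a that by blast
  qed
  thus ?thesis by blast
qed

lemma int_vector_representative_in_box:
  fixes z :: "plane"
  assumes "fst z - fst a \<notin> \<int>" "snd z - snd a \<notin> \<int>"
  obtains w where "w \<in> int_vectors" "z + w \<in> box a (a + (1,1))"
proof -
  let ?w = "(of_int (- \<lfloor>fst z - fst a\<rfloor>), of_int (- \<lfloor>snd z - snd a\<rfloor>))"
  have frac: "0 < t + of_int (- \<lfloor>t\<rfloor>)" "t + of_int (- \<lfloor>t\<rfloor>) < 1" if "t \<notin> \<int>" for t :: real
    using frac_gt_0_iff[of t] frac_lt_1[of t] that by (auto simp: frac_def)
  show ?thesis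
  proof
    show "?w \<in> int_vectors"
      by (rule int_vectors_simps)
    show "z + ?w \<in> box a (a + (1,1))"
      using frac[OF assms(1)] frac[OF assms(2)] by (cases z; cases a) (simp add: mem_box Basis_prod_def)
  qed
qed

abbreviation unit_cell :: "plane \<Rightarrow> plane set" where
  "unit_cell a \<equiv> cbox a (a + (1,1))"

lemma integral_periodic_real:
  fixes h :: "real \<Rightarrow> 'a::euclidean_space"
  assumes cont: "continuous_on UNIV h" and periodic: "\<And>x. h (x + 1) = h x"
  shows "integral {a..a + 1} h = integral {0..1} h"
proof -
  interpret periodic_fun_simple' h by unfold_locales (rule periodic)
  have int: "h integrable_on {u..v}" for u v
    by (rule integrable_continuous_real) (rule continuous_on_subset[OF cont], simp)
  have shift: "integral {u + of_int n..v + of_int n} h = integral {u..v} h" for u v n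
    using integral_shift_real_ivl[of "u + of_int n" "of_int n" "v + of_int n" h]
    by (simp add: plus_of_int)
  define n where "n = \<lfloor>a\<rfloor>"
  have n: "of_int n \<le> a" "a \<le> of_int n + 1" unfolding n_def by linarith+
  have "integral {a..a + 1} h = integral {a..of_int n + 1} h + integral {of_int n + 1..a + 1} h"
    using n by (intro Henstock_Kurzweil_Integration.integral_combine[symmetric] int) auto
  also have "integral {of_int n + 1..a + 1} h = integral {of_int n..a} h"
    using shift[of "of_int n" 1 a] by simp
  also have "integral {a..of_int n + 1} h + integral {of_int n..a} h = integral {of_int n..of_int n + 1} h"
    using n by (subst add.commute) (intro Henstock_Kurzweil_Integration.integral_combine int, auto)
  also have "\<dots> = integral {0..1} h" using shift[of 0 n 1] by (simp add: add.commute)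
  finally show ?thesis .
qed

lemma integral_unit_cell_iterated:
  fixes g :: "plane \<Rightarrow> 'b::euclidean_space"
  assumes "continuous_on UNIV g"
  shows "integral (unit_cell (a,b)) g = integral {a..a + 1} (\<lambda>x. integral {b..b + 1} (\<lambda>y. g (x,y)))" (is ?x_outer)
    "integral (unit_cell (a,b)) g = integral {b..b + 1} (\<lambda>y. integral {a..a + 1} (\<lambda>x. g (x,y)))" (is ?y_outer)
proof -
  have cont: "continuous_on S g" for S using assms continuous_on_subset by blast
  show fst_outer: ?x_outer
    using integral_prod_continuous[OF cont, of a b "a + 1" "b + 1"] by simp
  show ?y_outer
    using integral_swap_continuous[of a b "a + 1" "b + 1" "\<lambda>x y. g (x,y)"] cont fst_outer
    by (simp add: case_prod_unfold)
qed

lemma integral_unit_cell_shift: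
  fixes g :: "plane \<Rightarrow> 'b::euclidean_space"
  assumes cont: "continuous_on UNIV g" and "torus_periodic g"
  shows "integral (unit_cell a) g = integral (unit_cell 0) g"
proof -
  obtain u v where a: "a = (u,v)" by fastforce
  note periodic = torus_periodic_unit_shift[OF assms(2)]
  have slice: "continuous_on UNIV (\<lambda>y. g (x,y))" for x
    by (rule continuous_on_compose2[OF cont]) (auto intro!: continuous_intros)
  have "integral (unit_cell a) g = integral {u..u + 1} (\<lambda>x. integral {0..1} (\<lambda>y. g (x,y)))"
    unfolding a integral_unit_cell_iterated(1)[OF cont]
    by (simp add: integral_periodic_real[OF slice] periodic)
  also have "\<dots> = integral {0..1} (\<lambda>x. integral {0..1} (\<lambda>y. g (x,y)))"
  proof (rule integral_periodic_real)
    show "continuous_on UNIV (\<lambda>x. integral {0..1} (\<lambda>y. g (x,y)))"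
      using integral_continuous_on_param[of UNIV 0 1 "\<lambda>x y. g (x,y)"] continuous_on_subset[OF cont]
      by (simp add: case_prod_unfold)
  qed (simp add: periodic)
  also have "\<dots> = integral (unit_cell 0) g"
    using integral_unit_cell_iterated(1)[OF cont, of 0 0] by (simp add: zero_prod_def)
  finally show ?thesis .
qed

lemma integral_unit_cell_pd:
  fixes g :: "plane \<Rightarrow> 'b::euclidean_space"
  assumes g: "smooth_map g" and "torus_periodic g"
  shows "integral (unit_cell a) (pd g e1) = 0" "integral (unit_cell a) (pd g e2) = 0"
proof -
  obtain u v where a: "a = (u,v)" by fastforce
  note periodic = torus_periodic_unit_shift[OF assms(2)]
  have cont: "continuous_on UNIV (pd g v)" for v by (intro smooth_map_continuous_on smooth_map_pd g)
  have "integral {u..u + 1} (\<lambda>x. pd g e1 (x,y)) = 0" for y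
    using fundamental_theorem_of_calculus[of u "u + 1" "\<lambda>x. g (x,y)" "\<lambda>x. pd g e1 (x,y)"]
      smooth_map_partials(1)[OF g] periodic by (simp add: integral_unique)
  then show "integral (unit_cell a) (pd g e1) = 0"
    unfolding a integral_unit_cell_iterated(2)[OF cont] by simp
  have "integral {v..v + 1} (\<lambda>y. pd g e2 (x,y)) = 0" for x
    using fundamental_theorem_of_calculus[of v "v + 1" "\<lambda>y. g (x,y)" "\<lambda>y. pd g e2 (x,y)"]
      smooth_map_partials(2)[OF g] periodic by (simp add: integral_unique)
  then show "integral (unit_cell a) (pd g e2) = 0"
    unfolding a integral_unit_cell_iterated(1)[OF cont] by simp
qed

section \<open>The geometry of an immersed torus\<close>

locale immersed_torus =
  fixes f :: "plane \<Rightarrow> real^4"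
  assumes immersion: "torus_immersion f"
begin

abbreviation "f1 \<equiv> pd f e1"
abbreviation "f2 \<equiv> pd f e2"
abbreviation "f11 \<equiv> pd (pd f e1) e1"
abbreviation "f12 \<equiv> pd (pd f e1) e2"
abbreviation "f22 \<equiv> pd (pd f e2) e2"
abbreviation "EE \<equiv> fffE f"
abbreviation "FF \<equiv> fffF f"
abbreviation "GG \<equiv> fffG f"
abbreviation "HH \<equiv> mean_curv f"
abbreviation "XN x \<equiv> nor_proj f x (f x)"
abbreviation "XT x \<equiv> tan_proj f x (f x)"

definition "dA x = sqrt (gdet f x)"

text \<open>With \<open>J\<close> the complex structure of the surface, \<open>V1 = - J f2\<close> and \<open>V2 = J f1\<close>.\<close>
definition "V1 x = (GG x / dA x) *\<^sub>R f1 x - (FF x / dA x) *\<^sub>R f2 x"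
definition "V2 x = (EE x / dA x) *\<^sub>R f2 x - (FF x / dA x) *\<^sub>R f1 x"

definition "rho x = f x \<bullet> f x"

lemma smooth_f [smooth_intros]: "smooth_map f"
  and periodic_f: "torus_periodic f"
  and inj_frechet_derivative: "inj (frechet_derivative f (at x))"
  using immersion unfolding torus_immersion_def by blast+

lemma gdet_pos: "gdet f x > 0"
proof -
  have lin: "linear (frechet_derivative f (at x))"
    using smooth_map_has_derivative[OF smooth_f, of x] has_derivative_linear unfolding pd_def by metis
  have "pd f v x \<noteq> 0" if "v \<noteq> 0" for v
    using inj_frechet_derivative[of x] lin that unfolding pd_def by (metis linear_injective_0)
  then have nz: "a *\<^sub>R f1 x + b *\<^sub>R f2 x \<noteq> 0" if "a \<noteq> 0 \<or> b \<noteq> 0" for a b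
    using smooth_map_pd_decompose[OF smooth_f, of "(a,b)" x] that
    by (metis fst_conv snd_conv zero_prod_def prod.inject)
  have E: "EE x > 0" using nz[of 1 0] by (simp add: fffE_def)
  define w where "w = EE x *\<^sub>R f2 x - FF x *\<^sub>R f1 x"
  have "w \<noteq> 0" using nz[of "- FF x" "EE x"] E by (simp add: w_def)
  then have "0 < w \<bullet> w" by simp
  also have "w \<bullet> w = EE x * gdet f x"
    by (simp add: w_def gdet_def fffE_def fffF_def fffG_def inner_simps inner_commute
        power2_eq_square algebra_simps)
  finally show ?thesis using E zero_less_mult_pos by blast
qed

lemma dA_pos: "dA x > 0"
  using gdet_pos by (simp add: dA_def)

lemma dA_nonzero [simp]: "dA x \<noteq> 0"
  using dA_pos[of x] by simp

lemma dA_mult_self: "dA x * dA x = gdet f x"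
  using gdet_pos[of x] by (simp add: dA_def)

lemma dA_mult_self_fff: "dA x * dA x = EE x * GG x - FF x * FF x"
  by (simp add: dA_mult_self gdet_def power2_eq_square)

lemma EE_pos: "EE x > 0"
proof -
  have "EE x \<noteq> 0" using gdet_pos[of x] zero_le_power2[of "FF x"] by (auto simp: gdet_def)
  then show ?thesis by (simp add: fffE_def)
qed

lemma EE_nonzero [simp]: "EE x \<noteq> 0"
  using EE_pos[of x] by simp

lemma smooth_fff [smooth_intros]: "smooth_map EE" "smooth_map FF" "smooth_map GG"
  unfolding fffE_def[abs_def] fffF_def[abs_def] fffG_def[abs_def] by (intro smooth_intros)+

lemma smooth_gdet [smooth_intros]: "smooth_map (gdet f)"
  unfolding gdet_def[abs_def] by (intro smooth_intros)

lemma smooth_dA [smooth_intros]: "smooth_map dA"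
  unfolding dA_def[abs_def] by (intro smooth_intros gdet_pos)

lemma smooth_V [smooth_intros]: "smooth_map V1" "smooth_map V2"
  unfolding V1_def[abs_def] V2_def[abs_def] by (intro smooth_intros dA_nonzero)+

lemma smooth_tan_proj [smooth_intros]: "smooth_map w \<Longrightarrow> smooth_map (\<lambda>x. tan_proj f x (w x))"
  unfolding tan_proj_def using gdet_pos by (intro smooth_intros) (auto simp: less_imp_neq[symmetric])

lemma smooth_nor_proj [smooth_intros]: "smooth_map w \<Longrightarrow> smooth_map (\<lambda>x. nor_proj f x (w x))"
  unfolding nor_proj_def by (intro smooth_intros)

lemma smooth_HH [smooth_intros]: "smooth_map HH"
  unfolding mean_curv_def[abs_def] using gdet_pos
  by (intro smooth_intros) (auto simp: less_imp_neq[symmetric])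

lemma smooth_rho [smooth_intros]: "smooth_map rho"
  unfolding rho_def[abs_def] by (intro smooth_intros)

lemma periodic_geometry: "torus_periodic f1" "torus_periodic f2" "torus_periodic EE"
  "torus_periodic FF" "torus_periodic GG" "torus_periodic dA" "torus_periodic HH"
  "torus_periodic XN" "torus_periodic rho" "torus_periodic V1" "torus_periodic V2"
  using periodic_f torus_periodic_pd[OF smooth_f periodic_f]
    torus_periodic_pd[OF smooth_map_pd[OF smooth_f] torus_periodic_pd[OF smooth_f periodic_f]]
  unfolding torus_periodic_def
  by (simp_all add: fffE_def fffF_def fffG_def dA_def gdet_def mean_curv_def nor_proj_def tan_proj_def rho_def V1_def V2_def)

lemma fff_inner: "f1 x \<bullet> f1 x = EE x" "f1 x \<bullet> f2 x = FF x" "f2 x \<bullet> f1 x = FF x" "f2 x \<bullet> f2 x = GG x"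
  by (simp_all add: fffE_def fffF_def fffG_def inner_commute)

lemma V_inner: "V1 x \<bullet> f1 x = dA x" "V1 x \<bullet> f2 x = 0" "V2 x \<bullet> f1 x = 0" "V2 x \<bullet> f2 x = dA x"
  "f1 x \<bullet> V1 x = dA x" "f2 x \<bullet> V1 x = 0" "f1 x \<bullet> V2 x = 0" "f2 x \<bullet> V2 x = dA x"
  using dA_mult_self_fff[of x] by (simp_all add: V1_def V2_def inner_simps fff_inner field_simps)

lemma V2_inner_V2: "V2 x \<bullet> V2 x = EE x"
proof -
  have "V2 x \<bullet> V2 x = (EE x * (V2 x \<bullet> f2 x) - FF x * (V2 x \<bullet> f1 x)) / dA x"
    by (subst (2) V2_def) (simp add: inner_simps diff_divide_distrib)
  then show ?thesis by (simp add: V_inner)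
qed

lemma tan_proj_eq: "tan_proj f x w = (1 / dA x) *\<^sub>R ((w \<bullet> V1 x) *\<^sub>R f1 x + (w \<bullet> V2 x) *\<^sub>R f2 x)"
  unfolding tan_proj_def dA_mult_self[symmetric] V1_def V2_def
  by (simp add: inner_simps algebra_simps diff_divide_distrib scaleR_add_right)

lemma tan_proj_eq_conormal:
  "tan_proj f x w = (1 / dA x) *\<^sub>R ((w \<bullet> f1 x) *\<^sub>R V1 x + (w \<bullet> f2 x) *\<^sub>R V2 x)"
  unfolding tan_proj_def dA_mult_self[symmetric] V1_def V2_def
  by (simp add: inner_simps algebra_simps diff_divide_distrib scaleR_add_right)

lemma linear_tan_proj: "linear (tan_proj f x)"
  unfolding tan_proj_eq[abs_def] by (intro linearI) (simp_all add: inner_simps algebra_simps)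

lemma linear_nor_proj: "linear (nor_proj f x)"
  by (intro linearI)
    (simp_all add: nor_proj_def linear_add[OF linear_tan_proj] linear_scale[OF linear_tan_proj] algebra_simps)

lemmas nor_proj_simps = linear_add[OF linear_nor_proj] linear_diff[OF linear_nor_proj]
  linear_scale[OF linear_nor_proj] linear_0[OF linear_nor_proj]

lemma nor_proj_inner: "nor_proj f x w \<bullet> f1 x = 0" "nor_proj f x w \<bullet> f2 x = 0"
  unfolding nor_proj_def tan_proj_eq_conormal by (simp_all add: inner_simps V_inner)

lemma nor_proj_tangent: "nor_proj f x (f1 x) = 0" "nor_proj f x (f2 x) = 0"
  unfolding nor_proj_def tan_proj_eq by (simp_all add: V_inner)

lemma nor_proj_pd: "nor_proj f x (pd f v x) = 0"
  unfolding smooth_map_pd_decompose[OF smooth_f, of v x] by (simp add: nor_proj_simps nor_proj_tangent)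

lemma nor_proj_normal: "w \<bullet> f1 x = 0 \<Longrightarrow> w \<bullet> f2 x = 0 \<Longrightarrow> nor_proj f x w = w"
  unfolding nor_proj_def tan_proj_eq_conormal by simp

lemma nor_proj_inner_tan_proj: "nor_proj f x w \<bullet> tan_proj f x v = 0"
  unfolding tan_proj_eq by (simp add: inner_simps nor_proj_inner)

lemma tan_proj_plus_nor_proj: "w = tan_proj f x w + nor_proj f x w"
  by (simp add: nor_proj_def)

lemma nor_proj_selfadjoint: "nor_proj f x w \<bullet> v = w \<bullet> nor_proj f x v"
proof -
  have "nor_proj f x w \<bullet> v = nor_proj f x w \<bullet> nor_proj f x v" for v w
    using arg_cong[OF tan_proj_plus_nor_proj[of v x], of "inner (nor_proj f x w)"]
    by (simp add: inner_add_right nor_proj_inner_tan_proj)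
  then show ?thesis by (metis inner_commute)
qed

lemma nor_proj_HH: "nor_proj f x (HH x) = HH x"
  by (rule nor_proj_normal) (simp_all add: mean_curv_def nor_proj_inner)

lemma HH_inner_f: "HH x \<bullet> f x = HH x \<bullet> XN x"
  using nor_proj_selfadjoint[of x "HH x" "f x"] by (simp add: nor_proj_HH)

lemma pd_f2_e1: "pd (pd f e2) e1 x = f12 x"
  by (rule pd_commute[OF smooth_f, symmetric])

lemma pd_fff: "pd EE v x = 2 * (pd f1 v x \<bullet> f1 x)" "pd GG v x = 2 * (pd f2 v x \<bullet> f2 x)"
  "pd FF v x = pd f1 v x \<bullet> f2 x + pd f2 v x \<bullet> f1 x"
  unfolding fffE_def[abs_def] fffF_def[abs_def] fffG_def[abs_def]
  by (simp_all add: pd_inner smooth_map_pd smooth_f inner_commute)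

lemma pd_dA: "pd dA v x = pd f1 v x \<bullet> V1 x + pd f2 v x \<bullet> V2 x"
proof -
  have "pd (\<lambda>x. dA x * dA x) v x = pd (\<lambda>x. EE x * GG x - FF x * FF x) v x"
    unfolding dA_mult_self_fff ..
  then have "2 * (dA x * pd dA v x) = pd EE v x * GG x + EE x * pd GG v x - 2 * (FF x * pd FF v x)"
    by (simp add: pd_diff pd_mult smooth_fff smooth_dA smooth_map_mult)
  then have "dA x * pd dA v x = dA x * (pd f1 v x \<bullet> V1 x + pd f2 v x \<bullet> V2 x)"
    unfolding pd_fff V1_def V2_def by (simp add: inner_simps algebra_simps)
  then show ?thesis by simp
qed

lemma smooth_V_coefficients: "smooth_map (\<lambda>x. GG x / dA x)" "smooth_map (\<lambda>x. FF x / dA x)" "smooth_map (\<lambda>x. EE x / dA x)"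
  by (intro smooth_intros dA_nonzero)+

lemma nor_proj_pd_V:
  "nor_proj f x (pd V1 v x)
    = (GG x / dA x) *\<^sub>R nor_proj f x (pd f1 v x) - (FF x / dA x) *\<^sub>R nor_proj f x (pd f2 v x)"
  "nor_proj f x (pd V2 v x)
    = (EE x / dA x) *\<^sub>R nor_proj f x (pd f2 v x) - (FF x / dA x) *\<^sub>R nor_proj f x (pd f1 v x)"
  unfolding V1_def[abs_def] V2_def[abs_def]
  by (simp_all add: pd_diff pd_scaleR smooth_V_coefficients smooth_map_scaleR smooth_map_pd smooth_f
      nor_proj_simps nor_proj_tangent)

lemma div_V: "pd V1 e1 x + pd V2 e2 x = dA x *\<^sub>R HH x"
proof -
  define L where "L = pd V1 e1 x + pd V2 e2 x"
  have products: "(\<lambda>x. V1 x \<bullet> f1 x) = dA" "(\<lambda>x. V1 x \<bullet> f2 x) = (\<lambda>x. 0)"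
    "(\<lambda>x. V2 x \<bullet> f1 x) = (\<lambda>x. 0)" "(\<lambda>x. V2 x \<bullet> f2 x) = dA"
    using V_inner by auto
  have "pd dA e1 x = V1 x \<bullet> f11 x + pd V1 e1 x \<bullet> f1 x" "0 = V2 x \<bullet> f12 x + pd V2 e2 x \<bullet> f1 x"
    "0 = V1 x \<bullet> f12 x + pd V1 e1 x \<bullet> f2 x" "pd dA e2 x = V2 x \<bullet> f22 x + pd V2 e2 x \<bullet> f2 x"
    using pd_inner[OF smooth_V(1) smooth_map_pd[OF smooth_f], of e1 e1 x]
      pd_inner[OF smooth_V(2) smooth_map_pd[OF smooth_f], of e1 e2 x]
      pd_inner[OF smooth_V(1) smooth_map_pd[OF smooth_f], of e2 e1 x]
      pd_inner[OF smooth_V(2) smooth_map_pd[OF smooth_f], of e2 e2 x]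
    unfolding products pd_const pd_f2_e1 by auto
  then have "L \<bullet> f1 x = 0" "L \<bullet> f2 x = 0"
    unfolding L_def pd_dA pd_f2_e1 by (simp_all add: inner_simps inner_commute)
  then have "L = nor_proj f x L" by (simp add: nor_proj_normal)
  also have "\<dots> = (GG x / dA x) *\<^sub>R nor_proj f x (f11 x) - (FF x / dA x) *\<^sub>R nor_proj f x (f12 x)
      + ((EE x / dA x) *\<^sub>R nor_proj f x (f22 x) - (FF x / dA x) *\<^sub>R nor_proj f x (f12 x))"
    unfolding L_def nor_proj_simps nor_proj_pd_V pd_f2_e1 ..
  also have "\<dots> = (1 / dA x) *\<^sub>R nor_proj f x (GG x *\<^sub>R f11 x - (2 * FF x) *\<^sub>R f12 x + EE x *\<^sub>R f22 x)"
    by (simp add: nor_proj_simps vec_eq_iff field_simps)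
  also have "\<dots> = dA x *\<^sub>R HH x"
    unfolding mean_curv_def dA_mult_self[symmetric] by (simp add: nor_proj_simps)
  finally show ?thesis unfolding L_def .
qed

lemma dA_XT: "dA x *\<^sub>R XT x = (f x \<bullet> V1 x) *\<^sub>R f1 x + (f x \<bullet> V2 x) *\<^sub>R f2 x"
  "dA x *\<^sub>R XT x = (f x \<bullet> f1 x) *\<^sub>R V1 x + (f x \<bullet> f2 x) *\<^sub>R V2 x"
  using tan_proj_eq[of x "f x"] tan_proj_eq_conormal[of x "f x"] by simp_all

lemma dA_XT_inner: "dA x * (XT x \<bullet> XT x) = (f x \<bullet> V1 x) * (f x \<bullet> f1 x) + (f x \<bullet> V2 x) * (f x \<bullet> f2 x)"
proof -
  have "dA x * (XT x \<bullet> XT x) = dA x * (XT x \<bullet> f x)"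
    by (subst (4) tan_proj_plus_nor_proj[of "f x" x])
      (simp add: inner_simps nor_proj_inner_tan_proj inner_commute)
  also have "\<dots> = (dA x *\<^sub>R XT x) \<bullet> f x" by simp
  finally show ?thesis unfolding dA_XT by (simp add: inner_simps inner_commute)
qed

lemma rho_split: "rho x = XT x \<bullet> XT x + XN x \<bullet> XN x"
  unfolding rho_def by (subst (1 2) tan_proj_plus_nor_proj[of "f x" x])
    (simp add: inner_simps nor_proj_inner_tan_proj inner_commute)

lemma rho_nonneg: "rho x \<ge> 0"
  by (simp add: rho_def)

lemma rho_plus_nonzero: "e > 0 \<Longrightarrow> rho x + e \<noteq> 0"
  using rho_nonneg[of x] by linarith

lemma rho_eq_0_iff: "rho x = 0 \<longleftrightarrow> f x = 0"
  by (simp add: rho_def)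

lemma rho_eq_norm: "rho x = (norm (f x))\<^sup>2"
  by (simp add: rho_def power2_norm_eq_inner)

lemma pd_rho: "pd rho v x = 2 * (f x \<bullet> pd f v x)"
  unfolding rho_def[abs_def] by (simp add: pd_inner smooth_f inner_commute)

lemma norm_pd_f: "(norm (pd f v x))\<^sup>2 = EE x * (fst v)\<^sup>2 + 2 * FF x * fst v * snd v + GG x * (snd v)\<^sup>2"
  unfolding smooth_map_pd_decompose[OF smooth_f, of v x] power2_norm_eq_inner
  by (simp add: inner_simps fff_inner power2_eq_square algebra_simps)

lemma vanishes_rho:
  assumes "f p = 0" shows "vanishes 3 (\<lambda>v. rho (p + v) - (norm (pd f v p))\<^sup>2)"
proof -
  let ?r = "\<lambda>v. f (p + v) - pd f v p"
  have r: "vanishes 2 ?r" by (rule vanishes_2_if_zero[OF smooth_f assms])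
  have "vanishes 3 (\<lambda>v. ?r v \<bullet> ?r v)" "vanishes 3 (\<lambda>v. ?r v \<bullet> pd f v p)"
    using vanishes_mono[OF vanishes_inner[OF r r], of 3]
      vanishes_inner[OF r smooth_map_vanishes_pd[OF smooth_f]] by (simp_all add: numeral_eq_Suc)
  then have "vanishes 3 (\<lambda>v. ?r v \<bullet> ?r v + (?r v \<bullet> pd f v p + ?r v \<bullet> pd f v p))"
    by (intro vanishes_add)
  then show ?thesis
    unfolding rho_def power2_norm_eq_inner by (simp add: inner_diff_left inner_diff_right inner_commute)
qed

section \<open>The Li--Yau inequality and its equality case\<close>

text \<open>Both densities come from the divergence of the field \<open>X^T / (|X|\<^sup>2 + e)\<close>, a regularisation of the
  one in the monotonicity formula. As \<open>e\<close> tends to 0 each zero of \<open>f\<close> contributes \<open>pi\<close> to the integral of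
  \<open>bubble\<close>.\<close>
definition "defect e x = dA x * (norm ((1/4) *\<^sub>R HH x + (1 / (rho x + e)) *\<^sub>R XN x))\<^sup>2"
definition "bubble e x = e * dA x / (rho x + e)\<^sup>2"

lemma div_regularised:
  assumes "e > 0"
  shows "pd (\<lambda>x. (V1 x \<bullet> f x) / (rho x + e)) e1 x + pd (\<lambda>x. (V2 x \<bullet> f x) / (rho x + e)) e2 x
    = dA x * ((HH x \<bullet> XN x) / (rho x + e) + 2 * (XN x \<bullet> XN x) / (rho x + e)\<^sup>2)
      + 2 * (e * dA x / (rho x + e)\<^sup>2)" (is "?div = ?density")
proof -
  note nz = rho_plus_nonzero[OF assms]
  have "pd (\<lambda>x. (V x \<bullet> f x) / (rho x + e)) v x
      = ((pd V v x \<bullet> f x + V x \<bullet> pd f v x) * (rho x + e) - (V x \<bullet> f x) * pd rho v x) / (rho x + e)\<^sup>2"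
    if V: "smooth_map V" for V v
    by (subst pd_divide)
      (simp_all add: nz V smooth_f smooth_rho smooth_map_inner smooth_map_add smooth_map_const pd_inner pd_add pd_const)
  from this[OF smooth_V(1)] this[OF smooth_V(2)]
  have "?div =
      (((pd V1 e1 x + pd V2 e2 x) \<bullet> f x + 2 * dA x) * (rho x + e) - 2 * (dA x * (XT x \<bullet> XT x))) / (rho x + e)\<^sup>2"
    unfolding dA_XT_inner
    by (simp add: pd_rho V_inner inner_simps inner_commute add_divide_distrib[symmetric]
        diff_divide_distrib[symmetric] algebra_simps)
  also have "\<dots> = (((dA x *\<^sub>R HH x) \<bullet> f x + 2 * dA x) * (rho x + e) - 2 * (dA x * (rho x - XN x \<bullet> XN x))) / (rho x + e)\<^sup>2"
    unfolding div_V rho_split by simp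
  also have "\<dots> = ?density"
    using nz[of x] by (simp add: HH_inner_f power2_eq_square divide_simps) (simp add: algebra_simps)
  finally show ?thesis .
qed

lemma smooth_densities:
  assumes "e > 0" shows "smooth_map (defect e)" "smooth_map (bubble e)"
proof -
  note nz = rho_plus_nonzero[OF assms]
  show "smooth_map (defect e)"
    unfolding defect_def[abs_def] power2_norm_eq_inner by (intro smooth_intros nz)
  show "smooth_map (bubble e)"
    unfolding bubble_def[abs_def] by (intro smooth_intros) (simp add: nz)
qed

lemma periodic_densities: "torus_periodic (defect e)" "torus_periodic (bubble e)"
  using periodic_geometry unfolding torus_periodic_def by (simp_all add: defect_def bubble_def)

lemma defect_nonneg: "defect e x \<ge> 0"
  using dA_pos[of x] by (simp add: defect_def)

lemma bubble_nonneg: "e \<ge> 0 \<Longrightarrow> bubble e x \<ge> 0"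
  using dA_pos[of x] by (simp add: bubble_def)

lemma integrable_on_unit_cell: "smooth_map h \<Longrightarrow> h integrable_on cbox a b" for h :: "plane \<Rightarrow> real"
  by (intro integrable_continuous smooth_map_continuous_on)

lemma Li_Yau_identity:
  assumes e: "e > 0"
  shows "integral (unit_cell a) (defect e) + integral (unit_cell a) (bubble e) = willmore f / 4"
proof -
  define g1 where "g1 = (\<lambda>x. (V1 x \<bullet> f x) / (rho x + e))"
  define g2 where "g2 = (\<lambda>x. (V2 x \<bullet> f x) / (rho x + e))"
  define w where "w = (\<lambda>x. (norm (HH x))\<^sup>2 * dA x)"
  note nz = rho_plus_nonzero[OF assms]
  have smooth: "smooth_map g1" "smooth_map g2" "smooth_map w"
    unfolding g1_def g2_def w_def power2_norm_eq_inner by (intro smooth_intros nz)+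
  have periodic: "torus_periodic g1" "torus_periodic g2" "torus_periodic w"
    using periodic_geometry periodic_f unfolding torus_periodic_def g1_def g2_def w_def by simp_all
  have split: "defect e x + bubble e x = (1/16) * w x + (1/2) * (pd g1 e1 x + pd g2 e2 x)" for x
  proof -
    define k where "k = 1 / (rho x + e)"
    have "defect e x = dA x * ((1/16) * (HH x \<bullet> HH x) + (1/2) * k * (HH x \<bullet> XN x) + k\<^sup>2 * (XN x \<bullet> XN x))"
      unfolding defect_def k_def[symmetric] power2_norm_eq_inner
      by (simp add: inner_add_left inner_add_right inner_commute power2_eq_square)
    moreover have "bubble e x = e * dA x * k\<^sup>2" by (simp add: bubble_def k_def power_divide)
    moreover have "pd g1 e1 x + pd g2 e2 x
        = dA x * (k * (HH x \<bullet> XN x) + 2 * k\<^sup>2 * (XN x \<bullet> XN x)) + 2 * (e * dA x * k\<^sup>2)"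
      unfolding g1_def g2_def div_regularised[OF e] by (simp add: k_def power_divide)
    ultimately show ?thesis by (simp add: w_def power2_norm_eq_inner algebra_simps)
  qed
  let ?T = "unit_cell a"
  have "integral ?T (defect e) + integral ?T (bubble e) = integral ?T (\<lambda>x. defect e x + bubble e x)"
    by (intro Henstock_Kurzweil_Integration.integral_add[symmetric] integrable_on_unit_cell smooth_densities e)
  also have "\<dots> = integral ?T (\<lambda>x. (1/16) * w x + (1/2) * (pd g1 e1 x + pd g2 e2 x))"
    by (simp add: split)
  also have "\<dots> = (1/16) * integral ?T w + (1/2) * (integral ?T (pd g1 e1) + integral ?T (pd g2 e2))"
    by (intro integral_unique has_integral_add has_integral_mult_right integrable_integral
        integrable_on_unit_cell smooth smooth_map_pd)
  also have "\<dots> = (1/16) * integral (unit_cell 0) w"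
    using integral_unit_cell_pd[OF smooth(1) periodic(1)] integral_unit_cell_pd[OF smooth(2) periodic(2)]
      integral_unit_cell_shift[OF smooth_map_continuous_on[OF smooth(3)] periodic(3)] by simp
  also have "\<dots> = willmore f / 4" by (simp add: willmore_def w_def dA_def zero_prod_def)
  finally show ?thesis .
qed

end

lemma nn_integral_FTC_real:
  fixes h F :: "real \<Rightarrow> real"
  assumes "\<And>x. (F has_real_derivative h x) (at x)" "\<And>x. isCont h x" and nonneg: "\<And>x. h x \<ge> 0"
    and "(F \<longlongrightarrow> A) at_bot" "(F \<longlongrightarrow> B) at_top"
  shows "(\<integral>\<^sup>+x. ennreal (h x) \<partial>lborel) = ennreal (B - A)"
proof -
  have FTC: "set_integrable lborel (einterval (-\<infinity>) \<infinity>) h" "(LBINT x=-\<infinity>..\<infinity>. h x) = B - A"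
    using assms by (intro interval_integral_FTC_nonneg[where F = F]; simp add: ereal_tendsto_simps)+
  then have "integrable lborel h" by (simp add: set_integrable_def einterval_def)
  then have "(\<integral>\<^sup>+x. ennreal (h x) \<partial>lborel) = ennreal (integral\<^sup>L lborel h)"
    using nonneg by (intro nn_integral_eq_integral) auto
  also have "integral\<^sup>L lborel h = B - A"
    using FTC(2) by (simp add: interval_lebesgue_integral_def set_lebesgue_integral_def einterval_def)
  finally show ?thesis .
qed

lemma nn_integral_inverse_square_quadratic:
  "(\<integral>\<^sup>+x. ennreal (1 / (1 + x\<^sup>2)\<^sup>2) \<partial>lborel) = ennreal (pi / 2)"
proof -
  define F where "F = (\<lambda>x::real. (x / (1 + x\<^sup>2) + arctan x) / 2)"
  have pos: "1 + x\<^sup>2 > 0" for x :: real by (simp add: add_pos_nonneg)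
  have deriv: "(F has_real_derivative 1 / (1 + x\<^sup>2)\<^sup>2) (at x)" for x
  proof -
    have "(F has_real_derivative (((1 + x\<^sup>2) - x * (2 * x)) / ((1 + x\<^sup>2) * (1 + x\<^sup>2)) + 1 / (1 + x\<^sup>2)) / 2) (at x)"
      unfolding F_def using pos[of x] by (auto intro!: derivative_eq_intros simp: inverse_eq_divide)
    moreover have "((1 + x\<^sup>2) - x * (2 * x)) / ((1 + x\<^sup>2) * (1 + x\<^sup>2)) + 1 / (1 + x\<^sup>2) = 2 / (1 + x\<^sup>2)\<^sup>2"
    proof -
      have "((y - 2 * (y - 1)) / (y * y) + 1 / y) = 2 / y\<^sup>2" if "y \<noteq> 0" for y :: real
        using that by (simp add: field_simps power2_eq_square)
      from this[of "1 + x\<^sup>2"] show ?thesis using pos[of x] by (simp add: power2_eq_square algebra_simps)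
    qed
    ultimately show ?thesis by simp
  qed
  have "(\<integral>\<^sup>+x. ennreal (1 / (1 + x\<^sup>2)\<^sup>2) \<partial>lborel) = ennreal (pi / 4 - - (pi / 4))"
  proof (rule nn_integral_FTC_real[OF deriv])
    show "(F \<longlongrightarrow> - (pi / 4)) at_bot" "(F \<longlongrightarrow> pi / 4) at_top"
      unfolding F_def by (real_asymp simp: field_simps)+
    show "isCont (\<lambda>x. 1 / (1 + x\<^sup>2)\<^sup>2) x" for x :: real
      using pos[of x] by (auto intro!: continuous_intros)
  qed simp
  then show ?thesis by simp
qed

lemma nn_integral_rational_quartic:
  fixes b e c :: real assumes b: "b > 0" and e: "e > 0"
  shows "(\<integral>\<^sup>+x. ennreal (1 / (b\<^sup>2 + e\<^sup>2 * (x + c)\<^sup>2)\<^sup>2) \<partial>lborel) = ennreal (pi / (2 * b^3 * e))"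
proof -
  let ?I = "\<integral>\<^sup>+x. ennreal (1 / (b\<^sup>2 + e\<^sup>2 * (x + c)\<^sup>2)\<^sup>2) \<partial>lborel"
  have eq: "1 / (1 + (e * c / b + e / b * x)\<^sup>2)\<^sup>2 = b^4 * (1 / (b\<^sup>2 + e\<^sup>2 * (x + c)\<^sup>2)\<^sup>2)" for x
  proof -
    have "1 + (e * c / b + e / b * x)\<^sup>2 = (b\<^sup>2 + e\<^sup>2 * (x + c)\<^sup>2) / b\<^sup>2"
      using b by (simp add: field_simps power2_eq_square)
    then show ?thesis by (simp add: power_divide flip: power_mult)
  qed
  have "ennreal (pi / 2) = ennreal (e / b) * (\<integral>\<^sup>+x. ennreal (1 / (1 + (e * c / b + e / b * x)\<^sup>2)\<^sup>2) \<partial>lborel)"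
    using nn_integral_real_affine[of "\<lambda>x. ennreal (1 / (1 + x\<^sup>2)\<^sup>2)" "e / b" "e * c / b"] b e
    by (simp add: nn_integral_inverse_square_quadratic)
  also have "\<dots> = ennreal (e / b) * (\<integral>\<^sup>+x. ennreal (b^4) * ennreal (1 / (b\<^sup>2 + e\<^sup>2 * (x + c)\<^sup>2)\<^sup>2) \<partial>lborel)"
    unfolding eq using b by (simp flip: ennreal_mult)
  also have "\<dots> = ennreal (e / b * b^4) * ?I"
    using b e by (subst nn_integral_cmult) (auto simp: mult.assoc[symmetric] ennreal_mult[symmetric])
  finally have "ennreal (1 / (e / b * b^4)) * ennreal (pi / 2)
      = ennreal (1 / (e / b * b^4)) * ennreal (e / b * b^4) * ?I"
    by (simp only: mult.assoc)
  then show ?thesis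
    using b e by (simp add: ennreal_mult[symmetric] field_simps power3_eq_cube power4_eq_xxxx)
qed

lemma nn_integral_inverse_sqrt_cubed:
  fixes k :: real assumes k: "k > 0"
  shows "(\<integral>\<^sup>+t. ennreal (1 / sqrt (1 + k * t\<^sup>2)^3) \<partial>lborel) = ennreal (2 / sqrt k)"
proof -
  let ?F = "\<lambda>t. t / sqrt (1 + k * t\<^sup>2)"
  have pos: "1 + k * t\<^sup>2 > 0" for t using k by (simp add: add_pos_nonneg)
  have deriv: "(?F has_real_derivative 1 / sqrt (1 + k * t\<^sup>2)^3) (at t)" for t
  proof -
    define r where "r = sqrt (1 + k * t\<^sup>2)"
    have r: "r > 0" "r * r = 1 + k * t\<^sup>2" using pos[of t] by (auto simp: r_def)
    have "(?F has_real_derivative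
        (r - t * (inverse r / 2 * (k * (2 * t)))) / (r * r)) (at t)"
      unfolding r_def using pos[of t] by (auto intro!: derivative_eq_intros)
    moreover have "r - t * (inverse r / 2 * (k * (2 * t))) = (r * r - k * t\<^sup>2) / r"
      using r(1) by (simp add: field_simps power2_eq_square)
    ultimately show ?thesis using r(2) by (simp add: power3_eq_cube mult_ac flip: r_def)
  qed
  have "(\<integral>\<^sup>+t. ennreal (1 / sqrt (1 + k * t\<^sup>2)^3) \<partial>lborel) = ennreal (1 / sqrt k - - (1 / sqrt k))"
  proof (rule nn_integral_FTC_real[OF deriv])
    show "(?F \<longlongrightarrow> - (1 / sqrt k)) at_bot"
      "(?F \<longlongrightarrow> 1 / sqrt k) at_top"
      using k by (real_asymp simp: powr_half_sqrt field_simps)+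
    show "isCont (\<lambda>t. 1 / sqrt (1 + k * t\<^sup>2)^3) t" for t using pos[of t] by (auto intro!: continuous_intros)
    show "0 \<le> 1 / sqrt (1 + k * t\<^sup>2)^3" for t using pos[of t] by simp
  qed
  then show ?thesis by simp
qed

lemma nn_integral_quadratic_form:
  fixes E F G :: real assumes E: "E > 0" and D: "E * G - F\<^sup>2 > 0"
  shows "(\<integral>\<^sup>+v. ennreal (sqrt (E * G - F\<^sup>2) / (1 + (E * (fst v)\<^sup>2 + 2 * F * fst v * snd v + G * (snd v)\<^sup>2))\<^sup>2) \<partial>lborel)
    = ennreal pi"
proof -
  define d where "d = sqrt (E * G - F\<^sup>2)"
  define k where "k = d\<^sup>2 / E"
  have d: "d > 0" "d\<^sup>2 = E * G - F\<^sup>2" using D by (auto simp: d_def)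
  have k: "k > 0" using E d(1) by (simp add: k_def)
  let ?h = "\<lambda>v. ennreal (d / (1 + (E * (fst v)\<^sup>2 + 2 * F * fst v * snd v + G * (snd v)\<^sup>2))\<^sup>2)"
  have square: "1 + (E * x\<^sup>2 + 2 * F * x * y + G * y\<^sup>2) = (sqrt (1 + k * y\<^sup>2))\<^sup>2 + (sqrt E)\<^sup>2 * (x + F * y / E)\<^sup>2" for x y
  proof -
    have "1 + k * y\<^sup>2 > 0" using k by (simp add: add_pos_nonneg)
    moreover have "E * (x + F * y / E)\<^sup>2 = E * x\<^sup>2 + 2 * F * x * y + F\<^sup>2 * y\<^sup>2 / E"
      using E by (simp add: power2_eq_square field_simps)
    moreover have "k * y\<^sup>2 = G * y\<^sup>2 - F\<^sup>2 * y\<^sup>2 / E"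
      unfolding k_def d(2) using E by (simp add: field_simps)
    ultimately show ?thesis using E by simp
  qed
  have slice: "(\<integral>\<^sup>+x. ?h (x,y) \<partial>lborel) = ennreal (d * pi / (2 * sqrt E)) * ennreal (1 / sqrt (1 + k * y\<^sup>2)^3)" for y
  proof -
    have pos: "sqrt (1 + k * y\<^sup>2) > 0" using k by (simp add: add_pos_nonneg)
    have "(\<integral>\<^sup>+x. ?h (x,y) \<partial>lborel)
        = (\<integral>\<^sup>+x. ennreal d * ennreal (1 / ((sqrt (1 + k * y\<^sup>2))\<^sup>2 + (sqrt E)\<^sup>2 * (x + F * y / E)\<^sup>2)\<^sup>2) \<partial>lborel)"
      using d(1) by (simp add: square[symmetric] ennreal_mult[symmetric])
    also have "\<dots> = ennreal d * ennreal (pi / (2 * sqrt (1 + k * y\<^sup>2)^3 * sqrt E))"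
      by (subst nn_integral_cmult) (auto simp: nn_integral_rational_quartic[OF pos] E)
    also have "\<dots> = ennreal (d * pi / (2 * sqrt E)) * ennreal (1 / sqrt (1 + k * y\<^sup>2)^3)"
      using d(1) pos E by (simp add: ennreal_mult[symmetric] field_simps)
    finally show ?thesis .
  qed
  have "(\<integral>\<^sup>+v. ?h v \<partial>lborel) = (\<integral>\<^sup>+v. ?h v \<partial>(lborel \<Otimes>\<^sub>M lborel))" by (simp add: lborel_prod)
  also have "\<dots> = (\<integral>\<^sup>+y. (\<integral>\<^sup>+x. ?h (x,y) \<partial>lborel) \<partial>lborel)"
    by (subst lborel_pair.nn_integral_snd[symmetric]) auto
  also have "\<dots> = ennreal (d * pi / (2 * sqrt E)) * ennreal (2 / sqrt k)"
    unfolding slice by (subst nn_integral_cmult) (auto simp: nn_integral_inverse_sqrt_cubed[OF k])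
  also have "\<dots> = ennreal pi"
    using d(1) E by (simp add: k_def real_sqrt_divide ennreal_mult[symmetric])
  finally show ?thesis unfolding d_def .
qed

lemma nn_integral_lborel_affine:
  fixes g :: "'a::euclidean_space \<Rightarrow> ennreal"
  assumes [measurable]: "g \<in> borel_measurable borel" and "t \<noteq> 0"
  shows "integral\<^sup>N lborel g = (\<integral>\<^sup>+v. ennreal (\<bar>t\<bar> ^ DIM('a)) * g (p + t *\<^sub>R v) \<partial>lborel)"
proof -
  have shift: "(\<lambda>x. p + t *\<^sub>R x) \<in> lborel \<rightarrow>\<^sub>M borel" by simp
  have "integral\<^sup>N lborel g
      = integral\<^sup>N (density (distr lborel borel (\<lambda>x. p + t *\<^sub>R x)) (\<lambda>_. ennreal (\<bar>t\<bar> ^ DIM('a)))) g"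
    by (rule arg_cong[OF lborel_affine[OF assms(2)], where f = "\<lambda>M. integral\<^sup>N M g"])
  also have "\<dots> = (\<integral>\<^sup>+v. ennreal (\<bar>t\<bar> ^ DIM('a)) * g (p + t *\<^sub>R v) \<partial>lborel)"
    by (subst nn_integral_density) (use shift in \<open>auto simp: nn_integral_distr[OF shift]\<close>)
  finally show ?thesis .
qed

lemma disjoint_small_balls:
  fixes Z :: "'a::euclidean_space set"
  assumes Z: "finite Z" "Z \<subseteq> U" and U: "open U"
  obtains d where "d > 0" "\<And>z. z \<in> Z \<Longrightarrow> ball z d \<subseteq> U" "disjoint_family_on (\<lambda>z. ball z d) Z"
proof -
  have "\<exists>e>0. ball z e \<subseteq> U - (Z - {z})" if "z \<in> Z" for z
    using finite_ball_avoid[OF U Z(1), of z] that Z(2) by blast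
  then obtain e where e: "\<And>z. z \<in> Z \<Longrightarrow> e z > 0" "\<And>z. z \<in> Z \<Longrightarrow> ball z (e z) \<subseteq> U - (Z - {z})"
    by metis
  define d where "d = Min (insert 1 (e ` Z)) / 2"
  have d: "d > 0" using Z(1) e(1) by (simp add: d_def)
  have d_le: "2 * d \<le> e z" if "z \<in> Z" for z using Z(1) that by (simp add: d_def Min_le_iff)
  show ?thesis
  proof
    show "ball z d \<subseteq> U" if "z \<in> Z" for z
      using e(2)[OF that] d_le[OF that] d subset_ball[of d "e z" z] by auto
    show "disjoint_family_on (\<lambda>z. ball z d) Z"
      unfolding disjoint_family_on_def
    proof (intro ballI impI)
      fix z w assume zw: "z \<in> Z" "w \<in> Z" "z \<noteq> w"
      then have "w \<notin> ball z (e z)" using e(2)[OF zw(1)] by blast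
      then show "ball z d \<inter> ball w d = {}" using d_le[OF zw(1)] by (intro disjoint_ballI) simp
    qed
  qed (rule d)
qed

context immersed_torus
begin

abbreviation "eps n \<equiv> 1 / (real n + 1)"

lemma bubble_rescaled: "e > 0 \<Longrightarrow> e * bubble e x = dA x / (rho x / e + 1)\<^sup>2"
proof -
  assume e: "e > 0"
  have "rho x / e + 1 = (rho x + e) / e" using e by (simp add: field_simps)
  then show ?thesis unfolding bubble_def using e by (simp add: power2_eq_square)
qed

lemma rho_blow_up:
  assumes p: "f p = 0"
  shows "(\<lambda>n. rho (p + eps n *\<^sub>R v) / (eps n)\<^sup>2) \<longlonglongrightarrow> (norm (pd f v p))\<^sup>2"
proof -
  have eps: "(\<lambda>n. eps n) \<longlonglongrightarrow> 0" by real_asymp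
  then have lim: "filterlim (\<lambda>n. eps n *\<^sub>R v) (nhds 0) sequentially"
    using tendsto_scaleR[OF _ tendsto_const, of eps 0 sequentially v] by simp
  obtain C where C: "\<forall>\<^sub>F u in nhds 0. norm (rho (p + u) - (norm (pd f u p))\<^sup>2) \<le> C * norm u ^ 3"
    using vanishes_rho[OF p] by (auto elim: vanishesE)
  have "\<forall>\<^sub>F n in sequentially.
      norm (rho (p + eps n *\<^sub>R v) / (eps n)\<^sup>2 - (norm (pd f v p))\<^sup>2) \<le> C * norm v ^ 3 * eps n"
    using filterlim_iff[THEN iffD1, OF lim, rule_format, OF C]
  proof (rule eventually_mono)
    fix n
    let ?t = "eps n"
    assume remainder: "norm (rho (p + ?t *\<^sub>R v) - (norm (pd f (?t *\<^sub>R v) p))\<^sup>2) \<le> C * norm (?t *\<^sub>R v) ^ 3"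
    have t: "?t > 0" by simp
    have "pd f (?t *\<^sub>R v) p = ?t *\<^sub>R pd f v p"
      using linear_scale[OF has_derivative_linear[OF smooth_map_has_derivative[OF smooth_f, of p]]] .
    then have "\<bar>rho (p + ?t *\<^sub>R v) - ?t\<^sup>2 * (norm (pd f v p))\<^sup>2\<bar> \<le> C * norm v ^ 3 * ?t * ?t\<^sup>2"
      using remainder t by (simp add: power_mult_distrib power2_eq_square power3_eq_cube mult_ac)
    moreover have "rho (p + ?t *\<^sub>R v) / ?t\<^sup>2 - (norm (pd f v p))\<^sup>2
        = (rho (p + ?t *\<^sub>R v) - ?t\<^sup>2 * (norm (pd f v p))\<^sup>2) / ?t\<^sup>2"
      using t by (simp add: diff_divide_distrib)
    ultimately show "norm (rho (p + ?t *\<^sub>R v) / ?t\<^sup>2 - (norm (pd f v p))\<^sup>2) \<le> C * norm v ^ 3 * ?t"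
      using t by (simp only: real_norm_def abs_divide abs_power2) (simp add: pos_divide_le_eq)
  qed
  moreover have "(\<lambda>n. C * norm v ^ 3 * eps n) \<longlonglongrightarrow> 0" using tendsto_mult_right[OF eps] by simp
  ultimately have "(\<lambda>n. rho (p + eps n *\<^sub>R v) / (eps n)\<^sup>2 - (norm (pd f v p))\<^sup>2) \<longlonglongrightarrow> 0"
    by (rule Lim_null_comparison)
  then show ?thesis using Lim_null by blast
qed

definition "blow_up p d n v =
  ennreal (dA (p + eps n *\<^sub>R v) / (rho (p + eps n *\<^sub>R v) / (eps n)\<^sup>2 + 1)\<^sup>2) * indicator (ball p d) (p + eps n *\<^sub>R v)"

lemma measurable_densities [measurable]: "dA \<in> borel_measurable borel" "rho \<in> borel_measurable borel"
  by (intro borel_measurable_continuous_onI smooth_map_continuous_on smooth_intros)+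

lemma bubble_mass_rescaled:
  "(\<integral>\<^sup>+x. ennreal (bubble ((eps n)\<^sup>2) x) * indicator (ball p d) x \<partial>lborel) = (\<integral>\<^sup>+v. blow_up p d n v \<partial>lborel)"
proof -
  let ?g = "\<lambda>x. ennreal (bubble ((eps n)\<^sup>2) x) * indicator (ball p d) x"
  have [measurable]: "bubble ((eps n)\<^sup>2) \<in> borel_measurable borel" unfolding bubble_def[abs_def] by measurable
  have [measurable]: "ball p d \<in> sets borel" by simp
  have "?g \<in> borel_measurable borel" by measurable
  then have "integral\<^sup>N lborel ?g = (\<integral>\<^sup>+v. ennreal ((eps n)\<^sup>2) * ?g (p + eps n *\<^sub>R v) \<partial>lborel)"
    using nn_integral_lborel_affine[of ?g "eps n" p] by (simp add: power2_eq_square)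
  also have "\<dots> = (\<integral>\<^sup>+v. blow_up p d n v \<partial>lborel)"
    unfolding blow_up_def
    by (intro nn_integral_cong) (simp add: bubble_rescaled[symmetric] ennreal_mult bubble_nonneg mult.assoc)
  finally show ?thesis .
qed

lemma blow_up_tendsto:
  assumes p: "f p = 0" and d: "d > 0"
  shows "(\<lambda>n. blow_up p d n v) \<longlonglongrightarrow> ennreal (dA p / ((norm (pd f v p))\<^sup>2 + 1)\<^sup>2)" (is "_ \<longlonglongrightarrow> ?limit")
proof -
  have "(\<lambda>n. eps n) \<longlonglongrightarrow> 0" by real_asymp
  then have "(\<lambda>n. p + eps n *\<^sub>R v) \<longlonglongrightarrow> p + 0 *\<^sub>R v" by (intro tendsto_intros)
  then have pt: "(\<lambda>n. p + eps n *\<^sub>R v) \<longlonglongrightarrow> p" by simp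
  have "(\<lambda>n. ennreal (dA (p + eps n *\<^sub>R v) / (rho (p + eps n *\<^sub>R v) / (eps n)\<^sup>2 + 1)\<^sup>2)) \<longlonglongrightarrow> ?limit"
    by (intro tendsto_ennrealI tendsto_intros smooth_map_tendsto[OF smooth_dA pt] rho_blow_up[OF p])
      (simp add: add_nonneg_eq_0_iff)
  moreover have "\<forall>\<^sub>F n in sequentially. p + eps n *\<^sub>R v \<in> ball p d"
    using topological_tendstoD[OF pt open_ball] d by simp
  then have "\<forall>\<^sub>F n in sequentially. ennreal (dA (p + eps n *\<^sub>R v) / (rho (p + eps n *\<^sub>R v) / (eps n)\<^sup>2 + 1)\<^sup>2)
      = blow_up p d n v"
    by (rule eventually_mono) (simp add: blow_up_def)
  ultimately show ?thesis by (rule Lim_transform_eventually)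
qed

lemma bubble_mass_at_zero:
  assumes p: "f p = 0" and d: "d > 0" and c: "c < pi"
  shows "\<forall>\<^sub>F n in sequentially.
    ennreal c \<le> (\<integral>\<^sup>+x. ennreal (bubble ((eps n)\<^sup>2) x) * indicator (ball p d) x \<partial>lborel)"
proof -
  have [measurable]: "ball p d \<in> sets borel" by simp
  have "ennreal pi = (\<integral>\<^sup>+v. ennreal (dA p / ((norm (pd f v p))\<^sup>2 + 1)\<^sup>2) \<partial>lborel)"
    using nn_integral_quadratic_form[of "EE p" "GG p" "FF p"] EE_pos[of p] gdet_pos[of p]
    unfolding norm_pd_f dA_def by (simp add: gdet_def add.commute)
  also have "\<dots> = (\<integral>\<^sup>+v. liminf (\<lambda>n. blow_up p d n v) \<partial>lborel)"
    using blow_up_tendsto[OF p d] lim_imp_Liminf[OF sequentially_bot] by (metis (no_types, lifting))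
  also have "\<dots> \<le> liminf (\<lambda>n. \<integral>\<^sup>+v. blow_up p d n v \<partial>lborel)"
    by (rule nn_integral_liminf) (simp add: blow_up_def)
  finally have "ennreal c < liminf (\<lambda>n. \<integral>\<^sup>+v. blow_up p d n v \<partial>lborel)"
    using c by (meson ennreal_lessI less_le_trans pi_gt_zero)
  then show ?thesis unfolding bubble_mass_rescaled by (auto dest!: less_LiminfD elim: eventually_mono)
qed

lemma bubble_mass_in_box:
  fixes c :: real
  assumes Z: "finite Z" "\<And>z. z \<in> Z \<Longrightarrow> f z = 0" "Z \<subseteq> box a (a + (1,1))" and c: "0 \<le> c" "c < pi"
  shows "\<forall>\<^sub>F n in sequentially. card Z * c \<le> integral (unit_cell a) (bubble ((eps n)\<^sup>2))"
proof -
  obtain d where d: "d > 0" "\<And>z. z \<in> Z \<Longrightarrow> ball z d \<subseteq> box a (a + (1,1))" "disjoint_family_on (\<lambda>z. ball z d) Z"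
    using disjoint_small_balls[OF Z(1,3) open_box] by blast
  have "\<forall>\<^sub>F n in sequentially. \<forall>z\<in>Z.
      ennreal c \<le> (\<integral>\<^sup>+x. ennreal (bubble ((eps n)\<^sup>2) x) * indicator (ball z d) x \<partial>lborel)"
    by (intro eventually_ball_finite Z ballI bubble_mass_at_zero d c)
  then show ?thesis
  proof (rule eventually_mono)
    fix n
    let ?b = "bubble ((eps n)\<^sup>2)" and ?T = "unit_cell a"
    assume mass: "\<forall>z\<in>Z. ennreal c \<le> (\<integral>\<^sup>+x. ennreal (?b x) * indicator (ball z d) x \<partial>lborel)"
    have smooth: "smooth_map ?b" by (rule smooth_densities) simp
    then have [measurable]: "?b \<in> borel_measurable borel"
      by (intro borel_measurable_continuous_onI smooth_map_continuous_on)
    have integral_nonneg: "0 \<le> integral ?T ?b"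
      by (intro Henstock_Kurzweil_Integration.integral_nonneg integrable_on_unit_cell smooth bubble_nonneg) simp
    have "ennreal (card Z * c) = (\<Sum>z\<in>Z. ennreal c)"
      using c by (simp add: ennreal_mult ennreal_of_nat_eq_real_of_nat)
    also have "\<dots> \<le> (\<Sum>z\<in>Z. \<integral>\<^sup>+x. ennreal (?b x) * indicator (ball z d) x \<partial>lborel)"
      by (intro sum_mono) (use mass in auto)
    also have "\<dots> = (\<integral>\<^sup>+x. (\<Sum>z\<in>Z. ennreal (?b x) * indicator (ball z d) x) \<partial>lborel)"
      by (intro nn_integral_sum[symmetric]) (auto intro!: borel_measurable_times_ennreal borel_measurable_indicator)
    also have "\<dots> \<le> (\<integral>\<^sup>+x. ennreal (?b x) * indicator ?T x \<partial>lborel)"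
    proof (intro nn_integral_mono)
      fix x
      have "(\<Union>z\<in>Z. ball z d) \<subseteq> ?T" using d(2) box_subset_cbox by blast
      then have "(\<Sum>z\<in>Z. indicator (ball z d) x) \<le> (indicator ?T x :: ennreal)"
        unfolding indicator_UN_disjoint[OF Z(1) d(3), symmetric] by (intro indicator_leI) blast
      then show "(\<Sum>z\<in>Z. ennreal (?b x) * indicator (ball z d) x) \<le> ennreal (?b x) * indicator ?T x"
        by (simp add: sum_distrib_left[symmetric] mult_left_mono)
    qed
    also have "\<dots> = ennreal (integral ?T ?b)"
      by (intro nn_integral_has_integral_lebesgue' integrable_integral integrable_on_unit_cell smooth bubble_nonneg)
        simp
    finally show "card Z * c \<le> integral ?T ?b" using integral_nonneg by (subst (asm) ennreal_le_iff)
  qed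
qed

lemma bubble_mass:
  fixes c :: real
  assumes Z: "finite Z" "\<And>z. z \<in> Z \<Longrightarrow> f z = 0" "\<And>z w. z \<in> Z \<Longrightarrow> w \<in> Z \<Longrightarrow> z - w \<in> int_vectors \<Longrightarrow> z = w"
    and c: "0 \<le> c" "c < pi"
  shows "\<forall>\<^sub>F n in sequentially. card Z * c \<le> integral (unit_cell a) (bubble ((eps n)\<^sup>2))"
proof -
  obtain b1 where b1: "\<And>z. z \<in> Z \<Longrightarrow> fst z - b1 \<notin> \<int>"
    using exists_real_avoiding_cosets[of "fst ` Z"] Z(1) by (metis finite_imageI imageI)
  obtain b2 where b2: "\<And>z. z \<in> Z \<Longrightarrow> snd z - b2 \<notin> \<int>"
    using exists_real_avoiding_cosets[of "snd ` Z"] Z(1) by (metis finite_imageI imageI)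
  define b where "b = (b1,b2)"
  have "\<exists>w. w \<in> int_vectors \<and> z + w \<in> box b (b + (1,1))" if "z \<in> Z" for z
    using int_vector_representative_in_box[of z b] b1[OF that] b2[OF that]
    by (metis b_def fst_conv snd_conv)
  then obtain w where w: "\<And>z. z \<in> Z \<Longrightarrow> w z \<in> int_vectors" "\<And>z. z \<in> Z \<Longrightarrow> z + w z \<in> box b (b + (1,1))"
    by metis
  define r where "r = (\<lambda>z. z + w z)"
  have "inj_on r Z"
  proof (rule inj_onI)
    fix y z assume yz: "y \<in> Z" "z \<in> Z" "r y = r z"
    then have "y - z = w z - w y" by (simp add: r_def algebra_simps)
    then show "y = z" using Z(3)[OF yz(1,2)] int_vectors_diff w(1) yz(1,2) by simp
  qed
  have "\<forall>\<^sub>F n in sequentially. card (r ` Z) * c \<le> integral (unit_cell b) (bubble ((eps n)\<^sup>2))"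
  proof (rule bubble_mass_in_box[OF _ _ _ c])
    show "f y = 0" if "y \<in> r ` Z" for y
      using that Z(2) torus_periodicD[OF periodic_f w(1)] by (metis imageE r_def)
    show "r ` Z \<subseteq> box b (b + (1,1))" using w(2) unfolding r_def by blast
  qed (simp add: Z(1))
  then show ?thesis
    unfolding card_image[OF \<open>inj_on r Z\<close>]
    by (rule eventually_mono)
      (metis integral_unit_cell_shift[OF smooth_map_continuous_on[OF smooth_densities(2)] periodic_densities(2)]
        of_nat_add of_nat_1 zero_less_divide_1_iff of_nat_0_less_iff zero_less_Suc Suc_eq_plus1 zero_less_power)
qed

lemma defect_integral_small:
  fixes c :: real
  assumes W: "willmore f = 8 * pi"
    and Z: "finite Z" "\<And>z. z \<in> Z \<Longrightarrow> f z = 0" "\<And>z w. z \<in> Z \<Longrightarrow> w \<in> Z \<Longrightarrow> z - w \<in> int_vectors \<Longrightarrow> z = w"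
    and c: "0 \<le> c" "c < pi"
  shows "\<forall>\<^sub>F n in sequentially. integral (unit_cell a) (defect ((eps n)\<^sup>2)) \<le> 2 * pi - card Z * c"
  using bubble_mass[OF Z c, of a]
proof (rule eventually_mono)
  fix n assume "card Z * c \<le> integral (unit_cell a) (bubble ((eps n)\<^sup>2))"
  then show "integral (unit_cell a) (defect ((eps n)\<^sup>2)) \<le> 2 * pi - card Z * c"
    using Li_Yau_identity[of "(eps n)\<^sup>2" a] W by simp
qed

lemma defect_integral_nonneg: "e > 0 \<Longrightarrow> 0 \<le> integral (unit_cell a) (defect e)"
  by (intro Henstock_Kurzweil_Integration.integral_nonneg integrable_on_unit_cell smooth_densities defect_nonneg)

lemma at_most_two_zeros:
  assumes W: "willmore f = 8 * pi" and zero: "f x = 0" "f y = 0" "f z = 0"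
  shows "x - y \<in> int_vectors \<or> x - z \<in> int_vectors \<or> y - z \<in> int_vectors"
proof (rule ccontr)
  assume inc: "\<not> ?thesis"
  then have distinct: "x \<noteq> y" "x \<noteq> z" "y \<noteq> z" by auto
  have "\<forall>\<^sub>F n in sequentially. integral (unit_cell 0) (defect ((eps n)\<^sup>2)) \<le> 2 * pi - card {x,y,z} * (3/4 * pi)"
  proof (rule defect_integral_small[OF W])
    show "v = w" if "v \<in> {x,y,z}" "w \<in> {x,y,z}" "v - w \<in> int_vectors" for v w
      using that inc by (metis insertE int_vectors_minus_commute singletonD)
  qed (use zero in auto)
  then obtain n where "integral (unit_cell 0) (defect ((eps n)\<^sup>2)) \<le> 2 * pi - card {x,y,z} * (3/4 * pi)"
    using eventually_happens'[OF sequentially_bot] by auto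
  moreover have "0 \<le> integral (unit_cell 0) (defect ((eps n)\<^sup>2))" by (rule defect_integral_nonneg) simp
  ultimately have "2 * pi - 9/4 * pi \<ge> 0" using distinct by simp
  then show False using pi_gt_zero by linarith
qed

lemma defect_lower_bound:
  assumes x0: "f x0 \<noteq> 0" and ne: "HH x0 \<noteq> - (4 / rho x0) *\<^sub>R XN x0"
  obtains m t where "m > 0" "0 < t" "t \<le> 1/2"
    "\<And>x e. x \<in> cbox (x0 - (t,t)) (x0 + (t,t)) \<Longrightarrow> \<bar>e\<bar> < t \<Longrightarrow> m \<le> defect e x"
proof -
  have rho0: "rho x0 > 0" using x0 rho_eq_0_iff[of x0] rho_nonneg[of x0] by linarith
  define g where "g = (\<lambda>(x,e). dA x * (norm ((1/4) *\<^sub>R HH x + (1 / (rho x + e)) *\<^sub>R XN x))\<^sup>2)"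
  have "4 *\<^sub>R ((1/4) *\<^sub>R HH x0 + (1 / rho x0) *\<^sub>R XN x0) \<noteq> 0"
    using ne by (simp add: scaleR_add_right eq_neg_iff_add_eq_0)
  then have pos: "g (x0,0) > 0" using dA_pos[of x0] by (auto simp: g_def)
  have fst: "((\<lambda>y. h (fst y)) \<longlongrightarrow> h x0) (at (x0, 0::real))" if "smooth_map h" for h :: "plane \<Rightarrow> 'a::real_normed_vector"
    by (rule smooth_map_tendsto[OF that]) (auto intro!: tendsto_eq_intros)
  have "((\<lambda>y. dA (fst y) * (norm ((1/4) *\<^sub>R HH (fst y) + (1 / (rho (fst y) + snd y)) *\<^sub>R XN (fst y)))\<^sup>2)
      \<longlongrightarrow> dA x0 * (norm ((1/4) *\<^sub>R HH x0 + (1 / (rho x0 + 0)) *\<^sub>R XN x0))\<^sup>2) (at (x0,0))"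
    by (intro tendsto_intros fst smooth_intros fst[of XN]) (use rho0 in \<open>auto intro!: tendsto_eq_intros smooth_intros\<close>)
  then have "isCont g (x0,0)" unfolding isCont_def g_def by (simp add: case_prod_unfold)
  then obtain d where d: "d > 0" "\<And>y. dist y (x0,0) < d \<Longrightarrow> dist (g y) (g (x0,0)) < g (x0,0) / 2"
    using pos unfolding continuous_at_eps_delta by (meson half_gt_zero)
  define t where "t = min (d/4) (1/2)"
  have t: "t > 0" "t \<le> d/4" "t \<le> 1/2" using d by (auto simp: t_def)
  have "g (x0,0) / 2 \<le> defect e x" if "x \<in> cbox (x0 - (t,t)) (x0 + (t,t))" "\<bar>e\<bar> < t" for x e
  proof -
    have "\<bar>fst x - fst x0\<bar> \<le> t" "\<bar>snd x - snd x0\<bar> \<le> t"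
      using that(1) by (cases x; cases x0; auto simp: cbox_Pair_eq)+
    then have "dist (x,e) (x0,0) < d"
      using that(2) t norm_Pair_le[of "x - x0" "e"] norm_Pair_le[of "fst x - fst x0" "snd x - snd x0"]
      by (cases x; cases x0) (auto simp: dist_norm)
    then have "\<bar>g (x,e) - g (x0,0)\<bar> < g (x0,0) / 2" using d(2)[of "(x,e)"] by (simp add: dist_real_def)
    then have "g (x0,0) / 2 \<le> g (x,e)" by linarith
    then show ?thesis by (simp add: g_def defect_def)
  qed
  then show ?thesis using that[of "g (x0,0) / 2" t] pos t by simp
qed

lemma mean_curvature_if_Li_Yau_equality:
  assumes W: "willmore f = 8 * pi" and zero: "f p = 0" "f q = 0" "p - q \<notin> int_vectors" and x0: "f x0 \<noteq> 0"
  shows "HH x0 = - (4 / rho x0) *\<^sub>R XN x0"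
proof (rule ccontr)
  assume "HH x0 \<noteq> - (4 / rho x0) *\<^sub>R XN x0"
  then obtain m t where mt: "m > 0" "0 < t" "t \<le> 1/2"
    "\<And>x e. x \<in> cbox (x0 - (t,t)) (x0 + (t,t)) \<Longrightarrow> \<bar>e\<bar> < t \<Longrightarrow> m \<le> defect e x"
    using defect_lower_bound[OF x0] by blast
  let ?a = "x0 - (1/2,1/2)" and ?Q = "cbox (x0 - (t,t)) (x0 + (t,t))"
  have sub: "?Q \<subseteq> unit_cell ?a"
    using mt(2,3) by (cases x0) (auto simp: cbox_Pair_eq)
  have content: "measure lborel ?Q = (2 * t) * (2 * t)" using mt(2) by (cases x0) (simp add: content_Pair)
  define c where "c = pi - m * t\<^sup>2"
  have "p \<noteq> q" using zero(3) by auto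
  have small: "\<forall>\<^sub>F n in sequentially. integral (unit_cell ?a) (defect ((eps n)\<^sup>2)) \<le> 2 * pi - card {p,q} * max 0 c"
  proof (rule defect_integral_small[OF W])
    show "v = w" if "v \<in> {p,q}" "w \<in> {p,q}" "v - w \<in> int_vectors" for v w
      using that zero(3) by (metis insertE int_vectors_minus_commute singletonD)
    show "max 0 c < pi" using mt by (simp add: c_def)
  qed (use zero in auto)
  have "(\<lambda>n. (eps n)\<^sup>2) \<longlonglongrightarrow> 0" by real_asymp
  then have "\<forall>\<^sub>F n in sequentially. (eps n)\<^sup>2 < t" by (rule order_tendstoD(2)) (rule mt(2))
  with small obtain n where n:
    "integral (unit_cell ?a) (defect ((eps n)\<^sup>2)) \<le> 2 * pi - card {p,q} * max 0 c" "(eps n)\<^sup>2 < t"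
    using eventually_happens'[OF sequentially_bot eventually_conj] by blast
  have integrable: "defect ((eps n)\<^sup>2) integrable_on cbox u v" for u v
    by (intro integrable_on_unit_cell smooth_densities) simp
  have "(2 * t) * (2 * t) * m = integral ?Q (\<lambda>x. m)" using content by simp
  also have "\<dots> \<le> integral ?Q (defect ((eps n)\<^sup>2))"
    by (intro Henstock_Kurzweil_Integration.integral_le integrable integrable_const mt(4)) (use n(2) in auto)
  also have "\<dots> \<le> integral (unit_cell ?a) (defect ((eps n)\<^sup>2))"
    by (intro integral_subset_le sub integrable) (auto intro: defect_nonneg)
  also have "\<dots> \<le> 2 * pi - 2 * c" using n(1) \<open>p \<noteq> q\<close> by (auto simp: max_def split: if_splits)
  finally have "4 * (m * t\<^sup>2) \<le> 2 * (m * t\<^sup>2)" by (simp add: c_def power2_eq_square)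
  then show False using mt by simp
qed

end

section \<open>Complex vectors and linear coordinates\<close>

definition cdot :: "complex^4 \<Rightarrow> complex^4 \<Rightarrow> complex" where
  "cdot x y = (\<Sum>i\<in>UNIV. x $ i * y $ i)"
definition cvec :: "real^4 \<Rightarrow> complex^4" where "cvec v = (\<chi> i. complex_of_real (v $ i))"
definition ccnj :: "complex^4 \<Rightarrow> complex^4" where "ccnj v = (\<chi> i. cnj (v $ i))"
definition rvec :: "complex^4 \<Rightarrow> real^4" where "rvec v = (\<chi> i. Re (v $ i))"

lemma bounded_bilinear_cdot: "bounded_bilinear cdot"
  unfolding bilinear_conv_bounded_bilinear[symmetric] bilinear_def cdot_def
  by (auto intro!: linearI simp: algebra_simps sum.distrib scaleR_sum_right)

interpretation cdot: bounded_bilinear cdot by (rule bounded_bilinear_cdot)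

lemma bounded_linear_cvec: "bounded_linear cvec"
  unfolding linear_conv_bounded_linear[symmetric] cvec_def[abs_def]
  by (intro linearI) (auto simp: vec_eq_iff scaleR_conv_of_real[where 'a = complex])

lemma bounded_linear_ccnj: "bounded_linear ccnj"
  unfolding linear_conv_bounded_linear[symmetric] ccnj_def[abs_def]
  by (intro linearI) (auto simp: vec_eq_iff)

lemma bounded_bilinear_smult: "bounded_bilinear ((*s) :: complex \<Rightarrow> complex^4 \<Rightarrow> complex^4)"
  unfolding bilinear_conv_bounded_bilinear[symmetric] bilinear_def
  by (auto intro!: linearI simp: vec_eq_iff algebra_simps)

lemma cdot_commute: "cdot x y = cdot y x"
  by (simp add: cdot_def mult.commute)

lemma cdot_smult: "cdot (c *s x) y = c * cdot x y" "cdot x (c *s y) = c * cdot x y"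
  by (simp_all add: cdot_def sum_distrib_left algebra_simps)

lemma cdot_cvec: "cdot (cvec u) (cvec v) = of_real (u \<bullet> v)"
  by (simp add: cdot_def cvec_def inner_vec_def)

lemma cdot_ccnj: "cdot (ccnj u) (ccnj v) = cnj (cdot u v)"
  by (simp add: cdot_def ccnj_def)

lemma Re_cdot_cvec: "Re (cdot (cvec u) n) = u \<bullet> rvec n"
  by (simp add: cdot_def cvec_def rvec_def inner_vec_def)

lemma cdot_ccnj_self: "cdot v (ccnj v) = of_real ((norm v)\<^sup>2)"
  unfolding cdot_def ccnj_def norm_vec_def L2_set_def
  by (simp add: sum_nonneg complex_norm_square flip: of_real_power)

lemma cvec_simps: "cvec (u + v) = cvec u + cvec v" "cvec (u - v) = cvec u - cvec v"
  "cvec (- v) = - cvec v" "cvec (r *\<^sub>R v) = of_real r *s cvec v" "cvec 0 = 0"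
  by (simp_all add: cvec_def vec_eq_iff scaleR_conv_of_real[where 'a = complex])

lemma ccnj_simps: "ccnj (u + v) = ccnj u + ccnj v" "ccnj (u - v) = ccnj u - ccnj v"
  "ccnj (c *s v) = cnj c *s ccnj v" "ccnj (cvec w) = cvec w" "ccnj (ccnj v) = v"
  by (simp_all add: ccnj_def cvec_def vec_eq_iff)

lemma rvec_simps: "rvec (u + v) = rvec u + rvec v" "rvec (u - v) = rvec u - rvec v"
  "rvec (r *\<^sub>R v) = r *\<^sub>R rvec v" "rvec (c *s cvec w) = Re c *\<^sub>R w" "rvec (cvec w) = w"
  by (simp_all add: rvec_def cvec_def vec_eq_iff)

lemma scaleR_eq_smult: "r *\<^sub>R v = of_real r *s v" for v :: "complex^4"
  by (simp add: vec_eq_iff scaleR_conv_of_real[where 'a = complex])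

lemmas cdot_simps = cdot.add_left cdot.add_right cdot.diff_left cdot.diff_right cdot_smult cdot_cvec

lemmas smooth_map_cdot [smooth_intros] = smooth_map_bilinear[OF bounded_bilinear_cdot]
lemmas smooth_map_smult [smooth_intros] = smooth_map_bilinear[OF bounded_bilinear_smult]
lemmas smooth_map_cvec [smooth_intros] = smooth_map_bounded_linear[OF bounded_linear_cvec]
lemmas smooth_map_ccnj [smooth_intros] = smooth_map_bounded_linear[OF bounded_linear_ccnj]

lemmas pd_cdot = pd_bilinear[OF bounded_bilinear_cdot]
lemmas pd_smult = pd_bilinear[OF bounded_bilinear_smult]
lemmas pd_cvec = pd_bounded_linear[OF bounded_linear_cvec smooth_map_differentiable]
lemmas pd_ccnj = pd_bounded_linear[OF bounded_linear_ccnj smooth_map_differentiable]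

definition lincoord :: "complex \<Rightarrow> plane \<Rightarrow> complex" where
  "lincoord m v = of_real (fst v) + m * of_real (snd v)"

lemma bounded_linear_lincoord: "bounded_linear (lincoord m)"
  unfolding linear_conv_bounded_linear[symmetric] lincoord_def[abs_def]
  by (intro linearI) (simp_all add: algebra_simps scaleR_conv_of_real)

lemma lincoord_simps: "lincoord m (v + w) = lincoord m v + lincoord m w"
  "lincoord m (v - w) = lincoord m v - lincoord m w" "lincoord m (r *\<^sub>R v) = of_real r * lincoord m v"
  "lincoord m 0 = 0" "lincoord m e1 = 1" "lincoord m e2 = m"
  by (simp_all add: lincoord_def e1_def e2_def algebra_simps)

lemma lincoord_eq_0_iff: "Im m \<noteq> 0 \<Longrightarrow> lincoord m v = 0 \<longleftrightarrow> v = 0"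
  by (auto simp: lincoord_def complex_eq_iff prod_eq_iff)

lemma lincoord_lower_bound:
  assumes "Im m \<noteq> 0" obtains c where "c > 0" "\<And>v. c * norm v \<le> norm (lincoord m v)"
proof -
  have "linear (lincoord m)" using bounded_linear_lincoord bounded_linear.linear by blast
  moreover from this have "inj (lincoord m)"
    by (simp add: linear_injective_0 lincoord_eq_0_iff[OF assms])
  ultimately show ?thesis using linear_inj_bounded_below_pos that by (metis mult.commute)
qed

section \<open>The inverted surface\<close>

text \<open>\<open>null_tan x\<close> spans the tangent vectors of type \<open>(1,0)\<close>, so that \<open>df\<close> is the real part of \<open>dz null_tan\<close>.
  Up to the factor \<open>1 / rho\<^sup>2\<close>, \<open>inversion_diff\<close> is the complex linear extension of the differential of the
  inversion \<open>y \<mapsto> y / |y|\<^sup>2\<close>, and \<open>Omega\<close> is the Weierstrass form of \<open>inverted\<close>.\<close>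

context immersed_torus
begin

definition "mu x = Complex (FF x / EE x) (dA x / EE x)"
definition "dz x v = lincoord (mu x) v"
definition "null_tan x = cvec (f1 x) - \<i> *s cvec (V2 x)"
definition "inversion_diff x n = rho x *\<^sub>R n - (2 * cdot (cvec (f x)) n) *s cvec (f x)"
definition "inverted x = (1 / rho x) *\<^sub>R f x"
definition "Omega x = (1 / (rho x)\<^sup>2) *\<^sub>R inversion_diff x (null_tan x)"

lemma mu_eq: "mu x = of_real (FF x / EE x) + \<i> * of_real (dA x / EE x)"
  by (simp add: mu_def complex_eq_iff)

lemma Im_mu_pos: "Im (mu x) > 0"
  using dA_pos EE_pos by (simp add: mu_def)

lemma Im_mu_nonzero [simp]: "Im (mu x) \<noteq> 0"
  using Im_mu_pos[of x] by simp

lemma smooth_mu [smooth_intros]: "smooth_map mu"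
  unfolding mu_eq[abs_def] by (intro smooth_intros EE_nonzero)

lemma smooth_null_tan [smooth_intros]: "smooth_map null_tan"
  unfolding null_tan_def[abs_def] by (intro smooth_intros)

lemma smooth_inversion_diff [smooth_intros]: "smooth_map n \<Longrightarrow> smooth_map (\<lambda>x. inversion_diff x (n x))"
  unfolding inversion_diff_def by (intro smooth_intros)

lemma dz_simps: "dz x (v + w) = dz x v + dz x w" "dz x (v - w) = dz x v - dz x w"
  "dz x (r *\<^sub>R v) = of_real r * dz x v" "dz x 0 = 0" "dz x e1 = 1" "dz x e2 = mu x"
  by (simp_all add: dz_def lincoord_simps)

lemma dz_lower_bound: obtains c where "c > 0" "\<And>v. c * norm v \<le> norm (dz x v)"
  using lincoord_lower_bound[of "mu x"] unfolding dz_def by auto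

lemma null_tan_null: "cdot (null_tan x) (null_tan x) = 0"
  unfolding null_tan_def by (simp add: cdot_simps V2_inner_V2 V_inner fff_inner)

lemma norm_null_tan: "cdot (null_tan x) (ccnj (null_tan x)) = of_real (2 * EE x)"
  unfolding null_tan_def by (simp add: ccnj_simps cdot_simps V2_inner_V2 V_inner fff_inner)

lemma null_tan_nonzero [simp]: "null_tan x \<noteq> 0"
  using norm_null_tan[of x] by (auto simp: cdot.zero_left)

lemma f2_eq: "f2 x = (FF x / EE x) *\<^sub>R f1 x + (dA x / EE x) *\<^sub>R V2 x"
  unfolding V2_def by (simp add: algebra_simps)

lemma V1_eq: "V1 x = (dA x / EE x) *\<^sub>R f1 x - (FF x / EE x) *\<^sub>R V2 x"
proof -
  have "(dA x / EE x) *\<^sub>R f1 x - (FF x / EE x) *\<^sub>R V2 x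
      = (1 / (dA x * EE x)) *\<^sub>R ((dA x * dA x) *\<^sub>R f1 x - FF x *\<^sub>R (EE x *\<^sub>R f2 x - FF x *\<^sub>R f1 x))"
    unfolding V2_def by (simp add: scaleR_diff_right)
  also have "(dA x * dA x) *\<^sub>R f1 x - FF x *\<^sub>R (EE x *\<^sub>R f2 x - FF x *\<^sub>R f1 x)
      = EE x *\<^sub>R (GG x *\<^sub>R f1 x - FF x *\<^sub>R f2 x)"
    unfolding dA_mult_self_fff by (simp add: algebra_simps)
  finally show ?thesis unfolding V1_def by (simp add: scaleR_diff_right)
qed

lemma mu_null_tan: "mu x *s null_tan x = cvec (f2 x) + \<i> *s cvec (V1 x)"
proof -
  have frames: "cvec (f2 x) = of_real (FF x / EE x) *s cvec (f1 x) + of_real (dA x / EE x) *s cvec (V2 x)"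
    "cvec (V1 x) = of_real (dA x / EE x) *s cvec (f1 x) - of_real (FF x / EE x) *s cvec (V2 x)"
    using arg_cong[OF f2_eq[of x], of cvec] arg_cong[OF V1_eq[of x], of cvec] by (simp_all only: cvec_simps)
  show ?thesis unfolding null_tan_def mu_eq frames by (simp add: vec_eq_iff algebra_simps)
qed

lemma cvec_eq_null_tan:
  "cvec w = (1 / of_real (2 * EE x)) *s (cdot (cvec w) (ccnj (null_tan x)) *s null_tan x
      + cdot (cvec w) (null_tan x) *s ccnj (null_tan x)) + cvec (nor_proj f x w)" (is "_ = ?T + _")
proof -
  have "tan_proj f x w = (1 / dA x) *\<^sub>R ((w \<bullet> f1 x) *\<^sub>R V1 x + (w \<bullet> f2 x) *\<^sub>R V2 x)"
    by (rule tan_proj_eq_conormal)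
  also have "\<dots> = (1 / EE x) *\<^sub>R ((w \<bullet> f1 x) *\<^sub>R f1 x + (w \<bullet> V2 x) *\<^sub>R V2 x)"
    unfolding V1_eq f2_eq[of x] by (simp add: inner_simps algebra_simps)
  finally have tangential: "tan_proj f x w = (1 / EE x) *\<^sub>R ((w \<bullet> f1 x) *\<^sub>R f1 x + (w \<bullet> V2 x) *\<^sub>R V2 x)" .
  have "cdot (cvec w) (null_tan x) = Complex (w \<bullet> f1 x) (- (w \<bullet> V2 x))"
    "cdot (cvec w) (ccnj (null_tan x)) = Complex (w \<bullet> f1 x) (w \<bullet> V2 x)"
    unfolding null_tan_def by (simp_all add: ccnj_simps cdot_simps complex_eq_iff)
  then have "cvec (tan_proj f x w) = ?T"
    unfolding tangential by (simp add: vec_eq_iff null_tan_def cvec_def ccnj_def complex_eq_iff field_simps)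
  then show ?thesis by (subst tan_proj_plus_nor_proj[of w x]) (simp add: cvec_simps)
qed

lemma rvec_dz_null_tan: "rvec (dz x v *s null_tan x) = pd f v x"
proof -
  have "dz x v *s null_tan x = fst v *\<^sub>R null_tan x + snd v *\<^sub>R (mu x *s null_tan x)"
    by (simp add: dz_def lincoord_def scaleR_eq_smult vec_eq_iff algebra_simps)
  then have "rvec (dz x v *s null_tan x) = fst v *\<^sub>R rvec (null_tan x) + snd v *\<^sub>R rvec (mu x *s null_tan x)"
    by (simp add: rvec_simps)
  then show ?thesis
    unfolding mu_null_tan unfolding null_tan_def smooth_map_pd_decompose[OF smooth_f, of v x]
    by (simp add: rvec_simps)
qed

lemma cdot_pd_f_null_tan: "cdot (cvec (pd f v x)) (null_tan x) = of_real (EE x) * cnj (dz x v)"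
  unfolding smooth_map_pd_decompose[OF smooth_f, of v x] dz_def lincoord_def null_tan_def mu_eq
  by (simp add: cvec_simps cdot_simps fff_inner V_inner field_simps)

lemma norm_pd_f_dz: "(norm (pd f v x))\<^sup>2 = EE x * (norm (dz x v))\<^sup>2"
proof -
  have "EE x * (norm (dz x v))\<^sup>2 = EE x * ((fst v + FF x / EE x * snd v)\<^sup>2 + (dA x / EE x * snd v)\<^sup>2)"
    unfolding cmod_power2 dz_def lincoord_def mu_def by simp
  also have "\<dots> = EE x * (fst v)\<^sup>2 + 2 * FF x * fst v * snd v + (FF x * FF x + dA x * dA x) / EE x * (snd v)\<^sup>2"
    by (simp add: power2_eq_square field_simps)
  also have "(FF x * FF x + dA x * dA x) / EE x = GG x" unfolding dA_mult_self_fff by simp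
  finally show ?thesis by (simp add: norm_pd_f)
qed

lemma inversion_diff_smult: "inversion_diff x (c *s n) = c *s inversion_diff x n"
  unfolding inversion_diff_def by (simp add: vec_eq_iff cdot_smult algebra_simps)

lemma cdot_inversion_diff: "cdot (inversion_diff x m) (inversion_diff x n) = of_real ((rho x)\<^sup>2) * cdot m n"
proof -
  have "cdot (cvec (f x)) (cvec (f x)) = of_real (rho x)" by (simp add: cdot_cvec rho_def)
  then show ?thesis
    unfolding inversion_diff_def scaleR_eq_smult
    by (simp add: cdot.diff_left cdot.diff_right cdot_smult cdot_commute[of m] power2_eq_square algebra_simps)
qed

lemma ccnj_inversion_diff: "ccnj (inversion_diff x n) = inversion_diff x (ccnj n)"
  using cdot_ccnj[of "cvec (f x)" n] unfolding inversion_diff_def scaleR_eq_smult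
  by (simp add: ccnj_simps)

lemma cdot_Omega: "cdot w (Omega x) = cdot w (inversion_diff x (null_tan x)) / of_real ((rho x)\<^sup>2)"
  unfolding Omega_def scaleR_eq_smult by (simp add: cdot_smult)

lemma Omega_null: "cdot (Omega x) (Omega x) = 0"
  unfolding Omega_def scaleR_eq_smult by (simp add: cdot_smult cdot_inversion_diff null_tan_null)

lemma Omega_nonzero: assumes "f x \<noteq> 0" shows "Omega x \<noteq> 0"
proof -
  have "cdot (inversion_diff x (null_tan x)) (ccnj (inversion_diff x (null_tan x))) \<noteq> 0"
    unfolding ccnj_inversion_diff cdot_inversion_diff norm_null_tan using assms rho_eq_0_iff by simp
  then have "inversion_diff x (null_tan x) \<noteq> 0" by (auto simp: cdot.zero_left)
  then show ?thesis unfolding Omega_def using assms rho_eq_0_iff by simp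
qed

lemma has_derivative_inverted:
  assumes "f x \<noteq> 0" shows "(inverted has_derivative (\<lambda>v. rvec (dz x v *s Omega x))) (at x)"
proof -
  let ?D = "\<lambda>v. (1 / rho x) *\<^sub>R pd f v x - (2 * (f x \<bullet> pd f v x) / (rho x)\<^sup>2) *\<^sub>R f x"
  have nz: "rho x \<noteq> 0" using assms rho_eq_0_iff by simp
  have "((\<lambda>x. inverse (rho x) *\<^sub>R f x) has_derivative (\<lambda>v. inverse (rho x) *\<^sub>R pd f v x
      + (- (inverse (rho x) * pd rho v x * inverse (rho x))) *\<^sub>R f x)) (at x)"
    by (intro has_derivative_scaleR Deriv.has_derivative_inverse nz smooth_map_has_derivative smooth_f smooth_rho)
  then have "(inverted has_derivative ?D) (at x)"
    unfolding inverted_def[abs_def] pd_rho by (simp add: divide_inverse power2_eq_square mult_ac)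
  moreover have "?D v = rvec (dz x v *s Omega x)" for v
  proof -
    have "dz x v *s Omega x = (1 / (rho x)\<^sup>2) *\<^sub>R inversion_diff x (dz x v *s null_tan x)"
      by (simp add: Omega_def inversion_diff_smult scaleR_eq_smult vec_eq_iff)
    then have "rvec (dz x v *s Omega x) = (1 / (rho x)\<^sup>2) *\<^sub>R (rho x *\<^sub>R pd f v x - (2 * (f x \<bullet> pd f v x)) *\<^sub>R f x)"
      by (simp add: inversion_diff_def rvec_simps rvec_dz_null_tan Re_cdot_cvec)
    then show ?thesis using nz by (simp add: scaleR_diff_right power2_eq_square)
  qed
  ultimately show ?thesis by simp
qed

lemma has_derivative_over_rho_square:
  fixes g :: "plane \<Rightarrow> complex^4"
  assumes "smooth_map g" "f x \<noteq> 0"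
  shows "((\<lambda>x. (1 / (rho x)\<^sup>2) *\<^sub>R g x) has_derivative
    (\<lambda>v. (1 / rho x ^ 3) *\<^sub>R (rho x *\<^sub>R pd g v x - (2 * pd rho v x) *\<^sub>R g x))) (at x)"
proof -
  have nz: "rho x \<noteq> 0" using assms rho_eq_0_iff by simp
  have "((\<lambda>x. (1 / (rho x)\<^sup>2)) has_derivative (\<lambda>v. - (2 * pd rho v x / rho x ^ 3))) (at x)"
    using nz by (auto intro!: derivative_eq_intros smooth_map_has_derivative[OF smooth_rho]
        simp: divide_simps power2_eq_square power3_eq_cube)
  from has_derivative_scaleR[OF this smooth_map_has_derivative[OF assms(1)]] show ?thesis
    by (rule has_derivative_eq_rhs) (use nz in
      \<open>simp add: fun_eq_iff scaleR_diff_right power2_eq_square power3_eq_cube algebra_simps\<close>)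
qed

lemma mu_Omega: "mu x *s Omega x = (1 / (rho x)\<^sup>2) *\<^sub>R inversion_diff x (mu x *s null_tan x)"
  by (simp add: Omega_def inversion_diff_smult scaleR_eq_smult vec_eq_iff)

lemma Omega_differentiable:
  assumes "f x \<noteq> 0"
  shows "Omega differentiable (at x)" "(\<lambda>x. mu x *s Omega x) differentiable (at x)"
  unfolding Omega_def[abs_def] mu_Omega[unfolded Omega_def] differentiable_def
  by (rule exI has_derivative_over_rho_square assms smooth_intros)+

lemma pd_inversion_diff:
  assumes "smooth_map n"
  shows "pd (\<lambda>x. inversion_diff x (n x)) v x = pd rho v x *\<^sub>R n x + rho x *\<^sub>R pd n v x
    - (2 * (cdot (cvec (pd f v x)) (n x) + cdot (cvec (f x)) (pd n v x))) *s cvec (f x)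
    - (2 * cdot (cvec (f x)) (n x)) *s cvec (pd f v x)"
  unfolding inversion_diff_def
  by (simp add: pd_diff pd_scaleR pd_smult pd_mult pd_cdot pd_cvec pd_const assms smooth_rho smooth_f
      smooth_map_scaleR smooth_map_smult smooth_map_mult smooth_map_cdot smooth_map_cvec smooth_map_const
      vec_eq_iff algebra_simps)

lemma div_null_tan: "pd (\<lambda>x. mu x *s null_tan x) e1 x - pd null_tan e2 x = (\<i> * of_real (dA x)) *s cvec (HH x)"
proof -
  have "pd (\<lambda>x. mu x *s null_tan x) e1 x - pd null_tan e2 x = \<i> *s cvec (pd V1 e1 x + pd V2 e2 x)"
    unfolding mu_null_tan unfolding null_tan_def[abs_def]
    by (simp add: pd_add pd_diff pd_smult pd_cvec pd_const pd_f2_e1 smooth_f smooth_V smooth_map_pd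
        smooth_map_cvec smooth_map_smult smooth_map_const cvec_simps vec_eq_iff algebra_simps)
  then show ?thesis unfolding div_V by (simp add: cvec_simps vec_eq_iff)
qed

end

locale willmore_torus = immersed_torus +
  fixes p1 p2 :: "plane"
  assumes zero_iff: "f x = 0 \<longleftrightarrow> x - p1 \<in> int_vectors \<or> x - p2 \<in> int_vectors"
    and incongruent: "p1 - p2 \<notin> int_vectors"
    and mean_curvature: "f x \<noteq> 0 \<Longrightarrow> HH x = - (4 / rho x) *\<^sub>R XN x"
begin

lemma XN_eq: "XN x = - (rho x / 4) *\<^sub>R HH x"
proof (cases "f x = 0")
  case True
  then show ?thesis by (simp add: rho_def nor_proj_simps)
next
  case False
  then show ?thesis using mean_curvature[OF False] rho_eq_0_iff[of x] by simp
qed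

lemma rho_HH_inner_f: "rho x * (f x \<bullet> HH x) = - 4 * (XN x \<bullet> XN x)"
proof -
  have "rho x *\<^sub>R HH x = - 4 *\<^sub>R XN x" by (simp add: XN_eq)
  then have "(rho x *\<^sub>R HH x) \<bullet> f x = (- 4 *\<^sub>R XN x) \<bullet> f x" by simp
  moreover have "XN x \<bullet> f x = XN x \<bullet> XN x"
    using nor_proj_inner_tan_proj[of x "f x" "f x"] tan_proj_plus_nor_proj[of "f x" x]
    by (metis add_0 inner_add_right)
  ultimately show ?thesis by (simp add: inner_commute)
qed

lemma inverted_minimal:
  "(rho x)\<^sup>2 *\<^sub>R HH x - (2 * rho x * (2 + f x \<bullet> HH x)) *\<^sub>R f x - (4 * rho x) *\<^sub>R XT x + (8 * (XT x \<bullet> XT x)) *\<^sub>R f x = 0"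
proof -
  have "2 * rho x * (2 + f x \<bullet> HH x) = 4 * rho x + 2 * (rho x * (f x \<bullet> HH x))" by (simp add: algebra_simps)
  also have "\<dots> = 8 * (XT x \<bullet> XT x) - 4 * rho x" unfolding rho_HH_inner_f using rho_split[of x] by simp
  finally have "(2 * rho x * (2 + f x \<bullet> HH x)) *\<^sub>R f x = (8 * (XT x \<bullet> XT x)) *\<^sub>R f x - (4 * rho x) *\<^sub>R f x"
    by (simp add: scaleR_diff_left)
  moreover have "(rho x)\<^sup>2 *\<^sub>R HH x = - (4 * rho x) *\<^sub>R XN x" by (simp add: XN_eq power2_eq_square)
  moreover have "(4 * rho x) *\<^sub>R f x = (4 * rho x) *\<^sub>R XT x + (4 * rho x) *\<^sub>R XN x"
    by (subst tan_proj_plus_nor_proj[of "f x" x]) (rule scaleR_add_right)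
  ultimately show ?thesis by simp
qed

lemma Omega_closed:
  assumes x: "f x \<noteq> 0"
  shows "pd Omega e2 x = pd (\<lambda>x. mu x *s Omega x) e1 x"
proof -
  define M where "M = (\<lambda>x. mu x *s null_tan x)"
  define c where "c = \<i> * complex_of_real (dA x)"
  let ?N = "null_tan x" and ?F = "cvec (f x)" and ?a1 = "f x \<bullet> f1 x" and ?a2 = "f x \<bullet> f2 x"
  let ?b1 = "f x \<bullet> V1 x" and ?b2 = "f x \<bullet> V2 x" and ?h = "f x \<bullet> HH x"
  have smooth: "smooth_map M" unfolding M_def by (intro smooth_intros)
  have M: "M x = cvec (f2 x) + \<i> *s cvec (V1 x)" by (simp add: M_def mu_null_tan)
  have pd_M: "pd M e1 x = pd null_tan e2 x + c *s cvec (HH x)"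
    using div_null_tan[of x] unfolding M_def c_def by (simp add: algebra_simps)
  have tangent: "of_real ?a1 *s cvec (V1 x) + of_real ?a2 *s cvec (V2 x) = of_real (dA x) *s cvec (XT x)"
    "of_real ?b1 *s cvec (f1 x) + of_real ?b2 *s cvec (f2 x) = of_real (dA x) *s cvec (XT x)"
    using dA_XT[of x] by (simp_all flip: cvec_simps)
  have position: "cdot ?F ?N *s cvec (f2 x) - cdot ?F (M x) *s cvec (f1 x)
      = of_real ?a1 *s cvec (f2 x) - of_real ?a2 *s cvec (f1 x) - c *s cvec (XT x)"
    unfolding M null_tan_def c_def vector_smult_assoc[symmetric] tangent(2)[symmetric]
    by (simp add: cdot_simps vec_eq_iff algebra_simps)
  have tangent_diff: "of_real ?a2 *s ?N - of_real ?a1 *s M x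
      = of_real ?a2 *s cvec (f1 x) - of_real ?a1 *s cvec (f2 x) - c *s cvec (XT x)"
    unfolding M null_tan_def c_def vector_smult_assoc[symmetric] tangent(1)[symmetric]
    by (simp add: cdot_simps vec_eq_iff algebra_simps)
  have norm_XT: "of_real ?a2 * cdot ?F ?N - of_real ?a1 * cdot ?F (M x) = - c * of_real (XT x \<bullet> XT x)"
    using arg_cong[OF dA_XT_inner[of x], of complex_of_real] unfolding M null_tan_def c_def
    by (simp add: cdot_simps algebra_simps)
  have mixed: "cdot (cvec (f2 x)) ?N - cdot (cvec (f1 x)) (M x) = - 2 * c"
    unfolding M null_tan_def c_def by (simp add: cdot_simps fff_inner V_inner)
  have "rho x *\<^sub>R pd (\<lambda>x. inversion_diff x (M x)) e1 x - (2 * pd rho e1 x) *\<^sub>R inversion_diff x (M x)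
      - (rho x *\<^sub>R pd (\<lambda>x. inversion_diff x (null_tan x)) e2 x - (2 * pd rho e2 x) *\<^sub>R inversion_diff x ?N)
    = c *s cvec ((rho x)\<^sup>2 *\<^sub>R HH x - (2 * rho x * (2 + ?h)) *\<^sub>R f x - (4 * rho x) *\<^sub>R XT x + (8 * (XT x \<bullet> XT x)) *\<^sub>R f x)"
  proof (intro vec_eq_iff[THEN iffD2] allI, goal_cases)
    case (1 i)
    have position_i: "cdot ?F ?N * (cvec (f2 x) $ i) - cdot ?F (M x) * (cvec (f1 x) $ i)
      = of_real ?a1 * (cvec (f2 x) $ i) - of_real ?a2 * (cvec (f1 x) $ i) - c * (cvec (XT x) $ i)"
      and tangent_diff_i: "of_real ?a2 * (?N $ i) - of_real ?a1 * (M x $ i)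
      = of_real ?a2 * (cvec (f1 x) $ i) - of_real ?a1 * (cvec (f2 x) $ i) - c * (cvec (XT x) $ i)"
      using position tangent_diff by (simp_all add: vec_eq_iff)
    show ?case
      unfolding pd_inversion_diff[OF smooth] pd_inversion_diff[OF smooth_null_tan]
      unfolding pd_M pd_rho inversion_diff_def cvec_simps scaleR_eq_smult
      using position_i tangent_diff_i norm_XT mixed
      by (simp add: cdot_simps power2_eq_square) algebra
  qed
  also have "\<dots> = 0" unfolding inverted_minimal by (simp add: cvec_simps)
  finally show ?thesis
    unfolding mu_Omega unfolding Omega_def[abs_def]
      pd_eqI[OF has_derivative_over_rho_square[OF smooth_inversion_diff[OF smooth_null_tan] x]]
      pd_eqI[OF has_derivative_over_rho_square[OF smooth_inversion_diff[OF smooth[unfolded M_def]] x]]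
    by (simp add: M_def)
qed

text \<open>Every term on the right vanishes to fourth order at a zero of \<open>f\<close>, except possibly the bracket: this is where
  umbilicity enters.\<close>
lemma cdot_inversion_diff_null_tan:
  defines "a x \<equiv> cdot (cvec (f x)) (null_tan x)"
  shows "cdot w (inversion_diff x (null_tan x))
    = of_real ((rho x)\<^sup>2 * (norm (HH x))\<^sup>2 / 16) * cdot w (null_tan x)
      + a x * (of_real (rho x) * cdot w (cvec (HH x)) / 2 - a x * cdot w (ccnj (null_tan x)) / of_real (EE x))"
    (is "_ = _ + ?q")
proof -
  define b where "b = cdot (cvec (f x)) (ccnj (null_tan x))"
  let ?f = "(1 / of_real (2 * EE x)) * (b * cdot w (null_tan x) + a x * cdot w (ccnj (null_tan x)))
      - of_real (rho x / 4) * cdot w (cvec (HH x))"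
  have f: "cvec (f x) = (1 / of_real (2 * EE x)) *s (b *s null_tan x + a x *s ccnj (null_tan x))
      - of_real (rho x / 4) *s cvec (HH x)"
    using cvec_eq_null_tan[of "f x" x] unfolding XN_eq by (simp add: cvec_simps a_def b_def)
  have "of_real (rho x) = cdot (cvec (f x)) (cvec (f x))" by (simp add: cdot_cvec rho_def)
  also have "\<dots> = (1 / of_real (2 * EE x)) * (2 * a x * b) - of_real (rho x / 4) * of_real (f x \<bullet> HH x)"
    by (subst (2) f) (simp add: cdot_simps a_def b_def del: of_real_mult)
  also have "f x \<bullet> HH x = - (rho x / 4) * (norm (HH x))\<^sup>2"
    using HH_inner_f[of x] unfolding XN_eq by (simp add: inner_commute power2_norm_eq_inner)
  finally have ab: "a x * b / of_real (EE x) = of_real (rho x) - of_real ((rho x)\<^sup>2 * (norm (HH x))\<^sup>2 / 16)"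
    by (simp add: field_simps power2_eq_square)
  have "cdot w (inversion_diff x (null_tan x))
      = of_real (rho x) * cdot w (null_tan x) - 2 * a x * cdot w (cvec (f x))"
    unfolding inversion_diff_def scaleR_eq_smult a_def by (simp add: cdot_simps)
  also have "cdot w (cvec (f x)) = ?f"
    by (subst f) (simp add: cdot_simps add_divide_distrib)
  also have "of_real (rho x) * cdot w (null_tan x) - 2 * a x * (?f)
      = (of_real (rho x) - a x * b / of_real (EE x)) * cdot w (null_tan x) + ?q"
    by (simp add: field_simps)
  finally show ?thesis unfolding ab by simp
qed

section \<open>Umbilicity at the zeros and the order of the Weierstrass form\<close>

text \<open>For a fixed vector \<open>u\<close> with normal part \<open>n x\<close> the identities \<open>n \<bullet> f + (rho/4) (u \<bullet> HH) = 0\<close> and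
  \<open>n \<bullet> df = 0\<close> hold everywhere; they are differentiated at a zero of \<open>f\<close>.\<close>
lemma umbilic:
  assumes p: "f p = 0"
  shows "nor_proj f p (pd (pd f v) w p) = ((pd f v p \<bullet> pd f w p) / 2) *\<^sub>R HH p"
proof (rule vector_eq_ldot[THEN iffD1], intro allI)
  fix u
  define n where "n = (\<lambda>x. nor_proj f x u)"
  let ?D = "\<lambda>x. 4 * (pd n v x \<bullet> f x) + 2 * ((f x \<bullet> pd f v x) * (u \<bullet> HH x)) + rho x * (u \<bullet> pd HH v x)"
  have smooth: "smooth_map n" "smooth_map f" "smooth_map rho" "smooth_map HH" "smooth_map (\<lambda>x. u \<bullet> HH x)"
    unfolding n_def by (intro smooth_intros)+
  note smooth_prods = smooth_map_add smooth_map_mult smooth_map_inner smooth_map_const smooth_map_pd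
  have n_inner: "n x \<bullet> y = u \<bullet> nor_proj f x y" for x y by (simp add: n_def nor_proj_selfadjoint)
  have n_df: "(\<lambda>x. n x \<bullet> pd f v x) = (\<lambda>x. 0)" for v
    by (simp add: n_inner nor_proj_pd)
  have n_f: "(\<lambda>x. 4 * (n x \<bullet> f x) + rho x * (u \<bullet> HH x)) = (\<lambda>x. 0)"
    by (simp add: n_inner XN_eq)
  have "pd (\<lambda>x. 4 * (n x \<bullet> f x) + rho x * (u \<bullet> HH x)) v x
      = ?D x" for x
    using fun_cong[OF n_df[of v], of x]
    by (simp add: pd_add pd_mult pd_inner pd_const pd_rho smooth smooth_prods)
  then have "?D = (\<lambda>x. 0)"
    unfolding n_f pd_const by metis
  then have "pd ?D w p = 0"
    by (simp add: pd_const)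
  then have "4 * (pd n v p \<bullet> pd f w p) + 2 * ((pd f w p \<bullet> pd f v p) * (u \<bullet> HH p)) = 0"
    by (simp add: pd_add pd_mult pd_inner pd_const pd_rho smooth smooth_prods p rho_def[of p])
  moreover have "n p \<bullet> pd (pd f w) v p + pd n v p \<bullet> pd f w p = 0"
    using pd_inner[OF smooth(1) smooth_map_pd[OF smooth(2)], of w v p] unfolding n_df pd_const by simp
  ultimately show "u \<bullet> nor_proj f p (pd (pd f v) w p) = u \<bullet> ((pd f v p \<bullet> pd f w p) / 2) *\<^sub>R HH p"
    by (simp add: n_inner pd_pd_commute[OF smooth_f, of v w] inner_commute)
qed

lemma umbilic_conormal:
  assumes p: "f p = 0"
  shows "nor_proj f p (pd V2 v p) = ((V2 p \<bullet> pd f v p) / 2) *\<^sub>R HH p"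
  unfolding nor_proj_pd_V umbilic[OF p] V2_def[of p]
  by (simp add: inner_diff_left diff_divide_distrib scaleR_diff_left)

lemma cdot_pd_null_tan:
  assumes p: "f p = 0" and w: "cdot w (ccnj (null_tan p)) = 0"
  shows "cdot w (ccnj (pd null_tan v p)) = of_real (EE p / 2) * cdot w (cvec (HH p)) * dz p v"
proof -
  let ?y = "pd null_tan v p" and ?N = "null_tan p"
  define k where "k = (1 / of_real (2 * EE p) :: complex)"
  have "pd (\<lambda>x. cdot (null_tan x) (null_tan x)) v p = 0" by (simp add: null_tan_null pd_const)
  then have null: "cdot ?y ?N = 0"
    unfolding pd_cdot[OF smooth_null_tan smooth_null_tan] by (simp add: cdot_commute[of ?N])
  have y: "?y = cvec (pd f1 v p) - \<i> *s cvec (pd V2 v p)"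
    unfolding null_tan_def[abs_def]
    by (simp add: pd_diff pd_smult pd_cvec pd_const smooth_f smooth_V smooth_map_pd smooth_map_cvec
        smooth_map_smult smooth_map_const)
  have normal: "cvec (nor_proj f p (pd f1 v p)) - \<i> *s cvec (nor_proj f p (pd V2 v p))
      = (cdot (cvec (pd f v p)) ?N / 2) *s cvec (HH p)"
    unfolding umbilic[OF p] umbilic_conormal[OF p] null_tan_def
    by (simp add: cvec_simps cdot_simps inner_commute vec_eq_iff diff_divide_distrib algebra_simps)
  have "?y = k *s (cdot ?y (ccnj ?N) *s ?N + cdot ?y ?N *s ccnj ?N)
      + (cvec (nor_proj f p (pd f1 v p)) - \<i> *s cvec (nor_proj f p (pd V2 v p)))"
    unfolding y k_def
    by (subst cvec_eq_null_tan[of "pd f1 v p" p], subst cvec_eq_null_tan[of "pd V2 v p" p])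
      (simp add: cdot_simps vec_eq_iff algebra_simps)
  then have "?y = (k * cdot ?y (ccnj ?N)) *s ?N + (of_real (EE p / 2) * cnj (dz p v)) *s cvec (HH p)"
    unfolding normal null cdot_pd_f_null_tan by (simp add: vec_eq_iff algebra_simps)
  then have "ccnj ?y = cnj (k * cdot ?y (ccnj ?N)) *s ccnj ?N + (of_real (EE p / 2) * dz p v) *s cvec (HH p)"
    by (metis (no_types, lifting) ccnj_simps(1,3,4) complex_cnj_cnj complex_cnj_complex_of_real complex_cnj_mult)
  then show ?thesis by (simp add: cdot_simps w)
qed

end

context immersed_torus
begin

lemma vanishes_at_most_f:
  assumes "f p = 0" shows "vanishes_at_most 1 (\<lambda>v. f (p + v))"
proof (rule vanishes_at_most_if_vanishes_diff)
  show "vanishes (Suc 1) (\<lambda>v. f (p + v) - pd f v p)" using vanishes_2_if_zero[OF smooth_f assms] by (simp add: numeral_2_eq_2)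
  obtain c where c: "c > 0" "\<And>v. c * norm v \<le> norm (dz p v)" using dz_lower_bound by blast
  have "norm (pd f v p) = sqrt (EE p) * norm (dz p v)" for v
    using arg_cong[OF norm_pd_f_dz[of v p], of sqrt] by (simp add: real_sqrt_mult)
  then show "vanishes_at_most 1 (\<lambda>v. pd f v p)"
    unfolding vanishes_at_most_def using c EE_pos[of p] by (intro exI[of _ "sqrt (EE p) * c"]) (simp add: mult.assoc)
qed

lemma vanishes_at_most_rho_square:
  assumes "f p = 0" shows "vanishes_at_most 4 (\<lambda>v. complex_of_real ((rho (p + v))\<^sup>2))"
proof -
  have "vanishes_at_most 1 (\<lambda>v. complex_of_real (norm (f (p + v))))"
    using vanishes_at_most_f[OF assms] by (simp add: vanishes_at_most_def)
  from vanishes_at_most_mult[OF this this]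
  have "vanishes_at_most 2 (\<lambda>v. complex_of_real (rho (p + v)))" by (simp add: rho_eq_norm power2_eq_square numeral_2_eq_2)
  from vanishes_at_most_mult[OF this this] show ?thesis by (simp add: power2_eq_square)
qed

lemma isolated_zero: "f p = 0 \<Longrightarrow> \<forall>\<^sub>F x in at p. f x \<noteq> 0"
  using eventually_nonzero_if_vanishes_at_most vanishes_at_most_f by blast

end

context willmore_torus
begin

lemma cdot_Omega_bracket_vanishes:
  assumes p: "f p = 0" and w: "cdot w (ccnj (null_tan p)) = 0"
  shows "vanishes 3 (\<lambda>v. of_real (rho (p + v)) * (of_real (EE (p + v)) * cdot w (cvec (HH (p + v))) / 2)
      - cdot (cvec (f (p + v))) (null_tan (p + v)) * cdot w (ccnj (null_tan (p + v))))"
proof -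
  define h where "h = (\<lambda>x. of_real (EE x / 2) * cdot w (cvec (HH x)))"
  define a where "a = (\<lambda>x. cdot (cvec (f x)) (null_tan x))"
  define b where "b = (\<lambda>x. cdot w (ccnj (null_tan x)))"
  have smooth: "smooth_map h" "smooth_map a" "smooth_map b"
    unfolding h_def a_def b_def by (intro smooth_intros; simp)+
  have zero: "a p = 0" "b p = 0" using p w by (simp_all add: a_def b_def cvec_simps cdot.zero_left)
  have pd_a: "pd a v p = of_real (EE p) * cnj (dz p v)" for v
    unfolding a_def pd_cdot[OF smooth_map_cvec[OF smooth_f] smooth_null_tan] pd_cvec[OF smooth_f]
    by (simp add: p cvec_simps cdot.zero_left cdot_pd_f_null_tan)
  have pd_b: "pd b v p = h p * dz p v" for v
    unfolding b_def pd_cdot[OF smooth_map_const smooth_map_ccnj[OF smooth_null_tan]]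
    by (simp add: pd_const pd_ccnj[OF smooth_null_tan] cdot.zero_left cdot_pd_null_tan[OF p w] h_def)
  have rho: "vanishes 3 (\<lambda>v. complex_of_real (rho (p + v)) - of_real ((norm (pd f v p))\<^sup>2))"
    using vanishes_of_real[OF vanishes_rho[OF p]] by simp
  have "vanishes 2 (\<lambda>v. complex_of_real ((norm (pd f v p))\<^sup>2))"
    using vanishes_of_real[OF vanishes_inner[OF smooth_map_vanishes_pd smooth_map_vanishes_pd, OF smooth_f smooth_f]]
    unfolding power2_norm_eq_inner by (simp add: numeral_2_eq_2)
  then have rho_h: "vanishes 3 (\<lambda>v. of_real (rho (p + v)) * h (p + v) - of_real ((norm (pd f v p))\<^sup>2) * h p)"
    using vanishes_mult_diff[of 2 _ _ 0 "\<lambda>v. h (p + v)" "\<lambda>_. h p"] rho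
      smooth_map_vanishes_increment[OF smooth(1), of p] smooth_map_vanishes_0[OF smooth(1)]
    by (simp add: numeral_3_eq_3 numeral_2_eq_2)
  have a_b: "vanishes 3 (\<lambda>v. a (p + v) * b (p + v) - pd a v p * pd b v p)"
    using vanishes_mult_diff[OF _ smooth_map_vanishes_pd[OF smooth(2)], of "\<lambda>v. a (p + v)" p 1 "\<lambda>v. b (p + v)"]
      vanishes_2_if_zero[OF smooth(2) zero(1)] vanishes_2_if_zero[OF smooth(3) zero(2)]
      vanishes_1_if_zero[OF smooth(3) zero(2)]
    by (simp add: numeral_3_eq_3 numeral_2_eq_2)
  have "of_real ((norm (pd f v p))\<^sup>2) * h p = pd a v p * pd b v p" for v
    unfolding norm_pd_f_dz pd_a pd_b of_real_mult complex_norm_square by (simp add: mult_ac)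
  then have "vanishes 3 (\<lambda>v. of_real (rho (p + v)) * h (p + v) - a (p + v) * b (p + v))"
    using vanishes_diff[OF rho_h a_b] by simp
  then show ?thesis by (simp add: h_def a_def b_def mult_ac)
qed

text \<open>Umbilicity removes the simple pole.\<close>

lemma cdot_Omega_bounded:
  assumes p: "f p = 0" and w: "cdot w (ccnj (null_tan p)) = 0"
  shows "\<exists>C. \<forall>\<^sub>F v in at 0. norm (cdot w (Omega (p + v))) \<le> C"
proof -
  let ?m = "\<lambda>v. of_real ((rho (p + v))\<^sup>2) * (of_real ((norm (HH (p + v)))\<^sup>2 / 16) * cdot w (null_tan (p + v)))"
  define a where "a = (\<lambda>x. cdot (cvec (f x)) (null_tan x))"
  define bracket where "bracket = (\<lambda>x. of_real (rho x) * (of_real (EE x) * cdot w (cvec (HH x)) / 2)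
      - a x * cdot w (ccnj (null_tan x)))"
  have "smooth_map a" unfolding a_def by (intro smooth_intros)
  then have "vanishes 1 (\<lambda>v. a (p + v))"
    by (rule vanishes_1_if_zero) (simp add: a_def p cvec_simps cdot.zero_left)
  moreover have "vanishes 3 (\<lambda>v. bracket (p + v))"
    using cdot_Omega_bracket_vanishes[OF p w] by (simp add: bracket_def a_def)
  moreover have "smooth_map (\<lambda>x. complex_of_real (1 / EE x))" by (intro smooth_intros) simp
  ultimately have "vanishes 4 (\<lambda>v. a (p + v) * bracket (p + v) * of_real (1 / EE (p + v)))"
    using vanishes_mult[OF vanishes_mult smooth_map_vanishes_0, of 1 _ 3] by fastforce
  moreover have "vanishes 4 (\<lambda>v. ?m v)"
  proof -
    have f: "vanishes 1 (\<lambda>v. f (p + v))" by (rule vanishes_1_if_zero[OF smooth_f p])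
    have "vanishes 2 (\<lambda>v. rho (p + v))" using vanishes_inner[OF f f] by (simp add: rho_def numeral_2_eq_2)
    from vanishes_of_real[OF vanishes_mult[OF this this]]
    have "vanishes 4 (\<lambda>v. complex_of_real ((rho (p + v))\<^sup>2))" by (simp add: power2_eq_square)
    moreover have "smooth_map (\<lambda>x. complex_of_real ((norm (HH x))\<^sup>2 / 16) * cdot w (null_tan x))"
      unfolding power2_norm_eq_inner by (intro smooth_intros) simp
    ultimately show ?thesis using vanishes_mult[OF _ smooth_map_vanishes_0] by fastforce
  qed
  ultimately have "vanishes 4 (\<lambda>v. ?m v + a (p + v) * bracket (p + v) * of_real (1 / EE (p + v)))"
    by (intro vanishes_add)
  also have "(\<lambda>v. ?m v
      + a (p + v) * bracket (p + v) * of_real (1 / EE (p + v)))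
      = (\<lambda>v. cdot w (inversion_diff (p + v) (null_tan (p + v))))"
    unfolding cdot_inversion_diff_null_tan bracket_def a_def by (simp add: fun_eq_iff field_simps)
  finally have "vanishes (4 + 0) (\<lambda>v. cdot w (inversion_diff (p + v) (null_tan (p + v))))" by simp
  then show ?thesis
    unfolding cdot_Omega using vanishes_quotient vanishes_at_most_rho_square[OF p] by fastforce
qed

end

section \<open>Primitives of closed forms with bounded coefficients\<close>

lemma integrable_on_bounded_continuous_off_finite:
  fixes g :: "real \<Rightarrow> complex"
  assumes K: "finite K" and cont: "continuous_on ({a..b} - K) g"
    and bound: "\<And>t. t \<in> {a..b} \<Longrightarrow> norm (g t) \<le> B"
  shows "g integrable_on {a..b}"
proof -
  have meas: "{a..b} - K \<in> sets lebesgue"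
    using K by (intro sets.Diff) (auto intro: negligible_imp_sets simp: negligible_finite)
  have negligible: "negligible ({a..b} \<inter> K)" by (rule negligible_finite) (simp add: K)
  have "(\<lambda>t. B) integrable_on ({a..b} - K)"
    by (rule integrable_spike_set[of _ "{a..b}"]) (auto intro: negligible_subset[OF negligible])
  then have "g integrable_on ({a..b} - K)"
    using bound by (intro measurable_bounded_by_integrable_imp_integrable[OF
          continuous_imp_measurable_on_sets_lebesgue[OF cont meas] _ _ meas]) auto
  then show ?thesis by (rule integrable_spike_set) (auto intro: negligible_subset[OF negligible])
qed

lemma has_derivative_from_partials:
  fixes F :: "plane \<Rightarrow> 'b::real_normed_vector"
  assumes W: "open W" "z \<in> W" and "isCont q z"
    and p: "\<And>x y. (x,y) \<in> W \<Longrightarrow> ((\<lambda>t. F (t,y)) has_vector_derivative p (x,y)) (at x)"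
    and q: "\<And>x y. (x,y) \<in> W \<Longrightarrow> ((\<lambda>t. F (x,t)) has_vector_derivative q (x,y)) (at y)"
  shows "(F has_derivative (\<lambda>v. fst v *\<^sub>R p z + snd v *\<^sub>R q z)) (at z)"
proof -
  obtain x y where z: "z = (x,y)" by fastforce
  obtain A C where AC: "open A" "open C" "x \<in> A" "y \<in> C" "A \<times> C \<subseteq> W"
    using W unfolding z by (metis open_prod_elim mem_Sigma_iff)
  obtain e where e: "e > 0" "ball y e \<subseteq> C" using AC open_contains_ball by blast
  have sub: "A \<times> ball y e \<subseteq> W" using e AC(5) by blast
  have "((\<lambda>(u,v). F (u,v)) has_derivative (\<lambda>(h,k). h *\<^sub>R p (x,y) + blinfun_apply (blinfun_scaleR_left (q (x,y))) k))
      (at (x,y) within A \<times> ball y e)"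
  proof (rule has_derivative_partialsI)
    show "((\<lambda>u. F (u,y)) has_derivative (\<lambda>h. h *\<^sub>R p (x,y))) (at x within A)"
      using p[of x y] W(2) unfolding z has_vector_derivative_def by (auto intro: has_derivative_at_withinI)
    show "((\<lambda>v. F (u,v)) has_derivative blinfun_apply (blinfun_scaleR_left (q (u,v)))) (at v within ball y e)"
      if "u \<in> A" "v \<in> ball y e" for u v
      using q[of u v] sub that unfolding has_vector_derivative_def
      by (auto intro: has_derivative_at_withinI simp del: mem_ball)
    have "isCont (\<lambda>z. blinfun_scaleR_left (q z)) (x,y)" using assms(3) unfolding z by (intro continuous_intros)
    then show "continuous (at (x,y) within A \<times> ball y e) (\<lambda>(u,v). blinfun_scaleR_left (q (u,v)))"
      by (simp add: case_prod_unfold continuous_at_imp_continuous_at_within)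
  qed (use e in auto)
  moreover have "at (x,y) within A \<times> ball y e = at (x,y)"
    using e AC by (intro at_within_open open_Times) auto
  ultimately show ?thesis unfolding z by (simp add: case_prod_unfold)
qed

text \<open>The form \<open>p dx + q dy\<close>; \<open>P\<close> contains the points where the coefficients may be discontinuous.\<close>
locale closed_form =
  fixes a b c d B :: real and P :: "plane set" and p q :: "plane \<Rightarrow> complex"
  assumes finite_P: "finite P"
    and bounded: "z \<in> {a..b} \<times> {c..d} \<Longrightarrow> norm (p z) \<le> B" "z \<in> {a..b} \<times> {c..d} \<Longrightarrow> norm (q z) \<le> B"
    and differentiable: "z \<in> {a..b} \<times> {c..d} - P \<Longrightarrow> p differentiable (at z)"
      "z \<in> {a..b} \<times> {c..d} - P \<Longrightarrow> q differentiable (at z)"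
    and continuous_pd: "continuous_on ({a..b} \<times> {c..d} - P) (pd q e1)"
    and closed: "z \<in> {a..b} \<times> {c..d} - P \<Longrightarrow> pd q e1 z = pd p e2 z"
begin

lemma isCont_slices:
  assumes "(x,y) \<in> {a..b} \<times> {c..d} - P"
  shows "isCont (\<lambda>t. p (t,y)) x" "isCont (\<lambda>t. q (x,t)) y" "isCont q (x,y)"
proof -
  have cont: "isCont p (x,y)" "isCont q (x,y)"
    using differentiable[OF assms] differentiable_imp_continuous_within by blast+
  show "isCont (\<lambda>t. p (t,y)) x" by (rule isCont_o2[where g = p]) (auto intro!: continuous_intros cont)
  show "isCont (\<lambda>t. q (x,t)) y" by (rule isCont_o2[where g = q]) (auto intro!: continuous_intros cont)
  show "isCont q (x,y)" by (rule cont)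
qed

lemma finite_slices: "finite {t. (x,t) \<in> P}" "finite {t. (t,y) \<in> P}"
  using finite_vimageI[OF finite_P, of "\<lambda>t. (x,t)"] finite_vimageI[OF finite_P, of "\<lambda>t. (t,y)"]
  by (simp_all add: vimage_def inj_on_def)

lemma integrable_p:
  assumes "y \<in> {c..d}" "x \<le> b" shows "(\<lambda>t. p (t,y)) integrable_on {a..x}"
  by (rule integrable_on_bounded_continuous_off_finite[OF finite_slices(2)[of y]])
    (use assms in \<open>auto intro!: continuous_at_imp_continuous_on isCont_slices(1) bounded(1)\<close>)

lemma integrable_q:
  assumes "x \<in> {a..b}" "y \<le> d" shows "(\<lambda>t. q (x,t)) integrable_on {c..y}"
  by (rule integrable_on_bounded_continuous_off_finite[OF finite_slices(1)[of x]])
    (use assms in \<open>auto intro!: continuous_at_imp_continuous_on isCont_slices(2) bounded(2)\<close>)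

definition "vertical y u = integral {c..y} (\<lambda>t. q (u,t))"

lemma continuous_on_vertical:
  assumes y: "y \<in> {c..d}" shows "continuous_on {a..b} (vertical y)"
  unfolding continuous_on_sequentially
proof (intro allI impI ballI, elim conjE)
  fix X u assume X: "\<forall>n. X n \<in> {a..b}" "X \<longlonglongrightarrow> u" and u: "u \<in> {a..b}"
  let ?N = "{t. (u,t) \<in> P}"
  have negligible: "negligible ?N" by (intro negligible_finite finite_slices)
  have spike: "g integrable_on ({c..y} - ?N)" "integral ({c..y} - ?N) g = integral {c..y} g"
    if "g integrable_on {c..y}" for g :: "real \<Rightarrow> complex"
    using that by (auto intro!: integrable_spike_set[OF that] integral_spike_set negligible_subset[OF negligible])
  have integrable: "(\<lambda>t. q (v,t)) integrable_on {c..y}" if "v \<in> {a..b}" for v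
    using that y by (intro integrable_q) auto
  have "(\<lambda>n. integral ({c..y} - ?N) (\<lambda>t. q (X n,t))) \<longlonglongrightarrow> integral ({c..y} - ?N) (\<lambda>t. q (u,t))"
  proof (rule dominated_convergence(2)[where h = "\<lambda>_. B"])
    show "(\<lambda>t. q (X n,t)) integrable_on ({c..y} - ?N)" for n using X by (intro spike integrable) auto
    show "(\<lambda>_. B) integrable_on ({c..y} - ?N)"
      by (rule integrable_spike_set[of _ "{c..y}"]) (auto intro: negligible_subset[OF negligible])
    show "norm (q (X n,t)) \<le> B" if "t \<in> {c..y} - ?N" for n t using that X y by (intro bounded) auto
    fix t assume t: "t \<in> {c..y} - ?N"
    then have "isCont q (u,t)" using u y by (intro isCont_slices) auto
    moreover have "(\<lambda>n. (X n,t)) \<longlonglongrightarrow> (u,t)" using X by (intro tendsto_Pair tendsto_const)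
    ultimately show "(\<lambda>n. q (X n,t)) \<longlonglongrightarrow> q (u,t)" by (rule isCont_tendsto_compose)
  qed
  moreover have "integral ({c..y} - ?N) (\<lambda>t. q (X n,t)) = vertical y (X n)" for n
    unfolding vertical_def using X by (intro spike integrable) auto
  moreover have "integral ({c..y} - ?N) (\<lambda>t. q (u,t)) = vertical y u"
    unfolding vertical_def using u by (intro spike integrable)
  ultimately show "(vertical y \<circ> X) \<longlonglongrightarrow> vertical y u" by (simp only: o_def)
qed

lemma vertical_has_vector_derivative:
  assumes y: "y \<in> {c..d}" and u: "u \<in> {a<..<b}" "u \<notin> fst ` P"
  shows "(vertical y has_vector_derivative p (u,y) - p (u,c)) (at u)"
proof -
  have "open ({a<..<b} - fst ` P)" using finite_P by (intro open_Diff finite_imp_closed) auto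
  then obtain e where e: "e > 0" "\<And>v. dist v u < e \<Longrightarrow> v \<in> {a<..<b} - fst ` P"
    using u by (metis DiffI open_dist)
  let ?U = "{u - e / 2..u + e / 2}"
  have off: "(v,t) \<in> {a..b} \<times> {c..d} - P" if "v \<in> ?U" "t \<in> {c..y}" for v t
  proof -
    have "dist v u < e" using that(1) e(1) by (auto simp: dist_real_def)
    then show ?thesis using e(2)[of v] that(2) y by (force simp: image_iff)
  qed
  have "((\<lambda>v. integral (cbox c y) (\<lambda>t. q (v,t))) has_vector_derivative integral (cbox c y) (\<lambda>t. pd q e1 (u,t)))
      (at u within ?U)"
  proof (rule leibniz_rule_vector_derivative)
    show "((\<lambda>v. q (v,t)) has_vector_derivative pd q e1 (v,t)) (at v within ?U)" if "v \<in> ?U" "t \<in> cbox c y" for v t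
      using off that by (intro has_vector_derivative_partials differentiable) auto
    show "(\<lambda>t. q (v,t)) integrable_on cbox c y" if "v \<in> ?U" for v
      using off[OF that, of c] y integrable_q[of v y] by auto
    show "continuous_on (?U \<times> cbox c y) (\<lambda>(v,t). pd q e1 (v,t))"
    proof -
      have "?U \<times> cbox c y \<subseteq> {a..b} \<times> {c..d} - P" using off unfolding cbox_interval by blast
      then show ?thesis using continuous_on_subset[OF continuous_pd] by (simp add: case_prod_unfold)
    qed
  qed (use e in auto)
  then have "(vertical y has_vector_derivative integral {c..y} (\<lambda>t. pd q e1 (u,t))) (at u)"
    using e(1) by (simp add: at_within_Icc_at vertical_def[abs_def])
  also have "integral {c..y} (\<lambda>t. pd q e1 (u,t)) = integral {c..y} (\<lambda>t. pd p e2 (u,t))"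
    using off[of u] e(1) closed by (intro Henstock_Kurzweil_Integration.integral_cong) auto
  also have "\<dots> = p (u,y) - p (u,c)"
    using y off[of u] e(1)
    by (intro integral_unique fundamental_theorem_of_calculus has_vector_derivative_partials differentiable) auto
  finally show ?thesis .
qed

lemma rectangle:
  assumes x: "x \<in> {a..b}" and y: "y \<in> {c..d}"
  shows "integral {a..x} (\<lambda>t. p (t,c)) + vertical y x = vertical y a + integral {a..x} (\<lambda>t. p (t,y))"
proof -
  have "((\<lambda>u. p (u,y) - p (u,c)) has_integral (vertical y x - vertical y a)) {a..x}"
  proof (rule fundamental_theorem_of_calculus_interior_strong)
    show "finite (fst ` P)" using finite_P by simp
    show "continuous_on {a..x} (vertical y)" using continuous_on_subset[OF continuous_on_vertical[OF y]] x by auto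
    show "(vertical y has_vector_derivative p (u,y) - p (u,c)) (at u)" if "u \<in> {a<..<x} - fst ` P" for u
      using that x by (intro vertical_has_vector_derivative[OF y]) auto
  qed (use x in auto)
  moreover have "((\<lambda>u. p (u,y) - p (u,c)) has_integral
      (integral {a..x} (\<lambda>u. p (u,y)) - integral {a..x} (\<lambda>u. p (u,c)))) {a..x}"
    using x y by (intro has_integral_diff integrable_integral integrable_p) auto
  ultimately have "vertical y x - vertical y a = integral {a..x} (\<lambda>u. p (u,y)) - integral {a..x} (\<lambda>u. p (u,c))"
    by (rule has_integral_unique)
  then show ?thesis by (simp add: algebra_simps)
qed

lemma indefinite_integral_has_vector_derivative:
  fixes g :: "real \<Rightarrow> complex"
  assumes "g integrable_on {l..r}" "x \<in> {l<..<r}" "isCont g x"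
  shows "((\<lambda>u. k + integral {l..u} g) has_vector_derivative g x) (at x)"
proof -
  have "((\<lambda>u. integral {l..u} g) has_vector_derivative g x) (at x within {l..r} - {})"
    by (rule integral_has_vector_derivative_continuous_at)
      (use assms in \<open>auto intro: continuous_at_imp_continuous_at_within\<close>)
  then show ?thesis using assms(2) by (auto simp: at_within_Icc_at intro!: derivative_eq_intros)
qed

lemma indefinite_integral_Lipschitz:
  fixes g :: "real \<Rightarrow> complex"
  assumes g: "g integrable_on {l..r}" "\<And>t. t \<in> {l..r} \<Longrightarrow> norm (g t) \<le> C" and uv: "u \<in> {l..r}" "v \<in> {l..r}"
  shows "norm (integral {l..u} g - integral {l..v} g) \<le> C * \<bar>u - v\<bar>"
  using uv
proof (induction u v rule: linorder_wlog)
  case (le u v)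
  have sub: "g integrable_on {l..v}" "g integrable_on {u..v}"
    using le by (auto intro: integrable_on_subinterval[OF g(1)])
  have "integral {l..u} g - integral {l..v} g = - integral {u..v} g"
    using Henstock_Kurzweil_Integration.integral_combine[OF _ _ sub(1), of u] le by (simp add: algebra_simps)
  moreover have "norm (integral {u..v} g) \<le> integral {u..v} (\<lambda>t. C)"
    using le by (intro integral_norm_bound_integral sub integrable_const_ivl g(2)) auto
  ultimately show ?case using le by (simp add: mult.commute)
next
  case (sym u v)
  then show ?case by (simp add: norm_minus_commute abs_minus_commute)
qed

definition "potential z = integral {a..fst z} (\<lambda>t. p (t,c)) + vertical (snd z) (fst z)"

lemma potential_eq:
  "x \<in> {a..b} \<Longrightarrow> y \<in> {c..d} \<Longrightarrow> potential (x,y) = vertical y a + integral {a..x} (\<lambda>t. p (t,y))"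
  using rectangle by (simp add: potential_def)

lemma has_derivative_potential:
  assumes z: "z \<in> {a<..<b} \<times> {c<..<d} - P"
  shows "(potential has_derivative (\<lambda>v. fst v *\<^sub>R p z + snd v *\<^sub>R q z)) (at z)"
proof (rule has_derivative_from_partials)
  show "open ({a<..<b} \<times> {c<..<d} - P)"
    using finite_P by (intro open_Diff finite_imp_closed open_Times) auto
  fix x y assume xy: "(x,y) \<in> {a<..<b} \<times> {c<..<d} - P"
  show "((\<lambda>t. potential (x,t)) has_vector_derivative q (x,y)) (at y)"
    unfolding potential_def fst_conv snd_conv vertical_def using xy
    by (intro indefinite_integral_has_vector_derivative[where r = d] integrable_q isCont_slices(2)) auto
  have "((\<lambda>u. vertical y a + integral {a..u} (\<lambda>t. p (t,y))) has_vector_derivative p (x,y)) (at x)"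
    using xy by (intro indefinite_integral_has_vector_derivative[where r = b] integrable_p isCont_slices(1)) auto
  then show "((\<lambda>t. potential (t,y)) has_vector_derivative p (x,y)) (at x)"
    by (rule has_vector_derivative_transform_within_open[of _ _ _ "{a<..<b}"]) (use xy potential_eq in auto)
qed (use z isCont_slices(3)[of "fst z" "snd z"] in auto)

lemma potential_Lipschitz:
  assumes "z \<in> {a..b} \<times> {c..d}" "z' \<in> {a..b} \<times> {c..d}"
  shows "norm (potential z - potential z') \<le> B * \<bar>fst z - fst z'\<bar> + B * \<bar>snd z - snd z'\<bar>"
proof -
  obtain x y x' y' where z: "z = (x,y)" "z' = (x',y')" by fastforce
  have "norm (potential (x,y) - potential (x,y')) \<le> B * \<bar>y - y'\<bar>"
    unfolding potential_def fst_conv snd_conv vertical_def using assms z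
    by (simp, intro indefinite_integral_Lipschitz[where r = d] integrable_q bounded(2)) auto
  moreover have "norm (potential (x,y') - potential (x',y')) \<le> B * \<bar>x - x'\<bar>"
    using assms z by (simp add: potential_eq, intro indefinite_integral_Lipschitz[where r = b] integrable_p bounded(1)) auto
  ultimately show ?thesis
    unfolding z using norm_triangle_ineq[of "potential (x,y) - potential (x,y')" "potential (x,y') - potential (x',y')"] by simp
qed

lemma continuous_on_potential: "continuous_on ({a<..<b} \<times> {c<..<d}) potential"
  unfolding continuous_on
proof
  fix z assume z: "z \<in> {a<..<b} \<times> {c<..<d}"
  let ?at = "at z within {a<..<b} \<times> {c<..<d}"
  show "(potential \<longlongrightarrow> potential z) ?at"
  proof (rule Lim_null[THEN iffD2], rule Lim_null_comparison)
    show "\<forall>\<^sub>F y in ?at. norm (potential y - potential z) \<le> B * \<bar>fst y - fst z\<bar> + B * \<bar>snd y - snd z\<bar>"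
      unfolding eventually_at_filter using z by (intro always_eventually allI impI potential_Lipschitz) auto
    show "((\<lambda>y. B * \<bar>fst y - fst z\<bar> + B * \<bar>snd y - snd z\<bar>) \<longlongrightarrow> 0) ?at" by (auto intro!: tendsto_eq_intros)
  qed
qed

end

section \<open>Conformal charts\<close>

context immersed_torus
begin

definition "dz_deriv F x g \<longleftrightarrow> (F has_derivative (\<lambda>v. dz x v * g)) (at x)"

definition "dz_inv x z = (Re z - Re (mu x) * (Im z / Im (mu x)), Im z / Im (mu x))"

lemma dz_dz_inv: "dz x (dz_inv x z) = z" and dz_inv_dz: "dz_inv x (dz x v) = v"
  by (auto simp: dz_def lincoord_def dz_inv_def complex_eq_iff prod_eq_iff)

lemma bounded_linear_dz: "bounded_linear (dz x)"
  unfolding dz_def[abs_def] by (rule bounded_linear_lincoord)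

lemma bounded_linear_dz_inv: "bounded_linear (\<lambda>z. dz_inv x (z / k))"
proof (rule bounded_linear_compose[OF _ bounded_linear_divide])
  show "bounded_linear (dz_inv x)"
    unfolding linear_conv_bounded_linear[symmetric] dz_inv_def
    by (intro linearI) (simp_all add: algebra_simps add_divide_distrib)
qed

lemma dz_deriv_unique: "dz_deriv F x g \<Longrightarrow> dz_deriv F x h \<Longrightarrow> g = h"
  unfolding dz_deriv_def using has_derivative_unique[of F "\<lambda>v. dz x v * g" x "\<lambda>v. dz x v * h"]
  by (metis dz_simps(5) mult_1)

lemma dz_deriv_isCont: "dz_deriv F x g \<Longrightarrow> isCont F x"
  unfolding dz_deriv_def by (rule has_derivative_continuous)

lemma dz_deriv_compose:
  assumes "dz_deriv F x g" "(h has_field_derivative h') (at (F x))" shows "dz_deriv (\<lambda>x. h (F x)) x (h' * g)"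
  using has_derivative_compose[OF assms[unfolded dz_deriv_def has_field_derivative_def]]
  unfolding dz_deriv_def by (simp add: mult_ac)

lemma dz_deriv_const: "dz_deriv (\<lambda>x. c) x 0"
  by (simp add: dz_deriv_def)

lemma dz_deriv_diff: "dz_deriv F x g \<Longrightarrow> dz_deriv G x h \<Longrightarrow> dz_deriv (\<lambda>x. F x - G x) x (g - h)"
  unfolding dz_deriv_def right_diff_distrib by (rule has_derivative_diff)

lemma dz_deriv_transform:
  "dz_deriv F x g \<Longrightarrow> open U \<Longrightarrow> x \<in> U \<Longrightarrow> (\<And>y. y \<in> U \<Longrightarrow> F y = G y) \<Longrightarrow> dz_deriv G x g"
  unfolding dz_deriv_def by (rule has_derivative_transform_within_open)

lemma norm_dz_mult_diff_le:
  "norm (dz x v * g - dz y v * h) \<le> (norm (g - h) + norm (mu x * g - mu y * h)) * norm v"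
proof -
  have "dz x v * g - dz y v * h = of_real (fst v) * (g - h) + of_real (snd v) * (mu x * g - mu y * h)"
    by (simp add: dz_def lincoord_def algebra_simps)
  then have "norm (dz x v * g - dz y v * h) \<le> \<bar>fst v\<bar> * norm (g - h) + \<bar>snd v\<bar> * norm (mu x * g - mu y * h)"
    by (metis norm_mult norm_of_real norm_triangle_ineq)
  also have "\<dots> \<le> norm v * norm (g - h) + norm v * norm (mu x * g - mu y * h)"
    using norm_fst_le[of v] norm_snd_le[of v] by (intro add_mono mult_right_mono) auto
  finally show ?thesis by (simp add: algebra_simps)
qed

lemma dz_deriv_locally_injective:
  assumes U: "open U" "x0 \<in> U" "\<And>x. x \<in> U \<Longrightarrow> dz_deriv F x (d x)" and d: "isCont d x0" "d x0 \<noteq> 0"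
  obtains r where "r > 0" "ball x0 r \<subseteq> U" "inj_on F (ball x0 r)" "\<And>x. x \<in> ball x0 r \<Longrightarrow> d x \<noteq> 0"
proof -
  have cont: "isCont (\<lambda>x. norm (d x - d x0) + norm (mu x * d x - mu x0 * d x0)) x0"
    by (intro continuous_intros d smooth_map_isCont smooth_mu)
  obtain r where r: "r > 0" "ball x0 r \<subseteq> U" "inj_on F (ball x0 r)"
  proof (rule has_derivative_locally_injective[of x0 U "\<lambda>z. dz_inv x0 (z / d x0)" "\<lambda>x v. dz x v * d x" F])
    show "bounded_linear (\<lambda>z. dz_inv x0 (z / d x0))" by (rule bounded_linear_dz_inv)
    show "(\<lambda>z. dz_inv x0 (z / d x0)) \<circ> (\<lambda>v. dz x0 v * d x0) = id" using d(2) by (auto simp: dz_inv_dz)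
    show "(F has_derivative (\<lambda>v. dz x v * d x)) (at x)" if "x \<in> U" for x
      using U(3)[OF that] by (simp add: dz_deriv_def)
    fix e :: real assume "e > 0"
    then have "\<exists>t>0. \<forall>x. dist x x0 < t \<longrightarrow> norm (d x - d x0) + norm (mu x * d x - mu x0 * d x0) < e"
      using cont unfolding continuous_at_eps_delta by (simp add: dist_real_def)
    then obtain t where t: "t > 0"
      "\<And>x. dist x x0 < t \<Longrightarrow> norm (d x - d x0) + norm (mu x * d x - mu x0 * d x0) < e"
      by blast
    have "onorm (\<lambda>v. dz x v * d x - dz x0 v * d x0) < e" if "dist x0 x < t" for x
      by (rule le_less_trans[OF onorm_bound t(2)]) (use that norm_dz_mult_diff_le in \<open>auto simp: dist_commute\<close>)
    then show "\<exists>t>0. \<forall>x. dist x0 x < t \<longrightarrow> onorm (\<lambda>v. dz x v * d x - dz x0 v * d x0) < e" using t(1) by blast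
  qed (use U in auto)
  obtain s where "s > 0" "\<And>x. dist x x0 < s \<Longrightarrow> d x \<noteq> 0"
    using continuous_at_avoid[OF d(1,2)] by (metis dist_commute)
  then show ?thesis
    using r by (intro that[of "min r s"]) (auto simp: dist_commute intro: inj_on_subset)
qed

text \<open>No continuity of \<open>d\<close> away from \<open>x0\<close> is required; it follows from \<open>F\<close> being a chart for the complex structure.\<close>
definition "chart x0 U F d \<longleftrightarrow> open U \<and> x0 \<in> U \<and> inj_on F U \<and> (\<forall>x\<in>U. dz_deriv F x (d x) \<and> d x \<noteq> 0) \<and>
  F x0 = 0 \<and> isCont d x0"

lemma chartD:
  assumes "chart x0 U F d"
  shows "open U" "x0 \<in> U" "inj_on F U" "\<And>x. x \<in> U \<Longrightarrow> dz_deriv F x (d x)" "\<And>x. x \<in> U \<Longrightarrow> d x \<noteq> 0"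
    "F x0 = 0" "isCont d x0"
  using assms unfolding chart_def by blast+

lemma chart_nonzero: "chart x0 U F d \<Longrightarrow> x \<in> U - {x0} \<Longrightarrow> F x \<noteq> 0"
  unfolding chart_def inj_on_def by fastforce

lemma chart_image_punctured: "chart x0 U F d \<Longrightarrow> F ` U = ball 0 r \<Longrightarrow> F ` (U - {x0}) = ball 0 r - {0}"
  unfolding chart_def using inj_on_image_set_diff[of F U U "{x0}"] by auto

lemma chart_restrict: "chart x0 U F d \<Longrightarrow> open V \<Longrightarrow> x0 \<in> V \<Longrightarrow> chart x0 (U \<inter> V) F d"
  unfolding chart_def by (auto intro: inj_on_subset)

lemma chart_exists:
  assumes U: "open U" "x0 \<in> U" "\<And>x. x \<in> U \<Longrightarrow> dz_deriv F x (d x)"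
    and d: "isCont d x0" "d x0 \<noteq> 0" and "F x0 = 0"
  shows "\<exists>V. V \<subseteq> U \<and> chart x0 V F d"
proof -
  obtain r where "r > 0" "ball x0 r \<subseteq> U" "inj_on F (ball x0 r)" "\<And>x. x \<in> ball x0 r \<Longrightarrow> d x \<noteq> 0"
    using dz_deriv_locally_injective[OF U d] by blast
  then show ?thesis using U(3) d assms(6) unfolding chart_def by (intro exI[of _ "ball x0 r"]) auto
qed

context
  fixes U F d
  assumes U: "open U" "inj_on F U" "\<And>x. x \<in> U \<Longrightarrow> dz_deriv F x (d x)"
begin

lemma open_image_dz_deriv:
  shows "open (F ` U)" "continuous_on (F ` U) (inv_into U F)"
proof -
  have cont: "continuous_on U F"
    using U(3) dz_deriv_isCont by (intro continuous_at_imp_continuous_on) blast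
  show "open (F ` U)" using invariance_of_domain_gen[OF U(1) cont U(2)] by simp
  show "continuous_on (F ` U) (inv_into U F)"
    using continuous_on_inverse_open[OF U(1) cont _ inv_into_f_f[OF U(2)]] by simp
qed

lemma has_derivative_inv_into_dz_deriv:
  assumes x: "x \<in> U" "d x \<noteq> 0"
  shows "(inv_into U F has_derivative (\<lambda>z. dz_inv x (z / d x))) (at (F x))"
proof (rule has_derivative_inverse_basic[where f = F and f' = "\<lambda>v. dz x v * d x" and T = "F ` U"])
  note inverse = open_image_dz_deriv
  show "(F has_derivative (\<lambda>v. dz x v * d x)) (at (inv_into U F (F x)))"
    using U(3)[OF x(1)] x(1) U(2) by (simp add: dz_deriv_def)
  show "bounded_linear (\<lambda>z. dz_inv x (z / d x))" by (rule bounded_linear_dz_inv)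
  show "(\<lambda>z. dz_inv x (z / d x)) \<circ> (\<lambda>v. dz x v * d x) = id" using x(2) by (auto simp: dz_inv_dz)
  show "isCont (inv_into U F) (F x)" using inverse x(1) by (simp add: continuous_on_eq_continuous_at)
  show "open (F ` U)" "F x \<in> F ` U" using inverse x(1) by auto
  show "F (inv_into U F z) = z" if "z \<in> F ` U" for z using that by (rule f_inv_into_f)
qed

lemma has_field_derivative_inv_into_dz_deriv:
  assumes x: "x \<in> U" "d x \<noteq> 0"
    and G: "dz_deriv G x g"
  shows "((\<lambda>z. G (inv_into U F z)) has_field_derivative g / d x) (at (F x))"
proof -
  have "((\<lambda>z. G (inv_into U F z)) has_derivative (\<lambda>z. dz x (dz_inv x (z / d x)) * g)) (at (F x))"
    using has_derivative_compose[OF has_derivative_inv_into_dz_deriv[OF x], of G "\<lambda>v. dz x v * g"] G x(1) U(2)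
    by (simp add: dz_deriv_def)
  then show ?thesis
    unfolding has_field_derivative_def by (rule has_derivative_eq_rhs) (auto simp: dz_dz_inv fun_eq_iff)
qed

end

lemma chart_image:
  assumes "chart x0 U F d" shows "open (F ` U)" "continuous_on (F ` U) (inv_into U F)"
  using open_image_dz_deriv[of U F d] assms unfolding chart_def by blast+

lemma chart_ball_image:
  assumes "chart x0 U F d"
  shows "\<exists>V r. V \<subseteq> U \<and> r > 0 \<and> chart x0 V F d \<and> F ` V = ball 0 r"
proof -
  note c = chartD[OF assms]
  have cont: "continuous_on U F"
    using c(4) dz_deriv_isCont by (intro continuous_at_imp_continuous_on) blast
  obtain r where r: "r > 0" "ball 0 r \<subseteq> F ` U"
    using chart_image(1)[OF assms] c(2,6) open_contains_ball by (metis imageI)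
  define V where "V = U \<inter> F -` ball 0 r"
  have "open V" unfolding V_def by (rule continuous_open_preimage[OF cont c(1) open_ball])
  moreover have "x0 \<in> V" using c(2,6) r(1) by (simp add: V_def)
  ultimately have "chart x0 (U \<inter> V) F d" by (rule chart_restrict[OF assms])
  moreover have "F ` V = ball 0 r" "U \<inter> V = V" "V \<subseteq> U" using r(2) by (auto simp: V_def)
  ultimately show ?thesis using r(1) by metis
qed

lemma chart_filterlim:
  assumes "chart x0 U F d"
  shows "filterlim (inv_into U F) (at x0) (at 0)" "\<forall>\<^sub>F z in at 0. z \<in> F ` U"
proof -
  note c = chartD[OF assms] and inverse = chart_image[OF assms]
  have "0 \<in> F ` U" using c(2,6) by (metis imageI)
  then have ev: "\<forall>\<^sub>F z in at 0. z \<in> F ` U - {0}" by (rule eventually_at_in_open[OF inverse(1)])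
  then show "\<forall>\<^sub>F z in at 0. z \<in> F ` U" by (rule eventually_mono) auto
  have "isCont (inv_into U F) 0"
    using continuous_on_eq_continuous_at[OF inverse(1)] inverse(2) \<open>0 \<in> F ` U\<close> by blast
  then have "(inv_into U F \<longlongrightarrow> x0) (at 0)" using c(2,3,6) by (metis isCont_def inv_into_f_f)
  moreover have "\<forall>\<^sub>F z in at 0. inv_into U F z \<noteq> x0"
    using ev by eventually_elim (use c(6) in \<open>metis DiffE f_inv_into_f singletonI\<close>)
  ultimately show "filterlim (inv_into U F) (at x0) (at 0)" by (simp add: filterlim_at)
qed

end

section \<open>Charts from the Weierstrass form\<close>

context willmore_torus
begin

lemma torus_periodic_mu: "torus_periodic mu"
  using periodic_geometry unfolding torus_periodic_def by (simp add: mu_def)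

lemma open_nonzero: "open {x. f x \<noteq> 0}"
  by (intro open_Collect_neq smooth_map_continuous_on smooth_f continuous_on_const)

lemma eventually_nonzero: "\<forall>\<^sub>F x in at x0. f x \<noteq> 0"
  using isolated_zero eventually_at_in_open'[OF open_nonzero] by (cases "f x0 = 0") auto

lemma continuous_on_pd_mu_Omega: "continuous_on {x. f x \<noteq> 0} (pd (\<lambda>x. mu x *s Omega x) e1)"
proof -
  define M where "M = (\<lambda>x. inversion_diff x (mu x *s null_tan x))"
  have smooth: "smooth_map M" unfolding M_def by (intro smooth_intros)
  have "continuous_on {x. f x \<noteq> 0} (\<lambda>x. (1 / rho x ^ 3) *\<^sub>R (rho x *\<^sub>R pd M e1 x - (2 * pd rho e1 x) *\<^sub>R M x))"
    using rho_eq_0_iff by (intro continuous_intros smooth_map_continuous_on smooth_map_pd smooth smooth_rho) auto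
  then show ?thesis
    by (rule continuous_on_eq) (simp add: mu_Omega M_def
        pd_eqI[OF has_derivative_over_rho_square[OF smooth[unfolded M_def]]])
qed

lemma cdot_Omega_locally_bounded:
  assumes "f x0 = 0 \<Longrightarrow> cdot w (ccnj (null_tan x0)) = 0"
  shows "\<exists>C. \<forall>\<^sub>F x in nhds x0. norm (cdot w (Omega x)) \<le> C"
proof (cases "f x0 = 0")
  case True
  obtain C where "\<forall>\<^sub>F v in at 0. norm (cdot w (Omega (x0 + v))) \<le> C"
    using cdot_Omega_bounded[OF True assms[OF True]] by blast
  then have "\<forall>\<^sub>F x in at x0. norm (cdot w (Omega x)) \<le> max C (norm (cdot w (Omega x0)))"
    by (simp add: at_to_0[of x0] eventually_filtermap add.commute) (auto elim: eventually_mono)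
  then show ?thesis unfolding eventually_nhds_conv_at by (meson max.cobounded2)
next
  case False
  have "isCont (\<lambda>x. cdot w (Omega x)) x0"
    using Omega_differentiable(1)[OF False] differentiable_imp_continuous_within
    by (intro bounded_linear.isCont[OF cdot.bounded_linear_right]) blast
  then have "\<forall>\<^sub>F x in nhds x0. dist (cdot w (Omega x)) (cdot w (Omega x0)) < 1"
    unfolding continuous_at_eps_delta eventually_nhds_metric by (meson zero_less_one)
  then show ?thesis
    by (intro exI[of _ "norm (cdot w (Omega x0)) + 1"], elim eventually_mono)
      (smt (verit) dist_norm norm_triangle_ineq2)
qed

lemma finite_zeros: "compact K \<Longrightarrow> finite (K \<inter> {x. f x = 0})"
  using finite_not_islimpt_in_compact[of K "{x. f x = 0}"] eventually_nonzero
  by (auto simp: islimpt_iff_eventually)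

lemma primitive_on_box:
  assumes bound: "\<And>x. x \<in> {a..b} \<times> {c..d} \<Longrightarrow> norm (cdot w (Omega x)) \<le> K"
  obtains G where "continuous_on ({a<..<b} \<times> {c<..<d}) G"
    "\<And>x. x \<in> {a<..<b} \<times> {c<..<d} \<Longrightarrow> f x \<noteq> 0 \<Longrightarrow> dz_deriv G x (cdot w (Omega x))"
proof -
  define p where "p = (\<lambda>x. cdot w (Omega x))"
  define q where "q = (\<lambda>x. cdot w (mu x *s Omega x))"
  let ?P = "cbox (a,c) (b,d) \<inter> {x. f x = 0}"
  obtain M where M: "M > 0" "\<And>x. norm (mu x) \<le> M"
    using torus_periodic_bounded[OF torus_periodic_mu smooth_map_continuous_on[OF smooth_mu]] by blast
  have nz: "f x \<noteq> 0" if "x \<in> {a..b} \<times> {c..d} - ?P" for x using that by (cases x) (auto simp: cbox_Pair_eq)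
  note pd_cdot_w = pd_bounded_linear[OF cdot.bounded_linear_right]
    and diff_cdot_w = differentiable_compose[OF bounded_linear_imp_differentiable[OF cdot.bounded_linear_right]]
  interpret closed_form a b c d "(1 + M) * K" ?P p q
  proof
    show "finite ?P" by (rule finite_zeros[OF compact_cbox])
  next
    fix z assume z: "z \<in> {a..b} \<times> {c..d}"
    have K: "norm (p z) \<le> K" using bound[OF z] by (simp add: p_def)
    then have "0 \<le> K" using norm_ge_zero order_trans by blast
    then have "K \<le> (1 + M) * K" "M * K \<le> (1 + M) * K" using M by (simp_all add: algebra_simps)
    moreover have "norm (q z) \<le> M * K"
      unfolding q_def cdot_smult norm_mult using M K \<open>0 \<le> K\<close> by (intro mult_mono) (auto simp: p_def)
    ultimately show "norm (p z) \<le> (1 + M) * K" "norm (q z) \<le> (1 + M) * K" using K by linarith+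
  next
    fix z assume "z \<in> {a..b} \<times> {c..d} - ?P"
    then have z: "f z \<noteq> 0" by (rule nz)
    show "p differentiable at z" "q differentiable at z"
      unfolding p_def q_def by (intro diff_cdot_w Omega_differentiable[OF z])+
    show "pd q e1 z = pd p e2 z"
      unfolding p_def q_def by (simp add: pd_cdot_w Omega_differentiable[OF z] Omega_closed[OF z])
  next
    have "continuous_on {x. f x \<noteq> 0} (\<lambda>x. cdot w (pd (\<lambda>x. mu x *s Omega x) e1 x))"
      by (intro bounded_linear.continuous_on[OF cdot.bounded_linear_right] continuous_on_pd_mu_Omega)
    then have "continuous_on {x. f x \<noteq> 0} (pd q e1)"
      unfolding q_def by (rule continuous_on_eq) (simp add: pd_cdot_w Omega_differentiable)
    then show "continuous_on ({a..b} \<times> {c..d} - ?P) (pd q e1)" by (rule continuous_on_subset) (use nz in blast)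
  qed
  have "dz_deriv potential x (cdot w (Omega x))" if "x \<in> {a<..<b} \<times> {c<..<d}" "f x \<noteq> 0" for x
  proof -
    have "fst v *\<^sub>R p x + snd v *\<^sub>R q x = dz x v * cdot w (Omega x)" for v
      by (simp add: p_def q_def cdot_smult dz_def lincoord_def scaleR_conv_of_real algebra_simps)
    then show ?thesis using has_derivative_potential[of x] that unfolding dz_deriv_def by simp
  qed
  then show ?thesis using that continuous_on_potential by blast
qed

lemma local_primitive:
  assumes "f x0 = 0 \<Longrightarrow> cdot w (ccnj (null_tan x0)) = 0"
  shows "\<exists>U G. open U \<and> x0 \<in> U \<and> (\<forall>x\<in>U. x \<noteq> x0 \<longrightarrow> f x \<noteq> 0) \<and> continuous_on U G \<and>
    (\<forall>x\<in>U. f x \<noteq> 0 \<longrightarrow> dz_deriv G x (cdot w (Omega x)))"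
proof -
  obtain K where "\<forall>\<^sub>F x in nhds x0. norm (cdot w (Omega x)) \<le> K"
    using cdot_Omega_locally_bounded[OF assms] by blast
  with eventually_nonzero[of x0, unfolded eventually_at_filter]
  have "\<forall>\<^sub>F x in nhds x0. norm (cdot w (Omega x)) \<le> K \<and> (x \<noteq> x0 \<longrightarrow> f x \<noteq> 0)" by eventually_elim auto
  then obtain e where e: "e > 0" "\<And>x. dist x x0 < e \<Longrightarrow> norm (cdot w (Omega x)) \<le> K"
    "\<And>x. dist x x0 < e \<Longrightarrow> x \<noteq> x0 \<Longrightarrow> f x \<noteq> 0"
    unfolding eventually_nhds_metric by blast
  define r where "r = e / 3"
  let ?U = "{fst x0 - r<..<fst x0 + r} \<times> {snd x0 - r<..<snd x0 + r}"
  have near: "dist x x0 < e" if "x \<in> {fst x0 - r..fst x0 + r} \<times> {snd x0 - r..snd x0 + r}" for x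
  proof -
    have "\<bar>fst x - fst x0\<bar> \<le> r" "\<bar>snd x - snd x0\<bar> \<le> r" using that by auto
    then show ?thesis using norm_Pair_le[of "fst x - fst x0" "snd x - snd x0"] e(1)
      by (cases x; cases x0) (auto simp: r_def dist_norm)
  qed
  obtain G where "continuous_on ?U G" "\<And>x. x \<in> ?U \<Longrightarrow> f x \<noteq> 0 \<Longrightarrow> dz_deriv G x (cdot w (Omega x))"
    using primitive_on_box[OF e(2)[OF near]] by blast
  moreover have "f x \<noteq> 0" if "x \<in> ?U" "x \<noteq> x0" for x using that by (intro e(3) near) auto
  moreover have "open ?U" "x0 \<in> ?U" using e(1) by (auto simp: r_def mem_Times_iff intro: open_Times)
  ultimately show ?thesis by (intro exI[of _ ?U] exI[of _ G]) blast
qed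

lemma isCont_cdot_Omega: "f x \<noteq> 0 \<Longrightarrow> isCont (\<lambda>x. cdot w (Omega x)) x"
  using Omega_differentiable(1) differentiable_imp_continuous_within
  by (intro bounded_linear.isCont[OF cdot.bounded_linear_right]) blast

lemma cdot_ccnj_Omega_nonzero: "f x \<noteq> 0 \<Longrightarrow> cdot (ccnj (Omega x)) (Omega x) \<noteq> 0"
  using Omega_nonzero cdot_ccnj_self[of "Omega x"] by (simp add: cdot_commute)

lemma chart_at_nonzero:
  assumes "f x0 \<noteq> 0" obtains U F d where "chart x0 U F d" "\<And>x. x \<in> U \<Longrightarrow> f x \<noteq> 0"
proof -
  define w where "w = ccnj (Omega x0)"
  have nz: "cdot w (Omega x0) \<noteq> 0" unfolding w_def by (rule cdot_ccnj_Omega_nonzero[OF assms])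
  obtain U G where U: "open U" "x0 \<in> U" "\<And>x. x \<in> U \<Longrightarrow> f x \<noteq> 0 \<Longrightarrow> dz_deriv G x (cdot w (Omega x))"
    "\<And>x. x \<in> U \<Longrightarrow> f x \<noteq> 0"
    using local_primitive[of x0 w] assms by metis
  have "dz_deriv (\<lambda>x. G x - G x0) x (cdot w (Omega x))" if "x \<in> U" for x
    using dz_deriv_diff[OF U(3)[OF that U(4)[OF that]] dz_deriv_const] by simp
  then obtain V where "V \<subseteq> U" "chart x0 V (\<lambda>x. G x - G x0) (\<lambda>x. cdot w (Omega x))"
    using chart_exists[OF U(1,2)] isCont_cdot_Omega[OF assms] nz by (metis (no_types, lifting) diff_self)
  then show ?thesis using that U(4) by blast
qed

text \<open>Near a zero \<open>p\<close> of \<open>f\<close> with \<open>n = null_tan p\<close>, let \<open>G\<close> be a primitive of \<open>ccnj n \<bullet> Omega\<close>, which is bounded. Then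
  \<open>polar_part p G = n \<bullet> inverted - cnj G / 2\<close> is holomorphic with a simple pole at \<open>p\<close>, and its reciprocal is a chart.\<close>
definition "polar_numerator p G x = cdot (null_tan p) (cvec (f x)) - of_real (rho x) * cnj (G x) / 2"
definition "polar_part p G x = cdot (null_tan p) (cvec (inverted x)) - cnj (G x) / 2"

lemma polar_part_eq: "f x \<noteq> 0 \<Longrightarrow> polar_part p G x = polar_numerator p G x / of_real (rho x)"
  unfolding polar_part_def polar_numerator_def inverted_def using rho_eq_0_iff[of x]
  by (simp add: cvec_simps cdot_smult field_simps)

lemma dz_deriv_cdot_inverted:
  assumes x: "f x \<noteq> 0" and G: "dz_deriv G x (cdot (ccnj n) (Omega x))"
  shows "dz_deriv (\<lambda>x. cdot n (cvec (inverted x)) - cnj (G x) / 2) x (cdot n (Omega x) / 2)"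
proof -
  have deriv: "((\<lambda>x. cdot n (cvec (inverted x)) - cnj (G x) / 2) has_derivative
      (\<lambda>v. cdot n (cvec (rvec (dz x v *s Omega x))) - cnj (dz x v * cdot (ccnj n) (Omega x)) / 2)) (at x)"
    by (intro has_derivative_diff bounded_linear.has_derivative[OF cdot.bounded_linear_right]
        bounded_linear.has_derivative[OF bounded_linear_cvec] has_derivative_inverted[OF x]
        bounded_linear.has_derivative[OF bounded_linear_divide] has_derivative_cnj G[unfolded dz_deriv_def])
  have half: "cdot n (cvec (rvec y)) - cnj (cdot (ccnj n) y) / 2 = cdot n y / 2" for y
  proof -
    have "cvec (rvec y) = (1/2) *s (y + ccnj y)"
      by (simp add: vec_eq_iff cvec_def rvec_def ccnj_def complex_eq_iff)
    then show ?thesis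
      using cdot_ccnj[of "ccnj n" y] by (simp add: cdot_simps ccnj_simps add_divide_distrib)
  qed
  have "cdot n (cvec (rvec (dz x v *s Omega x)))
      - cnj (dz x v * cdot (ccnj n) (Omega x)) / 2 = dz x v * (cdot n (Omega x) / 2)" for v
    using half[of "dz x v *s Omega x"] by (simp add: cdot_smult)
  with deriv show ?thesis unfolding dz_deriv_def by (simp only:)
qed

lemma vanishes_rho_of_real:
  assumes "f p = 0"
  shows "vanishes 2 (\<lambda>v. complex_of_real (rho (p + v)))"
    "vanishes 3 (\<lambda>v. complex_of_real (rho (p + v)) - of_real (EE p) * dz p v * cnj (dz p v))"
proof -
  have "vanishes 1 (\<lambda>v. f (p + v))" by (rule vanishes_1_if_zero[OF smooth_f assms])
  from vanishes_of_real[OF vanishes_inner[OF this this]]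
  show "vanishes 2 (\<lambda>v. complex_of_real (rho (p + v)))" by (simp add: rho_def numeral_2_eq_2)
  have "of_real ((norm (pd f v p))\<^sup>2) = of_real (EE p) * dz p v * cnj (dz p v)" for v
    unfolding norm_pd_f_dz of_real_mult complex_norm_square by (simp add: mult_ac)
  then show "vanishes 3 (\<lambda>v. complex_of_real (rho (p + v)) - of_real (EE p) * dz p v * cnj (dz p v))"
    using vanishes_of_real[OF vanishes_rho[OF assms]] by simp
qed

lemma cdot_f_null_tan_linear:
  assumes "f p = 0" and n: "smooth_map n" "n p = null_tan p"
  shows "vanishes 2 (\<lambda>v. cdot (cvec (f (p + v))) (n (p + v)) - of_real (EE p) * cnj (dz p v))"
proof -
  let ?a = "\<lambda>x. cdot (cvec (f x)) (n x)"
  have "smooth_map ?a" by (intro smooth_intros n)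
  moreover have "?a p = 0" by (simp add: assms cvec_simps cdot.zero_left)
  moreover have "pd ?a v p = of_real (EE p) * cnj (dz p v)" for v
    unfolding pd_cdot[OF smooth_map_cvec[OF smooth_f] n(1)] pd_cvec[OF smooth_f]
    by (simp add: assms cvec_simps cdot.zero_left cdot_pd_f_null_tan)
  ultimately show ?thesis using vanishes_2_if_zero[of ?a p] by simp
qed

lemma vanishes_dz: "vanishes 1 (\<lambda>v. dz p v)" "vanishes 1 (\<lambda>v. of_real (EE p) * cnj (dz p v))"
  by (rule vanishes_bounded_linear,
      (rule bounded_linear_dz | rule bounded_linear_compose[OF bounded_linear_mult_right]
        bounded_linear_compose[OF bounded_linear_cnj])+)+

context
  fixes p and G :: "plane \<Rightarrow> complex" and K :: real
  assumes p: "f p = 0" and G: "\<forall>\<^sub>F x in nhds p. norm (G x) \<le> K"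
begin

abbreviation "Q \<equiv> polar_numerator p G"

lemma polar_numerator_linear: "vanishes 2 (\<lambda>v. Q (p + v) - of_real (EE p) * cnj (dz p v))"
proof -
  have "((\<lambda>v. p + v) \<longlongrightarrow> p + 0) (nhds 0)" by (intro tendsto_add tendsto_const filterlim_ident)
  from filterlim_iff[THEN iffD1, OF this, rule_format] G
  have "\<forall>\<^sub>F v in nhds 0. norm (G (p + v)) \<le> K" by simp
  then have "vanishes 0 (\<lambda>v. cnj (G (p + v)) / 2)"
    unfolding vanishes_def by (intro exI[of _ "K / 2"]) (auto elim!: eventually_mono)
  from vanishes_mult[OF vanishes_rho_of_real(1)[OF p] this]
  have "vanishes 2 (\<lambda>v. of_real (rho (p + v)) * cnj (G (p + v)) / 2)" by simp
  from vanishes_diff[OF cdot_f_null_tan_linear[OF p smooth_map_const refl] this] show ?thesis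
    by (simp add: polar_numerator_def cdot_commute algebra_simps)
qed

lemma vanishes_at_most_polar_numerator: "vanishes_at_most 1 (\<lambda>v. Q (p + v))"
proof (rule vanishes_at_most_if_vanishes_diff)
  show "vanishes (Suc 1) (\<lambda>v. Q (p + v) - of_real (EE p) * cnj (dz p v))"
    using polar_numerator_linear by (simp add: numeral_2_eq_2)
  obtain c where c: "c > 0" "\<And>v. c * norm v \<le> norm (dz p v)" using dz_lower_bound by blast
  then show "vanishes_at_most 1 (\<lambda>v. of_real (EE p) * cnj (dz p v))"
    unfolding vanishes_at_most_def using EE_pos[of p] by (intro exI[of _ "EE p * c"]) (simp add: norm_mult mult.assoc)
qed

lemmas polar_numerator_nonzero = eventually_nonzero_if_vanishes_at_most[OF vanishes_at_most_polar_numerator]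

lemma dz_deriv_polar_chart: "dz_deriv (\<lambda>x. of_real (rho x) / Q x) p 1"
proof -
  let ?R = "\<lambda>v. (of_real (rho (p + v)) - dz p v * Q (p + v)) / (Q (p + v) * of_real (norm v))"
  have "vanishes 3 (\<lambda>v. dz p v * Q (p + v) - dz p v * (of_real (EE p) * cnj (dz p v)))"
    using vanishes_mult[OF vanishes_dz(1) polar_numerator_linear] by (simp add: algebra_simps numeral_3_eq_3)
  from vanishes_diff[OF vanishes_rho_of_real(2)[OF p] this]
  have numerator: "vanishes 3 (\<lambda>v. of_real (rho (p + v)) - dz p v * Q (p + v))" by (simp add: algebra_simps)
  have "vanishes_at_most 1 (\<lambda>v. complex_of_real (norm v))" unfolding vanishes_at_most_def by (intro exI[of _ 1]) simp
  from vanishes_at_most_mult[OF vanishes_at_most_polar_numerator this]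
  have "((\<lambda>v. ?R v) \<longlongrightarrow> 0) (at 0)"
    using numerator by (intro tendsto_quotient_if_vanishes[where k = 2]) (simp_all add: numeral_3_eq_3 numeral_2_eq_2)
  then have lim: "((\<lambda>v. norm (?R v)) \<longlongrightarrow> 0) (at 0)"
    by (rule tendsto_norm_zero)
  have "\<forall>\<^sub>F v in at 0. Q (p + v) \<noteq> 0"
    using polar_numerator_nonzero by (simp add: at_to_0[of p] eventually_filtermap add.commute)
  then have "\<forall>\<^sub>F v in at 0. norm (?R v)
      = norm (of_real (rho (p + v)) / Q (p + v) - of_real (rho p) / Q p - dz p v * 1) / norm v"
    by eventually_elim (simp add: p rho_def[of p] norm_divide norm_mult flip: divide_divide_eq_left,
        simp add: field_simps flip: norm_divide)
  from Lim_transform_eventually[OF lim this] show ?thesis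
    unfolding dz_deriv_def has_derivative_at using bounded_linear_dz by simp
qed

definition "polar_factor_numerator x =
  of_real (rho x) * cdot (null_tan p) (null_tan x) / 2 - cdot (cvec (f x)) (null_tan x) * cdot (cvec (f x)) (null_tan p)"

lemma polar_factor_numerator_expansion:
  "vanishes 3 (\<lambda>v. - polar_factor_numerator (p + v) - Q (p + v) * Q (p + v))"
proof -
  define L where "L = (\<lambda>v. of_real (EE p) * cnj (dz p v))"
  note lin = cdot_f_null_tan_linear[OF p, folded L_def]
  have "smooth_map (\<lambda>x. cdot (null_tan p) (null_tan x) * (1/2))" by (intro smooth_intros)
  then have "vanishes 1 (\<lambda>v. cdot (null_tan p) (null_tan (p + v)) * (1/2))"
    by (rule vanishes_1_if_zero) (simp add: null_tan_null)
  from vanishes_mult[OF vanishes_rho_of_real(1)[OF p] this]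
  have rho_n: "vanishes 3 (\<lambda>v. of_real (rho (p + v)) * cdot (null_tan p) (null_tan (p + v)) / 2)"
    by (simp add: numeral_3_eq_3 numeral_2_eq_2)
  have L: "vanishes 1 L" unfolding L_def by (rule vanishes_dz(2))
  have linear_part: "vanishes 1 g" if "vanishes 2 (\<lambda>v. g v - L v)" for g
    using vanishes_add[OF vanishes_mono[OF that, of 1] L] by simp
  have square: "vanishes 3 (\<lambda>v. g v * h v - L v * L v)"
    if "vanishes 2 (\<lambda>v. g v - L v)" "vanishes 2 (\<lambda>v. h v - L v)" for g h
    using vanishes_mult_diff[of 1 g L 1 h L] that L linear_part[OF that(2)]
    by (simp add: numeral_3_eq_3 numeral_2_eq_2)
  have "vanishes 2 (\<lambda>v. cdot (cvec (f (p + v))) (null_tan (p + v)) - L v)"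
    "vanishes 2 (\<lambda>v. cdot (cvec (f (p + v))) (null_tan p) - L v)" "vanishes 2 (\<lambda>v. Q (p + v) - L v)"
    using lin[OF smooth_null_tan] lin[OF smooth_map_const] polar_numerator_linear by (simp_all add: L_def)
  from vanishes_diff[OF vanishes_diff[OF square[OF this(1,2)] square[OF this(3,3)]] rho_n]
  show ?thesis by (simp add: polar_factor_numerator_def algebra_simps)
qed

lemma polar_factor_eq:
  assumes "f x \<noteq> 0"
  shows "cdot (null_tan p) (Omega x) / 2 * (of_real (rho x) / Q x)\<^sup>2 = polar_factor_numerator x / (Q x * Q x)"
proof -
  have "cdot (null_tan p) (Omega x) * (of_real (rho x))\<^sup>2 = cdot (null_tan p) (inversion_diff x (null_tan x))"
    using assms rho_eq_0_iff[of x] by (simp add: cdot_Omega)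
  also have "\<dots> = 2 * polar_factor_numerator x"
    unfolding inversion_diff_def scaleR_eq_smult polar_factor_numerator_def
    by (simp add: cdot_simps cdot_commute[of "null_tan p" "cvec (f x)"] algebra_simps)
  finally have numerator: "cdot (null_tan p) (Omega x) * (of_real (rho x))\<^sup>2 = 2 * polar_factor_numerator x" .
  have "cdot (null_tan p) (Omega x) / 2 * (of_real (rho x) / Q x)\<^sup>2
      = cdot (null_tan p) (Omega x) * (of_real (rho x))\<^sup>2 / 2 / (Q x * Q x)" by (simp add: power2_eq_square)
  then show ?thesis unfolding numerator by simp
qed

lemma polar_chart_factor_tendsto:
  "((\<lambda>x. - (cdot (null_tan p) (Omega x) / 2) * (of_real (rho x) / Q x)\<^sup>2) \<longlongrightarrow> 1) (at p)"
proof -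
  let ?R = "\<lambda>x. (- polar_factor_numerator x - Q x * Q x) / (Q x * Q x)"
  from vanishes_at_most_mult[OF vanishes_at_most_polar_numerator vanishes_at_most_polar_numerator]
  have "((\<lambda>v. ?R (p + v)) \<longlongrightarrow> 0) (at 0)"
    using polar_factor_numerator_expansion
    by (intro tendsto_quotient_if_vanishes[where k = 2]) (simp_all add: numeral_3_eq_3 numeral_2_eq_2)
  then have "((\<lambda>x. ?R x + 1) \<longlongrightarrow> 0 + 1) (at p)"
    by (intro tendsto_add tendsto_const) (simp add: at_to_0[of p] filterlim_filtermap add.commute)
  moreover have "\<forall>\<^sub>F x in at p. ?R x + 1 = - (cdot (null_tan p) (Omega x) / 2) * (of_real (rho x) / Q x)\<^sup>2"
    using polar_numerator_nonzero eventually_nonzero[of p]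
  proof eventually_elim
    case (elim x)
    show ?case unfolding mult_minus_left polar_factor_eq[OF elim(2)] using elim(1) by (simp add: diff_divide_distrib)
  qed
  ultimately show ?thesis using Lim_transform_eventually by fastforce
qed

end

lemma chart_at_zero:
  assumes p: "f p = 0"
  obtains U F d where "chart p U F d" "\<And>x. x \<in> U \<Longrightarrow> x \<noteq> p \<Longrightarrow> f x \<noteq> 0"
    "\<And>x. x \<in> U \<Longrightarrow> x \<noteq> p \<Longrightarrow> d x = - (cdot (null_tan p) (Omega x) / 2) * (F x)\<^sup>2"
proof -
  have "cdot (ccnj (null_tan p)) (ccnj (null_tan p)) = 0" by (simp add: cdot_ccnj null_tan_null)
  then obtain U G where U: "open U" "p \<in> U" "\<And>x. x \<in> U \<Longrightarrow> x \<noteq> p \<Longrightarrow> f x \<noteq> 0"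
    "\<And>x. x \<in> U \<Longrightarrow> f x \<noteq> 0 \<Longrightarrow> dz_deriv G x (cdot (ccnj (null_tan p)) (Omega x))" "continuous_on U G"
    using local_primitive by metis
  have "isCont G p" using U(1,2,5) by (simp add: continuous_on_eq_continuous_at)
  then have "\<forall>\<^sub>F x in nhds p. dist (G x) (G p) < 1"
    unfolding continuous_at_eps_delta eventually_nhds_metric by (meson zero_less_one)
  then have G: "\<forall>\<^sub>F x in nhds p. norm (G x) \<le> norm (G p) + 1"
    by (rule eventually_mono) (smt (verit) dist_norm norm_triangle_ineq2)
  define F where "F = (\<lambda>x. of_real (rho x) / polar_numerator p G x)"
  define d where "d = (\<lambda>x. if x = p then 1 else - (cdot (null_tan p) (Omega x) / 2) * (F x)\<^sup>2)"
  obtain e where e: "e > 0" "\<And>x. x \<in> ball p e \<Longrightarrow> x \<noteq> p \<Longrightarrow> polar_numerator p G x \<noteq> 0"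
    using polar_numerator_nonzero[OF p G] unfolding eventually_at by (auto simp: dist_commute)
  define V where "V = U \<inter> ball p e"
  have V: "open V" "p \<in> V" using U(1,2) e(1) by (auto simp: V_def)
  have deriv: "dz_deriv F x (d x)" if x: "x \<in> V" for x
  proof (cases "x = p")
    case True
    then show ?thesis using dz_deriv_polar_chart[OF p G] by (simp add: F_def d_def)
  next
    case False
    have nz: "f x \<noteq> 0" "polar_part p G x \<noteq> 0"
      using x False U(3) e(2) rho_eq_0_iff[of x] by (auto simp: V_def polar_part_eq)
    have F: "F y = inverse (polar_part p G y)" if "y \<in> V - {p}" for y
      using that U(3) by (simp add: F_def V_def polar_part_eq)
    have "dz_deriv (polar_part p G) x (cdot (null_tan p) (Omega x) / 2)"
      unfolding polar_part_def using x U(4) nz(1) by (intro dz_deriv_cdot_inverted) (auto simp: V_def)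
    from dz_deriv_compose[OF this, of inverse] DERIV_inverse[OF nz(2)]
    have "dz_deriv (\<lambda>x. inverse (polar_part p G x)) x (d x)"
      using False F x unfolding d_def by (fastforce simp: power2_eq_square mult_ac)
    then show ?thesis by (rule dz_deriv_transform[where U = "V - {p}"]) (use V x False F in auto)
  qed
  have "(d \<longlongrightarrow> 1) (at p)"
    using polar_chart_factor_tendsto[OF p G]
    by (rule Lim_transform_eventually) (auto simp: d_def F_def eventually_at_filter)
  then have "isCont d p" by (simp add: isCont_def d_def)
  then obtain W where W: "W \<subseteq> V" "chart p W F d"
    using chart_exists[OF V deriv] p by (auto simp: d_def F_def rho_def)
  show ?thesis by (rule that[OF W(2)]) (use W(1) U(3) in \<open>auto simp: V_def d_def\<close>)
qed

lemma chart_at_any_point: obtains U F d where "chart x0 U F d" "\<And>x. x \<in> U \<Longrightarrow> x \<noteq> x0 \<Longrightarrow> f x \<noteq> 0"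
  using chart_at_zero[of x0] chart_at_nonzero[of x0] by metis

end

section \<open>The index theorem on the torus\<close>

definition cell_boundary :: "plane \<Rightarrow> real \<Rightarrow> plane" where
  "cell_boundary a = linepath a (a + (1,0)) +++ linepath (a + (1,0)) (a + (1,1))
    +++ linepath (a + (1,1)) (a + (0,1)) +++ linepath (a + (0,1)) a"

lemma path_cell_boundary: "path (cell_boundary a)" "pathfinish (cell_boundary a) = pathstart (cell_boundary a)"
  by (auto simp: cell_boundary_def intro!: path_join_imp)

lemma path_image_cell_boundary: "path_image (cell_boundary a) \<subseteq> unit_cell a - box a (a + (1,1))" (is "_ \<subseteq> ?B")
proof -
  have "closed_segment a (a + (1,0)) \<subseteq> ?B"
    "closed_segment (a + (1,0)) (a + (1,1)) \<subseteq> ?B"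
    "closed_segment (a + (1,1)) (a + (0,1)) \<subseteq> ?B"
    "closed_segment (a + (0,1)) a \<subseteq> ?B"
    by (cases a; force simp: closed_segment_def cbox_Pair_eq mem_box Basis_prod_def algebra_simps)+
  then show ?thesis by (simp add: cell_boundary_def path_image_join)
qed

lemma cell_boundary_in: "t \<in> {0..1} \<Longrightarrow> cell_boundary a t \<in> unit_cell a - box a (a + (1,1))"
  using path_image_cell_boundary[of a] unfolding path_image_def by blast

lemma winding_number_lincoord_cell_boundary:
  assumes m: "Im m > 0" and z: "z \<in> box a (a + (1,1))"
  shows "winding_number ((\<lambda>x. lincoord m (x - z)) \<circ> cell_boundary a) 0 = 1"
proof -
  let ?loop = "\<lambda>m. (\<lambda>x. lincoord m (x - z)) \<circ> cell_boundary a"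
  have loop: "path (?loop m)"
    "pathfinish (?loop m) = pathstart (?loop m)" for m
    using path_cell_boundary[of a]
    by (auto simp: pathfinish_compose pathstart_compose lincoord_def
        intro!: path_continuous_image continuous_intros)
  have "homotopic_loops (- {0}) (?loop m)
      (?loop \<i>)"
  proof (rule homotopic_loops_linear[OF loop(1) loop(1) loop(2) loop(2)])
    fix t :: real assume "t \<in> {0..1}"
    then have "cell_boundary a t - z \<noteq> 0" using cell_boundary_in[of t a] z by auto
    moreover have "Im ((1 - u) *\<^sub>R m + u *\<^sub>R \<i>) \<noteq> 0" if "0 \<le> u" "u \<le> 1" for u
      using m that by (cases "u = 1") (auto simp: add_pos_nonneg less_imp_neq[symmetric])
    moreover have "(1 - u) *\<^sub>R lincoord m v + u *\<^sub>R lincoord \<i> v = lincoord ((1 - u) *\<^sub>R m + u *\<^sub>R \<i>) v" for u v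
      by (simp add: lincoord_def scaleR_conv_of_real algebra_simps)
    ultimately show "closed_segment ((?loop m) t)
        ((?loop \<i>) t) \<subseteq> - {0}"
      by (auto simp: closed_segment_def lincoord_eq_0_iff)
  qed
  then have "winding_number (?loop m) 0
      = winding_number (?loop \<i>) 0"
    by (rule winding_number_homotopic_loops)
  also have "?loop \<i>
      = (\<lambda>t. rectpath (lincoord \<i> a) (lincoord \<i> (a + (1,1))) t - lincoord \<i> z)"
  proof -
    have "lincoord \<i> (linepath p q t) = linepath (lincoord \<i> p) (lincoord \<i> q) t" for p q t
      by (simp add: linepath_def lincoord_simps scaleR_conv_of_real)
    moreover have "Complex (Re (lincoord \<i> (a + (1,1)))) (Im (lincoord \<i> a)) = lincoord \<i> (a + (1,0))"
      "Complex (Re (lincoord \<i> a)) (Im (lincoord \<i> (a + (1,1)))) = lincoord \<i> (a + (0,1))"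
      by (simp_all add: lincoord_def complex_eq_iff)
    ultimately show ?thesis
      by (simp add: cell_boundary_def rectpath_def Let_def joinpaths_def lincoord_simps fun_eq_iff)
  qed
  also have "winding_number (\<lambda>t. rectpath (lincoord \<i> a) (lincoord \<i> (a + (1,1))) t - lincoord \<i> z) 0 = 1"
    using z unfolding winding_number_offset[symmetric]
    by (intro winding_number_rectpath) (cases a; cases z; auto simp: lincoord_def in_box_complex_iff mem_box Basis_prod_def)
  finally show ?thesis .
qed

lemma winding_number_periodic_cell_boundary:
  fixes h :: "plane \<Rightarrow> complex"
  assumes cont: "continuous_on (path_image (cell_boundary a)) h"
    and nz: "\<And>x. x \<in> path_image (cell_boundary a) \<Longrightarrow> h x \<noteq> 0"
    and periodic: "\<And>x. h (x + (1,0)) = h x" "\<And>x. h (x + (0,1)) = h x"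
  shows "winding_number (h \<circ> cell_boundary a) 0 = 0"
proof -
  let ?bottom = "linepath a (a + (1,0))" and ?right = "linepath (a + (1,0)) (a + (1,1))"
  let ?top = "linepath (a + (0,1)) (a + (1,1))" and ?left = "linepath a (a + (0,1))"
  have split: "cell_boundary a = ?bottom +++ ?right +++ reversepath ?top +++ reversepath ?left"
    by (simp add: cell_boundary_def)
  have side: "path (h \<circ> p)" "0 \<notin> path_image (h \<circ> p)" if "p \<in> {?bottom, ?right, ?top, ?left}" for p
  proof -
    have sub: "path_image p \<subseteq> path_image (cell_boundary a)" and "path p"
      using that unfolding split by (auto simp: path_image_join closed_segment_commute)
    then show "path (h \<circ> p)" using cont continuous_on_subset by (intro path_continuous_image) auto
    show "0 \<notin> path_image (h \<circ> p)" using sub nz by (auto simp: path_image_compose)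
  qed
  have sides: "?top t = ?bottom t + (0,1)" "?right t = ?left t + (1,0)" for t
    by (simp_all add: linepath_def algebra_simps)
  have "winding_number (h \<circ> ?top) 0 = winding_number (h \<circ> ?bottom) 0"
    "winding_number (h \<circ> ?right) 0 = winding_number (h \<circ> ?left) 0"
    by (intro winding_number_cong, simp only: o_def sides periodic)+
  then show ?thesis
    unfolding split path_compose_join path_compose_reversepath
    using side[of ?bottom] side[of ?right] side[of ?top] side[of ?left]
    by (simp add: winding_number_join winding_number_reversepath path_image_join pathstart_compose pathfinish_compose)
qed

lemma lincoord_logarithm_on_cell_boundary:
  assumes m: "Im m > 0" and z: "z \<in> box a (a + (1,1))"
  shows "\<exists>q. path q \<and> pathfinish q - pathstart q = 2 * of_real pi * \<i>
    \<and> (\<forall>t\<in>{0..1}. lincoord m (cell_boundary a t - z) = exp (q t))"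
proof -
  let ?g = "(\<lambda>x. lincoord m (x - z)) \<circ> cell_boundary a"
  have "path ?g"
    using path_cell_boundary(1) unfolding lincoord_def by (intro path_continuous_image continuous_intros)
  moreover have "cell_boundary a t \<noteq> z" if "t \<in> {0..1}" for t using cell_boundary_in[OF that, of a] z by auto
  then have "0 \<notin> path_image ?g" using m by (auto simp: path_image_def lincoord_eq_0_iff)
  ultimately obtain q where "path q" "pathfinish q - pathstart q = 2 * of_real pi * \<i> * winding_number ?g 0"
    "\<And>t. t \<in> {0..1} \<Longrightarrow> ?g t = 0 + exp (q t)"
    by (metis winding_number_as_continuous_log)
  then show ?thesis using winding_number_lincoord_cell_boundary[OF m z] by (intro exI[of _ q]) simp
qed

text \<open>Near each \<open>z \<in> Z\<close> the function \<open>\<alpha>\<close> behaves like \<open>lincoord (m z) (x - z) ^ k z\<close>. A continuous logarithm of the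
  regularisation of \<open>\<alpha>\<close>, together with logarithms of the linear coordinates along the boundary of the cell, yields
  a logarithm of \<open>\<alpha>\<close> along the boundary; by periodicity the latter has no increment.\<close>

context
  fixes \<alpha> :: "plane \<Rightarrow> complex" and k :: "plane \<Rightarrow> int" and m c :: "plane \<Rightarrow> complex" and Z a
  assumes finite_Z: "finite Z" and cont: "continuous_on (unit_cell a - Z) \<alpha>"
    and m: "\<And>z. z \<in> Z \<Longrightarrow> Im (m z) > 0"
    and lim: "\<And>z. z \<in> Z \<Longrightarrow> ((\<lambda>x. \<alpha> x * lincoord (m z) (x - z) powi (- k z)) \<longlongrightarrow> c z) (at z)"
begin

abbreviation "factor w x \<equiv> lincoord (m w) (x - w) powi (- k w)"

definition "regularisation x =
  (if x \<in> Z then c x * (\<Prod>w\<in>Z - {x}. factor w x) else \<alpha> x * (\<Prod>w\<in>Z. factor w x))"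

lemma continuous_regularisation: "continuous_on (unit_cell a) regularisation"
  unfolding continuous_on
proof
  let ?T = "unit_cell a"
  have p_lim: "(factor w \<longlongrightarrow> factor w x) (at x within S)" if "w \<in> Z" "x \<noteq> w" for w x S
  proof -
    have "((\<lambda>y. lincoord (m w) (y - w)) \<longlongrightarrow> lincoord (m w) (x - w)) (at x within S)"
      unfolding lincoord_def by (intro tendsto_intros)
    then show ?thesis using that m[of w] by (intro tendsto_power_int) (auto simp: lincoord_eq_0_iff)
  qed
  have off: "\<forall>\<^sub>F y in at x within S. y \<notin> Z" for x S
    using islimpt_finite[OF finite_Z, of x] filter_leD[OF at_le[OF subset_UNIV]] by (metis islimpt_iff_eventually)
  fix x assume x: "x \<in> ?T"
  show "(regularisation \<longlongrightarrow> regularisation x) (at x within ?T)"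
  proof (cases "x \<in> Z")
    case True
    have "((\<lambda>y. (\<alpha> y * factor x y) * (\<Prod>w\<in>Z - {x}. factor w y)) \<longlongrightarrow> c x * (\<Prod>w\<in>Z - {x}. factor w x)) (at x within ?T)"
      using True by (intro tendsto_mult tendsto_prod tendsto_within_subset[OF lim[OF True]] p_lim) auto
    moreover have "\<forall>\<^sub>F y in at x within ?T. (\<alpha> y * factor x y) * (\<Prod>w\<in>Z - {x}. factor w y) = regularisation y"
      using off by (rule eventually_mono) (simp add: regularisation_def prod.remove[OF finite_Z True] mult.assoc)
    ultimately show ?thesis using True by (simp add: regularisation_def Lim_transform_eventually)
  next
    case False
    have "open (- Z)" using finite_Z by (simp add: finite_imp_closed open_Compl)
    have "(\<alpha> \<longlongrightarrow> \<alpha> x) (at x within ?T - Z)" using cont x False by (simp add: continuous_on)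
    moreover have "at x within ?T = at x within ?T - Z"
      using \<open>open (- Z)\<close> False by (intro at_within_nhd[of x "- Z"]) auto
    ultimately have "(\<alpha> \<longlongrightarrow> \<alpha> x) (at x within ?T)" by simp
    then have "((\<lambda>y. \<alpha> y * (\<Prod>w\<in>Z. factor w y)) \<longlongrightarrow> \<alpha> x * (\<Prod>w\<in>Z. factor w x)) (at x within ?T)"
      using False by (intro tendsto_mult tendsto_prod p_lim) auto
    moreover have "\<forall>\<^sub>F y in at x within ?T. \<alpha> y * (\<Prod>w\<in>Z. factor w y) = regularisation y"
      using off by (rule eventually_mono) (simp add: regularisation_def)
    ultimately show ?thesis using False by (simp add: regularisation_def Lim_transform_eventually)
  qed
qed

lemma logarithm_of_regularisation:
  assumes nz: "\<And>x. x \<in> unit_cell a - Z \<Longrightarrow> \<alpha> x \<noteq> 0" and c: "\<And>z. z \<in> Z \<Longrightarrow> c z \<noteq> 0"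
  shows "\<exists>g. continuous_on (unit_cell a) g \<and> (\<forall>x\<in>unit_cell a - Z. \<alpha> x * (\<Prod>w\<in>Z. factor w x) = exp (g x))"
proof -
  have "regularisation x \<noteq> 0" if "x \<in> unit_cell a" for x
    using that nz c m finite_Z
    by (auto simp: regularisation_def prod_zero_iff lincoord_eq_0_iff less_imp_neq[symmetric])
  then obtain g where g: "continuous_on (unit_cell a) g" "\<And>x. x \<in> unit_cell a \<Longrightarrow> regularisation x = exp (g x)"
    using continuous_logarithm_on_contractible[OF continuous_regularisation] convex_imp_contractible
    by (metis convex_box(1))
  have "\<alpha> x * (\<Prod>w\<in>Z. factor w x) = exp (g x)" if "x \<in> unit_cell a - Z" for x
    using g(2)[of x] that by (simp add: regularisation_def)
  then show ?thesis using g(1) by blast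
qed

lemma total_index_zero:
  assumes Z: "Z \<subseteq> box a (a + (1,1))" and nz: "\<And>x. x \<in> unit_cell a - Z \<Longrightarrow> \<alpha> x \<noteq> 0" and c: "\<And>z. z \<in> Z \<Longrightarrow> c z \<noteq> 0"
    and periodic: "\<And>x. \<alpha> (x + (1,0)) = \<alpha> x" "\<And>x. \<alpha> (x + (0,1)) = \<alpha> x"
  shows "(\<Sum>z\<in>Z. k z) = 0"
proof -
  let ?\<gamma> = "cell_boundary a"
  obtain g where g: "continuous_on (unit_cell a) g" "\<And>x. x \<in> unit_cell a - Z \<Longrightarrow> \<alpha> x * (\<Prod>w\<in>Z. factor w x) = exp (g x)"
    using logarithm_of_regularisation[OF nz c] by blast
  have \<gamma>: "?\<gamma> t \<in> unit_cell a - Z" if "t \<in> {0..1}" for t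
    using cell_boundary_in[OF that, of a] Z by auto
  have "\<exists>q. path q \<and> pathfinish q - pathstart q = 2 * of_real pi * \<i>
      \<and> (\<forall>t\<in>{0..1}. lincoord (m z) (?\<gamma> t - z) = exp (q t))" if z: "z \<in> Z" for z
    using lincoord_logarithm_on_cell_boundary[OF m[OF z]] z Z by blast
  then obtain q where q: "\<And>z. z \<in> Z \<Longrightarrow> path (q z)"
    "\<And>z. z \<in> Z \<Longrightarrow> pathfinish (q z) - pathstart (q z) = 2 * of_real pi * \<i>"
    "\<And>z t. z \<in> Z \<Longrightarrow> t \<in> {0..1} \<Longrightarrow> lincoord (m z) (?\<gamma> t - z) = exp (q z t)"
    by metis
  define L where "L = (\<lambda>t. g (?\<gamma> t) + (\<Sum>z\<in>Z. of_int (k z) * q z t))"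
  have "path L"
    unfolding path_def L_def
    using q(1) g(1) path_cell_boundary(1)[of a] \<gamma>
    by (intro continuous_intros continuous_on_compose2[OF g(1)]) (auto simp: path_def)
  have \<alpha>_L: "\<alpha> (?\<gamma> t) = exp (L t)" if t: "t \<in> {0..1}" for t
  proof -
    have "exp (L t) = \<alpha> (?\<gamma> t) * (\<Prod>z\<in>Z. factor z (?\<gamma> t)) * (\<Prod>z\<in>Z. exp (q z t) powi k z)"
      using g(2)[OF \<gamma>[OF t]] by (simp add: L_def exp_add exp_sum[OF finite_Z] exp_power_int mult.commute)
    also have "\<dots> = \<alpha> (?\<gamma> t) * (\<Prod>z\<in>Z. factor z (?\<gamma> t) * lincoord (m z) (?\<gamma> t - z) powi k z)"
      using q(3)[OF _ t] by (simp add: prod.distrib mult.assoc)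
    also have "(\<Prod>z\<in>Z. factor z (?\<gamma> t) * lincoord (m z) (?\<gamma> t - z) powi k z) = 1"
      using q(3)[OF _ t] by (intro prod.neutral) (simp add: power_int_minus)
    finally show ?thesis by simp
  qed
  have "winding_number (\<alpha> \<circ> ?\<gamma>) 0 = 0"
  proof (rule winding_number_periodic_cell_boundary[OF _ _ periodic])
    have "path_image ?\<gamma> \<subseteq> unit_cell a - Z" using \<gamma> by (auto simp: path_image_def)
    then show "continuous_on (path_image ?\<gamma>) \<alpha>" "\<And>x. x \<in> path_image ?\<gamma> \<Longrightarrow> \<alpha> x \<noteq> 0"
      using continuous_on_subset[OF cont] nz by blast+
  qed
  moreover have "winding_number (\<alpha> \<circ> ?\<gamma>) 0 = winding_number (exp \<circ> L) 0"
    by (rule winding_number_cong) (simp add: \<alpha>_L)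
  moreover have "winding_number (exp \<circ> L) 0 = (pathfinish L - pathstart L) / (2 * of_real pi * \<i>)"
    by (rule winding_number_compose_exp[OF \<open>path L\<close>])
  moreover have "pathfinish L - pathstart L = (\<Sum>z\<in>Z. of_int (k z) * (2 * of_real pi * \<i>))"
    using q(2) path_cell_boundary(2)[of a]
    by (simp add: L_def pathfinish_def pathstart_def sum_subtractf[symmetric] right_diff_distrib[symmetric])
  ultimately have "of_int (\<Sum>z\<in>Z. k z) * (2 * of_real pi * \<i>) = 0" by (simp add: sum_distrib_right)
  then have "(of_int (\<Sum>z\<in>Z. k z) :: complex) = 0" by simp
  then show ?thesis by (simp only: of_int_eq_0_iff)
qed

end

section \<open>Orders of functions and differentials on the torus\<close>

context immersed_torus
begin

definition has_order :: "(plane \<Rightarrow> complex) \<Rightarrow> plane \<Rightarrow> int \<Rightarrow> bool" where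
  "has_order \<alpha> x k \<longleftrightarrow> (\<exists>c. c \<noteq> 0 \<and> ((\<lambda>y. \<alpha> y * dz x (y - x) powi (- k)) \<longlongrightarrow> c) (at x))"

lemma dz_eq_0_iff: "dz x v = 0 \<longleftrightarrow> v = 0"
  by (simp add: dz_def lincoord_eq_0_iff)

lemma has_order_0_iff: "has_order \<alpha> x 0 \<longleftrightarrow> (\<exists>c. c \<noteq> 0 \<and> (\<alpha> \<longlongrightarrow> c) (at x))"
  by (simp add: has_order_def)

lemma chart_over_dz_tendsto:
  assumes "chart x U F d" shows "((\<lambda>y. F y / dz x (y - x)) \<longlongrightarrow> d x) (at x)"
proof -
  note c = chartD[OF assms]
  obtain b where b: "b > 0" "\<And>v. b * norm v \<le> norm (dz x v)" using dz_lower_bound by blast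
  have "(F has_derivative (\<lambda>v. dz x v * d x)) (at x)" using c(2,4) by (simp add: dz_deriv_def)
  then have "((\<lambda>y. inverse b * (norm (F y - F x - dz x (y - x) * d x) / norm (y - x))) \<longlongrightarrow> inverse b * 0) (at x)"
    unfolding has_derivative_iff_norm by (intro tendsto_mult_left) simp
  then have lim: "((\<lambda>y. inverse b * (norm (F y - dz x (y - x) * d x) / norm (y - x))) \<longlongrightarrow> 0) (at x)"
    by (simp add: c(6))
  have "norm (F y / dz x (y - x) - d x) \<le> inverse b * (norm (F y - dz x (y - x) * d x) / norm (y - x))"
    if "y \<noteq> x" for y
  proof -
    have "F y / dz x (y - x) - d x = (F y - dz x (y - x) * d x) / dz x (y - x)"
      using that by (simp add: diff_divide_distrib dz_eq_0_iff)
    then have "norm (F y / dz x (y - x) - d x) = norm (F y - dz x (y - x) * d x) / norm (dz x (y - x))"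
      by (simp add: norm_divide)
    also have "\<dots> \<le> norm (F y - dz x (y - x) * d x) / (b * norm (y - x))"
      using b that by (intro divide_left_mono) (auto simp: dz_eq_0_iff)
    finally show ?thesis by (simp add: field_simps)
  qed
  then have "((\<lambda>y. F y / dz x (y - x) - d x) \<longlongrightarrow> 0) (at x)"
    by (intro Lim_null_comparison[OF _ lim]) (simp add: eventually_at_filter)
  then show ?thesis by (simp add: Lim_null[symmetric])
qed

lemma chart_filterlim_at_0:
  assumes "chart x U F d" shows "filterlim F (at 0) (at x)"
proof -
  note c = chartD[OF assms]
  have "\<forall>\<^sub>F y in at x. y \<in> U - {x}" by (rule eventually_at_in_open[OF c(1,2)])
  then have "\<forall>\<^sub>F y in at x. F y \<noteq> 0"
  proof eventually_elim
    case (elim y)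
    then show ?case using inj_onD[OF c(3), of y x] c(2,6) by auto
  qed
  then show ?thesis using dz_deriv_isCont[OF c(4)[OF c(2)]] c(6) by (simp add: filterlim_at isCont_def)
qed

lemma has_order_if_chart_power:
  assumes c: "chart x U F d" and v: "(v \<longlongrightarrow> v0) (at x)" "v0 \<noteq> 0"
    and \<alpha>: "\<forall>\<^sub>F y in at x. \<alpha> y = F y powi k * v y"
  shows "has_order \<alpha> x k"
proof -
  have dx: "d x \<noteq> 0" using chartD(2,5)[OF c] by blast
  have "((\<lambda>y. (F y / dz x (y - x)) powi k * v y) \<longlongrightarrow> d x powi k * v0) (at x)"
    using dx by (intro tendsto_intros tendsto_power_int chart_over_dz_tendsto[OF c] v) auto
  moreover have "\<forall>\<^sub>F y in at x. (F y / dz x (y - x)) powi k * v y = \<alpha> y * dz x (y - x) powi (- k)"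
    using \<alpha> by eventually_elim (simp add: power_int_divide_distrib power_int_minus_divide)
  ultimately have "((\<lambda>y. \<alpha> y * dz x (y - x) powi (- k)) \<longlongrightarrow> d x powi k * v0) (at x)"
    by (rule Lim_transform_eventually)
  moreover have "d x powi k * v0 \<noteq> 0" using dx v(2) by simp
  ultimately show ?thesis unfolding has_order_def by blast
qed

lemma holomorphic_has_order:
  assumes c: "chart x U F d" and h: "h holomorphic_on ball 0 r" "r > 0" "\<exists>z\<in>ball 0 r. h z \<noteq> 0"
    and v: "(v \<longlongrightarrow> v0) (at x)" "v0 \<noteq> 0" and \<alpha>: "\<forall>\<^sub>F y in at x. \<alpha> y = h (F y) * v y"
  shows "\<exists>k::nat. has_order \<alpha> x (int k) \<and> (h 0 = 0 \<longrightarrow> k > 0)" "\<forall>\<^sub>F y in at x. \<alpha> y \<noteq> 0"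
proof -
  define g where "g = zor_poly h 0"
  define k where "k = nat (zorder h 0)"
  have "0 \<in> ball 0 r" using h(2) by simp
  note zorder = zorder_exist_zero[OF h(1) open_ball connected_ball this h(3)]
  have k_pos: "k > 0" if "h 0 = 0" using zorder that by (simp add: k_def)
  obtain s where "s > 0 \<and> cball (0::complex) s \<subseteq> ball 0 r \<and> g holomorphic_on cball 0 s
      \<and> (\<forall>w\<in>cball 0 s. h w = g w * (w - 0) ^ k \<and> g w \<noteq> 0)"
    using conjunct2[OF zorder, folded g_def k_def] ..
  then have s: "s > 0" "g holomorphic_on cball 0 s" "\<And>w. w \<in> cball 0 s \<Longrightarrow> h w = g w * w ^ k"
    "\<And>w. w \<in> cball 0 s \<Longrightarrow> g w \<noteq> 0" by simp_all
  note F = chart_filterlim_at_0[OF c]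
  have "(g \<longlongrightarrow> g 0) (at 0)"
    using continuous_on_interior[OF holomorphic_on_imp_continuous_on[OF s(2)], of 0] s(1)
    by (simp add: isCont_def)
  then have gv: "((\<lambda>y. g (F y) * v y) \<longlongrightarrow> g 0 * v0) (at x)" by (intro tendsto_mult v filterlim_compose[OF _ F])
  have "\<forall>\<^sub>F z in at 0. z \<in> cball (0::complex) s - {0}"
    using eventually_at_in_open[OF open_ball, of 0 0 s] s(1) by (auto elim!: eventually_mono)
  then have near: "\<forall>\<^sub>F y in at x. F y \<in> cball 0 s - {0}" by (rule eventually_compose_filterlim[OF _ F])
  have "\<forall>\<^sub>F y in at x. \<alpha> y = F y powi int k * (g (F y) * v y)"
    using \<alpha> near by eventually_elim (simp add: s(3))
  moreover have "g 0 * v0 \<noteq> 0" using s(1,4) v(2) by simp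
  ultimately have "has_order \<alpha> x (int k)" using has_order_if_chart_power[OF c gv] by blast
  then show "\<exists>k::nat. has_order \<alpha> x (int k) \<and> (h 0 = 0 \<longrightarrow> k > 0)" using k_pos by blast
  show "\<forall>\<^sub>F y in at x. \<alpha> y \<noteq> 0"
    using \<alpha> near tendsto_imp_eventually_ne[OF v(1,2)] by eventually_elim (simp add: s(3,4))
qed

lemma holomorphic_on_inv_into_chart:
  assumes c: "chart x U F d" and V: "open V" "V \<subseteq> U" and G: "\<And>y. y \<in> V \<Longrightarrow> \<exists>g. dz_deriv G y g"
  shows "(\<lambda>z. G (inv_into U F z)) holomorphic_on F ` V"
  unfolding holomorphic_on_def
proof
  fix z assume "z \<in> F ` V"
  then obtain y g where y: "y \<in> V" "y \<in> U" "z = F y" "dz_deriv G y g" using G V by blast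
  have "((\<lambda>z. G (inv_into U F z)) has_field_derivative g / d y) (at z)"
    unfolding y(3) using chartD[OF c] y by (intro has_field_derivative_inv_into_dz_deriv) auto
  then show "(\<lambda>z. G (inv_into U F z)) field_differentiable at z within F ` V"
    using field_differentiable_at_within field_differentiable_def by blast
qed

lemma dz_deriv_holomorphic_compose:
  assumes "h holomorphic_on S" "open S" "dz_deriv F y g" "F y \<in> S"
  shows "dz_deriv (\<lambda>y. h (F y)) y (deriv h (F y) * g)"
  by (rule dz_deriv_compose[OF assms(3) holomorphic_derivI[OF assms(1,2,4)]])

lemma chart_factorisation:
  assumes c: "chart x U F d" "F ` U = ball 0 r" and G: "\<And>y. y \<in> U \<Longrightarrow> dz_deriv G y (\<alpha> y)"
  obtains h where "h holomorphic_on ball 0 r" "\<And>y. y \<in> U \<Longrightarrow> G y = h (F y)"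
    "\<And>y. y \<in> U \<Longrightarrow> \<alpha> y = deriv h (F y) * d y"
proof
  let ?h = "\<lambda>z. G (inv_into U F z)"
  note cd = chartD[OF c(1)]
  show hol: "?h holomorphic_on ball 0 r"
    using holomorphic_on_inv_into_chart[OF c(1) cd(1) order_refl] G c(2) by metis
  show eq: "G y = ?h (F y)" if "y \<in> U" for y using cd(3) that by simp
  show "\<alpha> y = deriv ?h (F y) * d y" if y: "y \<in> U" for y
  proof (rule dz_deriv_unique[OF G[OF y]])
    have "F y \<in> ball 0 r" using c(2) y by blast
    from dz_deriv_holomorphic_compose[OF hol open_ball cd(4)[OF y] this]
    show "dz_deriv G y (deriv ?h (F y) * d y)"
      by (rule dz_deriv_transform[OF _ cd(1) y]) (simp add: eq)
  qed
qed

end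

context willmore_torus
begin

lemma chart_disc:
  assumes "open W" "x \<in> W"
  obtains U F d r where "chart x U F d" "U \<subseteq> W" "r > 0" "F ` U = ball 0 r" "\<And>y. y \<in> U \<Longrightarrow> y \<noteq> x \<Longrightarrow> f y \<noteq> 0"
proof -
  obtain U F d where U: "chart x U F d" "\<And>y. y \<in> U \<Longrightarrow> y \<noteq> x \<Longrightarrow> f y \<noteq> 0" using chart_at_any_point by metis
  from chart_ball_image[OF chart_restrict[OF U(1) assms]] obtain V r where
    "V \<subseteq> U \<inter> W" "r > 0" "chart x V F d" "F ` V = ball 0 r" by blast
  then show ?thesis using that U(2) by blast
qed

lemma disc_factorisation:
  assumes "open W" "x \<in> W" "\<And>y. y \<in> W \<Longrightarrow> dz_deriv G y (\<alpha> y)"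
  obtains U F d r h where "chart x U F d" "U \<subseteq> W" "r > 0" "F ` U = ball 0 r" "h holomorphic_on ball 0 r"
    "\<And>y. y \<in> U \<Longrightarrow> G y = h (F y)" "\<And>y. y \<in> U \<Longrightarrow> \<alpha> y = deriv h (F y) * d y"
proof (rule chart_disc[OF assms(1,2)])
  fix U F d r assume c: "chart x U F d" "U \<subseteq> W" "r > 0" "F ` U = ball 0 r"
  have "dz_deriv G y (\<alpha> y)" if "y \<in> U" for y using assms(3) c(2) that by blast
  from chart_factorisation[OF c(1,4) this] show thesis using that[OF c] by metis
qed

lemma dz_deriv_factor_isCont:
  assumes "open W" "x \<in> W" "\<And>y. y \<in> W \<Longrightarrow> dz_deriv G y (\<alpha> y)" shows "isCont \<alpha> x"
proof -
  obtain U F d r h where c: "chart x U F d" "r > 0" and h: "h holomorphic_on ball 0 r" "\<And>y. y \<in> U \<Longrightarrow> \<alpha> y = deriv h (F y) * d y"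
    using disc_factorisation[OF assms] by metis
  note cd = chartD[OF c(1)]
  have "isCont (deriv h) (F x)"
    using holomorphic_on_imp_continuous_on[OF holomorphic_deriv[OF h(1) open_ball]] cd(6) c(2)
    by (simp add: continuous_on_eq_continuous_at)
  then have "isCont (\<lambda>y. deriv h (F y) * d y) x"
    using isCont_o2[OF dz_deriv_isCont[OF cd(4)[OF cd(2)]], of "deriv h"] cd(7) by (intro continuous_intros) auto
  then have "((\<lambda>y. deriv h (F y) * d y) \<longlongrightarrow> \<alpha> x) (at x)" using h(2)[OF cd(2)] by (simp add: isCont_def)
  moreover have "\<forall>\<^sub>F y in at x. deriv h (F y) * d y = \<alpha> y"
    using eventually_at_in_open[OF cd(1,2)] by (rule eventually_mono) (use h(2) in auto)
  ultimately show ?thesis unfolding isCont_def by (rule Lim_transform_eventually)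
qed

lemma dz_deriv_removable:
  assumes W: "open W" "x \<in> W" "\<And>y. y \<in> W - {x} \<Longrightarrow> \<exists>g. dz_deriv G y g" and lim: "(G \<longlongrightarrow> l) (at x)"
  shows "\<exists>g. dz_deriv (G(x := l)) x g"
proof -
  obtain U F d r where c: "chart x U F d" "U \<subseteq> W" "r > 0" "F ` U = ball 0 r"
    using chart_disc[OF W(1,2)] by metis
  note cd = chartD[OF c(1)]
  note image = chart_image_punctured[OF c(1,4)]
  have inv: "inv_into U F (F y) = y" if "y \<in> U" for y using cd(3) that by simp
  have "(\<lambda>z. G (inv_into U F z)) holomorphic_on ball 0 r - {0}"
    unfolding image[symmetric] using W(3) c(2) cd(1)
    by (intro holomorphic_on_inv_into_chart[OF c(1)]) (auto simp: open_delete)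
  moreover have "((\<lambda>z. G (inv_into U F z)) \<longlongrightarrow> l) (at 0)"
    by (rule filterlim_compose[OF lim chart_filterlim(1)[OF c(1)]])
  ultimately obtain h where h: "h holomorphic_on ball 0 r" "\<And>z. z \<in> ball 0 r - {0} \<Longrightarrow> h z = G (inv_into U F z)"
    using holomorphic_on_extend_lim[of "\<lambda>z. G (inv_into U F z)" "ball 0 r" 0] c(3)
      tendsto_mult[OF tendsto_ident_at] by fastforce
  have G: "G y = h (F y)" if "y \<in> U - {x}" for y
  proof -
    have "F y \<in> ball 0 r - {0}" unfolding image[symmetric] using that by blast
    then show ?thesis using h(2) inv that by simp
  qed
  have deriv: "dz_deriv (\<lambda>y. h (F y)) x (deriv h (F x) * d x)"
    using c(3) cd(6) by (intro dz_deriv_holomorphic_compose[OF h(1) open_ball cd(4)[OF cd(2)]]) simp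
  have "\<forall>\<^sub>F y in at x. h (F y) = G y"
    using eventually_at_in_open[OF cd(1,2)] by (rule eventually_mono) (simp add: G)
  moreover have "((\<lambda>y. h (F y)) \<longlongrightarrow> h (F x)) (at x)" using dz_deriv_isCont[OF deriv] by (simp add: isCont_def)
  ultimately have "(G \<longlongrightarrow> h (F x)) (at x)" by (rule Lim_transform_eventually[rotated])
  then have "h (F x) = l" using lim LIM_unique by blast
  then have "dz_deriv (G(x := l)) x (deriv h (F x) * d x)"
    by (intro dz_deriv_transform[OF deriv cd(1,2)]) (auto simp: G)
  then show ?thesis ..
qed

context
  fixes W x G \<alpha>
  assumes W: "open W" "x \<in> W" and G: "\<And>y. y \<in> W \<Longrightarrow> dz_deriv G y (\<alpha> y)" and nz: "\<not> (\<forall>\<^sub>F y in nhds x. \<alpha> y = 0)"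
begin

lemma disc_factorisation_nonconstant:
  obtains U F d r h where "chart x U F d" "r > 0" "h holomorphic_on ball 0 r" "\<exists>z\<in>ball 0 r. deriv h z \<noteq> 0"
    "\<And>y. y \<in> U \<Longrightarrow> G y = h (F y)" "\<And>y. y \<in> U \<Longrightarrow> \<alpha> y = deriv h (F y) * d y"
proof -
  obtain U F d r h where c: "chart x U F d" "r > 0" "F ` U = ball 0 r" "h holomorphic_on ball 0 r"
    and h: "\<And>y. y \<in> U \<Longrightarrow> G y = h (F y)" "\<And>y. y \<in> U \<Longrightarrow> \<alpha> y = deriv h (F y) * d y"
    using disc_factorisation[OF W G] by metis
  have "\<exists>z\<in>ball 0 r. deriv h z \<noteq> 0"
  proof (rule ccontr)
    assume "\<not> ?thesis"
    then have "\<alpha> y = 0" if "y \<in> U" for y using that h(2) c(3) by auto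
    then show False using nz chartD(1,2)[OF c(1)] eventually_nhds by blast
  qed
  then show ?thesis using that c(1,2,4) h by blast
qed

lemma dz_deriv_factor_has_order: "\<exists>k::nat. has_order \<alpha> x (int k)"
  and dz_deriv_factor_isolated_zero: "\<forall>\<^sub>F y in at x. \<alpha> y \<noteq> 0"
proof -
  obtain U F d r h where c: "chart x U F d" "r > 0" "h holomorphic_on ball 0 r" "\<exists>z\<in>ball 0 r. deriv h z \<noteq> 0"
    and h: "\<And>y. y \<in> U \<Longrightarrow> \<alpha> y = deriv h (F y) * d y" using disc_factorisation_nonconstant by metis
  note cd = chartD[OF c(1)]
  have d: "(d \<longlongrightarrow> d x) (at x)" "d x \<noteq> 0" using cd(2,5,7) by (auto simp: isCont_def)
  have "\<forall>\<^sub>F y in at x. \<alpha> y = deriv h (F y) * d y"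
    using eventually_at_in_open[OF cd(1,2)] by eventually_elim (simp add: h)
  from holomorphic_has_order[OF c(1) holomorphic_deriv[OF c(3) open_ball] c(2,4) d this]
  show "\<exists>k::nat. has_order \<alpha> x (int k)" "\<forall>\<^sub>F y in at x. \<alpha> y \<noteq> 0" by blast+
qed

lemma dz_deriv_increment_has_order: "\<exists>k::nat. has_order (\<lambda>y. G y - G x) x (int k) \<and> k > 0 \<and> (\<alpha> x = 0 \<longrightarrow> k > 1)"
  and dz_deriv_isolated_value: "\<forall>\<^sub>F y in at x. G y \<noteq> G x"
proof -
  obtain U F d r h where c: "chart x U F d" "r > 0" "h holomorphic_on ball 0 r" "\<exists>z\<in>ball 0 r. deriv h z \<noteq> 0"
    and h: "\<And>y. y \<in> U \<Longrightarrow> G y = h (F y)" "\<And>y. y \<in> U \<Longrightarrow> \<alpha> y = deriv h (F y) * d y" using disc_factorisation_nonconstant by metis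
  note cd = chartD[OF c(1)]
  have near: "\<forall>\<^sub>F y in at x. y \<in> U - {x}" by (rule eventually_at_in_open[OF cd(1,2)])
  have "\<exists>z\<in>ball 0 r. h z - h 0 \<noteq> 0"
  proof (rule ccontr)
    assume "\<not> ?thesis"
    then have "deriv h z = 0" if "z \<in> ball 0 r" for z
      using that complex_derivative_transform_within_open[OF c(3) holomorphic_on_const open_ball that, of "h 0"] by simp
    then show False using c(4) by blast
  qed
  moreover have "\<forall>\<^sub>F y in at x. G y - G x = (h (F y) - h 0) * 1"
    using near by eventually_elim (simp add: h(1) cd(2,6))
  moreover have "(\<lambda>z. h z - h 0) holomorphic_on ball 0 r" by (intro holomorphic_intros c(3))
  ultimately have order: "\<exists>k::nat. has_order (\<lambda>y. G y - G x) x (int k) \<and> k > 0" "\<forall>\<^sub>F y in at x. G y - G x \<noteq> 0"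
    using holomorphic_has_order[OF c(1) _ c(2) _ tendsto_const, of "\<lambda>z. h z - h 0" 1 "\<lambda>y. G y - G x"] by auto
  then show "\<forall>\<^sub>F y in at x. G y \<noteq> G x" by simp
  obtain k :: nat where k: "has_order (\<lambda>y. G y - G x) x (int k)" "k > 0" using order(1) by blast
  have "k \<noteq> 1" if "\<alpha> x = 0"
  proof
    assume "k = 1"
    then obtain l where l: "l \<noteq> 0" "((\<lambda>y. (G y - G x) * dz x (y - x) powi (- 1)) \<longlongrightarrow> l) (at x)"
      using k(1) by (auto simp: has_order_def)
    have "deriv h 0 = 0" using that h(2)[OF cd(2)] cd(2,5,6) by simp
    then have "((\<lambda>z. (h z - h 0) / (z - 0)) \<longlongrightarrow> 0) (at 0)"
      using holomorphic_derivI[OF c(3) open_ball, of 0] c(2) by (simp add: has_field_derivative_iff)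
    from tendsto_mult[OF filterlim_compose[OF this chart_filterlim_at_0[OF c(1)]] chart_over_dz_tendsto[OF c(1)]]
    have "((\<lambda>y. (h (F y) - h 0) / F y * (F y / dz x (y - x))) \<longlongrightarrow> 0) (at x)" by simp
    moreover have "\<forall>\<^sub>F y in at x. (h (F y) - h 0) / F y * (F y / dz x (y - x)) = (G y - G x) * dz x (y - x) powi (- 1)"
      using near by eventually_elim (use chart_nonzero[OF c(1)] in \<open>simp add: h(1) cd(2,6) power_int_minus divide_inverse\<close>)
    ultimately have "((\<lambda>y. (G y - G x) * dz x (y - x) powi (- 1)) \<longlongrightarrow> 0) (at x)" by (rule Lim_transform_eventually)
    then show False using l LIM_unique by blast
  qed
  then show "\<exists>k::nat. has_order (\<lambda>y. G y - G x) x (int k) \<and> k > 0 \<and> (\<alpha> x = 0 \<longrightarrow> k > 1)"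
    using k by (metis less_one nat_neq_iff)
qed

end

lemma dz_deriv_identity:
  assumes W: "open W" "connected W" and G: "\<And>y. y \<in> W \<Longrightarrow> dz_deriv G y (\<alpha> y)"
    and x0: "x0 \<in> W" "\<forall>\<^sub>F y in nhds x0. \<alpha> y = 0" and x: "x \<in> W"
  shows "\<alpha> x = 0"
proof -
  define A where "A = {x \<in> W. \<forall>\<^sub>F y in nhds x. \<alpha> y = 0}"
  have "open A"
  proof (subst open_subopen, intro ballI)
    fix y assume "y \<in> A"
    then obtain T where "open T" "y \<in> T" "\<forall>z\<in>T. \<alpha> z = 0" "y \<in> W" by (auto simp: A_def eventually_nhds)
    then show "\<exists>T. open T \<and> y \<in> T \<and> T \<subseteq> A"
      using W(1) by (intro exI[of _ "T \<inter> W"]) (auto simp: A_def eventually_nhds)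
  qed
  moreover have "open (W - A)"
  proof (subst open_subopen, intro ballI)
    fix y assume y: "y \<in> W - A"
    then have "y \<in> W" "\<not> (\<forall>\<^sub>F z in nhds y. \<alpha> z = 0)" by (auto simp: A_def)
    then have "\<forall>\<^sub>F z in at y. \<alpha> z \<noteq> 0" using dz_deriv_factor_isolated_zero[OF W(1) _ G] by blast
    then obtain T where T: "open T" "y \<in> T" "\<And>z. z \<in> T \<Longrightarrow> z \<noteq> y \<Longrightarrow> \<alpha> z \<noteq> 0"
      unfolding eventually_at_topological by blast
    have "z \<notin> A" if "z \<in> T" for z using that y T(3) eventually_nhds_x_imp_x by (fastforce simp: A_def)
    then show "\<exists>T. open T \<and> y \<in> T \<and> T \<subseteq> W - A" using T(1,2) W(1) y by (intro exI[of _ "T \<inter> W"]) auto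
  qed
  ultimately have "A \<inter> W = {} \<or> (W - A) \<inter> W = {}" by (intro connectedD[OF W(2)]) auto
  then have "x \<in> A" using x0 x by (auto simp: A_def)
  then show ?thesis unfolding A_def using eventually_nhds_x_imp_x by blast
qed

lemma dz_deriv_periodic_norm_constant:
  assumes G: "\<And>x. dz_deriv G x (\<alpha> x)" and periodic: "torus_periodic (\<lambda>x. norm (G x))"
  shows "\<alpha> x = 0"
proof -
  have "continuous_on (cbox (0,0) (1,1)) (\<lambda>x. norm (G x))"
    using dz_deriv_isCont[OF G] by (intro continuous_on_norm continuous_at_imp_continuous_on) blast
  then obtain x0 where "\<And>x. x \<in> cbox (0,0) (1,1) \<Longrightarrow> norm (G x) \<le> norm (G x0)"
    using continuous_attains_sup[OF compact_cbox, of "(0,0)" "(1,1)" "\<lambda>x. norm (G x)"] by (auto simp: cbox_Pair_eq)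
  then have max: "norm (G x) \<le> norm (G x0)" for x
    using int_vector_representative[of x] torus_periodicD[OF periodic] by metis
  obtain U F d r h where c: "chart x0 U F d" "r > 0" "F ` U = ball 0 r"
    and h: "h holomorphic_on ball 0 r" "\<And>y. y \<in> U \<Longrightarrow> G y = h (F y)" "\<And>y. y \<in> U \<Longrightarrow> \<alpha> y = deriv h (F y) * d y"
    using disc_factorisation[OF open_UNIV UNIV_I G] by metis
  note cd = chartD[OF c(1)]
  have "norm (h z) \<le> norm (h 0)" if "z \<in> ball 0 r" for z
    using that max h(2) cd(2,6) unfolding c(3)[symmetric] by (metis imageE)
  then have "h constant_on ball 0 r"
    using maximum_modulus_principle[OF h(1) open_ball connected_ball open_ball order_refl, of 0] c(2) by simp
  then obtain k where "\<And>z. z \<in> ball 0 r \<Longrightarrow> h z = k" unfolding constant_on_def by blast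
  then have "deriv h z = 0" if "z \<in> ball 0 r" for z
    using that complex_derivative_transform_within_open[OF h(1) holomorphic_on_const open_ball that, of k] by simp
  then have "\<alpha> y = 0" if "y \<in> U" for y using that h(3)[OF that] imageI[OF that, of F] c(3) by simp
  then show ?thesis
    using dz_deriv_identity[OF open_UNIV connected_UNIV G] cd(1,2) eventually_nhds by blast
qed

lemma cell_avoiding_boundary:
  assumes S: "\<And>x. \<forall>\<^sub>F y in at x. y \<notin> S" "\<And>x w. x \<in> S \<Longrightarrow> w \<in> int_vectors \<Longrightarrow> x + w \<in> S" and x0: "x0 \<in> S"
  obtains a where "x0 \<in> box a (a + (1,1))" "S \<inter> unit_cell a \<subseteq> box a (a + (1,1))" "finite (S \<inter> unit_cell a)"
proof -
  have finite: "finite (K \<inter> S)" if "compact K" for K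
    using finite_not_islimpt_in_compact[OF that] S(1) by (auto simp: islimpt_iff_eventually)
  define Q where "Q = cbox (0,0) (1,1) \<inter> S"
  have "finite Q" unfolding Q_def by (rule finite[OF compact_cbox])
  then obtain b1 b2 where b: "\<And>q. q \<in> Q \<Longrightarrow> fst q - b1 \<notin> \<int>" "\<And>q. q \<in> Q \<Longrightarrow> snd q - b2 \<notin> \<int>"
    using exists_real_avoiding_cosets[of "fst ` Q"] exists_real_avoiding_cosets[of "snd ` Q"]
    by (metis finite_imageI imageI)
  have avoid: "fst x - b1 \<notin> \<int>" "snd x - b2 \<notin> \<int>" if "x \<in> S" for x
  proof -
    obtain w where w: "w \<in> int_vectors" "x + w \<in> cbox (0,0) (1,1)" by (rule int_vector_representative)
    then have "x + w \<in> Q" using S(2)[OF that] by (simp add: Q_def)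
    moreover have "fst w \<in> \<int>" "snd w \<in> \<int>" using w(1) by (simp_all add: int_vectors_def)
    ultimately show "fst x - b1 \<notin> \<int>" "snd x - b2 \<notin> \<int>"
      using b[of "x + w"] Ints_add[of "fst x - b1" "fst w"] Ints_add[of "snd x - b2" "snd w"] by (auto simp: algebra_simps)
  qed
  obtain w where w: "w \<in> int_vectors" "x0 + w \<in> box (b1,b2) ((b1,b2) + (1,1))"
    using int_vector_representative_in_box[of x0 "(b1,b2)"] avoid[OF x0] by auto
  let ?a = "(b1,b2) - w"
  have "fst x - fst ?a \<notin> \<int>" "snd x - snd ?a \<notin> \<int>" if "x \<in> S" for x
    using avoid[OF S(2)[OF that w(1)]] by (simp_all add: algebra_simps)
  then have "S \<inter> unit_cell ?a \<subseteq> box ?a (?a + (1,1))"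
    using Ints_0 Ints_1
    by (intro subsetI) (cases w; force simp: cbox_Pair_eq mem_box Basis_prod_def less_le)
  moreover have "x0 \<in> box ?a (?a + (1,1))" using w(2) by (auto simp: mem_box Basis_prod_def algebra_simps)
  ultimately show ?thesis using that finite[OF compact_cbox] by (metis Int_commute)
qed

context
  fixes \<alpha> :: "plane \<Rightarrow> complex" and S and k :: "plane \<Rightarrow> int" and x0
  assumes periodic: "torus_periodic \<alpha>"
    and S: "\<And>x. \<forall>\<^sub>F y in at x. y \<notin> S" "\<And>x w. x \<in> S \<Longrightarrow> w \<in> int_vectors \<Longrightarrow> x + w \<in> S"
    and regular: "\<And>x. x \<notin> S \<Longrightarrow> isCont \<alpha> x" "\<And>x. x \<notin> S \<Longrightarrow> \<alpha> x \<noteq> 0"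
    and order: "\<And>x. x \<in> S \<Longrightarrow> has_order \<alpha> x (k x)" and x0: "x0 \<in> S"
begin

theorem index_theorem:
  obtains Z where "finite Z" "Z \<subseteq> S" "x0 \<in> Z" "\<And>y z. y \<in> Z \<Longrightarrow> z \<in> Z \<Longrightarrow> y - z \<in> int_vectors \<Longrightarrow> y = z" "sum k Z = 0"
proof -
  obtain a where a: "x0 \<in> box a (a + (1,1))" "S \<inter> unit_cell a \<subseteq> box a (a + (1,1))" "finite (S \<inter> unit_cell a)"
    using cell_avoiding_boundary[OF S x0] by blast
  define Z where "Z = S \<inter> unit_cell a"
  obtain c where c: "\<And>x. x \<in> S \<Longrightarrow> c x \<noteq> 0" "\<And>x. x \<in> S \<Longrightarrow> ((\<lambda>y. \<alpha> y * lincoord (mu x) (y - x) powi (- k x)) \<longlongrightarrow> c x) (at x)"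
    using order unfolding has_order_def dz_def by metis
  have "sum k Z = 0"
  proof (rule total_index_zero[where \<alpha> = \<alpha> and m = mu and c = c and a = a])
    show "continuous_on (unit_cell a - Z) \<alpha>"
      using regular(1) by (intro continuous_at_imp_continuous_on) (auto simp: Z_def)
    show "\<alpha> (x + (1,0)) = \<alpha> x" "\<alpha> (x + (0,1)) = \<alpha> x" for x using periodic by (cases x; simp add: torus_periodic_def)+
  qed (use a regular(2) c Im_mu_pos in \<open>auto simp: Z_def\<close>)
  moreover have "y = z" if "y \<in> Z" "z \<in> Z" "y - z \<in> int_vectors" for y z
  proof -
    have "y \<in> box a (a + (1,1))" "z \<in> box a (a + (1,1))" using that a(2) by (auto simp: Z_def)
    then have "\<bar>fst (y - z)\<bar> < 1" "\<bar>snd (y - z)\<bar> < 1" by (cases a; cases y; cases z; auto simp: mem_box Basis_prod_def)+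
    then show ?thesis using that(3) Ints_nonzero_abs_less1[of "fst (y - z)"] Ints_nonzero_abs_less1[of "snd (y - z)"]
      by (auto simp: int_vectors_def prod_eq_iff)
  qed
  moreover have "x0 \<in> Z" using a(1) x0 box_subset_cbox by (auto simp: Z_def)
  moreover have "Z \<subseteq> S" "finite Z" using a(3) by (auto simp: Z_def)
  ultimately show ?thesis using that[of Z] by blast
qed

corollary order_zero_if_one_sign:
  assumes sign: "(\<forall>x\<in>S. k x \<ge> 0) \<or> (\<forall>x\<in>S. k x \<le> 0)"
  shows "k x0 = 0"
proof -
  obtain Z where Z: "finite Z" "Z \<subseteq> S" "x0 \<in> Z" "sum k Z = 0"
    using index_theorem by metis
  from sign show ?thesis
  proof
    assume "\<forall>x\<in>S. k x \<ge> 0"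
    then show ?thesis using sum_nonneg_eq_0_iff[OF Z(1), of k] Z by (metis subsetD)
  next
    assume "\<forall>x\<in>S. k x \<le> 0"
    then show ?thesis using sum_nonneg_eq_0_iff[OF Z(1), of "\<lambda>x. - k x"] Z by (simp add: sum_negf) (metis subsetD)
  qed
qed

end

theorem periodic_differential_nonzero:
  assumes G: "\<And>x. dz_deriv G x (\<alpha> x)" and periodic: "torus_periodic \<alpha>" and nz: "\<alpha> x1 \<noteq> 0"
  shows "\<alpha> x \<noteq> 0"
proof
  assume x: "\<alpha> x = 0"
  have not_constant: "\<not> (\<forall>\<^sub>F y in nhds z. \<alpha> y = 0)" for z
    using dz_deriv_identity[OF open_UNIV connected_UNIV G, of z x1] nz by auto
  note order = dz_deriv_factor_has_order[OF open_UNIV UNIV_I G not_constant]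
  note isolated = dz_deriv_factor_isolated_zero[OF open_UNIV UNIV_I G not_constant]
  from order obtain k :: "plane \<Rightarrow> nat" where k: "\<And>z. has_order \<alpha> z (int (k z))" by metis
  have "int (k x) = 0"
    by (rule order_zero_if_one_sign[OF periodic, of "{z. \<alpha> z = 0}"])
      (use isolated k x torus_periodicD[OF periodic] dz_deriv_factor_isCont[OF open_UNIV UNIV_I G] in auto)
  then obtain c where "c \<noteq> 0" "(\<alpha> \<longlongrightarrow> c) (at x)" using k[of x] by (auto simp: has_order_0_iff)
  moreover have "(\<alpha> \<longlongrightarrow> 0) (at x)" using dz_deriv_factor_isCont[OF open_UNIV UNIV_I G] x by (metis isCont_def)
  ultimately show False using LIM_unique by blast
qed

end

section \<open>Lattices in the complex plane\<close>

definition lattice :: "complex \<Rightarrow> complex \<Rightarrow> complex set" where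
  "lattice u v = {z. \<exists>m n :: int. z = of_int m * u + of_int n * v}"

lemma latticeI: "of_int m * u + of_int n * v \<in> lattice u v"
  unfolding lattice_def by blast

lemma latticeE:
  assumes "z \<in> lattice u v" obtains m n :: int where "z = of_int m * u + of_int n * v"
  using assms unfolding lattice_def by blast

lemma lattice_generators: "u \<in> lattice u v" "v \<in> lattice u v" "0 \<in> lattice u v"
  using latticeI[of 1 u 0 v] latticeI[of 0 u 1 v] latticeI[of 0 u 0 v] by simp_all

lemma lattice_diff: assumes "x \<in> lattice u v" "y \<in> lattice u v" shows "x - y \<in> lattice u v"
proof -
  obtain m n m' n' where "x = of_int m * u + of_int n * v" "y = of_int m' * u + of_int n' * v"
    using assms by (metis latticeE)
  then have "x - y = of_int (m - m') * u + of_int (n - n') * v" by (simp add: algebra_simps)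
  then show ?thesis using latticeI by metis
qed

lemma lattice_minus_iff [simp]: "- x \<in> lattice u v \<longleftrightarrow> x \<in> lattice u v"
  using lattice_diff[OF lattice_generators(3)] by (metis diff_0 minus_minus)

lemma lattice_add: "x \<in> lattice u v \<Longrightarrow> y \<in> lattice u v \<Longrightarrow> x + y \<in> lattice u v"
  using lattice_diff[of x u v "- y"] by simp

lemma lattice_add_iff:
  assumes "y \<in> lattice u v" shows "x + y \<in> lattice u v \<longleftrightarrow> x \<in> lattice u v" "y + x \<in> lattice u v \<longleftrightarrow> x \<in> lattice u v"
  using assms lattice_add lattice_diff[of "x + y" u v y] by (auto simp: add.commute)

lemma lattice_commute: "lattice u v = lattice v u"
  unfolding lattice_def by (metis add.commute)

lemma lattice_induct [consumes 1, case_names left right diff]: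
  assumes l: "l \<in> lattice u v" and left: "P u" and right: "P v" and diff: "\<And>x y. P x \<Longrightarrow> P y \<Longrightarrow> P (x - y)"
  shows "P l"
proof -
  have "P 0" using diff[OF left left] by simp
  then have add: "P (x + y)" if "P x" "P y" for x y using diff[OF that(1) diff[of 0 y]] that by simp
  have "P (of_int m * x)" if "P x" for m x
  proof (induction m rule: int_induct[where k = 0])
    case base show ?case using \<open>P 0\<close> by simp
  next
    case (step1 i) then show ?case using add[OF _ that] by (simp add: distrib_right)
  next
    case (step2 i) then show ?case using diff[OF _ that] by (simp add: left_diff_distrib)
  qed
  then show ?thesis using l add left right by (auto elim!: latticeE)
qed

lemma lattice_subset: assumes "u \<in> lattice u' v'" "v \<in> lattice u' v'" shows "lattice u v \<subseteq> lattice u' v'"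
  using lattice_induct[where P = "\<lambda>x. x \<in> lattice u' v'"] assms lattice_diff by blast

lemma lattice_eq:
  assumes "u \<in> lattice u' v'" "v \<in> lattice u' v'" "u' \<in> lattice u v" "v' \<in> lattice u v"
  shows "lattice u v = lattice u' v'"
  using assms lattice_subset by blast

lemma finite_lattice_ball:
  assumes area: "Im (cnj u * v) \<noteq> 0" shows "finite {z \<in> lattice u v. norm z \<le> R}"
proof -
  define A where "A = \<bar>Im (cnj u * v)\<bar>"
  define M where "M = \<lceil>(norm u + norm v) * \<bar>R\<bar> / A\<rceil>"
  have A: "A > 0" using area by (simp add: A_def)
  have "{z \<in> lattice u v. norm z \<le> R} \<subseteq> (\<lambda>(m, n). of_int m * u + of_int n * v) ` ({-M..M} \<times> {-M..M})"
  proof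
    fix z assume z: "z \<in> {z \<in> lattice u v. norm z \<le> R}"
    then obtain m n where mn: "z = of_int m * u + of_int n * v" by (auto elim: latticeE)
    have bound: "\<bar>Im (cnj x * z)\<bar> \<le> (norm u + norm v) * \<bar>R\<bar>" if "x \<in> {u, v}" for x
    proof -
      have "\<bar>Im (cnj x * z)\<bar> \<le> norm x * norm z" using abs_Im_le_cmod[of "cnj x * z"] by (simp add: norm_mult)
      also have "\<dots> \<le> (norm u + norm v) * \<bar>R\<bar>" using z that by (intro mult_mono) auto
      finally show ?thesis .
    qed
    have "Im (cnj u * z) = of_int n * Im (cnj u * v)" "Im (cnj v * z) = - of_int m * Im (cnj u * v)"
      unfolding mn by (simp_all add: algebra_simps)
    then have "\<bar>of_int n\<bar> * A \<le> (norm u + norm v) * \<bar>R\<bar>" "\<bar>of_int m\<bar> * A \<le> (norm u + norm v) * \<bar>R\<bar>"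
      using bound[of u] bound[of v] by (simp_all add: A_def abs_mult)
    then have "\<bar>n\<bar> \<le> M" "\<bar>m\<bar> \<le> M"
      using A unfolding M_def by (simp_all add: pos_le_divide_eq[symmetric]) linarith+
    then show "z \<in> (\<lambda>(m, n). of_int m * u + of_int n * v) ` ({-M..M} \<times> {-M..M})"
      unfolding mn by (intro image_eqI[of _ _ "(m, n)"]) auto
  qed
  then show ?thesis by (rule finite_subset) simp
qed

lemma lattice_discrete:
  assumes "Im (cnj u * v) \<noteq> 0" obtains e where "e > 0" "\<And>z. z \<in> lattice u v \<Longrightarrow> norm z < e \<Longrightarrow> z = 0"
proof -
  obtain d where d: "d > 0" "\<forall>z\<in>{z \<in> lattice u v. norm z \<le> 1}. z \<noteq> 0 \<longrightarrow> d \<le> dist 0 z"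
    using finite_set_avoid[OF finite_lattice_ball[OF assms]] by blast
  show ?thesis
  proof (rule that[of "min d 1"])
    fix z assume "z \<in> lattice u v" "norm z < min d 1"
    then show "z = 0" using d(2) by fastforce
  qed (use d(1) in simp)
qed

lemma closed_subset_lattice:
  assumes "Im (cnj u * v) \<noteq> 0" "S \<subseteq> lattice u v" shows "closed S"
proof -
  obtain e where e: "e > 0" "\<And>z. z \<in> lattice u v \<Longrightarrow> norm z < e \<Longrightarrow> z = 0" using lattice_discrete[OF assms(1)] by metis
  have "y = x" if "x \<in> S" "y \<in> S" "dist y x < e" for x y
    using e(2)[of "y - x"] lattice_diff[of y u v x] assms(2) that by (auto simp: dist_norm)
  then show ?thesis using discrete_imp_closed[OF e(1)] by blast
qed

lemma countable_lattice: "countable (lattice u v)"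
proof -
  have "lattice u v = range (\<lambda>(m, n). of_int m * u + of_int n * v)" by (auto simp: lattice_def)
  then show ?thesis by simp
qed

lemma lattice_fundamental_domain:
  assumes "Im (cnj u * v) \<noteq> 0" obtains l where "l \<in> lattice u v" "norm (z + l) \<le> norm u + norm v"
proof -
  define A where "A = Im (cnj u * v)"
  define s t where "s = - Im (cnj v * z) / A" and "t = Im (cnj u * z) / A"
  have A: "A \<noteq> 0" "A = Re u * Im v - Im u * Re v" using assms by (simp_all add: A_def)
  have z: "z = of_real s * u + of_real t * v"
    using A(1) by (simp add: complex_eq_iff s_def t_def field_simps) (simp add: A(2) algebra_simps)
  have "z + (of_int (- \<lfloor>s\<rfloor>) * u + of_int (- \<lfloor>t\<rfloor>) * v) = of_real (frac s) * u + of_real (frac t) * v"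
    by (simp add: z frac_def algebra_simps)
  also have "norm \<dots> \<le> frac s * norm u + frac t * norm v"
    by (rule order_trans[OF norm_triangle_ineq]) (simp add: norm_mult frac_ge_0)
  also have "\<dots> \<le> 1 * norm u + 1 * norm v"
    by (intro add_mono mult_right_mono) (auto simp: frac_lt_1 less_imp_le)
  finally show ?thesis using that[OF latticeI[of "- \<lfloor>s\<rfloor>" u "- \<lfloor>t\<rfloor>" v]] by simp
qed

lemma Im_divide_eq: "u \<noteq> 0 \<Longrightarrow> Im (v / u) = Im (cnj u * v) / (norm u)\<^sup>2"
  using complex_div_cnj[of v u] by (metis Im_divide_of_real mult.commute of_real_power)

lemma shortest_lattice_basis:
  assumes area: "Im (cnj u * v) > 0"
  obtains w1 w2 where "lattice w1 w2 = lattice u v" "Im (cnj w1 * w2) = Im (cnj u * v)"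
    "\<And>x y. lattice x y = lattice u v \<Longrightarrow> Im (cnj x * y) = Im (cnj u * v) \<Longrightarrow> norm w1 \<le> norm x"
proof -
  define S where "S = {x. norm x \<le> norm u \<and> (\<exists>y. lattice x y = lattice u v \<and> Im (cnj x * y) = Im (cnj u * v))}"
  have "S \<subseteq> {z \<in> lattice u v. norm z \<le> norm u}" using lattice_generators(1) by (auto simp: S_def)
  then have "finite S" using finite_lattice_ball area by (metis finite_subset less_irrefl)
  moreover have "S \<noteq> {}" by (auto simp: S_def)
  ultimately obtain w1 where w1: "w1 \<in> S" "\<And>x. x \<in> S \<Longrightarrow> norm w1 \<le> norm x"
    by (metis arg_min_if_finite(1) arg_min_least)
  then obtain w2 where w2: "lattice w1 w2 = lattice u v" "Im (cnj w1 * w2) = Im (cnj u * v)" "norm w1 \<le> norm u"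
    by (auto simp: S_def)
  have "norm w1 \<le> norm x" if "lattice x y = lattice u v" "Im (cnj x * y) = Im (cnj u * v)" for x y
  proof (cases "norm x \<le> norm u")
    case True then show ?thesis using that w1(2)[of x] by (auto simp: S_def)
  qed (use w2(3) in simp)
  then show ?thesis using that w2 by blast
qed

lemma reduced_lattice_basis:
  assumes area: "Im (cnj u * v) > 0"
  obtains w1 w2 where "lattice w1 w2 = lattice u v" "Im (cnj w1 * w2) = Im (cnj u * v)" "norm (w2 / w1) \<ge> 1"
    "\<bar>Re (w2 / w1)\<bar> \<le> 1/2"
proof -
  obtain w1 y where w: "lattice w1 y = lattice u v" "Im (cnj w1 * y) = Im (cnj u * v)"
    and shortest: "\<And>x y. lattice x y = lattice u v \<Longrightarrow> Im (cnj x * y) = Im (cnj u * v) \<Longrightarrow> norm w1 \<le> norm x"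
    using shortest_lattice_basis[OF area] by metis
  define k where "k = round (Re (y / w1))"
  define w2 where "w2 = y - of_int k * w1"
  have "w1 \<noteq> 0" using w(2) area by auto
  have "w2 \<in> lattice w1 y" "y \<in> lattice w1 w2"
    using latticeI[of "- k" w1 1 y] latticeI[of k w1 1 w2] by (simp_all add: w2_def)
  then have basis: "lattice w1 w2 = lattice u v"
    unfolding w(1)[symmetric] by (intro lattice_eq lattice_generators)
  have area': "Im (cnj w1 * w2) = Im (cnj u * v)" using w(2) by (simp add: w2_def algebra_simps)
  have "w2 / w1 = y / w1 - of_int k" using \<open>w1 \<noteq> 0\<close> by (simp add: w2_def diff_divide_distrib)
  then have "\<bar>Re (w2 / w1)\<bar> \<le> 1/2" using of_int_round_abs_le[of "Re (y / w1)"] by (simp add: k_def abs_minus_commute)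
  moreover have "norm w1 \<le> norm w2"
  proof (rule shortest)
    show "lattice w2 (- w1) = lattice u v"
      unfolding basis[symmetric] using latticeI[of 0 w2 "-1" "- w1"]
      by (intro lattice_eq) (simp_all add: lattice_generators)
    show "Im (cnj w2 * - w1) = Im (cnj u * v)" using area' by (simp add: algebra_simps)
  qed
  then have "norm (w2 / w1) \<ge> 1" using \<open>w1 \<noteq> 0\<close> by (simp add: norm_divide)
  ultimately show ?thesis using that basis area' by blast
qed

lemma lattice_halve_generator:
  assumes p: "2 * p = of_int m * u + of_int n * v" "even m" "odd n"
  shows "lattice u (v / 2) = {z. z \<in> lattice u v \<or> z - p \<in> lattice u v}"
proof -
  obtain i j where ij: "m = 2 * i" "n = 2 * j + 1" using p(2,3) by (auto elim!: evenE oddE)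
  have p_eq: "p = of_int i * u + of_int j * v + v / 2" using p(1) unfolding ij by (simp add: field_simps)
  show ?thesis
  proof (intro set_eqI iffI)
    fix z assume "z \<in> lattice u (v / 2)"
    then obtain a b where z: "z = of_int a * u + of_int b * (v / 2)" by (rule latticeE)
    show "z \<in> {z. z \<in> lattice u v \<or> z - p \<in> lattice u v}"
    proof (cases "even b")
      case True
      then obtain k where "b = 2 * k" by (rule evenE)
      then show ?thesis using latticeI[of a u k v] by (simp add: z)
    next
      case False
      then obtain k where "b = 2 * k + 1" by (rule oddE)
      then have "z - p = of_int (a - i) * u + of_int (k - j) * v" by (simp add: z p_eq field_simps)
      then show ?thesis using latticeI[of "a - i" u "k - j" v] by simp
    qed
  next
    have "v \<in> lattice u (v / 2)" using latticeI[of 0 u 2 "v / 2"] by simp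
    then have sub: "lattice u v \<subseteq> lattice u (v / 2)" by (intro lattice_subset lattice_generators)
    have "p \<in> lattice u (v / 2)"
      using latticeI[of i u "2 * j + 1" "v / 2"] by (simp add: p_eq field_simps)
    then show "z \<in> lattice u (v / 2)" if "z \<in> {z. z \<in> lattice u v \<or> z - p \<in> lattice u v}" for z
      using that sub lattice_add[of "z - p" u "v / 2" p] by auto
  qed
qed

lemma half_period_lattice:
  assumes p: "2 * p \<in> lattice u v" "p \<notin> lattice u v" and area: "Im (cnj u * v) > 0"
  obtains u' v' where "lattice u' v' = {z. z \<in> lattice u v \<or> z - p \<in> lattice u v}" "Im (cnj u' * v') = Im (cnj u * v) / 2"
proof -
  obtain m n where mn: "2 * p = of_int m * u + of_int n * v" using p(1) by (rule latticeE)
  have "\<not> (even m \<and> even n)"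
  proof
    assume "even m \<and> even n"
    then obtain a b where "m = 2 * a" "n = 2 * b" by (auto elim!: evenE)
    then have "2 * p = 2 * (of_int a * u + of_int b * v)" using mn by (simp add: algebra_simps)
    then have "p = of_int a * u + of_int b * v" by (simp only: mult_cancel_left) simp
    then show False using p(2) latticeI by metis
  qed
  then consider "even m" "odd n" | "odd m" "even n" | "odd m" "odd n" by blast
  then show ?thesis
  proof cases
    case 1
    then show ?thesis using that[OF lattice_halve_generator[OF mn]] area by simp
  next
    case 2
    have "2 * p = of_int (- n) * (- v) + of_int m * u" using mn by simp
    from lattice_halve_generator[OF this] 2
    have "lattice (- v) (u / 2) = {z. z \<in> lattice (- v) u \<or> z - p \<in> lattice (- v) u}" by simp
    moreover have "lattice (- v) u = lattice u v"
      using latticeI[of "-1" "- v" 0 u] by (intro lattice_eq) (simp_all add: lattice_generators)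
    ultimately show ?thesis using that[of "- v" "u / 2"] by (simp add: field_simps)
  next
    case 3
    have "2 * p = of_int (m - n) * u + of_int n * (u + v)" using mn by (simp add: algebra_simps)
    from lattice_halve_generator[OF this] 3
    have "lattice u ((u + v) / 2) = {z. z \<in> lattice u (u + v) \<or> z - p \<in> lattice u (u + v)}" by simp
    moreover have "lattice u (u + v) = lattice u v"
      using latticeI[of "-1" u 1 "u + v"] by (intro lattice_eq) (simp_all add: lattice_generators lattice_add)
    ultimately show ?thesis using that[of u "(u + v) / 2"] by (simp add: field_simps)
  qed
qed

section \<open>Eisenstein's cotangent series\<close>

definition cot_kernel :: "complex \<Rightarrow> complex" where
  "cot_kernel w = - (2 * of_real pi * \<i>) * exp (2 * of_real pi * \<i> * w) / (1 - exp (2 * of_real pi * \<i> * w))"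

definition cot_kernel' :: "complex \<Rightarrow> complex" where
  "cot_kernel' w = 4 * (of_real pi)\<^sup>2 * exp (2 * of_real pi * \<i> * w) / (1 - exp (2 * of_real pi * \<i> * w))\<^sup>2"

lemma exp_two_pi_i_eq_1_iff: "exp (2 * of_real pi * \<i> * w) = 1 \<longleftrightarrow> w \<in> \<int>"
proof -
  have "Im (2 * of_real pi * \<i> * w) = real_of_int (2 * n) * pi \<longleftrightarrow> Re w = of_int n" for n :: int
    by (simp add: field_simps)
  moreover have "Re (2 * of_real pi * \<i> * w) = 0 \<longleftrightarrow> Im w = 0" by simp
  ultimately have "exp (2 * of_real pi * \<i> * w) = 1 \<longleftrightarrow> (\<exists>n::int. w = of_int n)"
    unfolding exp_eq_1 by (simp add: complex_eq_iff) blast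
  then show ?thesis by (auto simp: Ints_def)
qed

lemma exp_two_pi_i_add_of_int: "exp (2 * of_real pi * \<i> * (w + of_int n)) = exp (2 * of_real pi * \<i> * w)"
  using exp_two_pi_i_eq_1_iff[of "of_int n"] by (simp add: distrib_left exp_add)

lemma cot_kernel_add_of_int: "cot_kernel (w + of_int n) = cot_kernel w" "cot_kernel' (w + of_int n) = cot_kernel' w"
  by (simp_all only: cot_kernel_def cot_kernel'_def exp_two_pi_i_add_of_int)

lemma has_field_derivative_cot_kernel:
  assumes "w \<notin> \<int>" shows "(cot_kernel has_field_derivative cot_kernel' w) (at w)"
proof -
  define c where "c = 2 * of_real pi * \<i>"
  let ?D = "- (c * c) * exp (c * w) / (1 - exp (c * w))\<^sup>2"
  have nz: "1 - exp (c * w) \<noteq> 0" using exp_two_pi_i_eq_1_iff[of w] assms by (simp add: c_def)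
  have "((\<lambda>w. - c * exp (c * w) / (1 - exp (c * w))) has_field_derivative ?D) (at w)"
    using nz by (auto intro!: derivative_eq_intros simp: power2_eq_square algebra_simps)
  moreover have "cot_kernel = (\<lambda>w. - c * exp (c * w) / (1 - exp (c * w)))"
    "cot_kernel' w = ?D"
  proof -
    have "- (c * c) = 4 * (of_real pi)\<^sup>2" by (simp add: c_def power2_eq_square)
    then show "cot_kernel' w = ?D"
      by (simp only: cot_kernel'_def) (simp only: c_def)
  qed (simp add: fun_eq_iff cot_kernel_def c_def)
  ultimately show ?thesis by (simp only:)
qed

lemma cot_kernel_minus: assumes "w \<notin> \<int>" shows "cot_kernel (- w) = 2 * of_real pi * \<i> - cot_kernel w"
proof -
  define c e where "c = 2 * of_real pi * \<i>" and "e = exp (c * w)"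
  have nz: "1 - e \<noteq> 0" "e \<noteq> 0" "e - 1 \<noteq> 0" using exp_two_pi_i_eq_1_iff[of w] assms by (auto simp: e_def c_def)
  have "exp (c * - w) = inverse e" by (simp add: e_def exp_minus)
  then have "cot_kernel (- w) = - c * inverse e / (1 - inverse e)" by (simp add: cot_kernel_def c_def)
  also have "\<dots> = - c / (e - 1)" using nz by (simp add: field_simps)
  also have "\<dots> = c - (- c * e / (1 - e))" using nz by (simp add: field_simps)
  finally show ?thesis by (simp add: cot_kernel_def c_def e_def)
qed

lemma norm_cot_kernel_le:
  assumes "Im w \<ge> 1" shows "norm (cot_kernel w) \<le> 2 * pi * exp (- 2 * pi * Im w) / (1 - exp (- 2 * pi))"
proof -
  have norm_exp: "norm (exp (2 * of_real pi * \<i> * w)) = exp (- 2 * pi * Im w)" by (simp add: norm_exp_eq_Re)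
  have "exp (- 2 * pi * Im w) \<le> exp (- 2 * pi)" "exp (- 2 * pi) < 1" using assms by simp_all
  then have "1 - exp (- 2 * pi) \<le> norm (1 - exp (2 * of_real pi * \<i> * w))" "0 < 1 - exp (- 2 * pi)"
    using norm_triangle_ineq2[of 1 "exp (2 * of_real pi * \<i> * w)"] unfolding norm_exp norm_one by linarith+
  then show ?thesis unfolding cot_kernel_def norm_divide by (intro frac_le) (auto simp: norm_mult norm_exp)
qed

lemma cot_kernel_residue: "((\<lambda>w. w * cot_kernel w) \<longlongrightarrow> 1) (at 0)"
proof -
  define c where "c = 2 * of_real pi * \<i>"
  have c: "c \<noteq> 0" by (simp add: c_def)
  have "((\<lambda>w. exp (c * w)) has_field_derivative c) (at 0)" by (auto intro!: derivative_eq_intros)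
  then have "((\<lambda>w. (exp (c * w) - 1) / w) \<longlongrightarrow> c) (at 0)" by (simp add: DERIV_def)
  then have "((\<lambda>w. c * exp (c * w) / ((exp (c * w) - 1) / w)) \<longlongrightarrow> c * exp (c * 0) / c) (at 0)"
    using c by (intro tendsto_intros) auto
  moreover have "c * exp (c * w) / ((exp (c * w) - 1) / w) = w * cot_kernel w" for w
  proof -
    have "- c * e / (1 - e) = c * e / (e - 1)" for e by (cases "e = 1") (auto simp: field_simps)
    then have "cot_kernel w = c * exp (c * w) / (exp (c * w) - 1)" by (simp add: cot_kernel_def c_def)
    then show ?thesis by simp
  qed
  ultimately show ?thesis using c by simp
qed

locale upper_half_plane =
  fixes \<tau> :: complex
  assumes Im_\<tau>_pos: "Im \<tau> > 0"
begin

abbreviation "level n \<equiv> of_nat (Suc n) * \<tau>"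

definition tail_domain :: "complex set" where
  "tail_domain = {z. \<forall>n::nat. level n + z \<notin> \<int>}"

lemma tail_domain_eq: "- tail_domain \<subseteq> lattice 1 \<tau>"
proof
  fix z assume "z \<in> - tail_domain"
  then obtain n m where "level n + z = of_int m" unfolding tail_domain_def by (auto elim!: Ints_cases)
  then have "z = of_int m * 1 + of_int (- int (Suc n)) * \<tau>" by (simp add: algebra_simps)
  then show "z \<in> lattice 1 \<tau>" using latticeI by metis
qed

lemma open_tail_domain: "open tail_domain"
  using closed_subset_lattice[OF _ tail_domain_eq] Im_\<tau>_pos by (simp add: closed_def)

lemma tail_domain_if_Im: assumes "Im z > - Im \<tau>" shows "z \<in> tail_domain"
proof -
  have "level n + z \<notin> \<int>" for n
  proof
    assume "level n + z \<in> \<int>"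
    then have "Im (level n + z) = 0" by (simp only: complex_is_Int_iff)
    moreover have "Im (level n + z) = real n * Im \<tau> + (Im \<tau> + Im z)" by (simp add: algebra_simps)
    moreover have "real n * Im \<tau> \<ge> 0" using Im_\<tau>_pos by simp
    ultimately show False using assms by linarith
  qed
  then show ?thesis by (simp add: tail_domain_def)
qed

lemma tail_domain_if_not_lattice:
  assumes "z \<notin> lattice 1 \<tau>" shows "z \<in> tail_domain" "- z \<in> tail_domain" "z \<notin> \<int>"
  using assms tail_domain_eq lattice_minus_iff[of z 1 \<tau>] latticeI[of _ 1 0 \<tau>] by (auto elim!: Ints_cases)

lemma cot_kernel_tail_le:
  assumes "real n * Im \<tau> + Im z \<ge> 1"
  shows "norm (cot_kernel (level n + z))
    \<le> 2 * pi / (1 - exp (- 2 * pi)) * exp (- 2 * pi * Im z) * exp (- 2 * pi * Im \<tau>) ^ n"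
proof -
  let ?e = "exp (- 2 * pi * Im (level n + z))" and ?C = "2 * pi / (1 - exp (- 2 * pi))"
  have Im_eq: "Im (level n + z) = real n * Im \<tau> + Im z + Im \<tau>" by (simp add: algebra_simps)
  have "?e \<le> exp (- 2 * pi * Im z + of_nat n * (- 2 * pi * Im \<tau>))"
    using Im_\<tau>_pos unfolding Im_eq by (simp add: algebra_simps)
  also have "\<dots> = exp (- 2 * pi * Im z) * exp (- 2 * pi * Im \<tau>) ^ n" by (simp only: exp_add exp_of_nat_mult)
  finally have "?C * ?e
      \<le> ?C * (exp (- 2 * pi * Im z) * exp (- 2 * pi * Im \<tau>) ^ n)"
    by (intro mult_left_mono) auto
  moreover have "Im (level n + z) \<ge> 1" using assms Im_\<tau>_pos unfolding Im_eq by linarith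
  from norm_cot_kernel_le[OF this] have "norm (cot_kernel (level n + z))
      \<le> ?C * ?e" by simp
  ultimately show ?thesis by (simp only: mult.assoc order_trans)
qed

lemma cot_kernel_tails_locally_summable:
  "\<exists>d h. 0 < d \<and> summable h \<and>
    (\<forall>\<^sub>F n in sequentially. \<forall>y\<in>ball z d \<inter> tail_domain. norm (cot_kernel (level n + y)) \<le> h n)"
proof -
  define h where "h = (\<lambda>n. 2 * pi / (1 - exp (- 2 * pi)) * exp (2 * pi * (\<bar>Im z\<bar> + 1)) * exp (- 2 * pi * Im \<tau>) ^ n)"
  have "summable h" unfolding h_def using Im_\<tau>_pos by (intro summable_mult summable_geometric) simp
  moreover have "norm (cot_kernel (level n + y)) \<le> h n"
    if n: "real n * Im \<tau> \<ge> \<bar>Im z\<bar> + 2" and y: "y \<in> ball z 1" for n y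
  proof -
    have Im_y: "\<bar>Im y - Im z\<bar> < 1"
      using y abs_Im_le_cmod[of "y - z"] by (auto simp: dist_norm norm_minus_commute)
    then have "real n * Im \<tau> + Im y \<ge> 1" using n by linarith
    note cot_kernel_tail_le[OF this]
    also have "2 * pi / (1 - exp (- 2 * pi)) * exp (- 2 * pi * Im y) * exp (- 2 * pi * Im \<tau>) ^ n \<le> h n"
    proof -
      have "pi * - Im y \<le> pi * (\<bar>Im z\<bar> + 1)" using Im_y by (intro mult_left_mono) auto
      then show ?thesis unfolding h_def by (intro mult_right_mono mult_left_mono) auto
    qed
    finally show ?thesis .
  qed
  moreover have "\<forall>\<^sub>F n in sequentially. real n * Im \<tau> \<ge> \<bar>Im z\<bar> + 2"
    using Im_\<tau>_pos by (intro eventually_sequentiallyI[of "nat \<lceil>(\<bar>Im z\<bar> + 2) / Im \<tau>\<rceil>"]) (simp add: pos_divide_le_eq[symmetric])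
  ultimately show ?thesis by (intro exI[of _ 1] exI[of _ h]) (auto elim!: eventually_mono)
qed

definition cot_tail :: "complex \<Rightarrow> complex" where
  "cot_tail z = (\<Sum>n. cot_kernel (level n + z))"

definition cot_tail' :: "complex \<Rightarrow> complex" where
  "cot_tail' z = (\<Sum>n. cot_kernel' (level n + z))"

lemma cot_tail_sums:
  assumes "z \<in> tail_domain"
  shows "(\<lambda>n. cot_kernel (level n + z)) sums cot_tail z"
    and "(\<lambda>n. cot_kernel' (level n + z)) sums cot_tail' z"
    and "(cot_tail has_field_derivative cot_tail' z) (at z)"
proof -
  have "((\<lambda>z. cot_kernel (level n + z)) has_field_derivative cot_kernel' (level n + z)) (at z)"
    if "z \<in> tail_domain" for n z
  proof -
    have "level n + z \<notin> \<int>" using that by (simp add: tail_domain_def del: of_nat_Suc)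
    from has_field_derivative_cot_kernel[OF this] show ?thesis
      using DERIV_shift[of cot_kernel _ z "level n"] by (simp only: add.commute)
  qed
  from series_and_derivative_comparison_local[OF open_tail_domain this cot_kernel_tails_locally_summable]
  obtain g g' where g: "\<And>z. z \<in> tail_domain \<Longrightarrow> (\<lambda>n. cot_kernel (level n + z)) sums g z"
    "\<And>z. z \<in> tail_domain \<Longrightarrow> (\<lambda>n. cot_kernel' (level n + z)) sums g' z"
    "\<And>z. z \<in> tail_domain \<Longrightarrow> (g has_field_derivative g' z) (at z)" by blast
  have eq: "cot_tail z = g z" "cot_tail' z = g' z" if "z \<in> tail_domain" for z
    using g(1,2)[OF that] by (simp_all only: cot_tail_def cot_tail'_def sums_iff)
  show "(\<lambda>n. cot_kernel (level n + z)) sums cot_tail z"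
    "(\<lambda>n. cot_kernel' (level n + z)) sums cot_tail' z"
    using g(1,2)[OF assms] eq[OF assms] by (simp_all only:)
  show "(cot_tail has_field_derivative cot_tail' z) (at z)"
    using has_field_derivative_transform_within_open[OF g(3)[OF assms] open_tail_domain assms, of cot_tail] eq assms
    by (simp only:)
qed

lemma cot_tail_add_of_int: "cot_tail (z + of_int n) = cot_tail z" "cot_tail' (z + of_int n) = cot_tail' z"
  by (simp_all only: cot_tail_def cot_tail'_def cot_kernel_add_of_int add.assoc[symmetric])

lemma cot_tail_shift:
  assumes "z \<in> tail_domain" "z - \<tau> \<in> tail_domain"
  shows "cot_tail (z - \<tau>) = cot_kernel z + cot_tail z" (is ?values)
    and "cot_tail' (z - \<tau>) = cot_kernel' z + cot_tail' z" (is ?derivatives)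
proof -
  have index: "level (Suc n) + (z - \<tau>) = level n + z" "level 0 + (z - \<tau>) = z" for n
    by (simp_all add: algebra_simps)
  have shift: "s = k z + t"
    if "(\<lambda>n. k (level n + (z - \<tau>))) sums s" "(\<lambda>n. k (level n + z)) sums t" for k :: "complex \<Rightarrow> complex" and s t
  proof -
    have "(\<lambda>n. k (level (Suc n) + (z - \<tau>))) sums (s - k (level 0 + (z - \<tau>)))"
      using that(1) sums_Suc_iff[of "\<lambda>n. k (level n + (z - \<tau>))"] by (simp only: diff_add_cancel)
    then have "s - k z = t" unfolding index using that(2) sums_unique2 by blast
    then show ?thesis by (simp add: algebra_simps)
  qed
  show ?values ?derivatives
    using shift cot_tail_sums(1,2)[OF assms(1)] cot_tail_sums(1,2)[OF assms(2)] by blast+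
qed

text \<open>The Eisenstein sums of \<open>\<pi> cot (\<pi> (z + n \<tau>))\<close> and \<open>\<pi>\<^sup>2 / sin\<^sup>2 (\<pi> (z + n \<tau>))\<close> over all integers \<open>n\<close>.\<close>

definition cot_sum :: "complex \<Rightarrow> complex" where
  "cot_sum z = cot_kernel z - of_real pi * \<i> + cot_tail z - cot_tail (- z)"

definition csc_sum :: "complex \<Rightarrow> complex" where
  "csc_sum z = - cot_kernel' z - cot_tail' z - cot_tail' (- z)"

lemma has_field_derivative_cot_sum:
  assumes "z \<notin> lattice 1 \<tau>" shows "(cot_sum has_field_derivative - csc_sum z) (at z)"
proof -
  note z = tail_domain_if_not_lattice[OF assms]
  have "((\<lambda>z. cot_tail (- z)) has_field_derivative cot_tail' (- z) * - 1) (at z)"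
    by (rule DERIV_chain2[where f = cot_tail and g = uminus]) (auto intro!: derivative_eq_intros cot_tail_sums(3)[OF z(2)])
  from DERIV_diff[OF DERIV_add[OF DERIV_diff[OF has_field_derivative_cot_kernel[OF z(3)] DERIV_const] cot_tail_sums(3)[OF z(1)]] this]
  show ?thesis unfolding cot_sum_def[abs_def] csc_sum_def by (simp add: algebra_simps)
qed

lemma cot_sum_minus: "z \<notin> lattice 1 \<tau> \<Longrightarrow> cot_sum (- z) = - cot_sum z"
  using cot_kernel_minus[OF tail_domain_if_not_lattice(3)] by (simp add: cot_sum_def)

lemma cot_sum_add_1: "cot_sum (z + 1) = cot_sum z"
  using cot_tail_add_of_int(1)[of z 1] cot_tail_add_of_int(1)[of "- z" "-1"] cot_kernel_add_of_int(1)[of z 1]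
  by (simp add: cot_sum_def)

lemma cot_sum_add_\<tau>: assumes z: "z \<notin> lattice 1 \<tau>" shows "cot_sum (z + \<tau>) = cot_sum z - 2 * of_real pi * \<i>"
proof -
  have "z + \<tau> \<notin> lattice 1 \<tau>" using z lattice_add_iff(1) lattice_generators(2) by blast
  note dom = tail_domain_if_not_lattice[OF z] tail_domain_if_not_lattice[OF this]
  have "cot_tail z = cot_kernel (z + \<tau>) + cot_tail (z + \<tau>)" using cot_tail_shift(1)[OF dom(4)] dom(1) by simp
  moreover have "cot_tail (- (z + \<tau>)) = cot_kernel (- z) + cot_tail (- z)"
    using cot_tail_shift(1)[OF dom(2)] dom(5) by simp
  ultimately show ?thesis using cot_kernel_minus[OF dom(3)] by (simp add: cot_sum_def)
qed

lemma cot_sum_residue: "((\<lambda>z. z * cot_sum z) \<longlongrightarrow> 1) (at 0)"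
proof -
  have "0 \<in> tail_domain" using Im_\<tau>_pos by (intro tail_domain_if_Im) simp
  then have cont: "isCont cot_tail 0" using cot_tail_sums(3) DERIV_isCont by blast
  then have "isCont (\<lambda>z. cot_tail (- z)) 0" using isCont_o2[of 0 uminus cot_tail] by (simp add: continuous_intros)
  then have "((\<lambda>z. z * cot_kernel z + z * (- of_real pi * \<i> + cot_tail z - cot_tail (- z)))
      \<longlongrightarrow> 1 + 0 * (- of_real pi * \<i> + cot_tail 0 - cot_tail (- 0))) (at 0)"
    using cont by (intro tendsto_intros cot_kernel_residue) (auto simp: isCont_def)
  then show ?thesis by (simp add: cot_sum_def algebra_simps)
qed

end

section \<open>Elliptic functions with real periods\<close>

locale period_lattice =
  fixes w1 w2 :: complex
  assumes area: "Im (cnj w1 * w2) > 0"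
begin

abbreviation \<Lambda> :: "complex set" where "\<Lambda> \<equiv> lattice w1 w2"

lemma w1_nonzero [simp]: "w1 \<noteq> 0"
  using area by auto

sublocale upper_half_plane "w2 / w1"
  using area by unfold_locales (simp only: Im_divide_eq[OF w1_nonzero], simp)

lemma divide_in_normalised_lattice_iff: "z / w1 \<in> lattice 1 (w2 / w1) \<longleftrightarrow> z \<in> \<Lambda>"
proof -
  have "z / w1 = of_int m * 1 + of_int n * (w2 / w1) \<longleftrightarrow> z = of_int m * w1 + of_int n * w2" for m n :: int
    by (simp add: field_simps)
  then show ?thesis by (simp add: lattice_def)
qed

definition \<kappa> :: real where "\<kappa> = pi / Im (cnj w1 * w2)"

lemma \<kappa>_pos: "\<kappa> > 0"
  using area by (simp add: \<kappa>_def)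

text \<open>Adding a linear term to Eisenstein's series makes the quasi-periods \<open>\<kappa> * cnj l\<close> independent of the basis.\<close>

definition zeta :: "complex \<Rightarrow> complex" where
  "zeta z = cot_sum (z / w1) / w1 + of_real \<kappa> * cnj w1 / w1 * z"

definition wp :: "complex \<Rightarrow> complex" where
  "wp z = csc_sum (z / w1) / w1\<^sup>2 - of_real \<kappa> * cnj w1 / w1"

lemma has_field_derivative_zeta: assumes "z \<notin> \<Lambda>" shows "(zeta has_field_derivative - wp z) (at z)"
proof -
  have "z / w1 \<notin> lattice 1 (w2 / w1)" using assms by (simp add: divide_in_normalised_lattice_iff)
  from has_field_derivative_cot_sum[OF this]
  have "((\<lambda>z. cot_sum (z / w1)) has_field_derivative - csc_sum (z / w1) * (1 / w1)) (at z)"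
    by (rule DERIV_chain2[where f = cot_sum and g = "\<lambda>z. z / w1"]) (auto intro!: derivative_eq_intros)
  then show ?thesis
    unfolding zeta_def[abs_def] wp_def
    by (auto intro!: derivative_eq_intros simp: power2_eq_square field_simps)
qed

lemma zeta_minus: "z \<notin> \<Lambda> \<Longrightarrow> zeta (- z) = - zeta z"
  using cot_sum_minus[of "z / w1"] by (simp add: zeta_def divide_in_normalised_lattice_iff)

lemma zeta_add: assumes "l \<in> \<Lambda>" "z \<notin> \<Lambda>" shows "zeta (z + l) = zeta z + of_real \<kappa> * cnj l"
proof -
  have "l \<in> \<Lambda> \<and> (\<forall>z. z \<notin> \<Lambda> \<longrightarrow> zeta (z + l) = zeta z + of_real \<kappa> * cnj l)"
    using assms(1)
  proof (induction rule: lattice_induct)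
    case left
    have "cot_sum ((z + w1) / w1) = cot_sum (z / w1)" for z
      using cot_sum_add_1[of "z / w1"] by (simp add: add_divide_distrib)
    then show ?case by (simp add: lattice_generators zeta_def field_simps)
  next
    case right
    have "\<kappa> * Im (cnj w1 * w2) = pi" using area unfolding \<kappa>_def by (metis less_irrefl nonzero_eq_divide_eq)
    then have "of_real \<kappa> * of_real (2 * Im (cnj w1 * w2)) = (of_real (2 * pi) :: complex)"
      by (simp only: of_real_mult[symmetric] mult.left_commute)
    then have "of_real \<kappa> * (cnj w1 * w2 - cnj (cnj w1 * w2)) = 2 * of_real pi * \<i>"
      unfolding complex_diff_cnj mult.assoc[symmetric] by simp
    then have "(of_real \<kappa> * cnj w1 * w2 - 2 * of_real pi * \<i>) / w1 = of_real \<kappa> * cnj w2"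
      by (simp add: field_simps)
    moreover have "cot_sum ((z + w2) / w1) = cot_sum (z / w1) - 2 * of_real pi * \<i>" if "z \<notin> \<Lambda>" for z
      using cot_sum_add_\<tau>[of "z / w1"] that by (simp add: divide_in_normalised_lattice_iff add_divide_distrib)
    ultimately show ?case by (simp add: lattice_generators zeta_def diff_divide_distrib add_divide_distrib distrib_left)
  next
    case (diff x y)
    have "zeta (z + (x - y)) = zeta z + of_real \<kappa> * cnj (x - y)" if "z \<notin> \<Lambda>" for z
    proof -
      have "z - y \<notin> \<Lambda>" using that diff(2) lattice_add_iff(1)[of y w1 w2 "z - y"] by simp
      then have "zeta (z - y + x) = zeta (z - y) + of_real \<kappa> * cnj x" "zeta (z - y + y) = zeta (z - y) + of_real \<kappa> * cnj y"
        using diff by blast+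
      then show ?thesis by (simp add: algebra_simps)
    qed
    then show ?case using diff lattice_diff by blast
  qed
  then show ?thesis using assms(2) by blast
qed

lemma real_part_lattice_multiples_zero:
  assumes "Re (w1 * x) = 0" "Re (w2 * x) = 0" shows "x = 0"
proof -
  have "Im (cnj w1 * w2) * Re x = Im w2 * Re (w1 * x) - Im w1 * Re (w2 * x)"
    "Im (cnj w1 * w2) * Im x = Re w2 * Re (w1 * x) - Re w1 * Re (w2 * x)" by (simp_all add: algebra_simps)
  then have "Re x = 0" "Im x = 0" using area assms by (simp_all only: mult_zero_right diff_self mult_eq_0_iff) auto
  then show ?thesis by (simp add: complex_eq_iff)
qed

definition punctured_plane :: "complex set \<Rightarrow> complex set" where
  "punctured_plane J = {z. \<forall>j\<in>J. z - j \<notin> \<Lambda>}"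

lemma open_complement_translates:
  assumes "finite J" shows "open (- (\<Union>j\<in>J. (+) j ` (\<Lambda> - A j)))"
proof -
  have "closed (\<Lambda> - B)" for B using closed_subset_lattice[of w1 w2] area by auto
  then show ?thesis using assms by (intro open_Compl closed_UN ballI closed_translation) auto
qed

lemma punctured_plane_eq: "punctured_plane J = - (\<Union>j\<in>J. (+) j ` \<Lambda>)"
  unfolding punctured_plane_def by (auto simp: image_iff) (metis add_diff_cancel_left' add.commute diff_add_cancel)+

lemma open_punctured_plane: "finite J \<Longrightarrow> open (punctured_plane J)"
  using open_complement_translates[of J "\<lambda>_. {}"] by (simp add: punctured_plane_eq)

lemma connected_punctured_plane: "finite J \<Longrightarrow> connected (punctured_plane J)"
  unfolding punctured_plane_eq
  by (intro path_connected_imp_connected path_connected_complement_countable countable_UN countable_image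
      countable_lattice countable_finite) auto

lemma punctured_plane_add: "l \<in> \<Lambda> \<Longrightarrow> z + l \<in> punctured_plane J \<longleftrightarrow> z \<in> punctured_plane J"
  using lattice_add_iff(1)[of l w1 w2 "z - _"] by (simp add: punctured_plane_def algebra_simps)

lemma open_insert_punctured_plane: assumes "finite J" shows "open (insert w (punctured_plane J))"
proof -
  have "insert w (punctured_plane J) = - (\<Union>j\<in>J. (+) j ` (\<Lambda> - {w - j}))"
    unfolding punctured_plane_eq by (force simp: image_iff)
  then show ?thesis using open_complement_translates[OF assms, of "\<lambda>j. {w - j}"] by simp
qed

lemma eventually_punctured_plane: "finite J \<Longrightarrow> \<forall>\<^sub>F z in at w. z \<in> punctured_plane J"
  using eventually_at_in_open[OF open_insert_punctured_plane, of J w w] by (auto elim: eventually_mono)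

lemma punctured_plane_0: "punctured_plane {0} = - \<Lambda>"
  by (auto simp: punctured_plane_def)

lemma zeta_holomorphic: "zeta holomorphic_on - \<Lambda>"
  using has_field_derivative_zeta open_punctured_plane[of "{0}"]
  by (force simp: holomorphic_on_open punctured_plane_0)

lemma wp_holomorphic: "wp holomorphic_on - \<Lambda>"
proof -
  have "(\<lambda>z. - deriv zeta z) holomorphic_on - \<Lambda>"
    using open_punctured_plane[of "{0}"]
    by (intro holomorphic_intros holomorphic_deriv[OF zeta_holomorphic]) (simp add: punctured_plane_0)
  then show ?thesis
    by (rule holomorphic_transform) (simp add: DERIV_imp_deriv[OF has_field_derivative_zeta])
qed

lemma wp_shift_holomorphic: assumes "\<And>z. z \<in> S \<Longrightarrow> z - j \<notin> \<Lambda>" shows "(\<lambda>z. wp (z - j)) holomorphic_on S"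
proof -
  have "(\<lambda>z. z - j) holomorphic_on S" by (intro holomorphic_intros)
  from holomorphic_on_compose_gen[OF this wp_holomorphic] show ?thesis using assms by (auto simp: o_def)
qed

lemma wp_isCont: "z \<notin> \<Lambda> \<Longrightarrow> isCont wp z"
  using holomorphic_on_imp_continuous_on[OF wp_holomorphic] open_punctured_plane[of "{0}"]
  by (simp add: punctured_plane_0 continuous_on_eq_continuous_at)

lemma zeta_derivative_unique:
  assumes "z \<notin> \<Lambda>" "(g has_field_derivative d) (at z)" "\<And>y. y \<notin> \<Lambda> \<Longrightarrow> g y = zeta y + c" shows "d = - wp z"
proof -
  have "((\<lambda>y. zeta y + c) has_field_derivative d) (at z)"
    using has_field_derivative_transform_within_open[OF assms(2), of "- \<Lambda>"] open_punctured_plane[of "{0}"] assms(1,3)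
    by (simp add: punctured_plane_0)
  moreover have "((\<lambda>y. zeta y + c) has_field_derivative - wp z) (at z)"
    using has_field_derivative_zeta[OF assms(1)] by (auto intro!: derivative_eq_intros)
  ultimately show ?thesis by (rule DERIV_unique)
qed

lemma wp_add: assumes "l \<in> \<Lambda>" "z \<notin> \<Lambda>" shows "wp (z + l) = wp z"
proof -
  have "z + l \<notin> \<Lambda>" using assms lattice_add_iff(1) by blast
  then have "((\<lambda>y. zeta (y + l)) has_field_derivative - wp (z + l)) (at z)"
    using has_field_derivative_zeta DERIV_shift by blast
  from zeta_derivative_unique[OF assms(2) this] show ?thesis using zeta_add[OF assms(1)] by fastforce
qed

lemma wp_minus: assumes "z \<notin> \<Lambda>" shows "wp (- z) = wp z"
proof -
  have "((\<lambda>y. zeta (- y)) has_field_derivative - wp (- z) * - 1) (at z)"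
    by (rule DERIV_chain2[where f = zeta and g = uminus])
      (use assms has_field_derivative_zeta[of "- z"] in \<open>auto intro!: derivative_eq_intros\<close>)
  then have "((\<lambda>y. - zeta (- y)) has_field_derivative - wp (- z)) (at z)" by (auto intro!: derivative_eq_intros)
  from zeta_derivative_unique[OF assms this, of 0] show ?thesis using zeta_minus by simp
qed

lemma zeta_residue: "((\<lambda>z. z * zeta z) \<longlongrightarrow> 1) (at 0)"
proof -
  have "filterlim (\<lambda>z. z / w1) (at 0) (at 0)"
    by (auto simp: filterlim_at eventually_at_filter intro!: tendsto_eq_intros)
  then have "((\<lambda>z. z / w1 * cot_sum (z / w1)) \<longlongrightarrow> 1) (at 0)" by (rule filterlim_compose[OF cot_sum_residue])
  then have "((\<lambda>z. z / w1 * cot_sum (z / w1) + of_real \<kappa> * cnj w1 / w1 * z\<^sup>2) \<longlongrightarrow> 1 + of_real \<kappa> * cnj w1 / w1 * 0\<^sup>2) (at 0)"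
    by (intro tendsto_intros)
  then show ?thesis by (simp add: zeta_def power2_eq_square algebra_simps)
qed

lemma wp_principal_part: obtains c where "((\<lambda>z. wp z - 1 / z\<^sup>2) \<longlongrightarrow> c) (at 0)"
proof -
  obtain e where e: "e > 0" "\<And>z. z \<in> \<Lambda> \<Longrightarrow> norm z < e \<Longrightarrow> z = 0" using lattice_discrete[of w1 w2] area by auto
  let ?B = "ball (0::complex) e - {0}"
  have off: "z \<notin> \<Lambda>" if "z \<in> ?B" for z using e(2) that by auto
  have hol: "(\<lambda>z. zeta z - 1 / z) holomorphic_on ?B"
    using off by (intro holomorphic_intros holomorphic_on_subset[OF zeta_holomorphic]) auto
  have "((\<lambda>z. z * zeta z - 1) \<longlongrightarrow> 1 - 1) (at 0)" by (intro tendsto_intros zeta_residue)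
  moreover have "\<forall>\<^sub>F z in at 0. z * zeta z - 1 = (z - 0) * (zeta z - 1 / z)"
    by (auto simp: eventually_at_filter algebra_simps)
  ultimately have "((\<lambda>z. (z - 0) * (zeta z - 1 / z)) \<longlongrightarrow> 0) (at 0)" using Lim_transform_eventually by fastforce
  then obtain k where k: "k holomorphic_on ball 0 e" "\<And>z. z \<in> ?B \<Longrightarrow> k z = zeta z - 1 / z"
    using holomorphic_on_extend_lim[OF hol] e(1) by auto
  have "isCont (deriv k) 0"
    using holomorphic_on_imp_continuous_on[OF holomorphic_deriv[OF k(1) open_ball]] e(1)
    by (simp add: continuous_on_eq_continuous_at)
  then have "((\<lambda>z. - deriv k z) \<longlongrightarrow> - deriv k 0) (at 0)" by (intro tendsto_minus) (simp add: isCont_def)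
  moreover have "- deriv k z = wp z - 1 / z\<^sup>2" if z: "z \<in> ?B" for z
  proof -
    have "((\<lambda>z. zeta z - 1 / z) has_field_derivative - wp z - - (1 / z\<^sup>2)) (at z)"
      using z off[OF z] by (auto intro!: derivative_eq_intros has_field_derivative_zeta simp: power2_eq_square)
    moreover have "open ?B" by (simp add: open_delete)
    ultimately have "(k has_field_derivative - wp z - - (1 / z\<^sup>2)) (at z)"
      using z k(2) by (metis (no_types, lifting) has_field_derivative_transform_within_open)
    then show ?thesis by (simp add: DERIV_imp_deriv)
  qed
  then have "\<forall>\<^sub>F z in at 0. - deriv k z = wp z - 1 / z\<^sup>2"
    using eventually_at_in_open[OF open_ball, of 0 0 e] e(1) by (auto elim!: eventually_mono)
  ultimately have "((\<lambda>z. wp z - 1 / z\<^sup>2) \<longlongrightarrow> - deriv k 0) (at 0)" by (rule Lim_transform_eventually)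
  then show ?thesis by (rule that)
qed

lemma wp_double_pole: "((\<lambda>z. z\<^sup>2 * wp z) \<longlongrightarrow> 1) (at 0)"
proof -
  obtain c where "((\<lambda>z. wp z - 1 / z\<^sup>2) \<longlongrightarrow> c) (at 0)" by (rule wp_principal_part)
  then have "((\<lambda>z. z\<^sup>2 * (wp z - 1 / z\<^sup>2) + 1) \<longlongrightarrow> 0\<^sup>2 * c + 1) (at 0)" by (intro tendsto_intros)
  moreover have "\<forall>\<^sub>F z in at 0. z\<^sup>2 * (wp z - 1 / z\<^sup>2) + 1 = z\<^sup>2 * wp z"
    by (auto simp: eventually_at_filter algebra_simps)
  ultimately show ?thesis using Lim_transform_eventually by fastforce
qed

lemma wp_not_eventually_constant:
  assumes w: "w \<notin> \<Lambda>" and const: "\<forall>\<^sub>F z in at w. wp z = c" shows False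
proof -
  have region: "open (- \<Lambda>)" "connected (- \<Lambda>)"
    using open_punctured_plane[of "{0}"] connected_punctured_plane[of "{0}"] by (simp_all add: punctured_plane_0)
  have "wp z - c = 0" if "z \<in> - \<Lambda>" for z
  proof (rule analytic_continuation[where f = "\<lambda>z. wp z - c" and S = "- \<Lambda>" and U = "{z \<in> - \<Lambda>. wp z = c}" and \<xi> = w])
    show "(\<lambda>z. wp z - c) holomorphic_on - \<Lambda>" by (intro holomorphic_intros wp_holomorphic)
    have "\<forall>\<^sub>F z in at w. z \<in> {z \<in> - \<Lambda>. wp z = c}"
      using const eventually_at_in_open[OF region(1), of w] w by (auto elim: eventually_elim2)
    then have "\<exists>\<^sub>F z in at w. z \<in> {z \<in> - \<Lambda>. wp z = c}" by (intro eventually_frequently) simp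
    then show "w islimpt {z \<in> - \<Lambda>. wp z = c}" by (simp add: islimpt_iff_eventually frequently_def)
  qed (use w that region in auto)
  moreover have "\<forall>\<^sub>F z in at 0. z \<in> - \<Lambda>" using eventually_punctured_plane[of "{0}" 0] by (simp add: punctured_plane_0)
  ultimately have "\<forall>\<^sub>F z in at 0. z\<^sup>2 * c = z\<^sup>2 * wp z" by (auto elim!: eventually_mono)
  moreover have "((\<lambda>z. z\<^sup>2 * c) \<longlongrightarrow> 0\<^sup>2 * c) (at 0)" by (intro tendsto_intros)
  ultimately have "((\<lambda>z. z\<^sup>2 * wp z) \<longlongrightarrow> 0\<^sup>2 * c) (at 0)" by (rule Lim_transform_eventually[rotated])
  then show False using wp_double_pole LIM_unique by fastforce
qed

lemma elliptic_constant:
  assumes J: "finite J" and hol: "G holomorphic_on punctured_plane J"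
    and periodic: "\<And>z l. l \<in> \<Lambda> \<Longrightarrow> z \<in> punctured_plane J \<Longrightarrow> G (z + l) = G z"
    and removable: "\<And>j. j \<in> J \<Longrightarrow> \<exists>c. (G \<longlongrightarrow> c) (at j)"
  obtains c where "\<And>z. z \<in> punctured_plane J \<Longrightarrow> G z = c"
proof -
  have shift: "(G \<longlongrightarrow> c) (at (w + l))" if l: "l \<in> \<Lambda>" and lim: "(G \<longlongrightarrow> c) (at w)" for c l w
  proof -
    have "\<forall>\<^sub>F z in at w. G z = G (z + l)"
      using eventually_punctured_plane[OF J] by (rule eventually_mono) (simp add: periodic l)
    with lim have "((\<lambda>z. G (z + l)) \<longlongrightarrow> c) (at w)" by (rule Lim_transform_eventually)
    then have "((\<lambda>z. G (z - l + l)) \<longlongrightarrow> c) (at (w + l))" using LIM_offset[of "\<lambda>z. G (z + l)" c w "- l"] by simp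
    then show ?thesis by simp
  qed
  have at: "(G \<longlongrightarrow> G w) (at w)" if "w \<in> punctured_plane J" for w
    using holomorphic_on_imp_continuous_on[OF hol] open_punctured_plane[OF J] that
    by (simp add: continuous_on_eq_continuous_at isCont_def)
  have lim: "\<exists>c. (G \<longlongrightarrow> c) (at w)" for w
  proof (cases "w \<in> punctured_plane J")
    case False
    then obtain j where j: "j \<in> J" "w - j \<in> \<Lambda>" by (auto simp: punctured_plane_def)
    then obtain c where "(G \<longlongrightarrow> c) (at j)" using removable by blast
    with j show ?thesis using shift[of "w - j" c j] by auto
  qed (use at in blast)
  define E where "E = remove_sings G"
  have E_lim: "(G \<longlongrightarrow> E w) (at w)" for w using lim[of w] remove_sings_eqI unfolding E_def by blast
  have "E analytic_on {w}" for w
  proof -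
    have "G holomorphic_on insert w (punctured_plane J) - {w}" by (rule holomorphic_on_subset[OF hol]) auto
    then have "isolated_singularity_at G w"
      by (rule isolated_singularity_at_holomorphic) (use open_insert_punctured_plane[OF J] in auto)
    then show ?thesis unfolding E_def using E_lim by (rule remove_sings_analytic_at)
  qed
  then have hol_E: "E holomorphic_on UNIV" using analytic_on_analytic_at analytic_imp_holomorphic by blast
  have "E z \<in> E ` cball 0 (norm w1 + norm w2)" for z
  proof -
    obtain l where l: "l \<in> \<Lambda>" "norm (z + l) \<le> norm w1 + norm w2" using lattice_fundamental_domain area by (metis less_irrefl)
    moreover have "E (z + l) = E z" using shift[OF l(1) E_lim] E_lim LIM_unique by blast
    ultimately show ?thesis by (metis imageI mem_cball_0)
  qed
  moreover have "compact (E ` cball 0 (norm w1 + norm w2))"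
    by (intro compact_continuous_image holomorphic_on_imp_continuous_on holomorphic_on_subset[OF hol_E]) auto
  ultimately have "bounded (range E)" by (meson bounded_subset compact_imp_bounded image_subsetI)
  then obtain c where "\<And>z. E z = c" using Liouville_theorem[OF hol_E] unfolding constant_on_def by auto
  then show ?thesis using that at E_lim LIM_unique by metis
qed

context
  fixes J :: "complex set" and g :: "complex \<Rightarrow> complex" and a :: "complex \<Rightarrow> complex"
  assumes J: "finite J" "\<And>i j. i \<in> J \<Longrightarrow> j \<in> J \<Longrightarrow> i - j \<in> \<Lambda> \<Longrightarrow> i = j"
    and hol: "g holomorphic_on punctured_plane J" and periodic: "\<And>z l. l \<in> \<Lambda> \<Longrightarrow> z \<in> punctured_plane J \<Longrightarrow> g (z + l) = g z"
    and pole: "\<And>j. j \<in> J \<Longrightarrow> \<exists>c. ((\<lambda>z. g z + a j / (z - j)\<^sup>2) \<longlongrightarrow> c) (at j)"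
begin

lemma elliptic_principal_parts:
  obtains c where "\<And>z. z \<in> punctured_plane J \<Longrightarrow> g z = c - (\<Sum>j\<in>J. a j * wp (z - j))"
proof (rule elliptic_constant[OF J(1), of "\<lambda>z. g z + (\<Sum>j\<in>J. a j * wp (z - j))"])
  show "(\<lambda>z. g z + (\<Sum>j\<in>J. a j * wp (z - j))) holomorphic_on punctured_plane J"
    by (intro holomorphic_intros hol wp_shift_holomorphic) (simp add: punctured_plane_def)
  have "wp (z + l - j) = wp (z - j)" if "l \<in> \<Lambda>" "z \<in> punctured_plane J" "j \<in> J" for z l j
    using wp_add[of l "z - j"] that by (simp add: punctured_plane_def algebra_simps)
  then show "g (z + l) + (\<Sum>j\<in>J. a j * wp (z + l - j)) = g z + (\<Sum>j\<in>J. a j * wp (z - j))"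
    if "l \<in> \<Lambda>" "z \<in> punctured_plane J" for z l
    using that periodic by simp
  fix j assume j: "j \<in> J"
  obtain c where c: "((\<lambda>z. g z + a j / (z - j)\<^sup>2) \<longlongrightarrow> c) (at j)" using pole[OF j] by blast
  obtain d where "((\<lambda>z. wp z - 1 / z\<^sup>2) \<longlongrightarrow> d) (at 0)" by (rule wp_principal_part)
  from LIM_offset[OF this, of "- j"] have d: "((\<lambda>z. wp (z - j) - 1 / (z - j)\<^sup>2) \<longlongrightarrow> d) (at j)" by simp
  have "isCont (\<lambda>z. wp (z - i)) j" if "i \<in> J - {j}" for i
    using isCont_o2[of j "\<lambda>z. z - i" wp] wp_isCont[of "j - i"] J(2)[of j i] j that by (auto intro: continuous_intros)
  then have "((\<lambda>z. \<Sum>i\<in>J - {j}. a i * wp (z - i)) \<longlongrightarrow> (\<Sum>i\<in>J - {j}. a i * wp (j - i))) (at j)"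
    by (intro tendsto_intros) (simp add: isCont_def)
  with c d have "((\<lambda>z. (g z + a j / (z - j)\<^sup>2) + a j * (wp (z - j) - 1 / (z - j)\<^sup>2) + (\<Sum>i\<in>J - {j}. a i * wp (z - i)))
      \<longlongrightarrow> c + a j * d + (\<Sum>i\<in>J - {j}. a i * wp (j - i))) (at j)"
    by (intro tendsto_add tendsto_mult tendsto_const)
  moreover have "(g z + a j / (z - j)\<^sup>2) + a j * (wp (z - j) - 1 / (z - j)\<^sup>2) + (\<Sum>i\<in>J - {j}. a i * wp (z - i))
      = g z + (\<Sum>j\<in>J. a j * wp (z - j))" for z
    using J(1) j by (simp add: sum.remove[of J j] right_diff_distrib)
  ultimately show "\<exists>c. ((\<lambda>z. g z + (\<Sum>j\<in>J. a j * wp (z - j))) \<longlongrightarrow> c) (at j)" by auto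
next
  fix c assume "\<And>z. z \<in> punctured_plane J \<Longrightarrow> g z + (\<Sum>j\<in>J. a j * wp (z - j)) = c"
  then show thesis by (intro that[of c]) (simp add: eq_diff_eq)
qed

text \<open>The constant is read off from the quasi-periods of the primitive \<open>c z + (\<Sum>j\<in>J. a j * zeta (z - j))\<close>, whose real
  part is periodic.\<close>

theorem elliptic_representation:
  assumes real_periodic: "\<And>z l. l \<in> \<Lambda> \<Longrightarrow> z \<in> punctured_plane J \<Longrightarrow> h (z + l) = h z"
    and derivative: "\<And>z. z \<in> punctured_plane J \<Longrightarrow> (h has_derivative (\<lambda>v. Re (v * g z))) (at z)"
    and z: "z \<in> punctured_plane J"
  shows "g z = - (\<Sum>j\<in>J. a j * wp (z - j)) - of_real \<kappa> * cnj (\<Sum>j\<in>J. a j)"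
proof -
  obtain c where c: "\<And>z. z \<in> punctured_plane J \<Longrightarrow> g z = c - (\<Sum>j\<in>J. a j * wp (z - j))"
    using elliptic_principal_parts by metis
  define A where "A = (\<Sum>j\<in>J. a j)"
  define S where "S = (\<lambda>z. c * z + (\<Sum>j\<in>J. a j * zeta (z - j)))"
  have dS: "(S has_field_derivative g z) (at z)" if "z \<in> punctured_plane J" for z
  proof -
    have "((\<lambda>z. zeta (z - j)) has_field_derivative - wp (z - j)) (at z)" if "j \<in> J" for j
      using DERIV_shift[of zeta "- wp (z - j)" z "- j"] has_field_derivative_zeta[of "z - j"] that \<open>z \<in> punctured_plane J\<close>
      by (simp add: punctured_plane_def)
    then have "((\<lambda>z. \<Sum>j\<in>J. a j * zeta (z - j)) has_field_derivative (\<Sum>j\<in>J. a j * - wp (z - j))) (at z)"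
      by (intro DERIV_sum DERIV_cmult) auto
    from DERIV_add[OF DERIV_cmult[OF DERIV_ident, of c] this] show ?thesis
      unfolding S_def c[OF that] by (simp add: sum_negf)
  qed
  have const: "h x - Re (S x) = h y - Re (S y)" if "x \<in> punctured_plane J" "y \<in> punctured_plane J" for x y
  proof (rule has_derivative_zero_unique_connected[OF open_punctured_plane[OF J(1)] connected_punctured_plane[OF J(1)] _ that])
    fix u assume u: "u \<in> punctured_plane J"
    have "((\<lambda>z. Re (S z)) has_derivative (\<lambda>v. Re (g u * v))) (at u)"
      using bounded_linear.has_derivative[OF bounded_linear_Re dS[OF u, unfolded has_field_derivative_def]] .
    from has_derivative_diff[OF derivative[OF u] this] show "((\<lambda>z. h z - Re (S z)) has_derivative (\<lambda>v. 0)) (at u)"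
      by (simp add: mult.commute)
  qed
  have "Re (l * (c + of_real \<kappa> * cnj A)) = 0" if l: "l \<in> \<Lambda>" for l
  proof -
    have "a j * zeta (z + l - j) = a j * zeta (z - j) + a j * (of_real \<kappa> * cnj l)" if "j \<in> J" for j
      using zeta_add[OF l, of "z - j"] z that by (simp add: punctured_plane_def algebra_simps)
    then have "S (z + l) = S z + (c * l + A * (of_real \<kappa> * cnj l))"
      by (simp add: S_def A_def sum.distrib sum_distrib_right distrib_left cong: sum.cong)
    moreover have "Re (S (z + l)) = Re (S z)"
      using const[of "z + l" z] z real_periodic[OF l z] punctured_plane_add[OF l] by simp
    ultimately have "Re (c * l + A * (of_real \<kappa> * cnj l)) = 0" by simp
    then show ?thesis by (simp add: algebra_simps)
  qed
  from this[OF lattice_generators(1)] this[OF lattice_generators(2)] have "c + of_real \<kappa> * cnj A = 0"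
    by (rule real_part_lattice_multiples_zero)
  then have "c = - (of_real \<kappa> * cnj A)" by (simp only: eq_neg_iff_add_eq_0)
  then show ?thesis using c[OF z] by (simp add: A_def)
qed

end

end

context period_lattice
begin

text \<open>Compare the poles at \<open>0\<close> of the two sides.\<close>

lemma wp_bilinear_relation_at_pole:
  assumes p: "p \<notin> \<Lambda>"
    and rel: "\<And>u. u \<notin> \<Lambda> \<Longrightarrow> u - p \<notin> \<Lambda> \<Longrightarrow> A * wp u * wp (u - p) + B * wp u + C * wp (u - p) + D = 0"
  shows "A * wp p + B = 0"
proof -
  let ?L = "A * 1 * wp p + B * 1 + 0\<^sup>2 * (C * wp p + D)"
  have "isCont (\<lambda>u. wp (u - p)) 0"
    using isCont_o2[of 0 "\<lambda>u. u - p" wp] wp_isCont[of "- p"] p by (auto intro: continuous_intros)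
  then have "((\<lambda>u. wp (u - p)) \<longlongrightarrow> wp p) (at 0)" using wp_minus[OF p] by (simp add: isCont_def)
  then have "((\<lambda>u. A * (u\<^sup>2 * wp u) * wp (u - p) + B * (u\<^sup>2 * wp u) + u\<^sup>2 * (C * wp (u - p) + D))
      \<longlongrightarrow> ?L) (at 0)"
    by (intro tendsto_intros wp_double_pole)
  moreover have "\<forall>\<^sub>F u in at 0. A * (u\<^sup>2 * wp u) * wp (u - p) + B * (u\<^sup>2 * wp u) + u\<^sup>2 * (C * wp (u - p) + D) = 0"
    using eventually_punctured_plane[of "{0, p}" 0, simplified]
  proof eventually_elim
    case (elim u)
    then have "u\<^sup>2 * (A * wp u * wp (u - p) + B * wp u + C * wp (u - p) + D) = 0"
      using rel by (simp add: punctured_plane_def)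
    then show ?case by (simp add: algebra_simps)
  qed
  ultimately have "((\<lambda>u. 0) \<longlongrightarrow> ?L) (at (0::complex))"
    by (rule Lim_transform_eventually)
  then have "?L = 0" by (metis LIM_const_eq)
  then show ?thesis by simp
qed

lemma wp_bilinear_relation:
  assumes p: "p \<notin> \<Lambda>"
    and rel: "\<And>u. u \<notin> \<Lambda> \<Longrightarrow> u - p \<notin> \<Lambda> \<Longrightarrow> A * wp u * wp (u - p) + B * wp u + C * wp (u - p) + D = 0"
  shows "A * wp p + B = 0" "A * wp p + C = 0" "A \<noteq> 0 \<Longrightarrow> 2 * p \<in> \<Lambda>"
proof -
  show B: "A * wp p + B = 0" by (rule wp_bilinear_relation_at_pole[OF p rel])
  have "A * wp (- p) + C = 0"
  proof (rule wp_bilinear_relation_at_pole)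
    show "A * wp u * wp (u - - p) + C * wp u + B * wp (u - - p) + D = 0" if "u \<notin> \<Lambda>" "u - - p \<notin> \<Lambda>" for u
      using rel[of "u + p"] that by (simp add: algebra_simps)
  qed (use p in simp)
  then show C: "A * wp p + C = 0" using wp_minus[OF p] by simp
  show "2 * p \<in> \<Lambda>" if A: "A \<noteq> 0"
  proof (rule ccontr)
    assume not: "2 * p \<notin> \<Lambda>"
    define e where "e = wp p"
    have BC: "B = - (A * e)" "C = - (A * e)" using B C by (simp_all add: e_def eq_neg_iff_add_eq_0 add.commute)
    have product: "A * ((wp u - e) * (wp (u - p) - e)) = A * e\<^sup>2 - D" if "u \<notin> \<Lambda>" "u - p \<notin> \<Lambda>" for u
      using rel[OF that] by (simp add: BC algebra_simps power2_eq_square)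
    have "- p \<notin> \<Lambda>" "- p - p \<notin> \<Lambda>" using p not lattice_minus_iff[of "2 * p"] by simp_all
    from product[OF this] have "A * e\<^sup>2 - D = 0" using wp_minus[OF p] by (simp add: e_def)
    then have factor: "wp u = e \<or> wp (u - p) = e" if "u \<notin> \<Lambda>" "u - p \<notin> \<Lambda>" for u
      using product[OF that] A by auto
    have "((\<lambda>u. u\<^sup>2 * wp u - u\<^sup>2 * e) \<longlongrightarrow> 1 - 0\<^sup>2 * e) (at 0)" by (intro tendsto_intros wp_double_pole)
    then have "\<forall>\<^sub>F u in at 0. u\<^sup>2 * wp u - u\<^sup>2 * e \<noteq> 0" by (rule tendsto_imp_eventually_ne) simp
    moreover have "\<forall>\<^sub>F u in at 0. u \<in> punctured_plane {0, p}" by (rule eventually_punctured_plane) simp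
    ultimately have "\<forall>\<^sub>F u in at 0. wp (u - p) = e"
      by eventually_elim (use factor in \<open>auto simp: punctured_plane_def\<close>)
    then have "\<forall>\<^sub>F u in at (- p). wp u = e" by (subst eventually_at_to_0) simp
    then show False using wp_not_eventually_constant \<open>- p \<notin> \<Lambda>\<close> by blast
  qed
qed

end

locale index_two_lattice = L: period_lattice w1 w2 + V: period_lattice v1 v2 for w1 w2 v1 v2 :: complex +
  fixes p :: complex
  assumes V_eq: "V.\<Lambda> = {z. z \<in> L.\<Lambda> \<or> z - p \<in> L.\<Lambda>}" and half_period: "2 * p \<in> L.\<Lambda>" "p \<notin> L.\<Lambda>"
    and half_area: "Im (cnj v1 * v2) = Im (cnj w1 * w2) / 2"
begin

lemma \<kappa>_double: "V.\<kappa> = 2 * L.\<kappa>"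
  by (simp only: V.\<kappa>_def L.\<kappa>_def half_area) simp

lemma not_in_V: "z \<notin> V.\<Lambda> \<Longrightarrow> z \<notin> L.\<Lambda>" "z \<notin> V.\<Lambda> \<Longrightarrow> z + p \<notin> L.\<Lambda>"
  using lattice_add_iff(1)[OF half_period(1), of "z - p"] unfolding V_eq by (auto simp: algebra_simps)

lemma sum_periodic:
  assumes l: "l \<in> V.\<Lambda>" and z: "z \<notin> V.\<Lambda>"
  shows "L.wp (z + l) + L.wp (z + l + p) = L.wp z + L.wp (z + p)" (is ?wp)
    and "L.zeta (z + l) + L.zeta (z + l + p) = L.zeta z + L.zeta (z + p) + of_real V.\<kappa> * cnj l" (is ?zeta)
proof -
  note off = not_in_V[OF z]
  have "?wp \<and> ?zeta"
  proof (cases "l \<in> L.\<Lambda>")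
    case True
    have "z + l + p = z + p + l" by simp
    then show ?thesis
      using L.wp_add[OF True off(1)] L.wp_add[OF True off(2)] L.zeta_add[OF True off(1)] L.zeta_add[OF True off(2)]
      by (simp only: \<kappa>_double) (simp add: algebra_simps)
  next
    case False
    then have m: "l - p \<in> L.\<Lambda>" "l + p \<in> L.\<Lambda>"
      using l lattice_add[OF _ half_period(1), of "l - p"] unfolding V_eq by (auto simp: add.commute)
    have "z + l = z + p + (l - p)" "z + l + p = z + (l + p)" by simp_all
    then show ?thesis
      using L.wp_add[OF m(1) off(2)] L.wp_add[OF m(2) off(1)] L.zeta_add[OF m(1) off(2)] L.zeta_add[OF m(2) off(1)]
      by (simp only: \<kappa>_double) (simp add: algebra_simps)
  qed
  then show ?wp ?zeta by blast+
qed

text \<open>Both sides have the same poles; \<open>elliptic_representation\<close> on the finer lattice compares the constants.\<close>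

theorem wp_index_two:
  assumes z: "z \<notin> V.\<Lambda>" shows "V.wp z = L.wp z + L.wp (z + p)"
proof -
  define g where "g = (\<lambda>z. - L.wp z - L.wp (z + p) - of_real V.\<kappa>)"
  define h where "h = (\<lambda>z. Re (L.zeta z + L.zeta (z + p) - of_real V.\<kappa> * z))"
  have "g z = - (\<Sum>j\<in>{0}. 1 * V.wp (z - j)) - of_real V.\<kappa> * cnj (\<Sum>j\<in>{0::complex}. 1)"
  proof (rule V.elliptic_representation[where a = "\<lambda>_. 1" and h = h], unfold V.punctured_plane_0)
    have "(\<lambda>z. L.wp (z - - p)) holomorphic_on - V.\<Lambda>" by (rule L.wp_shift_holomorphic) (use not_in_V in auto)
    then have "(\<lambda>z. L.wp (z + p)) holomorphic_on - V.\<Lambda>" by simp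
    moreover have "L.wp holomorphic_on - V.\<Lambda>" by (rule holomorphic_on_subset[OF L.wp_holomorphic]) (use not_in_V in auto)
    ultimately show "g holomorphic_on - V.\<Lambda>" unfolding g_def by (intro holomorphic_intros)
    fix j assume "j \<in> {0::complex}"
    obtain c where "((\<lambda>z. L.wp z - 1 / z\<^sup>2) \<longlongrightarrow> c) (at 0)" by (rule L.wp_principal_part)
    moreover have "isCont (\<lambda>z. L.wp (z + p)) 0"
      using isCont_o2[of 0 "\<lambda>z. z + p" L.wp] L.wp_isCont[OF half_period(2)] by (auto intro: continuous_intros)
    ultimately have "((\<lambda>z. - (L.wp z - 1 / z\<^sup>2) - L.wp (z + p) - of_real V.\<kappa>) \<longlongrightarrow> - c - L.wp (0 + p) - of_real V.\<kappa>) (at 0)"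
      unfolding isCont_def by (intro tendsto_intros)
    then show "\<exists>c. ((\<lambda>z. g z + 1 / (z - j)\<^sup>2) \<longlongrightarrow> c) (at j)" using \<open>j \<in> {0}\<close> by (auto simp: g_def algebra_simps)
  next
    fix z assume "z \<in> - V.\<Lambda>"
    then have z: "z \<notin> V.\<Lambda>" by simp
    have "((\<lambda>z. L.zeta (z + p)) has_field_derivative - L.wp (z + p)) (at z)"
      using L.has_field_derivative_zeta[OF not_in_V(2)[OF z]] DERIV_shift by blast
    from DERIV_diff[OF DERIV_add[OF L.has_field_derivative_zeta[OF not_in_V(1)[OF z]] this] DERIV_cmult[OF DERIV_ident, of "of_real V.\<kappa>"]]
    have "((\<lambda>z. L.zeta z + L.zeta (z + p) - of_real V.\<kappa> * z) has_field_derivative g z) (at z)"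
      by (simp add: g_def)
    then show "(h has_derivative (\<lambda>v. Re (v * g z))) (at z)"
      unfolding h_def has_field_derivative_def mult.commute[of _ "g z"] by (rule bounded_linear.has_derivative[OF bounded_linear_Re])
    show "g (z + l) = g z" "h (z + l) = h z" if "l \<in> V.\<Lambda>" for l
      using sum_periodic(1)[OF that z] arg_cong[OF sum_periodic(2)[OF that z], of Re] by (simp_all add: g_def h_def algebra_simps)
  qed (use z in auto)
  then have "- (L.wp z + L.wp (z + p)) = - V.wp z" by (simp add: g_def)
  then show ?thesis by (simp only: neg_equal_iff_equal)
qed

end

section \<open>The values at the half periods of a reduced lattice\<close>

lemma norm_inverse_square_minus_1_le:
  fixes x :: complex assumes "norm (x - 1) \<le> 7/100" shows "norm (1 / x\<^sup>2 - 1) \<le> 17/100"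
proof -
  have x: "norm x \<ge> 93/100" "norm (1 + x) \<le> 207/100"
    using assms norm_triangle_ineq2[of 1 "1 - x"] norm_triangle_ineq[of 2 "x - 1"] by (simp_all add: norm_minus_commute)
  then have "x \<noteq> 0" by auto
  then have "1 / x\<^sup>2 - 1 = (1 - x) * (1 + x) / x\<^sup>2" by (simp add: field_simps power2_eq_square)
  then have "norm (1 / x\<^sup>2 - 1) = norm (x - 1) * norm (1 + x) / (norm x)\<^sup>2"
    by (simp add: norm_mult norm_divide norm_power norm_minus_commute)
  also have "\<dots> \<le> (7/100) * (207/100) / (93/100)\<^sup>2"
    using assms x by (intro frac_le mult_mono power_mono) auto
  also have "\<dots> \<le> 17/100" by (simp add: power2_eq_square)
  finally show ?thesis .
qed

text \<open>The three numbers stand for the values of \<open>csc_sum / \<pi>\<^sup>2\<close> at \<open>1/2\<close>, \<open>\<tau>/2\<close> and \<open>(1 + \<tau>)/2\<close>; \<open>q\<close> is the nome and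
  \<open>t = 1 / (\<pi> Im \<tau>)\<close>.\<close>

locale half_value_estimates =
  fixes q U1 U2 U3 :: complex and t :: real
  assumes q: "q \<noteq> 0" "norm q \<le> 7/100" "Re q \<ge> 0" and t: "t > 0" "t \<le> 371/1000"
    and norm_q_le: "14.4 * (1 - 1.7 * t) * norm q \<le> t"
    and U1: "norm (U1 - 1) \<le> 1/25"
    and U2: "norm (U2 + 8 * q / (1 - q)\<^sup>2) \<le> (161/20) * norm q ^ 3"
    and U3: "norm (U3 - 8 * q / (1 + q)\<^sup>2) \<le> (161/20) * norm q ^ 3"
begin

lemma norm_q_pos: "norm q > 0"
  using q(1) by simp

lemma norm_q_squares: "(norm q)\<^sup>2 \<le> 7/100 * norm q" "norm q ^ 3 \<le> 7/100 * (norm q)\<^sup>2"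
  using mult_right_mono[OF q(2), of "norm q"] mult_right_mono[OF q(2), of "(norm q)\<^sup>2"]
  by (simp_all add: power2_eq_square power3_eq_cube)

lemma norm_q_le_t: "5.3 * norm q \<le> t"
proof -
  have "5.3 * norm q \<le> 14.4 * (1 - 1.7 * t) * norm q"
    using t norm_q_pos by (intro mult_right_mono) auto
  then show ?thesis using norm_q_le by linarith
qed

lemma U1_lower: "norm U1 \<ge> 24/25"
  using U1 norm_triangle_ineq2[of 1 "1 - U1"] by (simp add: norm_minus_commute)

lemma linear_estimates: "norm (U2 + 8 * q) \<le> 1.4 * norm q" "norm (U3 - 8 * q) \<le> 1.4 * norm q"
proof -
  have linear: "norm (U + s * q) \<le> 1.4 * norm q"
    if U: "norm (U + s * q / x\<^sup>2) \<le> (161/20) * norm q ^ 3" and s: "norm s = 8" and x: "norm (x - 1) = norm q" for U s x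
  proof -
    have "U + s * q = (U + s * q / x\<^sup>2) - s * q * (1 / x\<^sup>2 - 1)" by (simp add: algebra_simps)
    then have "norm (U + s * q) \<le> norm (U + s * q / x\<^sup>2) + norm (s * q * (1 / x\<^sup>2 - 1))"
      by (metis norm_triangle_ineq4)
    also have "norm (s * q * (1 / x\<^sup>2 - 1)) \<le> 8 * norm q * (17/100)"
      unfolding norm_mult s using norm_inverse_square_minus_1_le[of x] x q(2) by (intro mult_left_mono) auto
    finally show ?thesis using U norm_q_squares norm_q_pos by linarith
  qed
  show "norm (U2 + 8 * q) \<le> 1.4 * norm q" by (rule linear[of _ _ "1 - q"]) (use U2 in auto)
  show "norm (U3 - 8 * q) \<le> 1.4 * norm q" using linear[of U3 "- 8" "1 + q"] U3 by simp
qed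

lemma U2_U3_upper: "norm U2 \<le> 9.4 * norm q" "norm U3 \<le> 9.4 * norm q"
  using linear_estimates norm_triangle_ineq2[of U2 "- (8 * q)"] norm_triangle_ineq2[of U3 "8 * q"]
  by (simp_all add: norm_mult)

lemma values_distinct: "U1 \<noteq> U2" "U1 \<noteq> U3" "U2 \<noteq> U3"
proof -
  show "U1 \<noteq> U2" "U1 \<noteq> U3" using U1_lower U2_U3_upper q(2) by auto
  show "U2 \<noteq> U3"
  proof
    assume "U2 = U3"
    then have "16 * norm q \<le> norm (U2 + 8 * q) + norm (U3 - 8 * q)"
      using norm_triangle_ineq4[of "U2 + 8 * q" "U3 - 8 * q"] by (simp add: norm_mult)
    then show False using linear_estimates norm_q_pos by linarith
  qed
qed

lemma expand_product:
  assumes "(x - of_real t) * cnj (y - of_real t) = of_real (t\<^sup>2)" shows "x * cnj y = of_real t * (x + cnj y)"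
  using assms by (simp add: algebra_simps power2_eq_square)

definition ratio :: complex where "ratio = 1 - of_real t / U1"

lemma norm_ratio_le: "norm (ratio - of_real (1 - t)) \<le> t / 24"
proof -
  have "U1 \<noteq> 0" using U1_lower by auto
  then have "ratio - of_real (1 - t) = of_real t * ((U1 - 1) / U1)" by (simp add: ratio_def field_simps)
  then have "norm (ratio - of_real (1 - t)) = t * (norm (U1 - 1) / norm U1)" using t by (simp add: norm_mult norm_divide)
  also have "\<dots> \<le> t * ((1/25) / (24/25))" using t U1 U1_lower by (intro mult_left_mono frac_le) auto
  finally show ?thesis by simp
qed

lemma cnj_mult_ratio:
  assumes "(U1 - of_real t) * cnj (y - of_real t) = of_real (t\<^sup>2)" shows "cnj y * ratio = of_real t"
proof -
  have "U1 \<noteq> 0" using U1_lower by auto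
  moreover have "cnj y * (U1 - of_real t) = of_real t * U1" using expand_product[OF assms] by (simp add: algebra_simps)
  ultimately show ?thesis by (simp add: ratio_def field_simps)
qed

lemma product_12: "(U1 - of_real t) * cnj (U2 - of_real t) \<noteq> of_real (t\<^sup>2)"
proof
  assume "(U1 - of_real t) * cnj (U2 - of_real t) = of_real (t\<^sup>2)"
  then have "Re (cnj U2 * ratio) = t" by (simp add: cnj_mult_ratio)
  then have t_eq: "t = Re U2 * Re ratio + Im U2 * Im ratio" by simp
  have ratio: "\<bar>Re ratio - (1 - t)\<bar> \<le> t / 24" "\<bar>Im ratio\<bar> \<le> t / 24"
    using norm_ratio_le abs_Re_le_cmod[of "ratio - of_real (1 - t)"] abs_Im_le_cmod[of "ratio - of_real (1 - t)"] by auto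
  have "Re U2 \<le> 1.4 * norm q" using linear_estimates(1) complex_Re_le_cmod[of "U2 + 8 * q"] q(3) by simp
  moreover have "0 \<le> Re ratio" "Re ratio \<le> 1" using ratio(1) t by linarith+
  ultimately have "Re U2 * Re ratio \<le> 1.4 * norm q * Re ratio" "1.4 * norm q * Re ratio \<le> 1.4 * norm q * 1"
    by (intro mult_right_mono mult_left_mono; simp)+
  moreover have "Im U2 * Im ratio \<le> 1 * (t / 24)"
  proof -
    have "\<bar>Im U2\<bar> \<le> 1" using abs_Im_le_cmod[of U2] U2_U3_upper(1) q(2) by simp
    then have "\<bar>Im U2 * Im ratio\<bar> \<le> 1 * (t / 24)" unfolding abs_mult using ratio(2) by (intro mult_mono) auto
    then show ?thesis by simp
  qed
  ultimately have "t \<le> 1.4 * norm q + t / 24" using t_eq by linarith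
  then show False using norm_q_le_t norm_q_pos by simp
qed

lemma product_13: "(U1 - of_real t) * cnj (U3 - of_real t) \<noteq> of_real (t\<^sup>2)"
proof
  assume "(U1 - of_real t) * cnj (U3 - of_real t) = of_real (t\<^sup>2)"
  then have "norm (cnj U3 * ratio) = norm (of_real t :: complex)" by (simp only: cnj_mult_ratio)
  then have t_eq: "t = norm U3 * norm ratio" using t by (simp add: norm_mult)
  have "norm (1 + q) \<ge> 1" using abs_Re_le_cmod[of "1 + q"] q(3) by simp
  then have "norm (8 * q / (1 + q)\<^sup>2) \<le> 8 * norm q"
    using norm_q_pos by (simp add: norm_divide norm_mult norm_power divide_le_eq mult_le_cancel_left1)
  then have "norm U3 \<le> 8 * norm q + (161/20) * norm q ^ 3"
    using U3 norm_triangle_sub[of U3 "8 * q / (1 + q)\<^sup>2"] by simp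
  then have "norm U3 \<le> (201/25) * norm q" using norm_q_squares norm_q_pos by linarith
  moreover have "norm ratio \<le> 1 - t + t / 24"
    using norm_ratio_le norm_triangle_ineq2[of ratio "of_real (1 - t)"] t unfolding norm_of_real by linarith
  ultimately have "norm U3 * norm ratio \<le> ((201/25) * norm q) * (1 - t + t / 24)" using norm_q_pos by (intro mult_mono) auto
  also have "1 - t + t / 24 = 1 - t * (23/24)" by simp
  also have "(201/25) * norm q * (1 - t * (23/24)) = norm q * ((201/25) * (1 - t * (23/24)))" by (simp only: mult_ac)
  also have "\<dots> < norm q * (14.4 * (1 - 1.7 * t))" using norm_q_pos t by (intro mult_strict_left_mono) auto
  also have "\<dots> \<le> t" using norm_q_le by (simp add: algebra_simps)
  finally show False using t_eq by simp
qed

lemma norm_U2_plus_U3_le: "norm (U2 + U3) \<le> 35 * (norm q)\<^sup>2"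
proof -
  have "norm (q\<^sup>2) \<le> (7/100)\<^sup>2" using q(2) unfolding norm_power by (intro power_mono) auto
  then have norm: "norm (1 - q\<^sup>2) \<ge> 99/100" using norm_triangle_ineq2[of 1 "q\<^sup>2"] by (simp add: power2_eq_square)
  have factor: "1 - q\<^sup>2 = (1 - q) * (1 + q)" by (simp add: power2_eq_square algebra_simps)
  then have "1 - q \<noteq> 0" "1 + q \<noteq> 0" using norm by auto
  then have "8 * q / (1 + q)\<^sup>2 - 8 * q / (1 - q)\<^sup>2 = - (32 * (q\<^sup>2 / (1 - q\<^sup>2)\<^sup>2))"
    unfolding factor by (simp add: power_mult_distrib divide_simps) (simp add: power2_eq_square algebra_simps)
  then have split: "U2 + U3 = (U2 + 8 * q / (1 - q)\<^sup>2) + (U3 - 8 * q / (1 + q)\<^sup>2) - 32 * (q\<^sup>2 / (1 - q\<^sup>2)\<^sup>2)" by (simp add: algebra_simps)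
  have "norm (U2 + U3) \<le> norm (U2 + 8 * q / (1 - q)\<^sup>2) + norm (U3 - 8 * q / (1 + q)\<^sup>2) + norm (32 * (q\<^sup>2 / (1 - q\<^sup>2)\<^sup>2))"
    unfolding split using norm_triangle_ineq4[of "(U2 + 8 * q / (1 - q)\<^sup>2) + (U3 - 8 * q / (1 + q)\<^sup>2)" "32 * (q\<^sup>2 / (1 - q\<^sup>2)\<^sup>2)"]
      norm_triangle_ineq[of "U2 + 8 * q / (1 - q)\<^sup>2" "U3 - 8 * q / (1 + q)\<^sup>2"] by linarith
  also have "norm (32 * (q\<^sup>2 / (1 - q\<^sup>2)\<^sup>2)) \<le> 32 * ((norm q)\<^sup>2 / (99/100)\<^sup>2)"
    unfolding norm_mult norm_divide norm_power using norm by (simp add: divide_left_mono power_mono frac_le del: power2_eq_square)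
  also have "32 * ((norm q)\<^sup>2 / (99/100)\<^sup>2) = (320000/9801) * (norm q)\<^sup>2" by (simp add: power2_eq_square)
  finally show ?thesis using U2 U3 norm_q_squares(2) zero_le_power2[of "norm q"] by linarith
qed

lemma product_23: "(U2 - of_real t) * cnj (U3 - of_real t) \<noteq> of_real (t\<^sup>2)"
proof
  let ?S = "U2 * cnj U3 + of_real (64 * (norm q)\<^sup>2)"
  assume "(U2 - of_real t) * cnj (U3 - of_real t) = of_real (t\<^sup>2)"
  from expand_product[OF this] have Re_eq: "Re (U2 * cnj U3) = t * Re (U2 + U3)" by simp
  define d2 d3 where "d2 = U2 + 8 * q" and "d3 = U3 - 8 * q"
  have d: "norm d2 \<le> 1.4 * norm q" "norm d3 \<le> 1.4 * norm q" using linear_estimates by (simp_all add: d2_def d3_def)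
  have "?S = d2 * cnj (8 * q) - 8 * q * cnj d3 + d2 * cnj d3"
    unfolding d2_def d3_def of_real_mult complex_norm_square by (simp add: algebra_simps)
  then have "norm (?S) \<le> norm d2 * (8 * norm q) + 8 * norm q * norm d3 + norm d2 * norm d3"
    using norm_triangle_ineq[of "d2 * cnj (8 * q) - 8 * q * cnj d3" "d2 * cnj d3"]
      norm_triangle_ineq4[of "d2 * cnj (8 * q)" "8 * q * cnj d3"] by (simp add: norm_mult)
  also have "\<dots> \<le> (1.4 * norm q) * (8 * norm q) + 8 * norm q * (1.4 * norm q) + (1.4 * norm q) * (1.4 * norm q)"
    using d by (intro add_mono mult_mono) auto
  also have "\<dots> = (609/25) * (norm q)\<^sup>2" by (simp add: power2_eq_square)
  finally have "Re (?S) \<le> (609/25) * (norm q)\<^sup>2" using complex_Re_le_cmod order_trans by blast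
  then have "Re (U2 * cnj U3) + 64 * (norm q)\<^sup>2 \<le> (609/25) * (norm q)\<^sup>2" by (simp only: plus_complex.sel Re_complex_of_real)
  then have "Re (U2 * cnj U3) \<le> - 39 * (norm q)\<^sup>2" using zero_le_power2[of "norm q"] by linarith
  moreover have "t * Re (U2 + U3) \<ge> - ((371/1000) * (35 * (norm q)\<^sup>2))"
  proof -
    have "\<bar>t * Re (U2 + U3)\<bar> \<le> (371/1000) * (35 * (norm q)\<^sup>2)"
      unfolding abs_mult using t norm_U2_plus_U3_le abs_Re_le_cmod[of "U2 + U3"] by (intro mult_mono) auto
    then show ?thesis by linarith
  qed
  moreover have "(norm q)\<^sup>2 > 0" using norm_q_pos by simp
  ultimately show False using Re_eq by linarith
qed

end

context upper_half_plane
begin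

definition nome :: complex where "nome = exp (of_real pi * \<i> * \<tau>)"

lemma norm_nome: "norm nome = exp (- (pi * Im \<tau>))"
  by (simp add: nome_def norm_exp_eq_Re)

lemma norm_cot_tail'_le:
  assumes r: "norm (exp (2 * of_real pi * \<i> * z)) * (norm nome)\<^sup>2 = r" "r < 1"
  shows "norm (cot_tail' z) \<le> 4 * pi\<^sup>2 * (r / ((1 - r)\<^sup>2 * (1 - (norm nome)\<^sup>2)))"
proof -
  define x where "x = (norm nome)\<^sup>2"
  have x: "0 < x" "x < 1" using Im_\<tau>_pos by (auto simp: x_def norm_nome power_less_one_iff)
  have r_pos: "r > 0" using r(1) x by (auto simp: x_def[symmetric])
  have term_le: "norm (cot_kernel' (level n + z)) \<le> (4 * pi\<^sup>2 * r / (1 - r)\<^sup>2) * x ^ n" for n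
  proof -
    define e where "e = exp (2 * of_real pi * \<i> * (level n + z))"
    have "2 * of_real pi * \<i> * (level n + z) = of_nat (2 * Suc n) * (of_real pi * \<i> * \<tau>) + 2 * of_real pi * \<i> * z"
      by (simp add: algebra_simps)
    then have "e = nome ^ (2 * Suc n) * exp (2 * of_real pi * \<i> * z)"
      unfolding e_def nome_def by (simp only: exp_add exp_of_nat_mult)
    then have "norm e = x ^ Suc n * norm (exp (2 * of_real pi * \<i> * z))"
      by (simp only: norm_mult norm_power x_def power_mult)
    then have norm_e: "norm e = r * x ^ n"
      unfolding r(1)[symmetric] x_def[symmetric] by (simp only: power_Suc mult_ac)
    have "x ^ n \<le> 1" using x by (simp add: power_le_one)
    then have "norm e \<le> r" using norm_e r_pos by (simp add: mult_left_le)
    then have "norm (1 - e) \<ge> 1 - r" using norm_triangle_ineq2[of 1 e] by simp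
    then have "(norm (1 - e))\<^sup>2 \<ge> (1 - r)\<^sup>2" using r(2) by (intro power_mono) auto
    then have "4 * pi\<^sup>2 * norm e / (norm (1 - e))\<^sup>2 \<le> 4 * pi\<^sup>2 * norm e / (1 - r)\<^sup>2" using r(2) by (intro frac_le) auto
    then show ?thesis
      unfolding cot_kernel'_def e_def[symmetric] by (simp add: norm_divide norm_mult norm_power norm_e mult.assoc)
  qed
  have "norm (cot_tail' z) \<le> (\<Sum>n. (4 * pi\<^sup>2 * r / (1 - r)\<^sup>2) * x ^ n)"
    unfolding cot_tail'_def using x by (intro norm_suminf_le[OF term_le] summable_mult summable_geometric) simp
  also have "\<dots> = (4 * pi\<^sup>2 * r / (1 - r)\<^sup>2) * (1 / (1 - x))"
    using x by (subst suminf_mult) (simp_all add: summable_geometric suminf_geometric)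
  finally show ?thesis by (simp add: x_def)
qed

lemma norm_csc_sum_remainder_le:
  assumes r: "norm (exp (2 * of_real pi * \<i> * z)) * (norm nome)\<^sup>2 = r" "r \<le> R" "R < 1" and nome: "(norm nome)\<^sup>2 \<le> S" "S < 1"
  shows "norm (2 * cot_tail' z / (of_real pi)\<^sup>2) \<le> 8 / ((1 - R)\<^sup>2 * (1 - S)) * r"
proof -
  have "r \<ge> 0" using r(1) by auto
  have "norm (2 * cot_tail' z / (of_real pi)\<^sup>2) = 2 * norm (cot_tail' z) / pi\<^sup>2"
    by (simp add: norm_divide norm_mult norm_power)
  also have "\<dots> \<le> 2 * (4 * pi\<^sup>2 * (r / ((1 - r)\<^sup>2 * (1 - (norm nome)\<^sup>2)))) / pi\<^sup>2"
    using norm_cot_tail'_le[OF r(1)] r by (intro divide_right_mono mult_left_mono) auto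
  also have "\<dots> = 8 * (r / ((1 - r)\<^sup>2 * (1 - (norm nome)\<^sup>2)))" by simp
  also have "\<dots> \<le> 8 * (r / ((1 - R)\<^sup>2 * (1 - S)))"
    using r nome \<open>r \<ge> 0\<close> by (intro mult_left_mono divide_left_mono mult_mono power_mono mult_pos_pos) auto
  finally show ?thesis by simp
qed

lemma csc_sum_half:
  assumes "norm nome \<le> 7/100" shows "norm (csc_sum (1/2) / (of_real pi)\<^sup>2 - 1) \<le> 1/25" (is "norm ?s \<le> _")
proof -
  let ?C = "8 / ((1 - (7/100)\<^sup>2)\<^sup>2 * (1 - (7/100)\<^sup>2)) :: real"
  have exp_eq: "exp (2 * of_real pi * \<i> * (1/2)) = -1" by (simp add: exp_pi_i')
  have sq: "(norm nome)\<^sup>2 \<le> (7/100)\<^sup>2" using assms by (intro power_mono) auto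
  have "cot_tail' (- (1/2)) = cot_tail' (1/2)" using cot_tail_add_of_int(2)[of "- (1/2)" 1] by simp
  moreover have "cot_kernel' (1/2) = - (of_real pi)\<^sup>2" unfolding cot_kernel'_def exp_eq by simp
  ultimately have "?s = - (2 * cot_tail' (1/2) / (of_real pi)\<^sup>2)"
    by (simp add: csc_sum_def field_simps)
  then have "norm (?s) = norm (2 * cot_tail' (1/2) / (of_real pi)\<^sup>2)" by (simp only: norm_minus_cancel)
  also have "\<dots> \<le> ?C * (norm nome)\<^sup>2"
    using sq unfolding exp_eq by (intro norm_csc_sum_remainder_le) (auto simp: exp_eq power2_eq_square)
  also have "\<dots> \<le> ?C * (7/100)\<^sup>2"
    using sq by (intro mult_left_mono) (auto simp: power2_eq_square)
  also have "\<dots> \<le> 1/25" by (simp add: power2_eq_square)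
  finally show ?thesis .
qed

lemma csc_sum_upper_half:
  assumes nome: "norm nome \<le> 7/100" and e: "exp (2 * of_real pi * \<i> * z) = e" "norm e = norm nome"
    and z: "Im z = Im \<tau> / 2" "cot_tail' (- z) = cot_tail' (z - \<tau>)"
  shows "norm (csc_sum z / (of_real pi)\<^sup>2 + 8 * e / (1 - e)\<^sup>2) \<le> (161/20) * norm nome ^ 3" (is "norm ?s \<le> _")
proof -
  have "cot_tail' (z - \<tau>) = cot_kernel' z + cot_tail' z"
    using z(1) Im_\<tau>_pos by (intro cot_tail_shift tail_domain_if_Im) auto
  then have "csc_sum z = - 2 * cot_kernel' z - 2 * cot_tail' z" unfolding csc_sum_def z(2) by simp
  moreover have "cot_kernel' z = 4 * (of_real pi)\<^sup>2 * e / (1 - e)\<^sup>2" unfolding cot_kernel'_def e(1) ..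
  ultimately have "?s = - (2 * cot_tail' z / (of_real pi)\<^sup>2)"
    by (simp add: diff_divide_distrib)
  then have "norm (?s) = norm (2 * cot_tail' z / (of_real pi)\<^sup>2)"
    by (simp only: norm_minus_cancel)
  also have "\<dots> \<le> 8 / ((1 - (7/100) ^ 3)\<^sup>2 * (1 - (7/100)\<^sup>2)) * norm nome ^ 3"
    using nome power_mono[OF nome, of 3] power_mono[OF nome, of 2]
    by (intro norm_csc_sum_remainder_le) (auto simp: e power2_eq_square power3_eq_cube)
  also have "\<dots> \<le> (161/20) * norm nome ^ 3" by (intro mult_right_mono) (auto simp: power2_eq_square power3_eq_cube)
  finally show ?thesis .
qed

lemma nome_if_reduced:
  assumes "norm \<tau> \<ge> 1" "\<bar>Re \<tau>\<bar> \<le> 1/2"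
  shows "Re nome \<ge> 0" "pi * Im \<tau> \<ge> 2.7" "14.4 * (pi * Im \<tau> - 1.7) * norm nome \<le> 1"
proof -
  have "- (pi/2) \<le> pi * Re \<tau>" "pi * Re \<tau> \<le> pi/2"
    using assms(2) mult_left_mono[of "Re \<tau>" "1/2" pi] mult_left_mono[of "- (1/2)" "Re \<tau>" pi] by auto
  then have "cos (pi * Re \<tau>) \<ge> 0" by (intro cos_ge_zero) auto
  then show "Re nome \<ge> 0" by (simp add: nome_def Re_exp)
  have "(Re \<tau>)\<^sup>2 + (Im \<tau>)\<^sup>2 \<ge> 1" using assms(1) unfolding cmod_power2[symmetric] by (simp add: one_le_power)
  moreover have "(Re \<tau>)\<^sup>2 \<le> (1/2)\<^sup>2" using assms(2) by (metis abs_ge_zero power2_abs power_mono)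
  ultimately have "(Im \<tau>)\<^sup>2 \<ge> (866/1000)\<^sup>2" by (simp add: power2_eq_square)
  then have "Im \<tau> \<ge> 866/1000" using Im_\<tau>_pos power2_le_imp_le[of "866/1000" "Im \<tau>"] by simp
  moreover have "pi \<ge> 3.14" using pi_approx by simp
  ultimately have "3.14 * (866/1000) \<le> pi * Im \<tau>" by (intro mult_mono) auto
  then show Y: "pi * Im \<tau> \<ge> 2.7" by simp
  have "exp (0.3::real) \<ge> 1.345" using exp_lower_Taylor_quadratic[of "0.3"] by (simp add: power2_eq_square)
  then have "exp (0.3::real) ^ 9 \<ge> 1.345 ^ 9" by (intro power_mono) auto
  moreover have "exp (0.3::real) ^ 9 = exp 2.7" by (simp flip: exp_of_nat_mult)
  moreover have "(1.345::real) ^ 9 \<ge> 14.4" by (simp add: eval_nat_numeral)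
  ultimately have "exp (2.7::real) \<ge> 14.4" by linarith
  moreover have "exp (pi * Im \<tau> - 2.7) \<ge> pi * Im \<tau> - 1.7" using exp_ge_add_one_self[of "pi * Im \<tau> - 2.7"] by simp
  ultimately have "14.4 * (pi * Im \<tau> - 1.7) \<le> exp 2.7 * exp (pi * Im \<tau> - 2.7)" using Y by (intro mult_mono) auto
  also have "\<dots> = exp (pi * Im \<tau>)" by (simp flip: exp_add)
  finally have "14.4 * (pi * Im \<tau> - 1.7) * exp (- (pi * Im \<tau>)) \<le> exp (pi * Im \<tau>) * exp (- (pi * Im \<tau>))"
    by (intro mult_right_mono) auto
  then show "14.4 * (pi * Im \<tau> - 1.7) * norm nome \<le> 1" by (simp add: norm_nome flip: exp_add)
qed

lemma half_value_estimates_csc_sum: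
  assumes "norm \<tau> \<ge> 1" "\<bar>Re \<tau>\<bar> \<le> 1/2"
  shows "half_value_estimates nome (csc_sum (1/2) / (of_real pi)\<^sup>2) (csc_sum (\<tau>/2) / (of_real pi)\<^sup>2)
    (csc_sum ((1 + \<tau>)/2) / (of_real pi)\<^sup>2) (1 / (pi * Im \<tau>))"
proof
  note reduced = nome_if_reduced[OF assms]
  define Y where "Y = pi * Im \<tau>"
  have Y: "Y \<ge> 2.7" "14.4 * (Y - 1.7) * norm nome \<le> 1" using reduced by (simp_all add: Y_def)
  have "14.4 * 1 * norm nome \<le> 14.4 * (Y - 1.7) * norm nome" using Y(1) by (intro mult_right_mono) auto
  then show nome: "norm nome \<le> 7/100" using Y(2) by simp
  show "nome \<noteq> 0" by (simp add: nome_def)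
  show "Re nome \<ge> 0" by (rule reduced)
  show "1 / (pi * Im \<tau>) > 0" "1 / (pi * Im \<tau>) \<le> 371/1000" using Y(1) unfolding Y_def[symmetric] by (auto simp: field_simps)
  have "14.4 * (1 - 1.7 * (1 / Y)) * norm nome = (1 / Y) * (14.4 * (Y - 1.7) * norm nome)" using Y(1) by (simp add: field_simps)
  also have "\<dots> \<le> (1 / Y) * 1" using Y by (intro mult_left_mono) auto
  finally show "14.4 * (1 - 1.7 * (1 / (pi * Im \<tau>))) * norm nome \<le> 1 / (pi * Im \<tau>)" by (simp add: Y_def)
  show "norm (csc_sum (1/2) / (of_real pi)\<^sup>2 - 1) \<le> 1/25" by (rule csc_sum_half[OF nome])
  have "exp (2 * of_real pi * \<i> * (\<tau>/2)) = nome" by (simp add: nome_def mult.assoc)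
  from csc_sum_upper_half[OF nome this]
  show "norm (csc_sum (\<tau>/2) / (of_real pi)\<^sup>2 + 8 * nome / (1 - nome)\<^sup>2) \<le> (161/20) * norm nome ^ 3" by (simp add: field_simps)
  have "2 * of_real pi * \<i> * ((1 + \<tau>)/2) = of_real pi * \<i> + of_real pi * \<i> * \<tau>" by (simp add: field_simps)
  then have "exp (2 * of_real pi * \<i> * ((1 + \<tau>)/2)) = - nome" unfolding nome_def by (simp add: exp_add)
  moreover have "cot_tail' (- ((1 + \<tau>)/2)) = cot_tail' ((1 + \<tau>)/2 - \<tau>)"
    using cot_tail_add_of_int(2)[of "- ((1 + \<tau>)/2)" 1] by (simp add: field_simps)
  ultimately show "norm (csc_sum ((1 + \<tau>)/2) / (of_real pi)\<^sup>2 - 8 * nome / (1 + nome)\<^sup>2) \<le> (161/20) * norm nome ^ 3"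
    using csc_sum_upper_half[OF nome, of "(1 + \<tau>)/2" "- nome"] by simp
qed

end

context period_lattice
begin

lemma \<kappa>_norm_square: "\<kappa> * (norm w1)\<^sup>2 = pi\<^sup>2 * (1 / (pi * Im (w2 / w1)))"
  unfolding \<kappa>_def Im_divide_eq[OF w1_nonzero] by (simp add: power2_eq_square)

lemma wp_eq_csc_sum:
  "w1\<^sup>2 * wp z = (of_real pi)\<^sup>2 * (csc_sum (z / w1) / (of_real pi)\<^sup>2 - of_real (1 / (pi * Im (w2 / w1))))"
proof -
  have "of_real \<kappa> * (w1 * cnj w1) = (of_real pi)\<^sup>2 * of_real (1 / (pi * Im (w2 / w1)))"
    unfolding complex_norm_square[symmetric] of_real_mult[symmetric] of_real_power[symmetric] \<kappa>_norm_square ..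
  then show ?thesis by (simp add: wp_def right_diff_distrib power2_eq_square mult_ac)
qed

lemma wp_half_periods:
  assumes reduced: "norm (w2 / w1) \<ge> 1" "\<bar>Re (w2 / w1)\<bar> \<le> 1/2"
    and u: "u \<in> {w1 / 2, w2 / 2, (w1 + w2) / 2}" and v: "v \<in> {w1 / 2, w2 / 2, (w1 + w2) / 2}" and "u \<noteq> v"
  shows "wp u \<noteq> wp v" "wp u * cnj (wp v) \<noteq> of_real (\<kappa>\<^sup>2)"
proof -
  define t where "t = 1 / (pi * Im (w2 / w1))"
  define U where "U = (\<lambda>z. csc_sum (z / w1) / (of_real pi)\<^sup>2)"
  interpret half_value_estimates nome "U (w1/2)" "U (w2/2)" "U ((w1 + w2)/2)" t
    using half_value_estimates_csc_sum[OF reduced] by (simp add: U_def t_def add_divide_distrib mult.commute[of w1])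
  have sym: "(y - of_real t) * cnj (x - of_real t) \<noteq> of_real (t\<^sup>2)"
    if "(x - of_real t) * cnj (y - of_real t) \<noteq> of_real (t\<^sup>2)" for x y
    using that by (metis complex_cnj_cnj complex_cnj_complex_of_real complex_cnj_mult mult.commute)
  have distinct: "U u \<noteq> U v \<and> (U u - of_real t) * cnj (U v - of_real t) \<noteq> of_real (t\<^sup>2)"
    using u v \<open>u \<noteq> v\<close> values_distinct product_12 product_13 product_23 sym[OF product_12] sym[OF product_13] sym[OF product_23]
    by (elim insertE emptyE) (simp_all only:, metis+)
  moreover have wp: "w1\<^sup>2 * wp z = (of_real pi)\<^sup>2 * (U z - of_real t)" for z unfolding U_def t_def by (rule wp_eq_csc_sum)
  ultimately show "wp u \<noteq> wp v" by (metis diff_add_cancel mult_cancel_left of_real_eq_0_iff pi_neq_zero power_not_zero)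
  show "wp u * cnj (wp v) \<noteq> of_real (\<kappa>\<^sup>2)"
  proof
    assume "wp u * cnj (wp v) = of_real (\<kappa>\<^sup>2)"
    moreover have "(w1\<^sup>2 * wp u) * cnj (w1\<^sup>2 * wp v) = (w1 * cnj w1)\<^sup>2 * (wp u * cnj (wp v))"
      by (simp add: power2_eq_square mult_ac)
    ultimately have "(of_real pi)\<^sup>2 * (U u - of_real t) * cnj ((of_real pi)\<^sup>2 * (U v - of_real t)) = of_real ((\<kappa> * (norm w1)\<^sup>2)\<^sup>2)"
      unfolding wp complex_norm_square[symmetric] by (simp add: power_mult_distrib mult.commute)
    then have "((of_real pi)\<^sup>2)\<^sup>2 * ((U u - of_real t) * cnj (U v - of_real t)) = ((of_real pi)\<^sup>2)\<^sup>2 * of_real (t\<^sup>2)"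
      unfolding \<kappa>_norm_square t_def by (simp add: power_mult_distrib power2_eq_square mult_ac)
    then show False using distinct by simp
  qed
qed

end

section \<open>Null curves with two double poles on an elliptic curve\<close>

lemma norm_cdot_self_le: "norm (cdot v v) \<le> (norm v)\<^sup>2"
proof -
  have "norm (cdot v v) \<le> (\<Sum>i\<in>UNIV. norm (v$i * v$i))" unfolding cdot_def by (rule norm_sum)
  also have "\<dots> = (norm v)\<^sup>2" by (simp add: norm_mult power2_eq_square norm_vec_def L2_set_def sum_nonneg)
  finally show ?thesis .
qed

lemma conjugate_quadratic_roots:
  fixes \<sigma> X1 X2 :: complex and k n :: real
  assumes \<sigma>: "\<sigma> \<noteq> 0" "norm \<sigma> \<le> n" and "X1 \<noteq> X2"
    and root: "\<And>X. X \<in> {X1, X2} \<Longrightarrow> \<sigma> * X\<^sup>2 + 2 * of_real (k * n) * X + of_real (k\<^sup>2) * cnj \<sigma> = 0"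
  shows "X1 * cnj X2 = of_real (k\<^sup>2)"
proof -
  define Y1 Y2 where "Y1 = \<sigma> * X1" and "Y2 = \<sigma> * X2"
  have norm_\<sigma>: "\<sigma> * cnj \<sigma> = of_real ((norm \<sigma>)\<^sup>2)" by (simp only: complex_norm_square)
  have Y: "Y\<^sup>2 + 2 * of_real (k * n) * Y + of_real (k\<^sup>2 * (norm \<sigma>)\<^sup>2) = 0" if Y: "Y \<in> {Y1, Y2}" for Y
  proof -
    obtain X where X: "X \<in> {X1, X2}" "Y = \<sigma> * X" using Y Y1_def Y2_def by blast
    have "\<sigma> * (\<sigma> * X\<^sup>2 + 2 * of_real (k * n) * X + of_real (k\<^sup>2) * cnj \<sigma>)
        = (\<sigma> * X)\<^sup>2 + 2 * of_real (k * n) * (\<sigma> * X) + of_real (k\<^sup>2) * (\<sigma> * cnj \<sigma>)"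
      by (simp add: algebra_simps power2_eq_square)
    then show ?thesis using root[OF X(1)] unfolding norm_\<sigma> X(2) by simp
  qed
  have "Y1 - Y2 \<noteq> 0" using \<open>X1 \<noteq> X2\<close> \<sigma>(1) by (simp add: Y1_def Y2_def)
  moreover have "(Y1 - Y2) * (Y1 + Y2 + 2 * of_real (k * n)) = 0" using Y[of Y1] Y[of Y2] by simp algebra
  ultimately have sum: "Y1 + Y2 = - of_real (2 * k * n)" by (simp add: add_eq_0_iff2)
  have product: "Y1 * Y2 = of_real (k\<^sup>2 * (norm \<sigma>)\<^sup>2)" using Y[of Y1] sum by simp algebra
  have "(Y1 - Y2)\<^sup>2 = (Y1 + Y2)\<^sup>2 - 4 * (Y1 * Y2)" by (simp add: power2_eq_square algebra_simps)
  also have "\<dots> = of_real (4 * k\<^sup>2 * (n\<^sup>2 - (norm \<sigma>)\<^sup>2))" unfolding sum product by (simp add: power2_eq_square algebra_simps)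
  finally have square: "(Y1 - Y2)\<^sup>2 = of_real (4 * k\<^sup>2 * (n\<^sup>2 - (norm \<sigma>)\<^sup>2))" .
  have "(norm \<sigma>)\<^sup>2 \<le> n\<^sup>2" using \<sigma>(2) by (intro power_mono) auto
  then have "Re ((Y1 - Y2)\<^sup>2) \<ge> 0" "Im ((Y1 - Y2)\<^sup>2) = 0" unfolding square by simp_all
  then have "Im (Y1 - Y2) = 0" by (cases "Re (Y1 - Y2) = 0") (auto simp: power2_eq_square mult_le_0_iff)
  moreover have "Im (Y1 + Y2) = 0" unfolding sum by simp
  ultimately have "cnj Y2 = Y2" by (simp add: complex_eq_iff)
  moreover have "(X1 * cnj X2) * (\<sigma> * cnj \<sigma>) = Y1 * cnj Y2" by (simp add: Y1_def Y2_def)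
  ultimately have "(X1 * cnj X2) * (\<sigma> * cnj \<sigma>) = of_real (k\<^sup>2) * (\<sigma> * cnj \<sigma>)" by (simp add: product norm_\<sigma>)
  then show ?thesis using \<sigma>(1) by simp
qed

locale null_elliptic_curve = period_lattice +
  fixes \<Phi> :: "complex \<Rightarrow> complex^4" and h :: "complex \<Rightarrow> real^4" and a b w :: "complex^4" and z1 z2 :: complex
  assumes incongruent: "z2 - z1 \<notin> \<Lambda>"
    and periodic: "\<And>z l. l \<in> \<Lambda> \<Longrightarrow> z \<in> punctured_plane {z1, z2} \<Longrightarrow> \<Phi> (z + l) = \<Phi> z"
    and real_periodic: "\<And>z l. l \<in> \<Lambda> \<Longrightarrow> z \<in> punctured_plane {z1, z2} \<Longrightarrow> h (z + l) = h z"
    and holomorphic: "\<And>i. (\<lambda>z. \<Phi> z $ i) holomorphic_on punctured_plane {z1, z2}"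
    and derivative: "\<And>z i. z \<in> punctured_plane {z1, z2} \<Longrightarrow> ((\<lambda>z. h z $ i) has_derivative (\<lambda>v. Re (v * \<Phi> z $ i))) (at z)"
    and null: "\<And>z. z \<in> punctured_plane {z1, z2} \<Longrightarrow> cdot (\<Phi> z) (\<Phi> z) = 0"
    and normalised: "\<And>z. z \<in> punctured_plane {z1, z2} \<Longrightarrow> cdot w (\<Phi> z) = 1"
    and pole1: "\<And>i. \<exists>c. ((\<lambda>z. \<Phi> z $ i + a $ i / (z - z1)\<^sup>2) \<longlongrightarrow> c) (at z1)"
    and pole2: "\<And>i. \<exists>c. ((\<lambda>z. \<Phi> z $ i + b $ i / (z - z2)\<^sup>2) \<longlongrightarrow> c) (at z2)"
    and null_poles: "cdot a a = 0" "cdot b b = 0" and normalised_poles: "cdot w a = 0" "cdot w b = 0"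
begin

abbreviation "p \<equiv> z2 - z1"

lemma representation:
  assumes z: "z \<in> punctured_plane {z1, z2}"
  shows "\<Phi> z = - (wp (z - z1) *s a) - wp (z - z2) *s b - of_real \<kappa> *s ccnj (a + b)"
  unfolding vec_eq_iff
proof
  fix i
  have "z1 \<noteq> z2" using incongruent lattice_generators(3) by auto
  define c where "c = (\<lambda>j. if j = z1 then a $ i else b $ i)"
  have "\<Phi> z $ i = - (\<Sum>j\<in>{z1, z2}. c j * wp (z - j)) - of_real \<kappa> * cnj (\<Sum>j\<in>{z1, z2}. c j)"
  proof (rule elliptic_representation[where h = "\<lambda>z. h z $ i"])
    show "x = y" if "x \<in> {z1, z2}" "y \<in> {z1, z2}" "x - y \<in> \<Lambda>" for x y
      using that incongruent lattice_minus_iff[of p] by auto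
    show "\<exists>d. ((\<lambda>z. \<Phi> z $ i + c j / (z - j)\<^sup>2) \<longlongrightarrow> d) (at j)" if "j \<in> {z1, z2}" for j
      using that pole1 pole2 \<open>z1 \<noteq> z2\<close> by (auto simp: c_def)
  qed (use periodic real_periodic holomorphic derivative z in auto)
  then show "\<Phi> z $ i = (- (wp (z - z1) *s a) - wp (z - z2) *s b - of_real \<kappa> *s ccnj (a + b)) $ i"
    using \<open>z1 \<noteq> z2\<close> by (simp add: c_def ccnj_def algebra_simps)
qed

lemma null_relation:
  assumes "u \<notin> \<Lambda>" "u - p \<notin> \<Lambda>"
  shows "2 * cdot a b * wp u * wp (u - p) + 2 * of_real \<kappa> * cdot a (ccnj (a + b)) * wp u
    + 2 * of_real \<kappa> * cdot b (ccnj (a + b)) * wp (u - p) + of_real (\<kappa>\<^sup>2) * cnj (cdot (a + b) (a + b)) = 0"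
proof -
  have "z1 + u \<in> punctured_plane {z1, z2}" using assms by (simp add: punctured_plane_def algebra_simps)
  note rep = representation[OF this] null[OF this]
  have expand: "cdot (- (x *s a) - y *s b - k *s c) (- (x *s a) - y *s b - k *s c)
      = 2 * cdot a b * x * y + 2 * k * cdot a c * x + 2 * k * cdot b c * y + k\<^sup>2 * cdot c c" for x y k c
    by (simp add: cdot_simps cdot.minus_left cdot.minus_right null_poles cdot_commute[of b a] cdot_commute[of c a]
        cdot_commute[of c b] algebra_simps power2_eq_square)
  from rep(2) show ?thesis unfolding rep(1) expand by (simp add: cdot_ccnj algebra_simps)
qed

lemma cdot_poles_nonzero: "cdot a b \<noteq> 0"
proof
  assume ab: "cdot a b = 0"
  note wp_bilinear_relation(1,2)[OF incongruent null_relation]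
  then have "cdot a (ccnj (a + b)) = 0" "cdot b (ccnj (a + b)) = 0" using ab \<kappa>_pos by simp_all
  then have "cdot (a + b) (ccnj (a + b)) = 0" by (simp add: cdot_simps)
  then have sum: "a + b = 0" unfolding cdot_ccnj_self by simp
  obtain z where z: "z \<in> punctured_plane {z1, z2}"
    using eventually_happens'[OF at_neq_bot eventually_punctured_plane[of "{z1, z2}" 0]] by auto
  have "ccnj 0 = (0 :: complex^4)" by (simp add: ccnj_def vec_eq_iff)
  then have "cdot w (\<Phi> z) = 0"
    unfolding representation[OF z] sum using normalised_poles
    by (simp add: cdot_simps cdot.minus_right cdot.zero_right)
  then show False using normalised[OF z] by simp
qed

lemma half_period: "2 * p \<in> \<Lambda>"
  using wp_bilinear_relation(3)[OF incongruent null_relation] cdot_poles_nonzero by simp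

lemma wp_at_quarter_period:
  assumes u: "2 * u - p \<in> \<Lambda>"
  shows "u \<notin> \<Lambda>" "wp (u - p) = wp u" "wp (u + p) = wp u"
    and "cdot (a + b) (a + b) * (wp u)\<^sup>2 + 2 * of_real (\<kappa> * (norm (a + b))\<^sup>2) * wp u
      + of_real (\<kappa>\<^sup>2) * cnj (cdot (a + b) (a + b)) = 0" (is ?quadratic)
proof -
  show not: "u \<notin> \<Lambda>"
  proof
    assume "u \<in> \<Lambda>"
    then have "u + u - (2 * u - p) \<in> \<Lambda>" by (intro lattice_diff[OF _ u] lattice_add)
    then show False using incongruent by simp
  qed
  have shift: "- u + (2 * u - p) = u - p"
    "- u + (2 * u - p + 2 * p) = u + p" by (simp_all add: algebra_simps)
  have "- u \<notin> \<Lambda>" using not by simp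
  then show minus: "wp (u - p) = wp u" and "wp (u + p) = wp u"
    using wp_add[OF u, of "- u"] wp_add[OF lattice_add[OF u half_period], of "- u"] wp_minus[OF not]
    unfolding shift by simp_all
  have "u - p \<notin> \<Lambda>" using \<open>- u \<notin> \<Lambda>\<close> lattice_add_iff(1)[OF u, of "- u"] unfolding shift by simp
  from null_relation[OF not this]
  have "2 * cdot a b * (wp u)\<^sup>2 + 2 * of_real \<kappa> * (cdot a (ccnj (a + b)) + cdot b (ccnj (a + b))) * wp u
      + of_real (\<kappa>\<^sup>2) * cnj (cdot (a + b) (a + b)) = 0"
    unfolding minus by (simp add: algebra_simps power2_eq_square)
  moreover have "cdot a (ccnj (a + b)) + cdot b (ccnj (a + b)) = of_real ((norm (a + b))\<^sup>2)"
    unfolding cdot_ccnj_self[symmetric] by (simp add: cdot_simps)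
  moreover have "2 * cdot a b = cdot (a + b) (a + b)" by (simp add: cdot_simps null_poles cdot_commute[of b a])
  ultimately show ?quadratic by (simp add: mult.assoc)
qed

lemma wp_quarter_periods_conjugate:
  assumes "2 * u - p \<in> \<Lambda>" "2 * v - p \<in> \<Lambda>" "wp u \<noteq> wp v" shows "wp u * cnj (wp v) = of_real (\<kappa>\<^sup>2)"
proof (rule conjugate_quadratic_roots[OF _ norm_cdot_self_le assms(3)])
  show "cdot (a + b) (a + b) \<noteq> 0" using cdot_poles_nonzero by (simp add: cdot_simps null_poles cdot_commute[of b a])
qed (use wp_at_quarter_period(4)[OF assms(1)] wp_at_quarter_period(4)[OF assms(2)] in auto)

text \<open>Modulo \<open>\<Lambda>\<close> and its translate by \<open>p\<close>, the quarter periods are half periods.\<close>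

theorem inconsistent: False
proof -
  obtain v1' v2' where V': "lattice v1' v2' = {z. z \<in> \<Lambda> \<or> z - p \<in> \<Lambda>}" "Im (cnj v1' * v2') = Im (cnj w1 * w2) / 2"
    using half_period_lattice[OF half_period incongruent area] by metis
  obtain v1 v2 where v: "lattice v1 v2 = {z. z \<in> \<Lambda> \<or> z - p \<in> \<Lambda>}" "Im (cnj v1 * v2) = Im (cnj w1 * w2) / 2"
    and reduced: "norm (v2 / v1) \<ge> 1" "\<bar>Re (v2 / v1)\<bar> \<le> 1/2"
    using reduced_lattice_basis[of v1' v2'] V' area by (metis half_gt_zero)
  interpret index_two_lattice w1 w2 v1 v2 p
    by unfold_locales (use area v half_period incongruent in simp_all)
  have contradiction: False
    if u: "u \<in> {v1/2, v2/2, (v1 + v2)/2}" "2 * u \<notin> \<Lambda>" and u': "u' \<in> {v1/2, v2/2, (v1 + v2)/2}" "2 * u' \<notin> \<Lambda>" and "u \<noteq> u'"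
    for u u'
  proof -
    have quarter: "2 * x - p \<in> \<Lambda>" "V.wp x = 2 * wp x" if "x \<in> {v1/2, v2/2, (v1 + v2)/2}" "2 * x \<notin> \<Lambda>" for x
    proof -
      have "2 * x \<in> {v1, v2, v1 + v2}" using that(1) by (auto simp: mult.commute[of x])
      then have "2 * x \<in> V.\<Lambda>" using lattice_generators(1,2) lattice_add by (metis empty_iff insert_iff)
      then show x: "2 * x - p \<in> \<Lambda>" using that(2) unfolding v(1) by simp
      note wp = wp_at_quarter_period[OF x]
      have "x \<notin> V.\<Lambda>"
        using that(2) lattice_add[of x w1 w2 x] lattice_add[OF lattice_add[of "x - p" w1 w2 "x - p"] half_period(1)]
        unfolding v(1) by (auto simp: algebra_simps)
      from wp_index_two[OF this] show "V.wp x = 2 * wp x" using wp(3) by simp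
    qed
    note V.wp_half_periods[OF reduced u(1) u'(1) \<open>u \<noteq> u'\<close>]
    moreover from this have "wp u * cnj (wp u') = of_real (\<kappa>\<^sup>2)"
      using wp_quarter_periods_conjugate quarter[OF u] quarter[OF u'] by auto
    ultimately show False using quarter[OF u] quarter[OF u'] by (simp add: \<kappa>_double power_mult_distrib)
  qed
  have "p \<in> V.\<Lambda>" unfolding v(1) by (simp add: lattice_generators)
  then have not_both: "\<not> (v1 \<in> \<Lambda> \<and> v2 \<in> \<Lambda>)" using lattice_subset[of v1 w1 w2 v2] incongruent by blast
  have "v1 \<noteq> v2" "v1 \<noteq> 0" "v2 \<noteq> 0" using V.area by auto
  have "v1 \<notin> \<Lambda> \<and> v2 \<notin> \<Lambda> \<or> v1 \<notin> \<Lambda> \<and> v1 + v2 \<notin> \<Lambda> \<or> v2 \<notin> \<Lambda> \<and> v1 + v2 \<notin> \<Lambda>"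
    using not_both lattice_add_iff[of v1 w1 w2 v2] lattice_add_iff[of v2 w1 w2 v1] by blast
  moreover have "2 * (v1 / 2) = v1" "2 * (v2 / 2) = v2" "2 * ((v1 + v2) / 2) = v1 + v2"
    "v1 / 2 \<noteq> v2 / 2" "v1 / 2 \<noteq> (v1 + v2) / 2" "v2 / 2 \<noteq> (v1 + v2) / 2" using \<open>v1 \<noteq> v2\<close> \<open>v1 \<noteq> 0\<close> \<open>v2 \<noteq> 0\<close> by simp_all
  ultimately show False
    using contradiction[of "v1 / 2" "v2 / 2"] contradiction[of "v1 / 2" "(v1 + v2) / 2"]
      contradiction[of "v2 / 2" "(v1 + v2) / 2"] by (metis insertCI)
qed

end

section \<open>The double poles of the Weierstrass form\<close>

lemma reciprocal_principal_part:
  fixes \<phi> :: "complex \<Rightarrow> complex"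
  assumes r: "r > 0" and \<phi>: "\<phi> holomorphic_on ball 0 r" "\<phi> 0 = 0" "\<And>z. z \<in> ball 0 r - {0} \<Longrightarrow> \<phi> z \<noteq> 0"
    and d: "(\<phi> has_field_derivative d) (at 0)" "d \<noteq> 0"
  obtains k where "k holomorphic_on ball 0 r" "\<And>z. z \<in> ball 0 r - {0} \<Longrightarrow> inverse (\<phi> z) = 1 / d / z + k z"
proof -
  have hol: "(\<lambda>z. inverse (\<phi> z) - 1 / d / z) holomorphic_on ball 0 r - {0}"
    using \<phi>(3) by (intro holomorphic_intros holomorphic_on_subset[OF \<phi>(1)]) auto
  have "((\<lambda>z. \<phi> z / z) \<longlongrightarrow> d) (at 0)" using d(1) \<phi>(2) by (simp add: has_field_derivative_iff)
  then have "((\<lambda>z. inverse (\<phi> z / z) - 1 / d) \<longlongrightarrow> inverse d - 1 / d) (at 0)" using d(2) by (intro tendsto_intros)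
  moreover have "\<forall>\<^sub>F z in at 0. inverse (\<phi> z / z) - 1 / d = (z - 0) * (inverse (\<phi> z) - 1 / d / z)"
    using eventually_neq_at_within[of 0] by eventually_elim (simp add: field_simps)
  ultimately have "((\<lambda>z. (z - 0) * (inverse (\<phi> z) - 1 / d / z)) \<longlongrightarrow> inverse d - 1 / d) (at 0)"
    by (rule Lim_transform_eventually)
  then have "((\<lambda>z. (z - 0) * (inverse (\<phi> z) - 1 / d / z)) \<longlongrightarrow> 0) (at 0)" by (simp add: divide_inverse)
  then obtain k where "k holomorphic_on ball 0 r" "\<And>z. z \<in> ball 0 r - {0} \<Longrightarrow> k z = inverse (\<phi> z) - 1 / d / z"
    using holomorphic_on_extend_lim[OF hol] r by auto
  then show ?thesis using that[of k] by simp
qed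

context willmore_torus
begin

lemma torus_periodic_Omega: "torus_periodic Omega"
  using periodic_geometry periodic_f unfolding torus_periodic_def
  by (simp add: Omega_def inversion_diff_def null_tan_def)

lemma Omega_quotient_holomorphic:
  assumes U: "open U" "inj_on F U" "\<And>x. x \<in> U \<Longrightarrow> dz_deriv F x (d x)" "\<And>x. x \<in> U \<Longrightarrow> d x \<noteq> 0"
    and W: "open W" "W \<subseteq> U" "\<And>x. x \<in> W \<Longrightarrow> f x \<noteq> 0"
  shows "(\<lambda>z. cdot w (Omega (inv_into U F z)) / d (inv_into U F z)) holomorphic_on F ` W"
    (is "?\<psi> holomorphic_on _")
  unfolding holomorphic_on_def
proof
  fix z assume "z \<in> F ` W"
  then obtain x where x: "x \<in> W" "z = F x" by blast
  obtain V G where V: "open V" "x \<in> V" "\<And>y. y \<in> V \<Longrightarrow> f y \<noteq> 0 \<Longrightarrow> dz_deriv G y (cdot w (Omega y))"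
    using local_primitive[of x w] W(3)[OF x(1)] by blast
  define T where "T = F ` (V \<inter> W)"
  have inv: "inv_into U F (F y) = y" if "y \<in> V \<inter> W" for y using that W(2) inv_into_f_f[OF U(2)] by blast
  have "open T" unfolding T_def using open_image_dz_deriv(1)[of "V \<inter> W" F d] U(2,3) V(1) W(1,2)
    by (metis Int_lower2 inj_on_subset open_Int subset_iff)
  have deriv: "((\<lambda>z. G (inv_into U F z)) has_field_derivative ?\<psi> z) (at z)" if z: "z \<in> T" for z
  proof -
    obtain y where y: "y \<in> V \<inter> W" "z = F y" using z by (auto simp: T_def)
    then have "y \<in> U" using W(2) by blast
    from has_field_derivative_inv_into_dz_deriv[OF U(1,2,3) this U(4)[OF this] V(3)] show ?thesis
      using y W(3) inv by simp
  qed
  then have "(\<lambda>z. G (inv_into U F z)) holomorphic_on T" using \<open>open T\<close> holomorphic_on_open by blast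
  then have "deriv (\<lambda>z. G (inv_into U F z)) holomorphic_on T" using \<open>open T\<close> by (rule holomorphic_deriv)
  then have "?\<psi> holomorphic_on T" by (rule holomorphic_transform) (simp add: DERIV_imp_deriv[OF deriv])
  moreover have "z \<in> T" using x V(2) by (simp add: T_def)
  ultimately show "?\<psi> field_differentiable at z within F ` W"
    using \<open>open T\<close> by (metis field_differentiable_at_within holomorphic_on_imp_differentiable_at)
qed

lemma chart_transition:
  assumes c: "chart q U F d" "F ` U = ball 0 r" and c0: "chart q U0 F0 d0" "U \<subseteq> U0"
  obtains \<phi> where "\<phi> holomorphic_on ball 0 r" "\<phi> 0 = 0" "\<And>z. z \<in> ball 0 r - {0} \<Longrightarrow> \<phi> z \<noteq> 0"
    "\<And>x. x \<in> U \<Longrightarrow> \<phi> (F x) = F0 x" "\<And>x. x \<in> U \<Longrightarrow> (\<phi> has_field_derivative d0 x / d x) (at (F x))"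
proof -
  note cd = chartD[OF c(1)] and cd0 = chartD[OF c0(1)]
  define \<phi> where "\<phi> = (\<lambda>z. F0 (inv_into U F z))"
  have \<phi>_F: "\<phi> (F x) = F0 x" if "x \<in> U" for x using that cd(3) by (simp add: \<phi>_def)
  have deriv: "(\<phi> has_field_derivative d0 x / d x) (at (F x))" if "x \<in> U" for x
    unfolding \<phi>_def using that c0(2) by (intro has_field_derivative_inv_into_dz_deriv cd cd0) auto
  have "\<exists>f'. (\<phi> has_field_derivative f') (at z)" if "z \<in> ball 0 r" for z
    using that deriv unfolding c(2)[symmetric] by blast
  then have "\<phi> holomorphic_on ball 0 r" by (simp add: holomorphic_on_open)
  moreover have "\<phi> z \<noteq> 0" if z: "z \<in> ball 0 r - {0}" for z
  proof -
    obtain x where x: "x \<in> U" "z = F x" using z unfolding c(2)[symmetric] by blast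
    then have "x \<noteq> q" using z cd(6) by auto
    then show ?thesis using x \<phi>_F chart_nonzero[OF c0(1), of x] c0(2) by auto
  qed
  moreover have "\<phi> 0 = 0" using \<phi>_F[OF cd(2)] cd(6) cd0(6) by simp
  ultimately show ?thesis using that \<phi>_F deriv by blast
qed

context
  fixes q U F d r
  assumes c: "chart q U F d" "F ` U = ball 0 r" "r > 0"
begin

lemma Omega_conormal_pole:
  assumes c0: "chart q U0 F0 d0" "U \<subseteq> U0" "\<And>x. x \<in> U0 \<Longrightarrow> x \<noteq> q \<Longrightarrow> d0 x = - (cdot (null_tan q) (Omega x) / 2) * (F0 x)\<^sup>2"
  obtains k h where "k \<noteq> 0" "h holomorphic_on ball 0 r"
    "\<And>x. x \<in> U - {q} \<Longrightarrow> cdot (null_tan q) (Omega x) = (h (F x) - k / (F x)\<^sup>2) * d x"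
proof -
  note cd = chartD[OF c(1)] and cd0 = chartD[OF c0(1)]
  obtain \<phi> where \<phi>: "\<phi> holomorphic_on ball 0 r" "\<phi> 0 = 0" "\<And>z. z \<in> ball 0 r - {0} \<Longrightarrow> \<phi> z \<noteq> 0"
    and \<phi>_F: "\<And>x. x \<in> U \<Longrightarrow> \<phi> (F x) = F0 x" and deriv: "\<And>x. x \<in> U \<Longrightarrow> (\<phi> has_field_derivative d0 x / d x) (at (F x))"
    using chart_transition[OF c(1,2) c0(1,2)] by metis
  define e where "e = d0 q / d q"
  have e: "e \<noteq> 0" "(\<phi> has_field_derivative e) (at 0)" using cd(2,5) cd0(2,5) deriv[OF cd(2)] by (simp_all add: e_def cd(6))
  then obtain k where k: "k holomorphic_on ball 0 r" "\<And>z. z \<in> ball 0 r - {0} \<Longrightarrow> inverse (\<phi> z) = 1 / e / z + k z"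
    using reciprocal_principal_part[OF c(3) \<phi>(1)] \<phi>(2,3) by metis
  show ?thesis
  proof (rule that[of "2 / e" "\<lambda>z. 2 * deriv k z"])
    show "(\<lambda>z. 2 * deriv k z) holomorphic_on ball 0 r" by (intro holomorphic_intros holomorphic_deriv k(1) open_ball)
    fix x assume x: "x \<in> U - {q}"
    have Fx: "F x \<in> ball 0 r - {0}" using x chart_image_punctured[OF c(1,2)] by blast
    have F0x: "F0 x \<noteq> 0" using x chart_nonzero[OF c0(1), of x] c0(2) by auto
    have "((\<lambda>z. 1 / e / z + k z) has_field_derivative - (1 / e / (F x)\<^sup>2) + deriv k (F x)) (at (F x))"
      using Fx e(1) by (auto intro!: derivative_eq_intros holomorphic_derivI[OF k(1) open_ball] simp: power2_eq_square)
    then have "((\<lambda>z. inverse (\<phi> z)) has_field_derivative - (1 / e / (F x)\<^sup>2) + deriv k (F x)) (at (F x))"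
      by (rule has_field_derivative_transform_within_open[of _ _ _ "ball 0 r - {0}"]) (use Fx k(2) in \<open>auto simp: open_delete\<close>)
    moreover have "((\<lambda>z. inverse (\<phi> z)) has_field_derivative - (inverse (F0 x) * (d0 x / d x) * inverse (F0 x))) (at (F x))"
      using DERIV_inverse'[OF deriv] x \<phi>_F F0x by auto
    ultimately have derivs: "- (inverse (F0 x) * (d0 x / d x) * inverse (F0 x)) = - (1 / e / (F x)\<^sup>2) + deriv k (F x)"
      by (rule DERIV_unique[rotated])
    have "cdot (null_tan q) (Omega x) = 2 * - (inverse (F0 x) * (d0 x / d x) * inverse (F0 x)) * d x"
      using c0(2) c0(3)[of x] x F0x cd(5)[of x] by (auto simp: field_simps power2_eq_square)
    then show "cdot (null_tan q) (Omega x) = (2 * deriv k (F x) - 2 / e / (F x)\<^sup>2) * d x"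
      unfolding derivs by (simp add: algebra_simps)
  qed (use e in simp)
qed

lemma Omega_regular:
  assumes nz: "\<And>x. x \<in> U \<Longrightarrow> x \<noteq> q \<Longrightarrow> f x \<noteq> 0" and w: "cdot w (ccnj (null_tan q)) = 0"
  obtains h where "h holomorphic_on ball 0 r" "\<And>x. x \<in> U - {q} \<Longrightarrow> cdot w (Omega x) = h (F x) * d x"
proof -
  note cd = chartD[OF c(1)]
  define \<psi> where "\<psi> = (\<lambda>z. cdot w (Omega (inv_into U F z)) / d (inv_into U F z))"
  note image = chart_image_punctured[OF c(1,2)]
  have "\<psi> holomorphic_on ball 0 r - {0}"
    unfolding image[symmetric] \<psi>_def using nz cd(1) by (intro Omega_quotient_holomorphic cd) (auto simp: open_delete)
  moreover have "\<exists>B. \<forall>\<^sub>F z in at 0. norm (\<psi> z) \<le> B"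
  proof -
    obtain C where C: "\<forall>\<^sub>F x in nhds q. norm (cdot w (Omega x)) \<le> C" using cdot_Omega_locally_bounded w by blast
    define D where "D = norm (d q) / 2"
    have D: "D > 0" using cd(2,5) by (simp add: D_def)
    have "((\<lambda>x. norm (d x)) \<longlongrightarrow> norm (d q)) (at q)" using cd(7) by (intro tendsto_norm) (simp add: isCont_def)
    then have "\<forall>\<^sub>F x in at q. norm (d x) > D" by (rule order_tendstoD) (use D in \<open>simp add: D_def\<close>)
    with C[unfolded eventually_nhds_conv_at, THEN conjunct1]
    have "\<forall>\<^sub>F x in at q. norm (cdot w (Omega x) / d x) \<le> C / D"
      by eventually_elim (use D in \<open>auto simp: norm_divide intro!: frac_le elim: order_trans[OF norm_ge_zero]\<close>)
    from eventually_compose_filterlim[OF this chart_filterlim(1)[OF c(1)]] show ?thesis unfolding \<psi>_def by blast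
  qed
  ultimately obtain h where h: "h holomorphic_on ball 0 r" "\<And>z. z \<in> ball 0 r - {0} \<Longrightarrow> h z = \<psi> z"
    using holomorphic_on_extend_bounded[of \<psi> "ball 0 r" 0] c(3) by auto
  have "cdot w (Omega x) = h (F x) * d x" if x: "x \<in> U - {q}" for x
  proof -
    have "h (F x) = \<psi> (F x)" by (rule h(2)) (use x image in blast)
    then show ?thesis using x cd(3,5) by (simp add: \<psi>_def)
  qed
  then show ?thesis using that h(1) by blast
qed

end

definition "double_pole_chart q U F d r k \<longleftrightarrow> chart q U F d \<and> r > 0 \<and> F ` U = ball 0 r \<and> k \<noteq> 0 \<and> (\<forall>x\<in>U - {q}. f x \<noteq> 0) \<and>
  (\<forall>w. \<exists>h. h holomorphic_on ball 0 r \<and>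
    (\<forall>x\<in>U - {q}. cdot w (Omega x) = (h (F x) - k * cdot w (ccnj (null_tan q)) / (F x)\<^sup>2) * d x))"

lemma double_pole_chartD:
  assumes "double_pole_chart q U F d r k"
  shows "chart q U F d" "r > 0" "F ` U = ball 0 r" "k \<noteq> 0" "\<And>x. x \<in> U - {q} \<Longrightarrow> f x \<noteq> 0"
  using assms unfolding double_pole_chart_def by blast+

lemma double_pole_expansion:
  assumes "double_pole_chart q U F d r k"
  obtains h where "h holomorphic_on ball 0 r" "(h \<longlongrightarrow> h 0) (at 0)"
    "\<And>x. x \<in> U - {q} \<Longrightarrow> cdot w (Omega x) = (h (F x) - k * cdot w (ccnj (null_tan q)) / (F x)\<^sup>2) * d x"
proof -
  obtain h where h: "h holomorphic_on ball 0 r"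
    "\<And>x. x \<in> U - {q} \<Longrightarrow> cdot w (Omega x) = (h (F x) - k * cdot w (ccnj (null_tan q)) / (F x)\<^sup>2) * d x"
    using assms unfolding double_pole_chart_def by meson
  moreover have "(h \<longlongrightarrow> h 0) (at 0)"
    using holomorphic_on_imp_continuous_on[OF h(1)] double_pole_chartD(2)[OF assms]
    by (simp add: continuous_on_eq_continuous_at isCont_def)
  ultimately show ?thesis using that by blast
qed

theorem double_pole_chart_exists:
  assumes c: "chart q U F d" and q: "f q = 0" obtains V r k where "double_pole_chart q V F d r k"
proof -
  obtain U0 F0 d0 where c0: "chart q U0 F0 d0" "\<And>x. x \<in> U0 \<Longrightarrow> x \<noteq> q \<Longrightarrow> f x \<noteq> 0"
    "\<And>x. x \<in> U0 \<Longrightarrow> x \<noteq> q \<Longrightarrow> d0 x = - (cdot (null_tan q) (Omega x) / 2) * (F0 x)\<^sup>2"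
    using chart_at_zero[OF q] by metis
  obtain V r where V: "V \<subseteq> U \<inter> U0" "r > 0" "chart q V F d" "F ` V = ball 0 r"
    using chart_ball_image[OF chart_restrict[OF c chartD(1,2)[OF c0(1)]]] by blast
  then have nz: "f x \<noteq> 0" if "x \<in> V" "x \<noteq> q" for x using c0(2) that by blast
  obtain k0 h0 where k0: "k0 \<noteq> 0" "h0 holomorphic_on ball 0 r"
    "\<And>x. x \<in> V - {q} \<Longrightarrow> cdot (null_tan q) (Omega x) = (h0 (F x) - k0 / (F x)\<^sup>2) * d x"
    using Omega_conormal_pole[OF V(3,4,2) c0(1) _ c0(3)] V(1) by blast
  define E where "E = complex_of_real (2 * EE q)"
  have E: "E \<noteq> 0" "cdot (null_tan q) (ccnj (null_tan q)) = E" by (simp_all add: E_def norm_null_tan)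
  have "\<exists>h. h holomorphic_on ball 0 r \<and>
      (\<forall>x\<in>V - {q}. cdot w (Omega x) = (h (F x) - k0 / E * cdot w (ccnj (null_tan q)) / (F x)\<^sup>2) * d x)" for w
  proof -
    define c where "c = cdot w (ccnj (null_tan q)) / E"
    have "cdot (w - c *s null_tan q) (ccnj (null_tan q)) = 0" using E by (simp add: cdot_simps c_def)
    then obtain h where h: "h holomorphic_on ball 0 r"
      "\<And>x. x \<in> V - {q} \<Longrightarrow> cdot (w - c *s null_tan q) (Omega x) = h (F x) * d x"
      using Omega_regular[OF V(3,4,2) nz] by metis
    have "cdot w (Omega x) = (h (F x) + c * h0 (F x) - k0 / E * cdot w (ccnj (null_tan q)) / (F x)\<^sup>2) * d x"
      if "x \<in> V - {q}" for x
    proof -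
      have "cdot w (Omega x) = cdot (w - c *s null_tan q) (Omega x) + c * cdot (null_tan q) (Omega x)"
        by (simp add: cdot_simps)
      then show ?thesis unfolding h(2)[OF that] k0(3)[OF that] by (simp add: c_def algebra_simps)
    qed
    moreover have "(\<lambda>z. h z + c * h0 z) holomorphic_on ball 0 r" by (intro holomorphic_intros h k0)
    ultimately show ?thesis by blast
  qed
  then show ?thesis using that[of V r "k0 / E"] V nz k0(1) E(1) unfolding double_pole_chart_def by auto
qed

end

section \<open>Uniformisation of the torus\<close>

lemma covering_space_if_uniform_local_homeomorphism:
  fixes F :: "plane \<Rightarrow> complex"
  assumes cont: "continuous_on UNIV F" and e: "e > 0" "\<And>x. inj_on F (ball x e)"
    and d: "d > 0" "\<And>x. ball (F x) d \<subseteq> F ` ball x (e / 3)"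
  shows "covering_space UNIV F (range F)"
proof
  fix z assume "z \<in> range F"
  let ?T = "range F \<inter> ball z d" and ?sheet = "\<lambda>x. ball x (e / 3) \<inter> F -` ball z d"
  have sheet: "open (?sheet x)" "inj_on F (?sheet x)" for x
    using continuous_open_vimage[OF open_ball, of F] cont e
    by (auto intro!: open_Int simp: continuous_on_eq_continuous_at intro: inj_on_subset[OF e(2)[of x]])
  have image: "F ` ?sheet x = ?T" if "F x = z" for x using d(2)[of x] that by auto
  have sheets: "\<Union> (?sheet ` (F -` {z})) = UNIV \<inter> F -` ?T"
  proof (intro equalityI subsetI)
    fix y assume "y \<in> UNIV \<inter> F -` ?T"
    then have "z \<in> F ` ball y (e / 3)" "F y \<in> ball z d" using d(2)[of y] by (auto simp: dist_commute)
    then show "y \<in> \<Union> (?sheet ` (F -` {z}))" by (auto simp: dist_commute)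
  qed auto
  have "disjnt (?sheet x) (?sheet y)" if "F x = z" "F y = z" "?sheet x \<noteq> ?sheet y" for x y
  proof (rule ccontr)
    assume "\<not> ?thesis"
    then obtain u where "dist x u < e / 3" "dist y u < e / 3" by (auto simp: disjnt_def)
    then have "y \<in> ball x e" using dist_triangle2[of x y u] e(1) by simp
    then have "x = y" using inj_onD[OF e(2)[of x], of x y] e(1) that by simp
    then show False using that(3) by simp
  qed
  then have "pairwise disjnt (?sheet ` (F -` {z}))" by (auto simp: pairwise_def)
  moreover have "\<exists>q. homeomorphism (?sheet x) ?T F q" if "F x = z" for x
    using invariance_of_domain_homeomorphism[OF sheet(1) continuous_on_subset[OF cont] _ sheet(2), of x]
    unfolding image[OF that] by auto
  moreover have "z \<in> ?T" "openin (top_of_set (range F)) ?T" using \<open>z \<in> range F\<close> d(1) by (auto simp: openin_open_Int)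
  ultimately show "\<exists>T. z \<in> T \<and> openin (top_of_set (range F)) T \<and> (\<exists>v. \<Union> v = UNIV \<inter> F -` T \<and>
      (\<forall>u\<in>v. openin (top_of_set UNIV) u) \<and> pairwise disjnt v \<and> (\<forall>u\<in>v. \<exists>q. homeomorphism u T F q))"
    using sheets sheet(1) by (intro exI[of _ ?T] conjI exI[of _ "?sheet ` (F -` {z})"]) auto
qed (use cont in auto)

lemma bij_if_uniform_local_homeomorphism:
  fixes F :: "plane \<Rightarrow> complex"
  assumes cont: "continuous_on UNIV F" and e: "e > 0" "\<And>x. inj_on F (ball x e)"
    and d: "d > 0" "\<And>x. ball (F x) d \<subseteq> F ` ball x (e / 3)"
  shows "bij F"
proof -
  have nbhd: "ball (F x) d \<subseteq> range F" for x using d(2)[of x] by blast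
  then have "open (range F)" unfolding open_contains_ball using d(1) by blast
  moreover have "closed (range F)"
  proof -
    have "z \<in> range F" if z: "z \<in> closure (range F)" for z
    proof -
      obtain x where "dist (F x) z < d" using z d(1) unfolding closure_approachable by blast
      then show ?thesis using nbhd[of x] by auto
    qed
    then show ?thesis using closure_subset_eq by blast
  qed
  ultimately have surj: "range F = UNIV" using clopen[of "range F"] by simp
  have covering: "covering_space UNIV F UNIV"
    using covering_space_if_uniform_local_homeomorphism[OF assms] unfolding surj .
  have "x = y" if "F x = F y" for x y
  proof -
    have path: "path (F \<circ> linepath x y)" using cont by (intro path_continuous_image) (auto intro: continuous_on_subset)
    have "homotopic_paths UNIV (F \<circ> linepath x y) (linepath (F x) (F x))"
      using path that by (intro homotopic_paths_linear) (auto simp: pathstart_compose pathfinish_compose)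
    from covering_space_monodromy[OF covering path _ _ _ this, of "linepath x y" "linepath x x"]
    show ?thesis by simp
  qed
  then show ?thesis using surj by (simp add: bij_def inj_def)
qed

context willmore_torus
begin

lemma cdot_Omega_globally_bounded:
  assumes w: "\<And>q. f q = 0 \<Longrightarrow> cdot w (ccnj (null_tan q)) = 0"
  obtains K where "\<And>x. norm (cdot w (Omega x)) \<le> K"
proof -
  have "\<exists>d>0. \<forall>x. norm (cdot w (Omega x)) \<le> 1 / d"
  proof (rule torus_periodic_uniform)
    fix x0
    obtain C where "\<forall>\<^sub>F x in nhds x0. norm (cdot w (Omega x)) \<le> C" using cdot_Omega_locally_bounded w by metis
    then obtain e where e: "e > 0" "\<And>x. dist x x0 < e \<Longrightarrow> norm (cdot w (Omega x)) \<le> C"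
      unfolding eventually_nhds_metric by blast
    have "norm (cdot w (Omega x)) \<le> 1 / (1 / max C 1)" if "x \<in> ball x0 e" for x
      using e(2)[of x] that by (simp add: dist_commute)
    then show "\<exists>d>0. \<exists>e>0. \<forall>x\<in>ball x0 e. norm (cdot w (Omega x)) \<le> 1 / d"
      using e(1) by (intro exI[of _ "1 / max C 1"] conjI exI[of _ e]) auto
  next
    show "norm (cdot w (Omega x)) \<le> 1 / d'" if "norm (cdot w (Omega x)) \<le> 1 / d" "0 < d'" "d' \<le> d" for x d d'
      using that frac_le[of 1 1 d' d] by simp
  qed (simp add: torus_periodicD[OF torus_periodic_Omega])
  then show ?thesis using that by blast
qed

lemma primitives_differ_by_constant:
  assumes S: "open S" "convex S" "bounded S" and "continuous_on S G" "continuous_on S H"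
    and deriv: "\<And>x. x \<in> S \<Longrightarrow> f x \<noteq> 0 \<Longrightarrow> dz_deriv G x (\<alpha> x)" "\<And>x. x \<in> S \<Longrightarrow> f x \<noteq> 0 \<Longrightarrow> dz_deriv H x (\<alpha> x)"
    and "x \<in> S" "y \<in> S"
  shows "G x - H x = G y - H y"
proof (rule has_derivative_zero_unique_strong_convex[where S = S and K = "S \<inter> {x. f x = 0}"])
  show "finite (S \<inter> {x. f x = 0})"
    by (rule finite_subset[OF _ finite_zeros[of "closure S"]]) (use S(3) closure_subset[of S] in auto)
  show "((\<lambda>x. G x - H x) has_derivative (\<lambda>v. 0)) (at z within S)" if "z \<in> S - S \<inter> {x. f x = 0}" for z
    using dz_deriv_diff[OF deriv, of z] that by (auto simp: dz_deriv_def intro: has_derivative_at_withinI)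
qed (use assms in \<open>auto intro: continuous_intros\<close>)

lemma primitive_glue:
  assumes B: "\<And>n::nat. open (B n)" "\<And>n. convex (B n)" "\<And>n. bounded (B n)" "\<And>n. x0 \<in> B n" "(\<Union>n. B n) = UNIV"
    and G: "\<And>n. continuous_on (B n) (G n)" "\<And>n x. x \<in> B n \<Longrightarrow> f x \<noteq> 0 \<Longrightarrow> dz_deriv (G n) x (\<alpha> x)"
  obtains F where "continuous_on UNIV F" "\<And>x. f x \<noteq> 0 \<Longrightarrow> dz_deriv F x (\<alpha> x)"
proof -
  obtain N where N: "\<And>x. x \<in> B (N x)" using B(5) by (metis UNIV_I UN_iff)
  define F where "F = (\<lambda>x. G (N x) x - G (N x) x0)"
  have F_eq: "F x = G n x - G n x0" if "x \<in> B n" for n x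
  proof -
    have "G (N x) x - G n x = G (N x) x0 - G n x0"
      by (rule primitives_differ_by_constant[of "B (N x) \<inter> B n" _ _ \<alpha>])
        (use that N B G(2) continuous_on_subset[OF G(1)] in \<open>auto intro: convex_Int bounded_Int\<close>)
    then show ?thesis by (simp add: F_def algebra_simps)
  qed
  have "isCont F x" for x
  proof -
    have "isCont (G (N x)) x" using G(1) N B(1) by (simp add: continuous_on_eq_continuous_at)
    then have "isCont (\<lambda>y. G (N x) y - G (N x) x0) x" by (intro continuous_intros)
    moreover have "\<forall>\<^sub>F y in nhds x. G (N x) y - G (N x) x0 = F y"
      using eventually_nhds_in_open[OF B(1) N] by (rule eventually_mono) (simp add: F_eq)
    ultimately show ?thesis by (rule iffD1[OF isCont_cong, rotated])
  qed
  moreover have "dz_deriv F x (\<alpha> x)" if "f x \<noteq> 0" for x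
  proof (rule dz_deriv_transform[OF _ B(1) N F_eq[symmetric]])
    show "dz_deriv (\<lambda>y. G (N x) y - G (N x) x0) x (\<alpha> x)" using dz_deriv_diff[OF G(2)[OF N that] dz_deriv_const] by simp
  qed
  ultimately show ?thesis using that[of F] continuous_at_imp_continuous_on by blast
qed

lemma global_primitive:
  assumes w: "\<And>q. f q = 0 \<Longrightarrow> cdot w (ccnj (null_tan q)) = 0"
  obtains F \<alpha> where "\<And>x. dz_deriv F x (\<alpha> x)" "\<And>x. f x \<noteq> 0 \<Longrightarrow> \<alpha> x = cdot w (Omega x)"
proof -
  define B :: "nat \<Rightarrow> plane set" where "B = (\<lambda>n. {- real (Suc n)<..<real (Suc n)} \<times> {- real (Suc n)<..<real (Suc n)})"
  obtain K where K: "\<And>x. norm (cdot w (Omega x)) \<le> K" using cdot_Omega_globally_bounded[OF w] by metis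
  have "\<exists>G. continuous_on (B n) G \<and> (\<forall>x\<in>B n. f x \<noteq> 0 \<longrightarrow> dz_deriv G x (cdot w (Omega x)))" for n
    unfolding B_def using primitive_on_box[of "- real (Suc n)" "real (Suc n)" "- real (Suc n)" "real (Suc n)" w K] K by metis
  then obtain G where G: "\<And>n. continuous_on (B n) (G n)" "\<And>n x. x \<in> B n \<Longrightarrow> f x \<noteq> 0 \<Longrightarrow> dz_deriv (G n) x (cdot w (Omega x))"
    by metis
  have "\<exists>n. x \<in> B n" for x
  proof -
    obtain n where "\<bar>fst x\<bar> + \<bar>snd x\<bar> < real n" using reals_Archimedean2 by blast
    then show ?thesis by (intro exI[of _ n]) (cases x; auto simp: B_def)
  qed
  then have "(\<Union>n. B n) = UNIV" by auto
  moreover have "open (B n)" "convex (B n)" "bounded (B n)" "0 \<in> B n" for n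
    by (auto simp: B_def zero_prod_def intro!: open_Times convex_Times bounded_Times)
  ultimately obtain F where F: "continuous_on UNIV F" "\<And>x. f x \<noteq> 0 \<Longrightarrow> dz_deriv F x (cdot w (Omega x))"
    using primitive_glue[of B 0 G "\<lambda>x. cdot w (Omega x)"] G by metis
  have "\<exists>g. dz_deriv F x g" for x
  proof (cases "f x = 0")
    case True
    obtain U where U: "open U" "x \<in> U" "\<And>y. y \<in> U - {x} \<Longrightarrow> f y \<noteq> 0"
      using isolated_zero[OF True] unfolding eventually_at_topological by blast
    have "(F \<longlongrightarrow> F x) (at x)" using F(1) continuous_on_eq_continuous_at[OF open_UNIV] by (metis UNIV_I isCont_def)
    then have "\<exists>g. dz_deriv (F(x := F x)) x g"
      by (rule dz_deriv_removable[OF U(1,2), rotated]) (use F(2) U(3) in blast)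
    then show ?thesis by simp
  qed (use F(2) in blast)
  then obtain \<alpha> where \<alpha>: "\<And>x. dz_deriv F x (\<alpha> x)" by metis
  show ?thesis by (rule that[OF \<alpha>]) (rule dz_deriv_unique[OF \<alpha> F(2)])
qed

lemma global_primitive_periods:
  assumes F: "\<And>x. dz_deriv F x (\<alpha> x)" "\<And>x. f x \<noteq> 0 \<Longrightarrow> \<alpha> x = cdot w (Omega x)"
  obtains l1 l2 where "torus_periodic \<alpha>" "\<And>x. F (x + (1,0)) = F x + l1" "\<And>x. F (x + (0,1)) = F x + l2"
proof -
  have cont: "isCont \<alpha> x" for x using dz_deriv_factor_isCont[OF open_UNIV UNIV_I F(1)] .
  have periodic: "\<alpha> (x + u) = \<alpha> x" if u: "u \<in> int_vectors" for x u
  proof -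
    have "((\<lambda>y. \<alpha> (y + u)) \<longlongrightarrow> \<alpha> (x + u)) (at x)"
      using LIM_offset[of \<alpha> "\<alpha> (x + u)" "x + u" u] cont[of "x + u"] by (simp add: isCont_def)
    moreover have "\<forall>\<^sub>F y in at x. \<alpha> (y + u) = \<alpha> y"
      using eventually_nonzero
      by (rule eventually_mono) (simp add: F(2) torus_periodicD[OF periodic_f u] torus_periodicD[OF torus_periodic_Omega u])
    ultimately have "(\<alpha> \<longlongrightarrow> \<alpha> (x + u)) (at x)" by (rule Lim_transform_eventually)
    then show ?thesis using cont[of x] LIM_unique unfolding isCont_def by blast
  qed
  have shift: "\<exists>l. \<forall>x. F (x + u) = F x + l" if u: "u \<in> int_vectors" for u
  proof -
    have "((\<lambda>x. x + u) has_derivative (\<lambda>v. v)) (at x)" for x by (auto intro!: derivative_eq_intros)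
    from has_derivative_compose[OF this] have "dz_deriv (\<lambda>x. F (x + u)) x (\<alpha> x)" for x
      using F(1)[of "x + u"] unfolding dz_deriv_def dz_def torus_periodicD[OF torus_periodic_mu u] periodic[OF u] by blast
    then have "((\<lambda>x. F (x + u) - F x) has_derivative (\<lambda>v. 0)) (at x)" for x
      using dz_deriv_diff[OF _ F(1)] by (fastforce simp: dz_deriv_def)
    then have "\<exists>l. \<forall>x\<in>UNIV. F (x + u) - F x = l" by (intro has_derivative_zero_constant) auto
    then show ?thesis by (metis UNIV_I add.commute diff_add_cancel)
  qed
  obtain l1 l2 where "\<And>x. F (x + (1,0)) = F x + l1" "\<And>x. F (x + (0,1)) = F x + l2"
    using shift[of "(1,0)"] shift[of "(0,1)"] by auto
  then show ?thesis using that torus_periodicI[of \<alpha>] periodic by blast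
qed

end

locale torus_uniformisation = willmore_torus +
  fixes F \<alpha> :: "plane \<Rightarrow> complex" and l1 l2 :: complex
  assumes dz_deriv_F: "\<And>x. dz_deriv F x (\<alpha> x)" and \<alpha>_nonzero: "\<And>x. \<alpha> x \<noteq> 0" and torus_periodic_\<alpha>: "torus_periodic \<alpha>"
    and F_add: "\<And>x. F (x + (1,0)) = F x + l1" "\<And>x. F (x + (0,1)) = F x + l2"
begin

lemma F_add_int: "F (x + (of_int m, of_int n)) = F x + of_int m * l1 + of_int n * l2"
proof -
  have "torus_periodic (\<lambda>x. F x - of_real (fst x) * l1 - of_real (snd x) * l2)"
    unfolding torus_periodic_def by (simp add: F_add algebra_simps)
  from torus_periodicD[OF this int_vectors_simps(3)[of m n], of x] show ?thesis by (simp add: algebra_simps)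
qed

lemma F_add_int_vector: assumes "u \<in> int_vectors" obtains l where "l \<in> lattice l1 l2" "\<And>x. F (x + u) = F x + l"
proof -
  obtain m n where "u = (of_int m, of_int n)" using assms by (rule int_vectorsE)
  then show ?thesis using that[OF latticeI[of m l1 n l2]] by (simp add: F_add_int add.assoc)
qed

lemma periods_independent: "Im (cnj l1 * l2) \<noteq> 0"
proof
  assume dependent: "Im (cnj l1 * l2) = 0"
  have "\<exists>c. c \<noteq> 0 \<and> Re (c * l1) = 0 \<and> Re (c * l2) = 0"
  proof (cases "l1 = 0")
    case True
    show ?thesis
    proof (cases "l2 = 0")
      case False
      then show ?thesis using True by (intro exI[of _ "\<i> * cnj l2"]) (simp add: algebra_simps)
    qed (use True in auto)
  next
    case False
    then show ?thesis using dependent by (intro exI[of _ "\<i> * cnj l1"]) (simp add: algebra_simps)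
  qed
  then obtain c where c: "c \<noteq> 0" "Re (c * l1) = 0" "Re (c * l2) = 0" by blast
  have "((\<lambda>z. exp (c * z)) has_field_derivative exp (c * F x) * c) (at (F x))" for x
    by (auto intro!: derivative_eq_intros)
  from dz_deriv_compose[OF dz_deriv_F this] have "dz_deriv (\<lambda>x. exp (c * F x)) x (exp (c * F x) * c * \<alpha> x)" for x .
  moreover have "torus_periodic (\<lambda>x. norm (exp (c * F x)))"
    unfolding torus_periodic_def using c(2,3) by (simp add: F_add norm_exp_eq_Re distrib_left)
  ultimately have "exp (c * F 0) * c * \<alpha> 0 = 0" by (rule dz_deriv_periodic_norm_constant)
  then show False using c(1) \<alpha>_nonzero by simp
qed

lemma continuous_on_F: "continuous_on UNIV F"
  using dz_deriv_isCont[OF dz_deriv_F] by (intro continuous_at_imp_continuous_on) blast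

lemma isCont_\<alpha>: "isCont \<alpha> x"
  by (rule dz_deriv_factor_isCont[OF open_UNIV UNIV_I dz_deriv_F])

lemma F_uniformly_injective: "\<exists>e>0. \<forall>x. inj_on F (ball x e)"
proof (rule torus_periodic_uniform)
  fix x0
  obtain r where r: "r > 0" "inj_on F (ball x0 r)"
    using dz_deriv_locally_injective[OF open_UNIV UNIV_I dz_deriv_F isCont_\<alpha> \<alpha>_nonzero, of x0] by metis
  have "inj_on F (ball x (r / 2))" if "x \<in> ball x0 (r / 2)" for x
    by (rule inj_on_subset[OF r(2)]) (use that dist_triangle_half_r[of x x0 r] in \<open>auto simp: dist_commute\<close>)
  then show "\<exists>d>0. \<exists>e>0. \<forall>x\<in>ball x0 e. inj_on F (ball x d)"
    using r(1) by (intro exI[of _ "r / 2"] conjI) auto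
next
  show "inj_on F (ball x d')" if "inj_on F (ball x d)" "0 < d'" "d' \<le> d" for x d d'
    using inj_on_subset[OF that(1)] that by (simp add: subset_ball)
  show "inj_on F (ball (x + u) d)" if inj: "inj_on F (ball x d)" and "u \<in> int_vectors" for x d u
  proof (rule inj_onI)
    fix a b assume ab: "a \<in> ball (x + u) d" "b \<in> ball (x + u) d" "F a = F b"
    obtain l where "\<And>y. F (y + u) = F y + l" using F_add_int_vector[OF \<open>u \<in> int_vectors\<close>] by metis
    from this[of "a - u"] this[of "b - u"] have "F (a - u) = F (b - u)" using ab(3) by simp
    moreover have "a - u \<in> ball x d" "b - u \<in> ball x d" using ab(1,2) by (simp_all add: dist_norm algebra_simps)
    ultimately show "a = b" using inj_onD[OF inj, of "a - u" "b - u"] by simp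
  qed
qed

lemma F_uniformly_open:
  assumes e: "e > 0" "\<And>x. inj_on F (ball x e)"
  shows "\<exists>d>0. \<forall>x. ball (F x) d \<subseteq> F ` ball x (e / 3)" (is "\<exists>d>0. \<forall>x. ?covers x d")
proof (rule torus_periodic_uniform)
  fix x0
  have "open (F ` ball x0 (e / 6))"
    using open_image_dz_deriv(1)[of "ball x0 (e / 6)" F \<alpha>] inj_on_subset[OF e(2)[of x0]] e(1) dz_deriv_F
    by (simp add: subset_ball)
  moreover have "F x0 \<in> F ` ball x0 (e / 6)" using e(1) by simp
  ultimately obtain d where d: "d > 0" "ball (F x0) d \<subseteq> F ` ball x0 (e / 6)" using open_contains_ball by blast
  obtain e' where e': "e' > 0" "\<And>x. dist x x0 < e' \<Longrightarrow> dist (F x) (F x0) < d / 2"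
    using dz_deriv_isCont[OF dz_deriv_F, of x0] d(1) unfolding continuous_at_eps_delta by (metis half_gt_zero)
  have "?covers x (d / 2)" if x: "x \<in> ball x0 (min e' (e / 6))" for x
  proof -
    have "ball (F x) (d / 2) \<subseteq> ball (F x0) d"
      using e'(2)[of x] x dist_triangle_half_r[of "F x" "F x0" d] by (auto simp: dist_commute)
    moreover have "ball x0 (e / 6) \<subseteq> ball x (e / 3)"
      using x dist_triangle_half_r[of x0 x "e / 3"] by (auto simp: dist_commute)
    ultimately show ?thesis using d(2) by blast
  qed
  then show "\<exists>d>0. \<exists>e'>0. \<forall>x\<in>ball x0 e'. ?covers x d"
    using d(1) e'(1) e(1) by (intro exI[of _ "d / 2"] conjI exI[of _ "min e' (e / 6)"]) auto
next
  show "?covers x d'" if "?covers x d" "d' \<le> d" for x d d'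
    using that subset_ball[of d' d "F x"] by blast
  show "?covers (x + u) d"
    if sub: "?covers x d" and "u \<in> int_vectors" for x d u
  proof
    obtain l where l: "\<And>y. F (y + u) = F y + l" using F_add_int_vector[OF \<open>u \<in> int_vectors\<close>] by metis
    fix z assume "z \<in> ball (F (x + u)) d"
    then have "z - l \<in> ball (F x) d" unfolding l by (simp add: dist_norm algebra_simps)
    then obtain y where y: "y \<in> ball x (e / 3)" "z - l = F y" using sub by blast
    then have "z = F (y + u)" unfolding l by (simp add: algebra_simps)
    moreover have "y + u \<in> ball (x + u) (e / 3)" using y(1) by (simp add: dist_norm)
    ultimately show "z \<in> F ` ball (x + u) (e / 3)" by blast
  qed
qed

theorem bij_F: "bij F"
proof -
  obtain e where e: "e > 0" "\<And>x. inj_on F (ball x e)" using F_uniformly_injective by blast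
  obtain d where "d > 0" "\<And>x. ball (F x) d \<subseteq> F ` ball x (e / 3)" using F_uniformly_open[OF e] by blast
  then show ?thesis by (rule bij_if_uniform_local_homeomorphism[OF continuous_on_F e])
qed

end

lemma cdot_axis: "cdot (axis i 1) v = v $ i"
  by (simp add: cdot_def axis_def if_distrib[of "\<lambda>c. c * _"] cong: if_cong)

context torus_uniformisation
begin

definition H :: "complex \<Rightarrow> plane" where "H = inv F"
definition \<Phi> :: "complex \<Rightarrow> complex^4" where "\<Phi> z = (1 / \<alpha> (H z)) *s Omega (H z)"

lemma inj_F: "inj F" and F_H [simp]: "F (H z) = z" and H_F [simp]: "H (F x) = x"
  using bij_F by (simp_all add: H_def bij_def surj_f_inv_f)

lemma has_derivative_H: "(H has_derivative (\<lambda>v. dz_inv (H z) (v / \<alpha> (H z)))) (at z)"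
  using has_derivative_inv_into_dz_deriv[OF open_UNIV inj_F dz_deriv_F UNIV_I \<alpha>_nonzero, of "H z"] by (simp add: H_def[symmetric])

lemma H_add: assumes "l \<in> lattice l1 l2" obtains u where "u \<in> int_vectors" "\<And>z. H (z + l) = H z + u"
proof -
  obtain m n where "l = of_int m * l1 + of_int n * l2" using assms by (rule latticeE)
  then have "F (H z + (of_int m, of_int n)) = z + l" for z by (simp add: F_add_int)
  then show ?thesis using that[OF int_vectors_simps(3)] H_F by metis
qed

lemma H_congruent_iff: "H z - q \<in> int_vectors \<longleftrightarrow> z - F q \<in> lattice l1 l2"
proof
  assume "H z - q \<in> int_vectors"
  then obtain l where "l \<in> lattice l1 l2" "F (q + (H z - q)) = F q + l" by (metis F_add_int_vector)
  then show "z - F q \<in> lattice l1 l2" by simp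
next
  assume "z - F q \<in> lattice l1 l2"
  then obtain u where "u \<in> int_vectors" "H (F q + (z - F q)) = H (F q) + u" by (metis H_add)
  then show "H z - q \<in> int_vectors" by simp
qed

lemma \<Phi>_holomorphic: "(\<lambda>z. \<Phi> z $ i) holomorphic_on {z. f (H z) \<noteq> 0}"
proof -
  have "z \<in> F ` {x. f x \<noteq> 0}" if "f (H z) \<noteq> 0" for z using that by (intro image_eqI[of _ _ "H z"]) simp_all
  then have image: "{z. f (H z) \<noteq> 0} = F ` {x. f x \<noteq> 0}" by auto
  have "(\<lambda>z. cdot (axis i 1) (Omega (inv F z)) / \<alpha> (inv F z)) holomorphic_on F ` {x. f x \<noteq> 0}"
    by (rule Omega_quotient_holomorphic[OF open_UNIV inj_F dz_deriv_F \<alpha>_nonzero open_nonzero]) auto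
  then show ?thesis unfolding image cdot_axis H_def[symmetric] by (simp add: \<Phi>_def)
qed

lemma has_derivative_inverted_H:
  assumes "f (H z) \<noteq> 0" shows "((\<lambda>z. inverted (H z) $ i) has_derivative (\<lambda>v. Re (v * \<Phi> z $ i))) (at z)"
proof -
  have "((\<lambda>z. inverted (H z)) has_derivative (\<lambda>v. rvec ((v / \<alpha> (H z)) *s Omega (H z)))) (at z)"
    using has_derivative_compose[OF has_derivative_H has_derivative_inverted[OF assms]] by (simp add: dz_dz_inv)
  from bounded_linear.has_derivative[OF bounded_linear_vec_nth this, of i] show ?thesis by (simp add: rvec_def \<Phi>_def)
qed

lemma \<Phi>_pole:
  assumes q: "f q = 0"
  shows "\<exists>k. \<forall>i. \<exists>c. ((\<lambda>z. \<Phi> z $ i + (k *s ccnj (null_tan q)) $ i / (z - F q)\<^sup>2) \<longlongrightarrow> c) (at (F q))"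
proof -
  have "chart q UNIV (\<lambda>x. F x - F q) \<alpha>"
    using dz_deriv_diff[OF dz_deriv_F dz_deriv_const] \<alpha>_nonzero isCont_\<alpha> inj_F by (auto simp: chart_def inj_def)
  then obtain V r k where pole: "double_pole_chart q V (\<lambda>x. F x - F q) \<alpha> r k"
    using double_pole_chart_exists[OF _ q] by metis
  note V = double_pole_chartD(2,3)[OF pole]
  let ?R = "\<lambda>i z. \<Phi> z $ i + (k *s ccnj (null_tan q)) $ i / (z - F q)\<^sup>2"
  have "\<exists>c. (?R i \<longlongrightarrow> c) (at (F q))" for i
  proof -
    obtain h where h: "(h \<longlongrightarrow> h 0) (at 0)"
      "\<And>x. x \<in> V - {q} \<Longrightarrow> Omega x $ i = (h (F x - F q) - k * ccnj (null_tan q) $ i / (F x - F q)\<^sup>2) * \<alpha> x"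
      using double_pole_expansion[OF pole, of "axis i 1"] unfolding cdot_axis by metis
    have "?R i z = h (z - F q)" if z: "z \<in> ball (F q) r - {F q}" for z
    proof -
      have "z - F q \<in> (\<lambda>x. F x - F q) ` V" unfolding V(2) using z by (simp add: dist_norm norm_minus_commute)
      then obtain x where "x \<in> V" "z = F x" by auto
      moreover from this have "x \<noteq> q" using z by auto
      ultimately show ?thesis using h(2)[of x] z \<alpha>_nonzero[of x] by (auto simp: \<Phi>_def)
    qed
    then have "\<forall>\<^sub>F z in at (F q). h (z - F q) = ?R i z"
      using eventually_at_in_open[OF open_ball, of "F q" "F q" r] V(1) by (auto elim!: eventually_mono)
    moreover from LIM_offset[OF h(1), of "- F q"] have "((\<lambda>z. h (z - F q)) \<longlongrightarrow> h 0) (at (F q))" by simp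
    ultimately have "(?R i \<longlongrightarrow> h 0) (at (F q))"
      by (rule Lim_transform_eventually[rotated])
    then show ?thesis ..
  qed
  then show ?thesis by blast
qed

theorem no_normalised_primitive:
  assumes w: "\<And>q. f q = 0 \<Longrightarrow> cdot w (ccnj (null_tan q)) = 0" and \<alpha>: "\<And>x. f x \<noteq> 0 \<Longrightarrow> \<alpha> x = cdot w (Omega x)"
  shows False
proof -
  obtain w1 w2 where L: "lattice w1 w2 = lattice l1 l2" "Im (cnj w1 * w2) > 0"
  proof (cases "Im (cnj l1 * l2) > 0")
    case False
    then have "Im (cnj l2 * l1) > 0" using periods_independent by (simp add: algebra_simps)
    then show ?thesis using that[of l2 l1] lattice_commute by blast
  qed (use that in blast)
  interpret period_lattice w1 w2 by unfold_locales (rule L(2))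
  have zero: "f p1 = 0" "f p2 = 0" by (simp_all add: zero_iff)
  obtain k1 where k1: "\<And>i. \<exists>c. ((\<lambda>z. \<Phi> z $ i + (k1 *s ccnj (null_tan p1)) $ i / (z - F p1)\<^sup>2) \<longlongrightarrow> c) (at (F p1))"
    using \<Phi>_pole[OF zero(1)] by blast
  obtain k2 where k2: "\<And>i. \<exists>c. ((\<lambda>z. \<Phi> z $ i + (k2 *s ccnj (null_tan p2)) $ i / (z - F p2)\<^sup>2) \<longlongrightarrow> c) (at (F p2))"
    using \<Phi>_pole[OF zero(2)] by blast
  have regular: "z \<in> punctured_plane {F p1, F p2} \<longleftrightarrow> f (H z) \<noteq> 0" for z
    by (simp add: punctured_plane_def zero_iff H_congruent_iff L(1))
  have null: "cdot (ccnj (null_tan q)) (ccnj (null_tan q)) = 0" for q by (simp add: cdot_ccnj null_tan_null)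
  have periodic: "\<Phi> (z + l) = \<Phi> z" "inverted (H (z + l)) = inverted (H z)" if l: "l \<in> \<Lambda>" for z l
  proof -
    obtain u where "u \<in> int_vectors" "H (z + l) = H z + u" using H_add l unfolding L(1) by metis
    then show "\<Phi> (z + l) = \<Phi> z" "inverted (H (z + l)) = inverted (H z)"
      by (simp_all add: \<Phi>_def inverted_def rho_def torus_periodicD[OF torus_periodic_\<alpha>]
          torus_periodicD[OF torus_periodic_Omega] torus_periodicD[OF periodic_f])
  qed
  interpret null_elliptic_curve w1 w2 \<Phi> "\<lambda>z. inverted (H z)" "k1 *s ccnj (null_tan p1)" "k2 *s ccnj (null_tan p2)" w
    "F p1" "F p2"
  proof
    show "F p2 - F p1 \<notin> \<Lambda>"
      using H_congruent_iff[of "F p2" p1] incongruent unfolding L(1) H_F by (metis int_vectors_minus_commute)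
    show "(\<lambda>z. \<Phi> z $ i) holomorphic_on punctured_plane {F p1, F p2}" for i
      by (rule holomorphic_on_subset[OF \<Phi>_holomorphic]) (auto simp: regular)
    show "((\<lambda>z. inverted (H z) $ i) has_derivative (\<lambda>v. Re (v * \<Phi> z $ i))) (at z)"
      if "z \<in> punctured_plane {F p1, F p2}" for z i using has_derivative_inverted_H that regular by blast
    show "cdot (\<Phi> z) (\<Phi> z) = 0" for z by (simp add: \<Phi>_def cdot_smult Omega_null)
    show "cdot w (\<Phi> z) = 1" if "z \<in> punctured_plane {F p1, F p2}" for z
      using that \<alpha>[of "H z"] \<alpha>_nonzero[of "H z"] regular by (simp add: \<Phi>_def cdot_smult)
  qed (use periodic k1 k2 null w zero in \<open>simp_all add: cdot_smult\<close>)
  show False by (rule inconsistent)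
qed

end

section \<open>Willmore tori with a double point do not exist\<close>

context willmore_torus
begin

lemma null_tan_periodic: "x - y \<in> int_vectors \<Longrightarrow> null_tan x = null_tan y"
  using torus_periodicD[of null_tan "x - y" y] periodic_geometry
  by (simp add: null_tan_def torus_periodic_def)

lemma zero_null_tan: assumes "f q = 0" obtains "null_tan q = null_tan p1" | "null_tan q = null_tan p2"
  using assms null_tan_periodic unfolding zero_iff by blast

text \<open>Otherwise the primitive of \<open>w \<bullet> Omega\<close> is a flat coordinate on the torus.\<close>

lemma cdot_Omega_eq_0:
  assumes "cdot w (ccnj (null_tan p1)) = 0" "cdot w (ccnj (null_tan p2)) = 0" and x: "f x \<noteq> 0"
  shows "cdot w (Omega x) = 0"
proof (rule ccontr)
  have w: "cdot w (ccnj (null_tan q)) = 0" if "f q = 0" for q using that assms(1,2) by (auto elim!: zero_null_tan)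
  assume nz: "cdot w (Omega x) \<noteq> 0"
  obtain F \<alpha> where F: "\<And>x. dz_deriv F x (\<alpha> x)" "\<And>x. f x \<noteq> 0 \<Longrightarrow> \<alpha> x = cdot w (Omega x)"
    using global_primitive[OF w] by metis
  obtain l1 l2 where periods: "torus_periodic \<alpha>" "\<And>x. F (x + (1,0)) = F x + l1" "\<And>x. F (x + (0,1)) = F x + l2"
    using global_primitive_periods[OF F] by metis
  have "\<alpha> y \<noteq> 0" for y using periodic_differential_nonzero[OF F(1) periods(1), of x y] F(2)[OF x] nz by simp
  then interpret torus_uniformisation f p1 p2 F \<alpha> l1 l2 by unfold_locales (use F periods in auto)
  show False by (rule no_normalised_primitive[OF w F(2)])
qed

lemma has_order_Omega_at_zero:
  assumes q: "f q = 0" and w: "cdot w (ccnj (null_tan q)) \<noteq> 0" shows "has_order (\<lambda>x. cdot w (Omega x)) q (- 2)"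
proof -
  obtain U F d where "chart q U F d" using chart_at_any_point by metis
  then obtain V r k where pole: "double_pole_chart q V F d r k" using double_pole_chart_exists[OF _ q] by metis
  note V = double_pole_chartD[OF pole]
  obtain h where h: "(h \<longlongrightarrow> h 0) (at 0)"
    "\<And>x. x \<in> V - {q} \<Longrightarrow> cdot w (Omega x) = (h (F x) - k * cdot w (ccnj (null_tan q)) / (F x)\<^sup>2) * d x"
    using double_pole_expansion[OF pole] by metis
  note cd = chartD[OF V(1)]
  have F: "filterlim F (at 0) (at q)" by (rule chart_filterlim_at_0[OF V(1)])
  from h(1) have "((\<lambda>z. z\<^sup>2 * h z - k * cdot w (ccnj (null_tan q))) \<longlongrightarrow> 0\<^sup>2 * h 0 - k * cdot w (ccnj (null_tan q))) (at 0)"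
    by (intro tendsto_intros)
  from tendsto_mult[OF filterlim_compose[OF this F] isContD[OF cd(7)]]
  have "((\<lambda>x. ((F x)\<^sup>2 * h (F x) - k * cdot w (ccnj (null_tan q))) * d x) \<longlongrightarrow> - (k * cdot w (ccnj (null_tan q))) * d q) (at q)"
    by simp
  moreover have "- (k * cdot w (ccnj (null_tan q))) * d q \<noteq> 0" using V(4) w cd(2,5) by simp
  moreover have "\<forall>\<^sub>F x in at q. cdot w (Omega x)
      = F x powi (- 2) * (((F x)\<^sup>2 * h (F x) - k * cdot w (ccnj (null_tan q))) * d x)"
    using eventually_at_in_open[OF cd(1,2)]
    by eventually_elim (use chart_nonzero[OF V(1)] in \<open>simp add: h(2) power_int_minus field_simps\<close>)
  ultimately show ?thesis by (rule has_order_if_chart_power[OF V(1)])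
qed

lemma null_tan_independent: "null_tan p2 \<noteq> c *s null_tan p1"
proof
  assume dependent: "null_tan p2 = c *s null_tan p1"
  have "c \<noteq> 0" using dependent null_tan_nonzero[of p2] by auto
  define k where "k = null_tan p1"
  have k: "cdot k (ccnj k) \<noteq> 0" unfolding cdot_ccnj_self k_def by simp
  have nz: "cdot k (Omega x) \<noteq> 0" if x: "f x \<noteq> 0" for x
  proof
    assume k_Omega: "cdot k (Omega x) = 0"
    have "cdot (ccnj (Omega x)) (Omega x) = 0"
      by (rule cdot_Omega_eq_0[OF _ _ x])
        (use dependent k_Omega in \<open>simp_all add: cdot_ccnj k_def cdot_smult cdot_commute[of "Omega x"]\<close>)
    then show False using cdot_ccnj_Omega_nonzero[OF x] by blast
  qed
  have "(- 2 :: int) = 0"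
  proof (rule order_zero_if_one_sign[where \<alpha> = "\<lambda>x. cdot k (Omega x)" and S = "{x. f x = 0}" and k = "\<lambda>_. - 2" and ?x0.0 = p1])
    show "torus_periodic (\<lambda>x. cdot k (Omega x))" by (simp add: torus_periodicI torus_periodicD[OF torus_periodic_Omega])
    show "has_order (\<lambda>x. cdot k (Omega x)) q (- 2)" if "q \<in> {x. f x = 0}" for q
    proof (rule has_order_Omega_at_zero)
      show "f q = 0" using that by simp
      then show "cdot k (ccnj (null_tan q)) \<noteq> 0"
        using dependent k \<open>c \<noteq> 0\<close> by (auto simp: k_def ccnj_simps cdot_smult elim!: zero_null_tan)
    qed
    show "x + u \<in> {x. f x = 0}" if "x \<in> {x. f x = 0}" "u \<in> int_vectors" for x u
      using that torus_periodicD[OF periodic_f] by simp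
  qed (use nz isCont_cdot_Omega eventually_nonzero in \<open>auto simp: zero_iff\<close>)
  then show False by simp
qed

end

context willmore_torus
begin

lemma has_order_eventually_nonzero:
  assumes "has_order \<alpha> x k" shows "\<forall>\<^sub>F y in at x. \<alpha> y \<noteq> 0"
proof -
  obtain c where "c \<noteq> 0" "((\<lambda>y. \<alpha> y * dz x (y - x) powi (- k)) \<longlongrightarrow> c) (at x)" using assms by (auto simp: has_order_def)
  then have "\<forall>\<^sub>F y in at x. \<alpha> y * dz x (y - x) powi (- k) \<noteq> 0" using tendsto_imp_eventually_ne by blast
  then show ?thesis by (rule eventually_mono) auto
qed

lemma connected_complement_countable: "countable S \<Longrightarrow> connected (- S :: plane set)"
  by (intro path_connected_imp_connected path_connected_complement_countable) auto

lemma countable_translate: "countable {x. x - p \<in> int_vectors}"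
  and closed_translate: "closed {x. x - p \<in> int_vectors}"
proof -
  have "{x. x - p \<in> int_vectors} = (+) p ` int_vectors" by (force simp: image_iff)
  moreover have "int_vectors = \<int> \<times> \<int>" by (auto simp: int_vectors_def)
  ultimately show "countable {x. x - p \<in> int_vectors}" "closed {x. x - p \<in> int_vectors}"
    using countable_int_vectors closed_translation[OF closed_Times[OF closed_Ints closed_Ints], of p] by simp_all
qed

text \<open>Otherwise the null directions span a nondegenerate plane containing \<open>Omega x\<close> for every \<open>x\<close>, and \<open>Omega x\<close> lies
  on one of its two null lines; this line cannot jump.\<close>

lemma null_directions_isotropic: "cdot (ccnj (null_tan p1)) (ccnj (null_tan p2)) = 0"
proof (rule ccontr)
  define a b where "a = ccnj (null_tan p1)" and "b = ccnj (null_tan p2)"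
  define \<sigma> where "\<sigma> = cdot a b"
  assume "cdot (ccnj (null_tan p1)) (ccnj (null_tan p2)) \<noteq> 0"
  then have \<sigma>: "\<sigma> \<noteq> 0" by (simp add: \<sigma>_def a_def b_def)
  have null: "cdot a a = 0" "cdot b b = 0" by (simp_all add: a_def b_def cdot_ccnj null_tan_null)
  have ba: "cdot b a = \<sigma>" unfolding \<sigma>_def by (rule cdot_commute)
  have span: "cdot v (Omega x) = cdot v b / \<sigma> * cdot a (Omega x) + cdot v a / \<sigma> * cdot b (Omega x)" if x: "f x \<noteq> 0" for v x
  proof -
    have "cdot (v - (cdot v b / \<sigma>) *s a - (cdot v a / \<sigma>) *s b) (Omega x) = 0"
      using x by (rule cdot_Omega_eq_0[rotated 2])
        (use \<sigma> in \<open>simp_all add: a_def[symmetric] b_def[symmetric] cdot_simps null ba \<sigma>_def[symmetric]\<close>)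
    then show ?thesis by (simp add: cdot_simps algebra_simps)
  qed
  have either: "cdot a (Omega x) * cdot b (Omega x) = 0 \<and> (cdot a (Omega x) \<noteq> 0 \<or> cdot b (Omega x) \<noteq> 0)" if x: "f x \<noteq> 0" for x
  proof -
    have "0 = cdot a (Omega x) * cdot b (Omega x) * (2 / \<sigma>)"
      using span[OF x, of "Omega x"] \<sigma> by (simp add: Omega_null cdot_commute[of "Omega x"] field_simps)
    then show ?thesis using span[OF x, of "ccnj (Omega x)"] cdot_ccnj_Omega_nonzero[OF x] \<sigma> by auto
  qed
  let ?V = "\<lambda>w. {x. f x \<noteq> 0} \<inter> (\<lambda>x. cdot w (Omega x)) -` (- {0})"
  have "open (?V w)" for w
    by (rule continuous_open_preimage[OF _ open_nonzero]) (auto intro!: continuous_at_imp_continuous_on isCont_cdot_Omega)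
  moreover have "connected {x. f x \<noteq> 0}"
  proof -
    have "{x. f x \<noteq> 0} = - ({x. x - p1 \<in> int_vectors} \<union> {x. x - p2 \<in> int_vectors})" by (auto simp: zero_iff)
    then show ?thesis using countable_translate by (simp only:) (intro connected_complement_countable countable_Un)
  qed
  ultimately have "?V a \<inter> {x. f x \<noteq> 0} = {} \<or> ?V b \<inter> {x. f x \<noteq> 0} = {}"
    by (intro connectedD) (use either in auto)
  moreover have "\<exists>x. f x \<noteq> 0 \<and> cdot w (Omega x) \<noteq> 0" if "f q = 0" "cdot w (ccnj (null_tan q)) \<noteq> 0" for w q
    using eventually_happens'[OF at_neq_bot eventually_conj[OF eventually_nonzero
          has_order_eventually_nonzero[OF has_order_Omega_at_zero[OF that]]]] by blast
  from this[of p2 a] this[of p1 b] have "\<exists>x. f x \<noteq> 0 \<and> cdot a (Omega x) \<noteq> 0" "\<exists>x. f x \<noteq> 0 \<and> cdot b (Omega x) \<noteq> 0"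
    using \<sigma> ba by (simp_all add: zero_iff \<sigma>_def a_def[symmetric] b_def[symmetric])
  ultimately show False by blast
qed

lemma card_congruent_le_1:
  assumes "finite Z" and "\<And>y z. y \<in> Z \<Longrightarrow> z \<in> Z \<Longrightarrow> y - z \<in> int_vectors \<Longrightarrow> y = z"
  shows "card (Z \<inter> {x. x - p \<in> int_vectors}) \<le> 1"
proof -
  have "y = z" if "y \<in> Z" "z \<in> Z" "y - p \<in> int_vectors" "z - p \<in> int_vectors" for y z
    using assms(2)[OF that(1,2)] int_vectors_diff[OF that(3,4)] by simp
  then show ?thesis using card_le_Suc0_iff_eq[of "Z \<inter> {x. x - p \<in> int_vectors}"] assms(1) by auto
qed

lemma increment_orders:
  assumes G: "\<And>x. x - p1 \<notin> int_vectors \<Longrightarrow> dz_deriv G x (\<alpha> x)" and nz: "x1 - p1 \<notin> int_vectors" "\<alpha> x1 \<noteq> 0"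
    and x: "x - p1 \<notin> int_vectors"
  shows "\<exists>k::nat. has_order (\<lambda>y. G y - G x) x (int k) \<and> (\<alpha> x = 0 \<longrightarrow> k > 1) \<and> (\<forall>\<^sub>F y in at x. G y \<noteq> G x)"
proof -
  let ?W = "- {x. x - p1 \<in> int_vectors}"
  have W: "open ?W" "connected ?W" "x \<in> ?W" "x1 \<in> ?W"
    using x nz(1) by (auto intro: connected_complement_countable countable_translate closed_translate)
  have GW: "dz_deriv G y (\<alpha> y)" if "y \<in> ?W" for y using that G by simp
  have "\<not> (\<forall>\<^sub>F y in nhds x. \<alpha> y = 0)" using dz_deriv_identity[OF W(1,2) GW W(3) _ W(4)] nz(2) by blast
  from dz_deriv_increment_has_order[OF W(1,3) GW this] dz_deriv_isolated_value[OF W(1,3) GW this]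
  show ?thesis by blast
qed

text \<open>For a zero \<open>x0\<close> of \<open>\<alpha>\<close> the function \<open>G - G x0\<close> would have at least two zeros but only one pole.\<close>

lemma derivative_nonzero_if_single_simple_pole:
  assumes periodic: "torus_periodic G" and G: "\<And>x. x - p1 \<notin> int_vectors \<Longrightarrow> dz_deriv G x (\<alpha> x)"
    and pole: "\<And>q c. q - p1 \<in> int_vectors \<Longrightarrow> has_order (\<lambda>x. G x - c) q (- 1)"
    and nz: "x1 - p1 \<notin> int_vectors" "\<alpha> x1 \<noteq> 0" and x0: "x0 - p1 \<notin> int_vectors"
  shows "\<alpha> x0 \<noteq> 0"
proof
  assume zero: "\<alpha> x0 = 0"
  define P where "P = {x. x - p1 \<in> int_vectors}"
  define S where "S = P \<union> {x. G x = G x0}"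
  have poleP: "has_order (\<lambda>x. G x - G x0) q (- 1)" if "q \<in> P" for q using that pole by (simp add: P_def)
  have GP: "dz_deriv G x (\<alpha> x)" if "x \<notin> P" for x using that G by (simp add: P_def)
  obtain m :: "plane \<Rightarrow> nat" where m: "\<And>x. x \<notin> P \<Longrightarrow> has_order (\<lambda>y. G y - G x) x (int (m x))"
    "\<And>x. x \<notin> P \<Longrightarrow> \<alpha> x = 0 \<Longrightarrow> m x > 1" and isolated_value: "\<And>x. x \<notin> P \<Longrightarrow> \<forall>\<^sub>F y in at x. G y \<noteq> G x"
    using increment_orders[OF G nz] unfolding P_def mem_Collect_eq by metis
  define k where "k = (\<lambda>x. if x \<in> P then - 1 else int (m x))"
  have isCont: "isCont G x" if "x \<notin> P" for x using dz_deriv_isCont GP that by blast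
  have isolated: "\<forall>\<^sub>F y in at x. y \<notin> S" for x
  proof -
    have "\<forall>\<^sub>F y in at x. G y \<noteq> G x0"
    proof (cases "x \<in> P")
      case True
      then show ?thesis using has_order_eventually_nonzero[OF poleP] by simp
    next
      case False
      then show ?thesis
        using isolated_value[of x] tendsto_imp_eventually_ne[OF isContD[OF isCont]] by (cases "G x = G x0") auto
    qed
    then show ?thesis using eventually_nonzero[of x] by eventually_elim (auto simp: S_def P_def zero_iff)
  qed
  obtain Z where Z: "finite Z" "x0 \<in> Z" "\<And>y z. y \<in> Z \<Longrightarrow> z \<in> Z \<Longrightarrow> y - z \<in> int_vectors \<Longrightarrow> y = z" "sum k Z = 0"
  proof (rule index_theorem[where \<alpha> = "\<lambda>x. G x - G x0" and S = S and k = k and ?x0.0 = x0])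
    show "torus_periodic (\<lambda>x. G x - G x0)" using periodic by (simp add: torus_periodic_def)
    show "x + u \<in> S" if "x \<in> S" "u \<in> int_vectors" for x u
      using that torus_periodicD[OF periodic] int_vectors_add[of "x - p1" u] by (auto simp: S_def P_def algebra_simps)
    show "has_order (\<lambda>x. G x - G x0) x (k x)" if "x \<in> S" for x
      using that poleP m(1)[of x] by (auto simp: S_def k_def)
  qed (use isolated isCont in \<open>auto simp: S_def intro: continuous_intros\<close>)
  have "card (Z \<inter> P) \<le> 1" unfolding P_def by (rule card_congruent_le_1[OF Z(1,3)])
  then have "sum k (Z \<inter> P) \<ge> - 1" by (simp add: k_def)
  moreover have "sum k (Z - P) \<ge> 2"
  proof -
    have "x0 \<in> Z - P" using Z(2) x0 by (simp add: P_def)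
    then have "k x0 \<le> sum k (Z - P)" using Z(1) by (intro member_le_sum) (auto simp: k_def)
    then show ?thesis using m(2)[of x0] zero x0 by (simp add: k_def P_def)
  qed
  ultimately show False using Z(1,4) sum.Int_Diff[of Z k P] by simp
qed

context
  fixes q G w
  assumes q: "f q = 0" and G: "\<And>x. f x \<noteq> 0 \<Longrightarrow> dz_deriv G x (cdot w (Omega x) / 2)"
begin

lemma primitive_at_zero:
  obtains U F d r h k where "chart q U F d" "r > 0" "F ` U = ball 0 r" "k \<noteq> 0" "h holomorphic_on ball 0 r"
    "\<And>x. x \<in> U - {q} \<Longrightarrow> f x \<noteq> 0 \<and> G x = h (F x) + k * cdot w (ccnj (null_tan q)) / F x"
proof -
  obtain U0 F d where "chart q U0 F d" using chart_at_any_point by metis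
  then obtain U r k where pole: "double_pole_chart q U F d r k" using double_pole_chart_exists[OF _ q] by metis
  note U = double_pole_chartD[OF pole]
  define c where "c = k * cdot w (ccnj (null_tan q))"
  obtain h where h: "h holomorphic_on ball 0 r" "\<And>x. x \<in> U - {q} \<Longrightarrow> cdot w (Omega x) = (h (F x) - c / (F x)\<^sup>2) * d x"
    using double_pole_expansion[OF pole, of w] unfolding c_def by metis
  obtain h' where h': "\<And>z. z \<in> ball 0 r \<Longrightarrow> (h' has_field_derivative h z) (at z)"
    using holomorphic_convex_primitive'[OF convex_ball open_ball h(1)] at_within_open[OF _ open_ball] by metis
  note cd = chartD[OF U(1)]
  note image = chart_image_punctured[OF U(1,3)]
  have F: "F x \<in> ball 0 r - {0}" if "x \<in> U - {q}" for x using that image by blast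
  define T where "T = (\<lambda>z. h' z / 2 + c / 2 / z)"
  define D where "D = (\<lambda>x. G x - T (F x))"
  have "dz_deriv D x 0" if x: "x \<in> U - {q}" for x
  proof -
    have "(T has_field_derivative h (F x) / 2 - c / 2 / (F x)\<^sup>2) (at (F x))"
      unfolding T_def using F[OF x] by (auto intro!: derivative_eq_intros h' simp: power2_eq_square)
    from dz_deriv_diff[OF G dz_deriv_compose[OF cd(4) this]] show ?thesis
      using x U(5) h(2)[OF x] by (auto simp: D_def field_simps)
  qed
  then have "((\<lambda>z. D (inv_into U F z)) has_field_derivative 0) (at (F x))" if "x \<in> U - {q}" for x
    using has_field_derivative_inv_into_dz_deriv[OF cd(1,3,4) _ cd(5), of x] that by fastforce
  then have "((\<lambda>z. D (inv_into U F z)) has_field_derivative 0) (at z)" if "z \<in> ball 0 r - {0}" for z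
    using that unfolding image[symmetric] by blast
  then have "(\<lambda>z. D (inv_into U F z)) constant_on ball 0 r - {0}"
    by (rule has_field_derivative_0_imp_constant_on) (auto simp: connected_punctured_ball open_delete)
  then obtain C where C: "\<And>z. z \<in> ball 0 r - {0} \<Longrightarrow> D (inv_into U F z) = C" unfolding constant_on_def by blast
  show ?thesis
  proof (rule that[OF U(1-3), of "k / 2" "\<lambda>z. h' z / 2 + C"])
    show "(\<lambda>z. h' z / 2 + C) holomorphic_on ball 0 r"
      by (intro holomorphic_intros) (use h' holomorphic_on_open[OF open_ball] in blast)+
    show "f x \<noteq> 0 \<and> G x = h' (F x) / 2 + C + k / 2 * cdot w (ccnj (null_tan q)) / F x" if x: "x \<in> U - {q}" for x
    proof -
      have "D x = C" using C[OF F[OF x]] x cd(3) by simp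
      then show ?thesis using x U(5) by (simp add: D_def T_def c_def algebra_simps)
    qed
  qed (use U(4) in simp)
qed

lemma primitive_order_or_limit:
  shows "cdot w (ccnj (null_tan q)) \<noteq> 0 \<Longrightarrow> has_order (\<lambda>x. G x - c) q (- 1)"
    and "cdot w (ccnj (null_tan q)) = 0 \<Longrightarrow> \<exists>l. (G \<longlongrightarrow> l) (at q)"
proof -
  obtain U F d r h k where U: "chart q U F d" "r > 0" "k \<noteq> 0" "h holomorphic_on ball 0 r"
    and eq: "\<And>x. x \<in> U - {q} \<Longrightarrow> f x \<noteq> 0 \<and> G x = h (F x) + k * cdot w (ccnj (null_tan q)) / F x"
    using primitive_at_zero by metis
  have F: "filterlim F (at 0) (at q)" by (rule chart_filterlim_at_0[OF U(1)])
  have near: "\<forall>\<^sub>F x in at q. x \<in> U - {q} \<and> F x \<noteq> 0"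
    using eventually_at_in_open[OF chartD(1,2)[OF U(1)]] by eventually_elim (use chart_nonzero[OF U(1)] in blast)
  let ?k = "k * cdot w (ccnj (null_tan q))"
  have h: "(h \<longlongrightarrow> h 0) (at 0)"
    using holomorphic_on_imp_continuous_on[OF U(4)] U(2) by (simp add: continuous_on_eq_continuous_at isCont_def)
  show "has_order (\<lambda>x. G x - c) q (- 1)" if "cdot w (ccnj (null_tan q)) \<noteq> 0"
  proof (rule has_order_if_chart_power[OF U(1)])
    have "((\<lambda>z. z * (h z - c) + ?k) \<longlongrightarrow> 0 * (h 0 - c) + ?k) (at 0)"
      by (intro tendsto_intros h)
    from filterlim_compose[OF this F]
    show "((\<lambda>x. F x * (h (F x) - c) + ?k) \<longlongrightarrow> ?k) (at q)" by simp
    show "?k \<noteq> 0" using that U(3) by simp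
    show "\<forall>\<^sub>F x in at q. G x - c = F x powi (- 1) * (F x * (h (F x) - c) + ?k)"
      using near by eventually_elim (simp add: eq power_int_minus field_simps)
  qed
  show "\<exists>l. (G \<longlongrightarrow> l) (at q)" if "cdot w (ccnj (null_tan q)) = 0"
  proof -
    have "((\<lambda>x. h (F x)) \<longlongrightarrow> h 0) (at q)" by (rule filterlim_compose[OF h F])
    moreover have "\<forall>\<^sub>F x in at q. h (F x) = G x" using near by eventually_elim (simp add: eq that)
    ultimately show ?thesis using Lim_transform_eventually by blast
  qed
qed

end

lemma conormal_exists:
  obtains w where "cdot w (ccnj (null_tan p1)) \<noteq> 0" "cdot w (ccnj (null_tan p2)) = 0" "\<And>x. f x \<noteq> 0 \<Longrightarrow> cdot (ccnj w) (Omega x) = 0"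
proof -
  define a b where "a = null_tan p1" and "b = null_tan p2"
  define c where "c = cdot a (ccnj b) / cdot b (ccnj b)"
  define w where "w = a - c *s b"
  have "cdot b (ccnj b) \<noteq> 0" unfolding cdot_ccnj_self b_def by simp
  then have wb: "cdot w (ccnj b) = 0" by (simp add: w_def c_def cdot_simps)
  have "w \<noteq> 0"
  proof
    assume "w = 0"
    then have "a = c *s b" by (simp add: w_def)
    moreover from this have "c \<noteq> 0" using null_tan_nonzero[of p1] by (auto simp: a_def)
    ultimately have "b = (1 / c) *s a" by (simp add: vec_eq_iff)
    then show False using null_tan_independent unfolding a_def b_def by blast
  qed
  moreover have "ccnj a = ccnj w + cnj c *s ccnj b" by (simp add: w_def ccnj_simps)
  then have "cdot w (ccnj a) = cdot w (ccnj w)" using wb by (simp add: cdot_simps)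
  ultimately have wa: "cdot w (ccnj a) \<noteq> 0" unfolding cdot_ccnj_self by simp
  have "cdot a b = 0" using null_directions_isotropic by (simp add: cdot_ccnj a_def b_def)
  then have "cdot w a = 0" "cdot w b = 0"
    by (simp_all add: w_def cdot_simps a_def b_def null_tan_null cdot_commute[of "null_tan p2"])
  then have "cdot (ccnj w) (Omega x) = 0" if "f x \<noteq> 0" for x
    using that by (intro cdot_Omega_eq_0) (simp_all add: cdot_ccnj a_def b_def)
  then show ?thesis using that wa wb by (simp add: a_def b_def)
qed

lemma single_pole_primitive:
  assumes w1: "cdot w (ccnj (null_tan p1)) \<noteq> 0" and w2: "cdot w (ccnj (null_tan p2)) = 0"
    and anti: "\<And>x. f x \<noteq> 0 \<Longrightarrow> cdot (ccnj w) (Omega x) = 0"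
  obtains G g where "torus_periodic G" "\<And>x. x - p1 \<notin> int_vectors \<Longrightarrow> dz_deriv G x (g x)"
    "\<And>q c. q - p1 \<in> int_vectors \<Longrightarrow> has_order (\<lambda>x. G x - c) q (- 1)" "\<And>x. f x \<noteq> 0 \<Longrightarrow> g x = cdot w (Omega x) / 2"
proof -
  define N where "N x = cdot w (cvec (inverted x))" for x
  have N_periodic: "N (x + u) = N x" if "u \<in> int_vectors" for x u
    by (simp add: N_def inverted_def rho_def torus_periodicD[OF periodic_f that])
  have N: "dz_deriv N x (cdot w (Omega x) / 2)" if "f x \<noteq> 0" for x
    using dz_deriv_cdot_inverted[OF that, of "\<lambda>_. 0"] dz_deriv_const[of 0 x] anti[OF that] by (simp add: N_def[abs_def])
  obtain l where l: "(N \<longlongrightarrow> l) (at p2)" using primitive_order_or_limit(2)[OF _ N w2] by (auto simp: zero_iff)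
  have limit: "(N \<longlongrightarrow> l) (at q)" if "q - p2 \<in> int_vectors" for q
    using LIM_offset[OF l, of "p2 - q"] that int_vectors_minus_commute[of p2 q] by (simp add: N_periodic)
  define G where "G x = (if x - p2 \<in> int_vectors then l else N x)" for x
  have G: "dz_deriv G x (cdot w (Omega x) / 2)" if "f x \<noteq> 0" for x
    by (rule dz_deriv_transform[OF N[OF that] open_nonzero]) (use that in \<open>auto simp: G_def zero_iff\<close>)
  have "\<exists>g. dz_deriv G x g" if "x - p1 \<notin> int_vectors" for x
  proof (cases "f x = 0")
    case True
    then have x: "x - p2 \<in> int_vectors" using that by (simp add: zero_iff)
    obtain W where W: "open W" "x \<in> W" "\<And>y. y \<in> W - {x} \<Longrightarrow> f y \<noteq> 0"
      using eventually_nonzero[of x] unfolding eventually_at_topological by blast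
    obtain g where "dz_deriv (N(x := l)) x g"
      using dz_deriv_removable[OF W(1,2) _ limit[OF x]] N W(3) by metis
    then have "dz_deriv G x g"
      by (rule dz_deriv_transform[OF _ W(1,2)]) (use x W(3) in \<open>auto simp: G_def zero_iff\<close>)
    then show ?thesis ..
  qed (use G in blast)
  then obtain g where g: "\<And>x. x - p1 \<notin> int_vectors \<Longrightarrow> dz_deriv G x (g x)" by metis
  show ?thesis
  proof (rule that[OF _ g])
    show "torus_periodic G"
    proof (rule torus_periodicI)
      fix x u :: "plane" assume u: "u \<in> int_vectors"
      then have "x + u - p2 \<in> int_vectors \<longleftrightarrow> x - p2 \<in> int_vectors"
        using int_vectors_add[of "x - p2" u] int_vectors_diff[of "x + u - p2" u] by (auto simp: algebra_simps)
      then show "G (x + u) = G x" by (simp add: G_def N_periodic u)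
    qed
    show "has_order (\<lambda>x. G x - c) q (- 1)" if "q - p1 \<in> int_vectors" for q c
      using primitive_order_or_limit(1)[OF _ G] that w1 null_tan_periodic[OF that] by (simp add: zero_iff)
    show "g x = cdot w (Omega x) / 2" if "f x \<noteq> 0" for x
      using dz_deriv_unique[OF g G] that by (simp add: zero_iff)
  qed
qed

theorem no_willmore_torus: False
proof -
  obtain w where w: "cdot w (ccnj (null_tan p1)) \<noteq> 0" "cdot w (ccnj (null_tan p2)) = 0"
    "\<And>x. f x \<noteq> 0 \<Longrightarrow> cdot (ccnj w) (Omega x) = 0" using conormal_exists by metis
  obtain G g where periodic: "torus_periodic G" and G: "\<And>x. x - p1 \<notin> int_vectors \<Longrightarrow> dz_deriv G x (g x)"
    and pole: "\<And>q c. q - p1 \<in> int_vectors \<Longrightarrow> has_order (\<lambda>x. G x - c) q (- 1)"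
    and g: "\<And>x. f x \<noteq> 0 \<Longrightarrow> g x = cdot w (Omega x) / 2" using single_pole_primitive[OF w] by metis
  have order_pole: "has_order (\<lambda>x. cdot w (Omega x)) q (- 2)" if "q - p1 \<in> int_vectors" for q
    by (rule has_order_Omega_at_zero) (use that w(1) null_tan_periodic[OF that] in \<open>simp_all add: zero_iff\<close>)
  have "\<forall>\<^sub>F x in at p1. cdot w (Omega x) \<noteq> 0 \<and> f x \<noteq> 0"
    by (intro eventually_conj eventually_nonzero has_order_eventually_nonzero[OF order_pole]) simp
  then obtain x1 where x1: "cdot w (Omega x1) \<noteq> 0" "f x1 \<noteq> 0" using eventually_happens'[OF at_neq_bot] by blast
  have "g x1 \<noteq> 0" unfolding g[OF x1(2)] using x1(1) by simp
  then have g_nz: "g x \<noteq> 0" if "x - p1 \<notin> int_vectors" for x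
    using derivative_nonzero_if_single_simple_pole[OF periodic G pole _ _ that, of x1] x1(2) by (simp add: zero_iff)
  have order_regular: "has_order (\<lambda>x. cdot w (Omega x)) q 0" if q: "q - p1 \<notin> int_vectors" for q
  proof -
    have "isCont g q"
      by (rule dz_deriv_factor_isCont[OF open_Compl[OF closed_translate[of p1]] _ G]) (use q in auto)
    then have "((\<lambda>x. 2 * g x) \<longlongrightarrow> 2 * g q) (at q)" by (intro tendsto_intros) (simp add: isCont_def)
    moreover have "\<forall>\<^sub>F x in at q. 2 * g x = cdot w (Omega x)"
      using eventually_nonzero by eventually_elim (simp add: g)
    ultimately have "((\<lambda>x. cdot w (Omega x)) \<longlongrightarrow> 2 * g q) (at q)" by (rule Lim_transform_eventually)
    moreover have "2 * g q \<noteq> 0" using g_nz[OF q] by simp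
    ultimately show ?thesis unfolding has_order_0_iff by blast
  qed
  define k :: "plane \<Rightarrow> int" where "k x = (if x - p1 \<in> int_vectors then - 2 else 0)" for x
  have "k p1 = 0"
  proof (rule order_zero_if_one_sign[where \<alpha> = "\<lambda>x. cdot w (Omega x)" and S = "{x. f x = 0}"])
    show "torus_periodic (\<lambda>x. cdot w (Omega x))" by (simp add: torus_periodicI torus_periodicD[OF torus_periodic_Omega])
    show "x + u \<in> {x. f x = 0}" if "x \<in> {x. f x = 0}" "u \<in> int_vectors" for x u
      using that torus_periodicD[OF periodic_f] by simp
    show "has_order (\<lambda>x. cdot w (Omega x)) q (k q)" for q using order_pole order_regular by (simp add: k_def)
    show "cdot w (Omega x) \<noteq> 0" if "x \<notin> {x. f x = 0}" for x using that g_nz[of x] g[of x] by (simp add: zero_iff)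
  qed (use isCont_cdot_Omega eventually_nonzero in \<open>auto simp: zero_iff k_def\<close>)
  then show False by (simp add: k_def)
qed

end

lemma pd_diff_const: "smooth_map g \<Longrightarrow> pd (\<lambda>x. g x - c) = pd g"
  by (simp add: fun_eq_iff pd_diff pd_const smooth_map_const)

lemma willmore_diff_const: "smooth_map g \<Longrightarrow> willmore (\<lambda>x. g x - c) = willmore g"
  by (simp add: willmore_def mean_curv_def nor_proj_def tan_proj_def gdet_def fffE_def fffF_def fffG_def pd_diff_const)

lemma torus_immersion_diff_const:
  assumes "torus_immersion g" shows "torus_immersion (\<lambda>x. g x - c)"
proof -
  have smooth: "smooth_map g" using assms by (simp add: torus_immersion_def)
  have "frechet_derivative (\<lambda>x. g x - c) (at x) = frechet_derivative g (at x)" for x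
    using fun_cong[OF fun_cong[OF pd_diff_const[OF smooth, of c]], of _ x] by (auto simp: pd_def)
  then show ?thesis using assms smooth_map_diff[OF smooth smooth_map_const]
    by (simp add: torus_immersion_def torus_periodic_def)
qed

theorem theorem2p4:
  shows "\<not> (\<exists>f0 :: real \<times> real \<Rightarrow> real^4.
            torus_immersion f0 \<and> has_double_point f0 \<and> willmore f0 = 8 * pi)"
proof (intro notI, elim exE conjE)
  fix f0 :: "real \<times> real \<Rightarrow> real^4"
  assume f0: "torus_immersion f0" "willmore f0 = 8 * pi" and "has_double_point f0"
  then obtain p q where pq: "p - q \<notin> int_vectors" "f0 p = f0 q"
    unfolding has_double_point_def int_vectors_def mem_Collect_eq fst_diff snd_diff by blast
  define f where "f = (\<lambda>x. f0 x - f0 p)"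
  have zero: "f p = 0" "f q = 0" using pq(2) by (simp_all add: f_def)
  interpret immersed_torus f by unfold_locales (simp add: f_def torus_immersion_diff_const f0(1))
  have W: "willmore f = 8 * pi" using f0 by (simp add: f_def willmore_diff_const torus_immersion_def)
  interpret willmore_torus f p q
  proof
    have "f x = 0" if "x - y \<in> int_vectors" "f y = 0" for x y using torus_periodicD[OF periodic_f that(1), of y] that(2) by simp
    then show "f x = 0 \<longleftrightarrow> x - p \<in> int_vectors \<or> x - q \<in> int_vectors" for x
      using at_most_two_zeros[OF W _ zero, of x] pq(1) zero by blast
    show "HH x = - (4 / rho x) *\<^sub>R XN x" if "f x \<noteq> 0" for x by (rule mean_curvature_if_Li_Yau_equality[OF W zero pq(1) that])
  qed (rule pq(1))
  show False by (rule no_willmore_torus)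
qed

end
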